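(* Let $M$ be a closed connected smooth Riemannian manifold and let $G:T^*M\to\mathbb{R}$ be continuous, convex in $p$, and superlinear in $p$ ($G(x,p)/\|p\|_x\to+\infty$ as $\|p\|_x\to\infty$). For any fixed continuous function $\sigma:M\to(0,+\infty)$, the image in $C(M)$ of the operator $\mathbb{P}^\sigma_G:C(M)\to C(M)$, $$\mathbb{P}^\sigma_G\varphi(x)=\inf_{\mu\in\mathfrak M(L_G)}\left\{\frac{\int_M\sigma(y)h_G(y,x)\,d\mu(y)}{\int_M\sigma(y)\,d\mu(y)}+\frac{\int_M\sigma(y)\varphi(y)\,d\mu(y)}{\int_M\sigma(y)\,d\mu(y)}\right\},$$ coincides with the set of all viscosity solutions of the Hamilton-Jacobi equation $G(x,d_xu)=c(G)$ in $M$.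
   Context: $C(M)$ is the space of continuous real functions on $M$. The critical value of $G$ is $c(G)=\inf_{f\in C^1(M)}\max_{x\in M}G(x,d_xf)$; it is the only constant $c$ for which $G(x,d_xu)=c$ admits viscosity solutions on $M$. The Lagrangian is $L_G(x,v)=\sup_{p\in T_x^*M}(p(v)-G(x,p))$ on $TM$. A Borel probability measure $\tilde\mu$ on $TM$ is closed if $\int_{TM}\|v\|_x\,d\tilde\mu<\infty$ and $\int_{TM}d_x\varphi(v)\,d\tilde\mu(x,v)=0$ for all $\varphi\in C^1(M)$. A Mather measure of $L_G$ is a closed probability measure $\tilde\mu$ with $\int_{TM}L_G\,d\tilde\mu=-c(G)$. A projected Mather measure is $\mu=\pi_\#\tilde\mu$ with $\tilde\mu$ a Mather measure and $\pi:TM\to M$ the canonical projection; $\mathfrak M(L_G)$ is the set of all projected Mather measures. The Peierls barrier of $L_G$ is $h_G(x,y)=\liminf_{t\to+\infty}[h_t(x,y)+c(G)t]$, where $h_t(x,y)=\inf\int_0^tL_G(\gamma(s),\dot\gamma(s))\,ds$ over absolutely continuous $\gamma:[0,t]\to M$ with $\gamma(0)=x$, $\gamma(t)=y$. *)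

theory Defs
  imports "HOL-Probability.Probability"
begin

section \<open>Smooth manifolds\<close>

text \<open>
  The manifold is a whole Hausdorff topological type \<open>'m\<close>, with a smooth atlas of charts onto open
  subsets of a Euclidean space \<open>'e\<close>. A chart is a pair of its domain and its coordinate map; the
  values of the map outside the domain are irrelevant. The atlas need not be maximal: all
  notions below depend only on the smooth structure that it generates.
\<close>

primrec Ck_on :: "nat \<Rightarrow> ('a::real_normed_vector \<Rightarrow> 'b::real_normed_vector) \<Rightarrow> 'a set \<Rightarrow> bool" where
  "Ck_on 0 f S \<longleftrightarrow> continuous_on S f"
| "Ck_on (Suc k) f S \<longleftrightarrow>
     (\<forall>x\<in>S. f differentiable (at x)) \<and> (\<forall>v. Ck_on k (\<lambda>x. frechet_derivative f (at x) v) S)"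

definition smooth_on :: "('a::real_normed_vector \<Rightarrow> 'b::real_normed_vector) \<Rightarrow> 'a set \<Rightarrow> bool" where
  "smooth_on f S \<longleftrightarrow> (\<forall>k. Ck_on k f S)"

type_synonym ('m, 'e) chart = "'m set \<times> ('m \<Rightarrow> 'e)"

abbreviation cdom :: "('m, 'e) chart \<Rightarrow> 'm set" where
  "cdom c \<equiv> fst c"

abbreviation cmap :: "('m, 'e) chart \<Rightarrow> 'm \<Rightarrow> 'e" where
  "cmap c \<equiv> snd c"

abbreviation cimage :: "('m, 'e) chart \<Rightarrow> 'e set" where
  "cimage c \<equiv> cmap c ` cdom c"

definition cinv :: "('m, 'e) chart \<Rightarrow> 'e \<Rightarrow> 'm" where
  "cinv c = inv_into (cdom c) (cmap c)"

definition smooth_atlas :: "('m::topological_space, 'e::euclidean_space) chart set \<Rightarrow> bool" where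
  "smooth_atlas A \<longleftrightarrow>
     (\<Union>c\<in>A. cdom c) = UNIV \<and>
     (\<forall>c\<in>A. open (cdom c) \<and> open (cimage c) \<and> homeomorphism (cdom c) (cimage c) (cmap c) (cinv c)) \<and>
     (\<forall>c\<in>A. \<forall>d\<in>A. smooth_on (cmap d \<circ> cinv c) (cmap c ` (cdom c \<inter> cdom d)))"

definition C1_manifold ::
  "('m::topological_space, 'e::euclidean_space) chart set \<Rightarrow> ('m \<Rightarrow> real) set" where
  "C1_manifold A = {f. \<forall>c\<in>A. Ck_on 1 (f \<circ> cinv c) (cimage c)}"


section \<open>Tangent and cotangent bundles\<close>

text \<open>
  A tangent vector at \<open>x\<close> is the family of its coordinate representations, indexed by the charts
  around \<open>x\<close> and transforming by the derivatives of the coordinate changes; it is \<open>0\<close> at all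
  other indices. A covector is a linear functional on the tangent space, \<open>0\<close> outside of it.
\<close>

type_synonym ('m, 'e) tvec = "('m, 'e) chart \<Rightarrow> 'e"

type_synonym ('m, 'e) covec = "('m, 'e) tvec \<Rightarrow> real"

definition tangent_space ::
  "('m::topological_space, 'e::euclidean_space) chart set \<Rightarrow> 'm \<Rightarrow> ('m, 'e) tvec set" where
  "tangent_space A x =
     {v. (\<forall>c. \<not> (c \<in> A \<and> x \<in> cdom c) \<longrightarrow> v c = 0) \<and>
         (\<forall>c\<in>A. \<forall>d\<in>A. x \<in> cdom c \<longrightarrow> x \<in> cdom d \<longrightarrow>
            v d = frechet_derivative (cmap d \<circ> cinv c) (at (cmap c x)) (v c))}"

definition cotangent_space ::
  "('m::topological_space, 'e::euclidean_space) chart set \<Rightarrow> 'm \<Rightarrow> ('m, 'e) covec set" where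
  "cotangent_space A x =
     {p. (\<forall>v. v \<notin> tangent_space A x \<longrightarrow> p v = 0) \<and>
         (\<forall>v\<in>tangent_space A x. \<forall>w\<in>tangent_space A x. p (\<lambda>c. v c + w c) = p v + p w) \<and>
         (\<forall>a. \<forall>v\<in>tangent_space A x. p (\<lambda>c. a *\<^sub>R v c) = a * p v)}"

text \<open>
  The tangent vector, and the covector, at \<open>x\<close> with coordinates \<open>w\<close> in the chart \<open>c\<close>.
\<close>

definition tvec_of ::
  "('m::topological_space, 'e::euclidean_space) chart set \<Rightarrow> ('m, 'e) chart \<Rightarrow> 'm \<Rightarrow> 'e
    \<Rightarrow> ('m, 'e) tvec" where
  "tvec_of A c x w =
     (\<lambda>d. if d \<in> A \<and> x \<in> cdom d
          then frechet_derivative (cmap d \<circ> cinv c) (at (cmap c x)) w else 0)"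

definition covec_of ::
  "('m::topological_space, 'e::euclidean_space) chart set \<Rightarrow> ('m, 'e) chart \<Rightarrow> 'm \<Rightarrow> 'e
    \<Rightarrow> ('m, 'e) covec" where
  "covec_of A c x w = (\<lambda>v. if v \<in> tangent_space A x then w \<bullet> v c else 0)"

text \<open>
  The usual topologies of \<open>TM\<close> and \<open>T*M\<close>: a set is open iff it is open in all the
  local trivialisations induced by the charts.
\<close>

definition tangent_bundle ::
  "('m::topological_space, 'e::euclidean_space) chart set \<Rightarrow> ('m \<times> ('m, 'e) tvec) topology" where
  "tangent_bundle A = topology (\<lambda>T.
     T \<subseteq> Sigma UNIV (tangent_space A) \<and>
     (\<forall>c\<in>A. open {(z, w). z \<in> cimage c \<and> (cinv c z, tvec_of A c (cinv c z) w) \<in> T}))"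

definition cotangent_bundle ::
  "('m::topological_space, 'e::euclidean_space) chart set \<Rightarrow> ('m \<times> ('m, 'e) covec) topology" where
  "cotangent_bundle A = topology (\<lambda>T.
     T \<subseteq> Sigma UNIV (cotangent_space A) \<and>
     (\<forall>c\<in>A. open {(z, w). z \<in> cimage c \<and> (cinv c z, covec_of A c (cinv c z) w) \<in> T}))"

lemma istopology_trivialisations:
  fixes E :: "'b set" and tr :: "'c \<Rightarrow> 'a::topological_space \<Rightarrow> 'd::topological_space \<Rightarrow> 'b"
  assumes "\<And>c. c \<in> A \<Longrightarrow> open (V c)"
  shows "istopology (\<lambda>T. T \<subseteq> E \<and> (\<forall>c\<in>A. open {(z, w). z \<in> V c \<and> tr c z w \<in> T}))"
  unfolding istopology_def
proof (intro conjI allI impI ballI; (elim conjE)?)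
  fix S T c
  assume S: "\<forall>c\<in>A. open {(z, w). z \<in> V c \<and> tr c z w \<in> S}"
    and T: "\<forall>c\<in>A. open {(z, w). z \<in> V c \<and> tr c z w \<in> T}" and "c \<in> A"
  have "{(z, w). z \<in> V c \<and> tr c z w \<in> S \<inter> T} =
      {(z, w). z \<in> V c \<and> tr c z w \<in> S} \<inter> {(z, w). z \<in> V c \<and> tr c z w \<in> T}"
    by auto
  then show "open {(z, w). z \<in> V c \<and> tr c z w \<in> S \<inter> T}"
    using S T \<open>c \<in> A\<close> by (simp add: open_Int)
next
  fix K c
  assume K: "\<forall>S\<in>K. S \<subseteq> E \<and> (\<forall>c\<in>A. open {(z, w). z \<in> V c \<and> tr c z w \<in> S})" and "c \<in> A"
  have "{(z, w). z \<in> V c \<and> tr c z w \<in> \<Union>K} = (\<Union>S\<in>K. {(z, w). z \<in> V c \<and> tr c z w \<in> S})"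
    by auto
  then show "open {(z, w). z \<in> V c \<and> tr c z w \<in> \<Union>K}"
    using K \<open>c \<in> A\<close> by auto
qed auto

lemma openin_tangent_bundle:
  assumes "smooth_atlas A"
  shows "openin (tangent_bundle A) T \<longleftrightarrow>
     T \<subseteq> Sigma UNIV (tangent_space A) \<and>
     (\<forall>c\<in>A. open {(z, w). z \<in> cimage c \<and> (cinv c z, tvec_of A c (cinv c z) w) \<in> T})"
  unfolding tangent_bundle_def
  by (subst topology_inverse', rule istopology_trivialisations[where V = "\<lambda>c. cimage c"
        and tr = "\<lambda>c z w. (cinv c z, tvec_of A c (cinv c z) w)"])
    (use assms in \<open>auto simp: smooth_atlas_def\<close>)

lemma openin_cotangent_bundle:
  assumes "smooth_atlas A"
  shows "openin (cotangent_bundle A) T \<longleftrightarrow>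
     T \<subseteq> Sigma UNIV (cotangent_space A) \<and>
     (\<forall>c\<in>A. open {(z, w). z \<in> cimage c \<and> (cinv c z, covec_of A c (cinv c z) w) \<in> T})"
  unfolding cotangent_bundle_def
  by (subst topology_inverse', rule istopology_trivialisations[where V = "\<lambda>c. cimage c"
        and tr = "\<lambda>c z w. (cinv c z, covec_of A c (cinv c z) w)"])
    (use assms in \<open>auto simp: smooth_atlas_def\<close>)

definition borel_of :: "'a topology \<Rightarrow> 'a measure" where
  "borel_of X = sigma (topspace X) {U. openin X U}"

text \<open>
  The differential is computed in an arbitrary chart around \<open>x\<close>; by the chain rule the choice does
  not matter.
\<close>

definition chart_at ::
  "('m::topological_space, 'e::euclidean_space) chart set \<Rightarrow> 'm \<Rightarrow> ('m, 'e) chart" where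
  "chart_at A x = (SOME c. c \<in> A \<and> x \<in> cdom c)"

definition differential ::
  "('m::topological_space, 'e::euclidean_space) chart set \<Rightarrow> ('m \<Rightarrow> real) \<Rightarrow> 'm
    \<Rightarrow> ('m, 'e) covec" where
  "differential A f x =
     (\<lambda>v. if v \<in> tangent_space A x
          then (let c = chart_at A x
                in frechet_derivative (f \<circ> cinv c) (at (cmap c x)) (v c))
          else 0)"


section \<open>Riemannian metrics\<close>

definition riemannian_metric ::
  "('m::topological_space, 'e::euclidean_space) chart set
    \<Rightarrow> ('m \<Rightarrow> ('m, 'e) tvec \<Rightarrow> ('m, 'e) tvec \<Rightarrow> real) \<Rightarrow> bool" where
  "riemannian_metric A g \<longleftrightarrow>
     (\<forall>x. \<forall>u\<in>tangent_space A x. \<forall>v\<in>tangent_space A x. \<forall>w\<in>tangent_space A x. \<forall>a b.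
        g x (\<lambda>c. a *\<^sub>R u c + b *\<^sub>R v c) w = a * g x u w + b * g x v w) \<and>
     (\<forall>x. \<forall>v\<in>tangent_space A x. \<forall>w\<in>tangent_space A x. g x v w = g x w v) \<and>
     (\<forall>x. \<forall>v\<in>tangent_space A x. v \<noteq> (\<lambda>_. 0) \<longrightarrow> g x v v > 0) \<and>
     (\<forall>c\<in>A. \<forall>a b. smooth_on
        (\<lambda>z. g (cinv c z) (tvec_of A c (cinv c z) a) (tvec_of A c (cinv c z) b)) (cimage c))"

definition closed_connected_riemannian_manifold ::
  "('m::t2_space, 'e::euclidean_space) chart set
    \<Rightarrow> ('m \<Rightarrow> ('m, 'e) tvec \<Rightarrow> ('m, 'e) tvec \<Rightarrow> real) \<Rightarrow> bool" where
  "closed_connected_riemannian_manifold A g \<longleftrightarrow>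
     smooth_atlas A \<and> riemannian_metric A g \<and> compact (UNIV :: 'm set) \<and> connected (UNIV :: 'm set)"

definition tnorm ::
  "('m \<Rightarrow> ('m, 'e) tvec \<Rightarrow> ('m, 'e) tvec \<Rightarrow> real) \<Rightarrow> 'm \<Rightarrow> ('m, 'e) tvec \<Rightarrow> real" where
  "tnorm g x v = sqrt (g x v v)"

definition conorm ::
  "('m::topological_space, 'e::euclidean_space) chart set
    \<Rightarrow> ('m \<Rightarrow> ('m, 'e) tvec \<Rightarrow> ('m, 'e) tvec \<Rightarrow> real) \<Rightarrow> 'm \<Rightarrow> ('m, 'e) covec \<Rightarrow> real" where
  "conorm A g x p = (SUP v\<in>{v \<in> tangent_space A x. tnorm g x v \<le> 1}. p v)"


section \<open>Hamiltonian and Lagrangian\<close>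

definition continuous_hamiltonian ::
  "('m::topological_space, 'e::euclidean_space) chart set \<Rightarrow> ('m \<Rightarrow> ('m, 'e) covec \<Rightarrow> real)
    \<Rightarrow> bool" where
  "continuous_hamiltonian A G \<longleftrightarrow>
     continuous_map (cotangent_bundle A) euclideanreal (\<lambda>(x, p). G x p)"

definition convex_hamiltonian ::
  "('m::topological_space, 'e::euclidean_space) chart set \<Rightarrow> ('m \<Rightarrow> ('m, 'e) covec \<Rightarrow> real)
    \<Rightarrow> bool" where
  "convex_hamiltonian A G \<longleftrightarrow>
     (\<forall>x. \<forall>p\<in>cotangent_space A x. \<forall>q\<in>cotangent_space A x. \<forall>t\<in>{0..1}.
        G x (\<lambda>v. (1 - t) * p v + t * q v) \<le> (1 - t) * G x p + t * G x q)"

definition superlinear_hamiltonian ::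
  "('m::topological_space, 'e::euclidean_space) chart set
    \<Rightarrow> ('m \<Rightarrow> ('m, 'e) tvec \<Rightarrow> ('m, 'e) tvec \<Rightarrow> real) \<Rightarrow> ('m \<Rightarrow> ('m, 'e) covec \<Rightarrow> real)
    \<Rightarrow> bool" where
  "superlinear_hamiltonian A g G \<longleftrightarrow>
     (\<forall>x K. \<exists>R. \<forall>p\<in>cotangent_space A x. conorm A g x p > R \<longrightarrow> G x p / conorm A g x p \<ge> K)"

definition critical_value ::
  "('m::topological_space, 'e::euclidean_space) chart set \<Rightarrow> ('m \<Rightarrow> ('m, 'e) covec \<Rightarrow> real)
    \<Rightarrow> real" where
  "critical_value A G = (INF f\<in>C1_manifold A. SUP x. G x (differential A f x))"

definition lagrangian ::
  "('m::topological_space, 'e::euclidean_space) chart set \<Rightarrow> ('m \<Rightarrow> ('m, 'e) covec \<Rightarrow> real)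
    \<Rightarrow> 'm \<Rightarrow> ('m, 'e) tvec \<Rightarrow> real" where
  "lagrangian A G x v = (SUP p\<in>cotangent_space A x. p v - G x p)"

definition viscosity_solution ::
  "('m::topological_space, 'e::euclidean_space) chart set \<Rightarrow> ('m \<Rightarrow> ('m, 'e) covec \<Rightarrow> real)
    \<Rightarrow> real \<Rightarrow> ('m \<Rightarrow> real) \<Rightarrow> bool" where
  "viscosity_solution A G a u \<longleftrightarrow>
     continuous_on UNIV u \<and>
     (\<forall>f\<in>C1_manifold A. \<forall>x.
        (\<forall>\<^sub>F y in nhds x. u y - f y \<le> u x - f x) \<longrightarrow> G x (differential A f x) \<le> a) \<and>
     (\<forall>f\<in>C1_manifold A. \<forall>x.
        (\<forall>\<^sub>F y in nhds x. u y - f y \<ge> u x - f x) \<longrightarrow> G x (differential A f x) \<ge> a)"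


section \<open>Mather measures\<close>

definition closed_measure ::
  "('m::topological_space, 'e::euclidean_space) chart set
    \<Rightarrow> ('m \<Rightarrow> ('m, 'e) tvec \<Rightarrow> ('m, 'e) tvec \<Rightarrow> real) \<Rightarrow> ('m \<times> ('m, 'e) tvec) measure
    \<Rightarrow> bool" where
  "closed_measure A g m \<longleftrightarrow>
     sets m = sets (borel_of (tangent_bundle A)) \<and> prob_space m \<and>
     integrable m (\<lambda>(x, v). tnorm g x v) \<and>
     (\<forall>f\<in>C1_manifold A. (LINT (x, v)|m. differential A f x v) = 0)"

definition mather_measure ::
  "('m::topological_space, 'e::euclidean_space) chart set
    \<Rightarrow> ('m \<Rightarrow> ('m, 'e) tvec \<Rightarrow> ('m, 'e) tvec \<Rightarrow> real) \<Rightarrow> ('m \<Rightarrow> ('m, 'e) covec \<Rightarrow> real)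
    \<Rightarrow> ('m \<times> ('m, 'e) tvec) measure \<Rightarrow> bool" where
  "mather_measure A g G m \<longleftrightarrow>
     closed_measure A g m \<and>
     integrable m (\<lambda>(x, v). lagrangian A G x v) \<and>
     (LINT (x, v)|m. lagrangian A G x v) = - critical_value A G"

definition projected_mather_measures ::
  "('m::topological_space, 'e::euclidean_space) chart set
    \<Rightarrow> ('m \<Rightarrow> ('m, 'e) tvec \<Rightarrow> ('m, 'e) tvec \<Rightarrow> real) \<Rightarrow> ('m \<Rightarrow> ('m, 'e) covec \<Rightarrow> real)
    \<Rightarrow> 'm measure set" where
  "projected_mather_measures A g G = (\<lambda>m. distr m borel fst) ` {m. mather_measure A g G m}"


section \<open>Peierls barrier\<close>

definition abs_continuous_on :: "real \<Rightarrow> real \<Rightarrow> (real \<Rightarrow> 'a::metric_space) \<Rightarrow> bool" where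
  "abs_continuous_on a b f \<longleftrightarrow>
     (\<forall>e>0. \<exists>d>0. \<forall>D. finite D \<and> (\<forall>(r, s)\<in>D. a \<le> r \<and> r \<le> s \<and> s \<le> b) \<and>
        pairwise (\<lambda>(r, s) (r', s'). {r<..<s} \<inter> {r'<..<s'} = {}) D \<and> (\<Sum>(r, s)\<in>D. s - r) < d
        \<longrightarrow> (\<Sum>(r, s)\<in>D. dist (f r) (f s)) < e)"

definition abs_continuous_curve ::
  "('m::topological_space, 'e::euclidean_space) chart set \<Rightarrow> real \<Rightarrow> (real \<Rightarrow> 'm) \<Rightarrow> bool" where
  "abs_continuous_curve A t \<gamma> \<longleftrightarrow>
     continuous_on {0..t} \<gamma> \<and>
     (\<forall>c\<in>A. \<forall>a b. 0 \<le> a \<longrightarrow> a \<le> b \<longrightarrow> b \<le> t \<longrightarrow> \<gamma> ` {a..b} \<subseteq> cdom c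
        \<longrightarrow> abs_continuous_on a b (cmap c \<circ> \<gamma>))"

text \<open>
  The velocity is meaningful at almost every time only, namely where the coordinate representations
  of an absolutely continuous curve are differentiable.
\<close>

definition velocity ::
  "('m::topological_space, 'e::euclidean_space) chart set \<Rightarrow> (real \<Rightarrow> 'm) \<Rightarrow> real
    \<Rightarrow> ('m, 'e) tvec" where
  "velocity A \<gamma> s =
     (\<lambda>c. if c \<in> A \<and> \<gamma> s \<in> cdom c then vector_derivative (cmap c \<circ> \<gamma>) (at s) else 0)"

text \<open>
  The Lagrangian of a continuous superlinear Hamiltonian is continuous and bounded below, so along
  an absolutely continuous curve its integral is either finite or \<open>+\<infinity>\<close>.
\<close>

definition action ::
  "('m::topological_space, 'e::euclidean_space) chart set \<Rightarrow> ('m \<Rightarrow> ('m, 'e) covec \<Rightarrow> real)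
    \<Rightarrow> real \<Rightarrow> (real \<Rightarrow> 'm) \<Rightarrow> ereal" where
  "action A G t \<gamma> =
     (if (\<lambda>s. lagrangian A G (\<gamma> s) (velocity A \<gamma> s)) absolutely_integrable_on {0..t}
      then ereal (integral {0..t} (\<lambda>s. lagrangian A G (\<gamma> s) (velocity A \<gamma> s)))
      else \<infinity>)"

definition minimal_action ::
  "('m::topological_space, 'e::euclidean_space) chart set \<Rightarrow> ('m \<Rightarrow> ('m, 'e) covec \<Rightarrow> real)
    \<Rightarrow> real \<Rightarrow> 'm \<Rightarrow> 'm \<Rightarrow> ereal" where
  "minimal_action A G t x y =
     (INF \<gamma>\<in>{\<gamma>. abs_continuous_curve A t \<gamma> \<and> \<gamma> 0 = x \<and> \<gamma> t = y}. action A G t \<gamma>)"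

definition peierls_barrier ::
  "('m::topological_space, 'e::euclidean_space) chart set \<Rightarrow> ('m \<Rightarrow> ('m, 'e) covec \<Rightarrow> real)
    \<Rightarrow> 'm \<Rightarrow> 'm \<Rightarrow> ereal" where
  "peierls_barrier A G x y =
     Liminf at_top (\<lambda>t. minimal_action A G t x y + ereal (critical_value A G * t))"


section \<open>The operator\<close>

text \<open>
  The Peierls barrier is finite on a closed connected manifold, hence the use of
  \<open>real_of_ereal\<close>.
\<close>

definition P_operator ::
  "('m::topological_space, 'e::euclidean_space) chart set
    \<Rightarrow> ('m \<Rightarrow> ('m, 'e) tvec \<Rightarrow> ('m, 'e) tvec \<Rightarrow> real) \<Rightarrow> ('m \<Rightarrow> ('m, 'e) covec \<Rightarrow> real)
    \<Rightarrow> ('m \<Rightarrow> real) \<Rightarrow> ('m \<Rightarrow> real) \<Rightarrow> 'm \<Rightarrow> real" where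
  "P_operator A g G \<sigma> \<phi> x =
     (INF \<mu>\<in>projected_mather_measures A g G.
        (LINT y|\<mu>. \<sigma> y * real_of_ereal (peierls_barrier A G y x)) / (LINT y|\<mu>. \<sigma> y)
        + (LINT y|\<mu>. \<sigma> y * \<phi> y) / (LINT y|\<mu>. \<sigma> y))"

end

theory Submission
  imports Defs
begin

text \<open>
  Write \<open>c\<close> for the critical value. A subsolution can be approximated uniformly by smooth
  \<open>f\<close> with \<open>G(x, df) \<le> c + \<epsilon>\<close>, and integrating \<open>df(v) \<le> L + G(x, df)\<close> against a
  Mather measure shows that a subsolution with a margin \<open>b \<ge> 0\<close>, that is
  \<open>G(x, du) + b \<le> c\<close>, satisfies \<open>b = 0\<close> almost everywhere for its projection. Applied to
  time averages of the finite time potentials, this gives that the Peierls barrier \<open>h\<close> is finite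
  and that \<open>h(z, z) \<le> 0\<close> almost everywhere. By a separation argument, over every compact set
  \<open>K\<close> there is either a Mather measure or a smooth \<open>f\<close> with \<open>G(x, df) < c\<close> on \<open>K\<close>.

  The key step is the constraint that the \<open>\<sigma>\<close>-weighted integral of \<open>P\<phi>\<close> is at most that of
  \<open>\<phi>\<close> for every projected Mather measure: multiplying a Mather measure by a function of the
  difference of two subsolutions preserves closedness and minimality, so the measure can be cut
  into pieces on which \<open>h(z, x) + h(x, z)\<close> is small, and on such a piece the barrier averages to
  almost nothing.

  \<open>P\<phi>\<close> is a subsolution. If it failed to be a supersolution, a bump would give a larger
  subsolution with a margin where it is larger; this agrees with \<open>P\<phi>\<close> almost everywhere, hence
  satisfies the constraint, hence is at most \<open>P\<phi>\<close>. Conversely, a solution \<open>u\<close> satisfies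
  \<open>u \<le> Pu\<close>. On the compact set \<open>K\<close> where \<open>Pu - u\<close> is maximal, a Mather measure together
  with the constraint forces \<open>Pu \<le> u\<close>, while a strict subsolution on \<open>K\<close>, mixed with a
  smooth approximation of \<open>Pu\<close>, would touch \<open>u\<close> from below near \<open>K\<close>.
\<close>

subsection \<open>Subgradients and gradients\<close>

lemma convex_on_UNIV_imp_subgradient:
  fixes f :: "'a::euclidean_space \<Rightarrow> real"
  assumes "convex_on UNIV f"
  obtains v where "\<And>q. f q \<ge> f p + v \<bullet> (q - p)"
proof -
  have "convex ({p} \<times> {..<f p})" "convex (epigraph UNIV f)"
    using assms by (auto intro: convex_Times convex_epigraphI)
  moreover have "{p} \<times> {..<f p} \<noteq> {}" "epigraph UNIV f \<noteq> {}"
    by (auto simp: epigraph_def)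
  moreover have "({p} \<times> {..<f p}) \<inter> epigraph UNIV f = {}"
    by (auto simp: epigraph_def)
  ultimately obtain n b where "n \<noteq> 0" and below: "\<forall>x\<in>{p} \<times> {..<f p}. n \<bullet> x \<le> b"
    and above: "\<forall>x\<in>epigraph UNIV f. n \<bullet> x \<ge> b"
    using separating_hyperplane_sets by metis
  obtain \<alpha> \<beta> where n: "n = (\<alpha>, \<beta>)" by (cases n)
  have ray: "\<alpha> \<bullet> p + \<beta> * s \<le> b" if "s < f p" for s
    using below that by (auto simp: n inner_Pair)
  have graph: "\<alpha> \<bullet> q + \<beta> * s \<ge> b" if "f q \<le> s" for q s
    using above that by (auto simp: n inner_Pair epigraph_def)
  have "\<beta> * (f p - 1) \<le> \<beta> * f p"
    using ray[of "f p - 1"] graph[of p "f p"] by simp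
  then have "\<beta> \<ge> 0" by (simp add: right_diff_distrib)
  moreover have "\<beta> \<noteq> 0"
  proof
    assume "\<beta> = 0"
    then have "\<alpha> \<bullet> \<alpha> \<le> 0"
      using ray[of "f p - 1"] graph[of "p - \<alpha>" "f (p - \<alpha>)"] by (simp add: inner_diff_right)
    then have "\<alpha> = 0" by (metis inner_gt_zero_iff not_le)
    then show False using \<open>n \<noteq> 0\<close> \<open>\<beta> = 0\<close> by (simp add: n zero_prod_def)
  qed
  ultimately have "\<beta> > 0" by simp
  have "f q \<ge> f p + (- \<alpha> /\<^sub>R \<beta>) \<bullet> (q - p)" for q
  proof -
    have "f p \<le> (\<alpha> \<bullet> (q - p)) / \<beta> + f q"
    proof (rule dense_le)
      fix s assume "s < f p"
      then have "\<beta> * s \<le> \<alpha> \<bullet> (q - p) + \<beta> * f q"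
        using ray[of s] graph[of q "f q"] by (simp add: inner_diff_right)
      then show "s \<le> (\<alpha> \<bullet> (q - p)) / \<beta> + f q"
        using \<open>\<beta> > 0\<close> by (simp add: field_simps)
    qed
    then show ?thesis by (simp add: divide_inverse mult.commute)
  qed
  then show thesis using that by blast
qed

definition riesz_vector :: "('a::euclidean_space \<Rightarrow> real) \<Rightarrow> 'a" where
  "riesz_vector l = (\<Sum>i\<in>Basis. l i *\<^sub>R i)"

lemma inner_riesz_vector:
  assumes "linear l" shows "riesz_vector l \<bullet> v = l v"
proof -
  have "l v = l (\<Sum>i\<in>Basis. (v \<bullet> i) *\<^sub>R i)" by (simp add: euclidean_representation)
  also have "\<dots> = (\<Sum>i\<in>Basis. (v \<bullet> i) * l i)"
    using assms by (simp add: linear_sum linear_scale)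
  finally show ?thesis
    by (simp add: riesz_vector_def inner_sum_left inner_commute[of v] mult.commute)
qed

lemma riesz_vector_inner: "riesz_vector (\<lambda>v. d \<bullet> v) = d"
  by (simp add: riesz_vector_def euclidean_representation)

definition gradient :: "('a::euclidean_space \<Rightarrow> real) \<Rightarrow> 'a \<Rightarrow> 'a" where
  "gradient f z = riesz_vector (frechet_derivative f (at z))"

lemma gradient_eqI: "(f has_derivative (\<lambda>v. d \<bullet> v)) (at z) \<Longrightarrow> gradient f z = d"
  by (simp add: gradient_def frechet_derivative_at[symmetric] riesz_vector_inner)

definition has_gradient_on ::
  "('a::euclidean_space \<Rightarrow> real) \<Rightarrow> ('a \<Rightarrow> 'a) \<Rightarrow> 'a set \<Rightarrow> bool" where
  "has_gradient_on f D S \<longleftrightarrow>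
     (\<forall>x\<in>S. (f has_derivative (\<lambda>v. D x \<bullet> v)) (at x)) \<and> continuous_on S D"

lemma has_gradient_onI:
  assumes "\<And>x. x \<in> S \<Longrightarrow> (f has_derivative f' x) (at x)"
    and "\<And>v. continuous_on S (\<lambda>x. f' x v)"
  shows "has_gradient_on f (\<lambda>x. riesz_vector (f' x)) S"
  unfolding has_gradient_on_def
proof (intro conjI ballI)
  fix x assume x: "x \<in> S"
  show "(f has_derivative (\<lambda>v. riesz_vector (f' x) \<bullet> v)) (at x)"
    using assms(1)[OF x] by (simp add: inner_riesz_vector has_derivative_linear)
next
  show "continuous_on S (\<lambda>x. riesz_vector (f' x))"
    unfolding riesz_vector_def by (intro continuous_intros assms)
qed

lemma has_gradient_onD:
  "has_gradient_on f D S \<Longrightarrow> x \<in> S \<Longrightarrow> (f has_derivative (\<lambda>v. D x \<bullet> v)) (at x)"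
  by (simp add: has_gradient_on_def)

lemma has_gradient_on_continuous: "has_gradient_on f D S \<Longrightarrow> continuous_on S D"
  by (simp add: has_gradient_on_def)

lemma has_gradient_on_subset: "has_gradient_on f D S \<Longrightarrow> T \<subseteq> S \<Longrightarrow> has_gradient_on f D T"
  by (auto simp: has_gradient_on_def intro: continuous_on_subset)

lemma has_gradient_on_imp_continuous_on: "has_gradient_on f D S \<Longrightarrow> continuous_on S f"
  unfolding has_gradient_on_def
  by (meson continuous_at_imp_continuous_on has_derivative_continuous)

lemma has_gradient_on_cong:
  assumes f: "has_gradient_on f D S" and "open S" "\<And>x. x \<in> S \<Longrightarrow> f x = h x"
  shows "has_gradient_on h D S"
  unfolding has_gradient_on_def
proof (intro conjI ballI)
  fix x assume x: "x \<in> S"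
  show "(h has_derivative (\<lambda>v. D x \<bullet> v)) (at x)"
    using has_derivative_transform_within_open[OF has_gradient_onD[OF f x] assms(2) x assms(3)] .
qed (rule has_gradient_on_continuous[OF f])

lemma has_gradient_on_gradient:
  assumes "has_gradient_on f D S"
  shows "has_gradient_on f (gradient f) S" and "x \<in> S \<Longrightarrow> gradient f x = D x"
proof -
  show eq: "gradient f x = D x" if "x \<in> S" for x
    using has_gradient_onD[OF assms that] by (rule gradient_eqI)
  show "has_gradient_on f (gradient f) S"
    using assms unfolding has_gradient_on_def by (simp add: eq cong: continuous_on_cong)
qed

lemma has_gradient_on_local:
  assumes "\<And>x. x \<in> S \<Longrightarrow> \<exists>U D. open U \<and> x \<in> U \<and> has_gradient_on f D U"
  shows "has_gradient_on f (gradient f) S"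
proof -
  have "(f has_derivative (\<lambda>v. gradient f x \<bullet> v)) (at x) \<and> isCont (gradient f) x"
    if x: "x \<in> S" for x
  proof -
    obtain U D where U: "open U" "x \<in> U" "has_gradient_on f D U" using assms x by blast
    note grad = has_gradient_on_gradient(1)[OF U(3)]
    show ?thesis
      using has_gradient_onD[OF grad U(2)] has_gradient_on_continuous[OF grad] U(1,2)
      by (simp add: continuous_on_eq_continuous_at)
  qed
  then show ?thesis
    unfolding has_gradient_on_def by (simp add: continuous_at_imp_continuous_on)
qed

lemma Ck_on_1_iff:
  "Ck_on 1 f S \<longleftrightarrow> (\<forall>x\<in>S. (f has_derivative frechet_derivative f (at x)) (at x)) \<and>
     (\<forall>v. continuous_on S (\<lambda>x. frechet_derivative f (at x) v))"
  by (simp add: One_nat_def frechet_derivative_works)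

lemma Ck_on_1_imp_lipschitz_on:
  fixes T :: "'a::euclidean_space \<Rightarrow> 'b::real_normed_vector"
  assumes T: "Ck_on 1 T S" and K: "compact K" "convex K" "K \<subseteq> S"
  shows "\<exists>C. C-lipschitz_on K T"
proof -
  define T' where "T' x = frechet_derivative T (at x)" for x
  have T': "(T has_derivative T' x) (at x)" "continuous_on S (\<lambda>x. T' x v)" if "x \<in> S" for x v
    using T that by (auto simp: Ck_on_1_iff T'_def frechet_derivative_works)
  have "continuous_on K (\<lambda>x. \<Sum>i\<in>Basis. norm (T' x i))"
    using K(3) T'(2) by (cases "K = {}") (auto intro!: continuous_intros intro: continuous_on_subset)
  from compact_imp_bounded[OF compact_continuous_image[OF this K(1)]]
  obtain C where C: "C > 0" "\<And>x. x \<in> K \<Longrightarrow> (\<Sum>i\<in>Basis. norm (T' x i)) \<le> C"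
    unfolding bounded_pos by (force simp: abs_of_nonneg sum_nonneg)
  have "onorm (T' x) \<le> C" if x: "x \<in> K" for x
  proof (rule onorm_le)
    fix v
    interpret linear "T' x" using T'(1) K(3) x has_derivative_linear by blast
    have "T' x v = (\<Sum>i\<in>Basis. (v \<bullet> i) *\<^sub>R T' x i)"
      by (subst euclidean_representation[of v, symmetric]) (simp only: sum scale)
    also have "norm \<dots> \<le> (\<Sum>i\<in>Basis. norm v * norm (T' x i))"
      by (intro sum_norm_le) (simp add: mult_right_mono Basis_le_norm)
    also have "\<dots> \<le> C * norm v"
      using mult_left_mono[OF C(2)[OF x], of "norm v"] by (simp add: sum_distrib_left mult.commute)
    finally show "norm (T' x v) \<le> C * norm v" .
  qed
  then have "norm (T x - T y) \<le> C * norm (x - y)" if "x \<in> K" "y \<in> K" for x y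
    using that K(3) T'(1) by (intro differentiable_bound[OF K(2)]) (auto intro: has_derivative_at_withinI)
  then show ?thesis using C(1) by (intro exI[of _ C] lipschitz_onI) (auto simp: dist_norm)
qed

lemma Ck_on_1_iff_has_gradient_on: "Ck_on 1 f S \<longleftrightarrow> has_gradient_on f (gradient f) S"
proof
  assume "Ck_on 1 f S"
  then show "has_gradient_on f (gradient f) S"
    unfolding Ck_on_1_iff gradient_def by (intro has_gradient_onI) auto
next
  assume f: "has_gradient_on f (gradient f) S"
  have eq: "frechet_derivative f (at x) = (\<lambda>v. gradient f x \<bullet> v)" if "x \<in> S" for x
    by (rule frechet_derivative_at[symmetric], rule has_gradient_onD[OF f that])
  show "Ck_on 1 f S"
    unfolding Ck_on_1_iff using has_gradient_onD[OF f] has_gradient_on_continuous[OF f]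
    by (auto simp: eq intro!: continuous_intros cong: continuous_on_cong)
qed

lemma has_gradient_on_const: "has_gradient_on (\<lambda>_. a) (\<lambda>_. 0) S"
  by (auto simp: has_gradient_on_def)

lemma has_gradient_on_add:
  "has_gradient_on f D S \<Longrightarrow> has_gradient_on g E S
    \<Longrightarrow> has_gradient_on (\<lambda>x. f x + g x) (\<lambda>x. D x + E x) S"
  unfolding has_gradient_on_def
  by (auto intro!: continuous_intros has_derivative_eq_rhs[OF has_derivative_add]
      simp: inner_add_left)

lemma has_gradient_on_mult:
  assumes "has_gradient_on f D S" "has_gradient_on g E S"
  shows "has_gradient_on (\<lambda>x. f x * g x) (\<lambda>x. f x *\<^sub>R E x + g x *\<^sub>R D x) S"
  using assms has_gradient_on_imp_continuous_on[OF assms(1)]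
    has_gradient_on_imp_continuous_on[OF assms(2)]
  unfolding has_gradient_on_def
  by (auto intro!: continuous_intros has_derivative_eq_rhs[OF has_derivative_mult]
      simp: inner_add_left algebra_simps)

lemma has_gradient_on_cmult:
  "has_gradient_on f D S \<Longrightarrow> has_gradient_on (\<lambda>x. a * f x) (\<lambda>x. a *\<^sub>R D x) S"
  using has_gradient_on_mult[OF has_gradient_on_const[of a]] by fastforce

lemma has_gradient_on_compose_real:
  fixes \<theta> \<theta>' :: "real \<Rightarrow> real"
  assumes f: "has_gradient_on f D S"
    and \<theta>: "\<And>x. x \<in> S \<Longrightarrow> (\<theta> has_real_derivative \<theta>' (f x)) (at (f x))"
    and "continuous_on (f ` S) \<theta>'"
  shows "has_gradient_on (\<lambda>x. \<theta> (f x)) (\<lambda>x. \<theta>' (f x) *\<^sub>R D x) S"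
  unfolding has_gradient_on_def
proof (intro conjI ballI)
  fix x assume x: "x \<in> S"
  show "((\<lambda>x. \<theta> (f x)) has_derivative (\<lambda>v. \<theta>' (f x) *\<^sub>R D x \<bullet> v)) (at x)"
    using has_derivative_compose[OF has_gradient_onD[OF f x]
        \<theta>[OF x, unfolded has_field_derivative_def]] by simp
next
  show "continuous_on S (\<lambda>x. \<theta>' (f x) *\<^sub>R D x)"
    using continuous_on_compose2[OF assms(3) has_gradient_on_imp_continuous_on[OF f]]
    by (intro continuous_intros has_gradient_on_continuous[OF f]) auto
qed

lemma has_gradient_on_compose_Ck_on_1:
  fixes T :: "'a::euclidean_space \<Rightarrow> 'b::euclidean_space"
  assumes T: "Ck_on 1 T S" and F: "has_gradient_on F D U" and TS: "T ` S \<subseteq> U"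
  shows "\<exists>E. has_gradient_on (F \<circ> T) E S"
proof
  let ?T' = "\<lambda>x. frechet_derivative T (at x)"
  have der: "(T has_derivative ?T' x) (at x)" if "x \<in> S" for x
    using T that by (simp add: Ck_on_1_iff del: One_nat_def)
  show "has_gradient_on (F \<circ> T) (\<lambda>x. riesz_vector (\<lambda>v. D (T x) \<bullet> ?T' x v)) S"
  proof (rule has_gradient_onI)
    fix x assume x: "x \<in> S"
    then have "T x \<in> U" using TS by blast
    from has_derivative_compose[OF der[OF x] has_gradient_onD[OF F this]]
    show "(F \<circ> T has_derivative (\<lambda>v. D (T x) \<bullet> ?T' x v)) (at x)" by (simp add: o_def)
  next
    fix v
    have "continuous_on S T"
      using der by (meson continuous_at_imp_continuous_on has_derivative_continuous)
    then have "continuous_on S (\<lambda>x. D (T x))"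
      using continuous_on_compose2[OF has_gradient_on_continuous[OF F]] TS by blast
    then show "continuous_on S (\<lambda>x. D (T x) \<bullet> ?T' x v)"
      using T by (intro continuous_intros) (simp_all add: Ck_on_1_iff del: One_nat_def)
  qed
qed

lemma has_gradient_on_inner_self:
  "has_gradient_on (\<lambda>x. (x - a) \<bullet> (x - a)) (\<lambda>x. 2 *\<^sub>R (x - a)) S"
  unfolding has_gradient_on_def
  by (auto intro!: continuous_intros derivative_eq_intros simp: inner_commute)

lemma inner_derivative_le_if_increments_le:
  fixes F :: "'a::euclidean_space \<Rightarrow> real"
  assumes F: "(F has_derivative (\<lambda>h. d \<bullet> h)) (at y)"
    and le: "\<forall>\<^sub>F t in at_right 0. F (y + t *\<^sub>R v) - F y \<le> t * k"
  shows "d \<bullet> v \<le> k"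
proof -
  have line: "((\<lambda>t::real. y + t *\<^sub>R v) has_derivative (\<lambda>t. t *\<^sub>R v)) (at 0)"
    by (auto intro!: derivative_eq_intros)
  have "((\<lambda>t. F (y + t *\<^sub>R v)) has_derivative (\<lambda>t. t * (d \<bullet> v))) (at 0)"
    using has_derivative_compose[OF line, of F "\<lambda>h. d \<bullet> h"] F by simp
  then have "((\<lambda>t. F (y + t *\<^sub>R v)) has_real_derivative (d \<bullet> v)) (at 0)"
    unfolding has_field_derivative_def
    by (rule has_derivative_eq_rhs) (simp add: mult.commute fun_eq_iff)
  then have "((\<lambda>t. (F (y + t *\<^sub>R v) - F y) / t) \<longlongrightarrow> d \<bullet> v) (at 0)"
    by (simp add: DERIV_def)
  then have "((\<lambda>t. (F (y + t *\<^sub>R v) - F y) / t) \<longlongrightarrow> d \<bullet> v) (at_right 0)"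
    by (rule tendsto_within_subset) simp
  moreover have "\<forall>\<^sub>F t in at_right 0. (F (y + t *\<^sub>R v) - F y) / t \<le> k"
    using le eventually_at_right_less[of 0] by eventually_elim (simp add: field_simps)
  ultimately show ?thesis by (rule tendsto_upperbound) simp
qed

subsection \<open>Continuously differentiable cut-off functions\<close>

definition sqpos :: "real \<Rightarrow> real" where
  "sqpos t = (max 0 t)\<^sup>2"

lemma sqpos_nonneg [simp]: "sqpos t \<ge> 0"
  by (simp add: sqpos_def)

lemma sqpos_pos_iff: "sqpos t > 0 \<longleftrightarrow> t > 0"
  by (auto simp: sqpos_def max_def)

lemma sqpos_eq_0: "t \<le> 0 \<Longrightarrow> sqpos t = 0"
  by (simp add: sqpos_def max_def)

lemma has_real_derivative_sqpos: "(sqpos has_real_derivative 2 * max 0 t) (at t)"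
proof -
  consider "t > 0" | "t < 0" | "t = 0" by linarith
  then show ?thesis
  proof cases
    assume "t > 0"
    have "((\<lambda>t. t\<^sup>2) has_real_derivative 2 * max 0 t) (at t)"
      using \<open>t > 0\<close> by (auto intro!: derivative_eq_intros)
    then show ?thesis
      using \<open>t > 0\<close> by (elim has_field_derivative_transform_within_open[where S = "{0<..}"])
        (auto simp: sqpos_def)
  next
    assume "t < 0"
    have "((\<lambda>t. 0) has_real_derivative 2 * max 0 t) (at t)"
      using \<open>t < 0\<close> by (auto intro!: derivative_eq_intros)
    then show ?thesis
      using \<open>t < 0\<close> by (elim has_field_derivative_transform_within_open[where S = "{..<0}"])
        (auto simp: sqpos_def)
  next
    assume "t = 0"
    have "((\<lambda>h. (sqpos (0 + h) - sqpos 0) / h) \<longlongrightarrow> 0) (at 0)"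
    proof (rule Lim_null_comparison)
      show "\<forall>\<^sub>F h in at 0. norm ((sqpos (0 + h) - sqpos 0) / h) \<le> \<bar>h\<bar>"
        by (intro always_eventually allI) (auto simp: sqpos_def max_def power2_eq_square)
      show "((\<lambda>h. \<bar>h\<bar>) \<longlongrightarrow> (0::real)) (at 0)"
        by (auto intro: tendsto_eq_intros)
    qed
    then show ?thesis by (simp add: \<open>t = 0\<close> DERIV_def)
  qed
qed

lemma has_gradient_on_sqpos_compose:
  "has_gradient_on f D S \<Longrightarrow> has_gradient_on (\<lambda>x. sqpos (f x)) (\<lambda>x. (2 * max 0 (f x)) *\<^sub>R D x) S"
  by (rule has_gradient_on_compose_real[where \<theta>' = "\<lambda>t. 2 * max 0 t"])
    (auto intro!: continuous_intros has_real_derivative_sqpos)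

text \<open>The quadratic spline with knots \<open>0\<close>, \<open>1/2\<close> and \<open>1\<close> that falls from \<open>1\<close> to \<open>0\<close>.\<close>

definition cutoff :: "real \<Rightarrow> real" where
  "cutoff t = 1 - 2 * sqpos t + 4 * sqpos (t - 1 / 2) - 2 * sqpos (t - 1)"

definition cutoff' :: "real \<Rightarrow> real" where
  "cutoff' t = - 4 * max 0 t + 8 * max 0 (t - 1 / 2) - 4 * max 0 (t - 1)"

lemma has_real_derivative_cutoff: "(cutoff has_real_derivative cutoff' t) (at t)"
proof -
  have "((\<lambda>t. sqpos (t - a)) has_real_derivative 2 * max 0 (t - a)) (at t)" for a
    using DERIV_chain2[of sqpos _ "\<lambda>t. t - a", OF has_real_derivative_sqpos
        DERIV_diff[OF DERIV_ident DERIV_const]] by simp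
  from DERIV_diff[OF DERIV_add[OF DERIV_diff[OF DERIV_const[of 1]
        DERIV_cmult[OF has_real_derivative_sqpos, of 2]] DERIV_cmult[OF this, of 4]]
      DERIV_cmult[OF this, of 2]]
  show ?thesis unfolding cutoff_def by (rule DERIV_cong) (simp add: cutoff'_def)
qed

lemma continuous_on_cutoff': "continuous_on S f \<Longrightarrow> continuous_on S (\<lambda>x. cutoff' (f x))"
  unfolding cutoff'_def by (intro continuous_intros)

lemma abs_cutoff'_le: "\<bar>cutoff' t\<bar> \<le> 2"
  by (auto simp: cutoff'_def max_def)

lemma cutoff_eq_1: "t \<le> 0 \<Longrightarrow> cutoff t = 1"
  by (simp add: cutoff_def sqpos_eq_0)

lemma cutoff_eq_0: "t \<ge> 1 \<Longrightarrow> cutoff t = 0"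
  by (simp add: cutoff_def sqpos_def power2_eq_square algebra_simps)

lemma cutoff_strict_bounds: "t > 0 \<Longrightarrow> 0 \<le> cutoff t \<and> cutoff t < 1"
proof -
  assume "t > 0"
  then consider "0 < t" "t \<le> 1 / 2" | "1 / 2 \<le> t" "t \<le> 1" | "1 \<le> t" by linarith
  then show ?thesis
  proof cases
    assume t: "0 < t" "t \<le> 1 / 2"
    then have "t\<^sup>2 \<le> (1 / 2)\<^sup>2" by (intro power_mono) auto
    then show ?thesis using t by (simp add: cutoff_def sqpos_def power_divide)
  next
    assume t: "1 / 2 \<le> t" "t \<le> 1"
    then have "(1 - t)\<^sup>2 \<le> (1 / 2)\<^sup>2" by (intro power_mono) auto
    moreover have "cutoff t = 2 * (1 - t)\<^sup>2"
      using t by (simp add: cutoff_def sqpos_def power2_eq_square algebra_simps)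
    ultimately show ?thesis by (simp add: power_divide)
  qed (simp add: cutoff_eq_0)
qed

lemma cutoff_bounds: "cutoff t \<ge> 0" "cutoff t \<le> 1"
  using cutoff_strict_bounds[of t] cutoff_eq_1[of t] by (cases "t > 0"; simp)+

definition bump :: "'a::euclidean_space \<Rightarrow> real \<Rightarrow> real \<Rightarrow> 'a \<Rightarrow> real" where
  "bump z r s x = cutoff (((x - z) \<bullet> (x - z) - r\<^sup>2) / (s\<^sup>2 - r\<^sup>2))"

lemma has_gradient_on_bump: "\<exists>D. has_gradient_on (bump z r s) D S"
proof -
  have "has_gradient_on
      (\<lambda>x. (1 / (s\<^sup>2 - r\<^sup>2)) * ((x - z) \<bullet> (x - z)) + (- r\<^sup>2 / (s\<^sup>2 - r\<^sup>2)))
      (\<lambda>x. (1 / (s\<^sup>2 - r\<^sup>2)) *\<^sub>R (2 *\<^sub>R (x - z)) + 0) S"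
    by (intro has_gradient_on_add has_gradient_on_cmult has_gradient_on_inner_self
        has_gradient_on_const)
  from has_gradient_on_compose_real[OF this has_real_derivative_cutoff]
  show ?thesis
    unfolding bump_def by (auto simp: diff_divide_distrib continuous_on_cutoff')
qed

lemma bump_bounds: "bump z r s x \<ge> 0" "bump z r s x \<le> 1"
  by (simp_all add: bump_def cutoff_bounds)

lemma bump_eq_1:
  assumes "0 \<le> r" "r < s" "dist z x \<le> r" shows "bump z r s x = 1"
proof -
  have "r\<^sup>2 < s\<^sup>2" "(x - z) \<bullet> (x - z) \<le> r\<^sup>2"
    using assms by (auto intro!: power_strict_mono power_mono
        simp: dist_norm norm_minus_commute simp flip: power2_norm_eq_inner)
  then show ?thesis unfolding bump_def by (intro cutoff_eq_1) (simp add: divide_nonpos_pos)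
qed

lemma bump_less_1:
  assumes "0 \<le> r" "r < s" "dist z x > r" shows "bump z r s x < 1"
proof -
  have "r\<^sup>2 < s\<^sup>2" "r\<^sup>2 < (x - z) \<bullet> (x - z)"
    using assms by (auto intro!: power_strict_mono
        simp: dist_norm norm_minus_commute simp flip: power2_norm_eq_inner)
  then show ?thesis unfolding bump_def using cutoff_strict_bounds by simp
qed

lemma bump_eq_0:
  assumes "0 \<le> r" "r < s" "dist z x \<ge> s" shows "bump z r s x = 0"
proof -
  have "r\<^sup>2 < s\<^sup>2" "s\<^sup>2 \<le> (x - z) \<bullet> (x - z)"
    using assms by (auto intro!: power_strict_mono power_mono
        simp: dist_norm norm_minus_commute simp flip: power2_norm_eq_inner)
  then show ?thesis unfolding bump_def by (intro cutoff_eq_0) (simp add: le_divide_eq)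
qed

subsection \<open>Mollification\<close>

lemma lborel_integral_reflect:
  fixes f :: "'a::euclidean_space \<Rightarrow> real"
  assumes [measurable]: "f \<in> borel_measurable borel"
  shows "(\<integral>x. f (z - x) \<partial>lborel) = (\<integral>x. f x \<partial>lborel)"
proof -
  have "lborel = distr lborel borel (\<lambda>x::'a. z - x)"
    using lborel_affine[of "-1" z] by (simp add: density_1)
  then have "(\<integral>x. f x \<partial>lborel) = (\<integral>x. f x \<partial>distr lborel borel (\<lambda>x::'a. z - x))"
    by simp
  also have "\<dots> = (\<integral>x. f (z - x) \<partial>lborel)"
    by (rule integral_distr) simp_all
  finally show ?thesis by simp
qed

lemma has_gradient_on_integral_translates:
  fixes \<rho> W :: "'a::euclidean_space \<Rightarrow> real"
  assumes \<rho>: "has_gradient_on \<rho> \<rho>' UNIV" and W: "continuous_on UNIV W"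
  shows "has_gradient_on (\<lambda>z. integral (cbox a b) (\<lambda>t. \<rho> (z - t) * W t))
    (\<lambda>z. integral (cbox a b) (\<lambda>t. W t *\<^sub>R \<rho>' (z - t))) S"
proof -
  note cont = continuous_intros continuous_on_compose2[OF W]
    continuous_on_compose2[OF has_gradient_on_continuous[OF \<rho>]]
    continuous_on_compose2[OF has_gradient_on_imp_continuous_on[OF \<rho>]]
  define f' where "f' z t = blinfun_inner_right (W t *\<^sub>R \<rho>' (z - t))" for z t
  have int: "(\<lambda>t. W t *\<^sub>R \<rho>' (z - t)) integrable_on cbox a b" for z
    by (intro integrable_continuous cont) auto
  have "((\<lambda>z. integral (cbox a b) (\<lambda>t. \<rho> (z - t) * W t)) has_derivative
      blinfun_apply (integral (cbox a b) (f' z))) (at z within UNIV)" for z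
  proof (rule leibniz_rule)
    fix x t :: 'a
    have "((\<lambda>x. x - t) has_derivative (\<lambda>v. v)) (at x)"
      by (auto intro!: derivative_eq_intros)
    from has_derivative_mult_left[OF has_derivative_compose[OF this has_gradient_onD[OF \<rho> UNIV_I]],
        of "W t"]
    show "((\<lambda>x. \<rho> (x - t) * W t) has_derivative blinfun_apply (f' x t)) (at x within UNIV)"
      by (rule has_derivative_eq_rhs) (auto simp: f'_def mult.commute)
    show "(\<lambda>t. \<rho> (x - t) * W t) integrable_on cbox a b"
      by (intro integrable_continuous cont) auto
  next
    show "continuous_on (UNIV \<times> cbox a b) (\<lambda>(x, t). f' x t)"
      unfolding f'_def case_prod_beta
      by (intro cont bounded_linear.continuous_on[OF bounded_linear_blinfun_inner_right]) auto
  qed auto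
  moreover have "integral (cbox a b) (f' z) =
      blinfun_inner_right (integral (cbox a b) (\<lambda>t. W t *\<^sub>R \<rho>' (z - t)))" for z
    using integral_linear[OF int bounded_linear_blinfun_inner_right, of z]
    by (simp add: f'_def[abs_def] o_def)
  moreover have "continuous_on S (\<lambda>z. integral (cbox a b) (\<lambda>t. W t *\<^sub>R \<rho>' (z - t)))"
    by (rule integral_continuous_on_param) (auto simp: case_prod_beta intro!: cont)
  ultimately show ?thesis by (simp add: has_gradient_on_def)
qed

definition mollifier :: "real \<Rightarrow> 'a::euclidean_space \<Rightarrow> real" where
  "mollifier e y = sqpos (e\<^sup>2 - y \<bullet> y)"

definition mollify :: "real \<Rightarrow> ('a::euclidean_space \<Rightarrow> real) \<Rightarrow> 'a \<Rightarrow> real" where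
  "mollify e W z =
     (\<integral>\<zeta>. mollifier e \<zeta> * W (z - \<zeta>) \<partial>lborel) / (\<integral>\<zeta>. mollifier e (\<zeta>::'a) \<partial>lborel)"

lemma mollifier_nonneg: "mollifier e y \<ge> 0"
  by (simp add: mollifier_def)

lemma has_gradient_on_mollifier: "\<exists>D. has_gradient_on (mollifier e) D S"
proof -
  have "has_gradient_on (\<lambda>y::'a. (- 1) * ((y - 0) \<bullet> (y - 0)) + e\<^sup>2)
      (\<lambda>y. (- 1) *\<^sub>R (2 *\<^sub>R (y - 0)) + 0) S"
    by (intro has_gradient_on_add has_gradient_on_cmult has_gradient_on_inner_self
        has_gradient_on_const)
  from has_gradient_on_sqpos_compose[OF this] show ?thesis unfolding mollifier_def[abs_def] by (auto simp del: scaleR_minus_left)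
qed

lemma continuous_on_mollifier: "continuous_on S (mollifier e)"
  using has_gradient_on_mollifier has_gradient_on_imp_continuous_on by blast

context
  fixes e :: real
  assumes e: "e > 0"
begin

lemma mollifier_eq_0: "norm y > e \<Longrightarrow> mollifier e y = 0"
  using e power_mono[of e "norm y" 2]
  by (simp add: mollifier_def sqpos_eq_0 flip: power2_norm_eq_inner)

lemma integrable_mollifier_mult:
  fixes \<phi> :: "'a::euclidean_space \<Rightarrow> real"
  assumes "continuous_on UNIV \<phi>" shows "integrable lborel (\<lambda>\<zeta>. mollifier e \<zeta> * \<phi> \<zeta>)"
proof -
  have "integrable lborel (\<lambda>\<zeta>. indicator (cball 0 e) \<zeta> *\<^sub>R (mollifier e \<zeta> * \<phi> \<zeta>))"
    by (intro borel_integrable_compact continuous_intros continuous_on_mollifier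
        continuous_on_subset[OF assms]) auto
  then show ?thesis
    by (rule back_subst[where P = "integrable lborel"])
      (auto simp: indicator_def mollifier_eq_0 intro!: ext)
qed

lemma integral_mollifier_pos: "(\<integral>\<zeta>. mollifier e (\<zeta>::'a::euclidean_space) \<partial>lborel) > 0"
proof -
  have int: "integrable lborel (mollifier e :: 'a \<Rightarrow> real)"
    using integrable_mollifier_mult[of "\<lambda>_. 1"] by simp
  have "(\<integral>\<zeta>. mollifier e (\<zeta>::'a) \<partial>lborel) \<noteq> 0"
  proof
    assume "(\<integral>\<zeta>. mollifier e (\<zeta>::'a) \<partial>lborel) = 0"
    then have "AE \<zeta>::'a in lborel. mollifier e \<zeta> = 0"
      using integral_nonneg_eq_0_iff_AE[OF int] by (simp add: mollifier_nonneg)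
    moreover have "mollifier e \<zeta> > 0" if "\<zeta> \<in> ball (0::'a) e" for \<zeta>
      using that power_strict_mono[of "norm \<zeta>" e 2]
      by (simp add: mollifier_def sqpos_pos_iff power2_norm_eq_inner)
    ultimately have "AE \<zeta> in lborel. \<zeta> \<notin> ball (0::'a) e"
      by (force elim!: eventually_mono)
    then have "emeasure lborel (ball (0::'a) e) = 0"
      by (subst (asm) AE_iff_measurable[where N = "ball 0 e"]) auto
    then show False using content_ball_pos[OF e, of "0::'a"] by (simp add: measure_def)
  qed
  then show ?thesis
    using integral_nonneg_AE[of "mollifier e :: 'a \<Rightarrow> real" lborel]
    by (simp add: mollifier_nonneg order_less_le)
qed

lemma mollify_eq_integral:
  fixes W :: "'a::euclidean_space \<Rightarrow> real"
  assumes W: "continuous_on UNIV W" and Q: "cball z e \<subseteq> cbox a b"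
  shows "mollify e W z =
    integral (cbox a b) (\<lambda>t. mollifier e (z - t) * W t) / (\<integral>\<zeta>. mollifier e (\<zeta>::'a) \<partial>lborel)"
proof -
  let ?f = "\<lambda>t. mollifier e (z - t) * W t"
  have cont: "continuous_on S ?f" for S
    by (intro continuous_intros continuous_on_subset[OF W]
        continuous_on_compose2[OF continuous_on_mollifier[of UNIV]]) auto
  have "integral (cbox a b) ?f = (\<integral>t. indicator (cbox a b) t *\<^sub>R ?f t \<partial>lborel)"
    using set_borel_integral_eq_integral(2)[of "cbox a b" ?f] borel_integrable_compact[OF _ cont]
    by (simp add: set_integrable_def set_lebesgue_integral_def)
  also have "\<dots> = (\<integral>t. ?f t \<partial>lborel)"
  proof (rule Bochner_Integration.integral_cong[OF refl])
    fix t show "indicator (cbox a b) t *\<^sub>R ?f t = ?f t"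
    proof (cases "t \<in> cbox a b")
      case False
      then have "t \<notin> cball z e" using Q by blast
      then have "norm (z - t) > e" by (simp add: dist_norm)
      then show ?thesis by (simp add: mollifier_eq_0)
    qed simp
  qed
  also have "\<dots> = (\<integral>\<zeta>. mollifier e \<zeta> * W (z - \<zeta>) \<partial>lborel)"
    using lborel_integral_reflect[of ?f z] cont[of UNIV] by (simp add: borel_measurable_continuous_onI)
  finally show ?thesis by (simp add: mollify_def)
qed

lemma has_gradient_on_mollify:
  fixes W :: "'a::euclidean_space \<Rightarrow> real"
  assumes W: "continuous_on UNIV W"
  shows "has_gradient_on (mollify e W) (gradient (mollify e W)) S"
proof (rule has_gradient_on_local)
  fix z :: 'a
  obtain b where b: "ball z (1 + e) \<subseteq> cbox (- b) b"
    using bounded_subset_cbox_symmetric[OF bounded_ball] by blast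
  obtain D where "has_gradient_on (mollifier e) D (UNIV :: 'a set)"
    using has_gradient_on_mollifier by blast
  note grad = has_gradient_on_cmult[OF has_gradient_on_integral_translates[OF this W],
      of "1 / (\<integral>\<zeta>. mollifier e (\<zeta>::'a) \<partial>lborel)"]
  have "1 / (\<integral>\<zeta>. mollifier e (\<zeta>::'a) \<partial>lborel) *
      integral (cbox (- b) b) (\<lambda>t. mollifier e (x - t) * W t) = mollify e W x"
    if "x \<in> ball z 1" for x
  proof -
    have "cball x e \<subseteq> ball z (1 + e)"
    proof
      fix y assume "y \<in> cball x e"
      then show "y \<in> ball z (1 + e)" using that dist_triangle[of z y x] by simp
    qed
    then show ?thesis using b by (simp add: mollify_eq_integral[OF W order_trans])
  qed
  from has_gradient_on_cong[OF grad open_ball this]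
  have "\<exists>E. has_gradient_on (mollify e W) E (ball z 1)" by blast
  then show "\<exists>U D. open U \<and> z \<in> U \<and> has_gradient_on (mollify e W) D U"
    by (meson centre_in_ball open_ball zero_less_one)
qed

lemma mollify_le:
  fixes V W :: "'a::euclidean_space \<Rightarrow> real"
  assumes cont: "continuous_on UNIV V" "continuous_on UNIV W"
    and le: "\<And>\<zeta>. norm \<zeta> \<le> e \<Longrightarrow> V (y - \<zeta>) \<le> W (z - \<zeta>) + k"
  shows "mollify e V y \<le> mollify e W z + k"
proof -
  have int: "integrable lborel (\<lambda>\<zeta>. mollifier e \<zeta> * U (x - \<zeta>))"
    if "continuous_on UNIV U" for U :: "'a \<Rightarrow> real" and x
    by (intro integrable_mollifier_mult continuous_on_compose2[OF that] continuous_intros) auto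
  have "(\<integral>\<zeta>. mollifier e \<zeta> * V (y - \<zeta>) \<partial>lborel)
      \<le> (\<integral>\<zeta>. mollifier e \<zeta> * W (z - \<zeta>) + mollifier e \<zeta> * k \<partial>lborel)"
  proof (rule integral_mono)
    fix \<zeta> :: 'a
    show "mollifier e \<zeta> * V (y - \<zeta>) \<le> mollifier e \<zeta> * W (z - \<zeta>) + mollifier e \<zeta> * k"
      using mult_left_mono[OF le mollifier_nonneg[of e \<zeta>], of \<zeta>]
      by (cases "norm \<zeta> \<le> e") (auto simp: mollifier_eq_0 algebra_simps)
  qed (intro int cont integrable_mollifier_mult Bochner_Integration.integrable_add
      continuous_on_const)+
  also have "\<dots> = (\<integral>\<zeta>. mollifier e \<zeta> * W (z - \<zeta>) \<partial>lborel) + (\<integral>\<zeta>. mollifier e (\<zeta>::'a) \<partial>lborel) * k"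
    using int[OF cont(2)] integrable_mollifier_mult[of "\<lambda>_::'a. k"] by simp
  finally show ?thesis
    using integral_mollifier_pos[where 'a = 'a] by (simp add: mollify_def field_simps)
qed

lemma mollify_const: "mollify e (\<lambda>_. k) (z::'a::euclidean_space) = k"
  using integral_mollifier_pos[where 'a = 'a] by (simp add: mollify_def less_le)

lemma abs_mollify_diff_le:
  assumes W: "continuous_on UNIV W" and "\<And>\<zeta>. norm \<zeta> \<le> e \<Longrightarrow> \<bar>W (z - \<zeta>) - a\<bar> \<le> k"
  shows "\<bar>mollify e W z - a\<bar> \<le> k"
proof -
  have le: "W (z - \<zeta>) \<le> a + k" "a \<le> W (z - \<zeta>) + k" if "norm \<zeta> \<le> e" for \<zeta>
    using assms(2)[OF that] by (auto simp: abs_le_iff)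
  have "mollify e W z \<le> a + k" "a \<le> mollify e W z + k"
    using mollify_le[OF W continuous_on_const[of _ a] le(1)]
      mollify_le[OF continuous_on_const[of _ a] W le(2)] by (auto simp: mollify_const)
  then show ?thesis by (simp add: abs_le_iff)
qed

end

subsection \<open>A viscosity mean value inequality\<close>

lemma open_segment_neighbourhood:
  fixes z v :: "'a::euclidean_space"
  assumes "open B" "closed_segment z (z + r *\<^sub>R v) \<subseteq> B" "r > 0"
  obtains e where "e > 0" "\<And>t w. t \<in> {0..r} \<Longrightarrow> w \<in> cball 0 e \<Longrightarrow> z + t *\<^sub>R v + w \<in> B"
proof -
  obtain e where "e > 0" and e: "(\<Union>p\<in>closed_segment z (z + r *\<^sub>R v). cball p e) \<subseteq> B"
    using compact_subset_open_imp_cball_epsilon_subset[OF compact_segment assms(1,2)] by blast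
  have "z + t *\<^sub>R v \<in> closed_segment z (z + r *\<^sub>R v)" if "t \<in> {0..r}" for t
    using that \<open>r > 0\<close> unfolding closed_segment_def
    by (intro CollectI exI[of _ "t / r"]) (auto simp: algebra_simps)
  then show thesis using that \<open>e > 0\<close> e by (force simp: dist_norm)
qed

lemma penalized_maximum_near_segment:
  fixes U :: "'a::euclidean_space \<Rightarrow> real"
  assumes U: "continuous_on B U" and "r \<ge> 0" "e > 0" "d > 0"
    and tube: "\<And>t w. t \<in> {0..r} \<Longrightarrow> w \<in> cball 0 e \<Longrightarrow> z + t *\<^sub>R v + w \<in> B"
  obtains N t w where "t \<in> {0..r}" "norm w \<le> e" "norm w < d"
    "\<And>t' w'. t' \<in> {0..r} \<Longrightarrow> norm w' \<le> e \<Longrightarrow>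
      U (z + t' *\<^sub>R v + w') - N * (w' \<bullet> w') - k * t' \<le> U (z + t *\<^sub>R v + w) - N * (w \<bullet> w) - k * t"
    "N > 0"
proof -
  define Q where "Q = {0..r} \<times> cball (0::'a) e"
  have "compact Q" "Q \<noteq> {}" using assms(2,3) by (auto simp: Q_def compact_Times)
  have cont: "continuous_on Q (\<lambda>(t, w). U (z + t *\<^sub>R v + w))"
    unfolding case_prod_beta
    by (intro continuous_on_compose2[OF U] continuous_intros) (auto simp: Q_def intro!: tube)
  obtain M where "M > 0" and M: "\<And>t w. (t, w) \<in> Q \<Longrightarrow> \<bar>U (z + t *\<^sub>R v + w)\<bar> \<le> M"
    using compact_imp_bounded[OF compact_continuous_image[OF cont \<open>compact Q\<close>]]
    unfolding bounded_pos by fastforce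
  define N where "N = (2 * M + 1) / d\<^sup>2"
  have N: "N > 0" "N * d\<^sup>2 = 2 * M + 1" using \<open>M > 0\<close> \<open>d > 0\<close> by (auto simp: N_def)
  define F where "F t w = U (z + t *\<^sub>R v + w) - N * (w \<bullet> w) - k * t" for t w
  have "continuous_on Q (\<lambda>(t, w). F t w)"
    using cont unfolding F_def case_prod_beta by (intro continuous_intros)
  then obtain t w where tw: "(t, w) \<in> Q" and max: "\<And>t' w'. (t', w') \<in> Q \<Longrightarrow> F t' w' \<le> F t w"
    using continuous_attains_sup[OF \<open>compact Q\<close> \<open>Q \<noteq> {}\<close>] by fastforce
  have t0: "(t, 0) \<in> Q" using tw \<open>e > 0\<close> by (simp add: Q_def)
  have "N * (norm w)\<^sup>2 \<le> U (z + t *\<^sub>R v + w) - U (z + t *\<^sub>R v)"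
    using max[OF t0] by (simp add: F_def power2_norm_eq_inner)
  also have "\<dots> < N * d\<^sup>2"
    using M[OF tw] M[OF t0] N(2) by simp
  finally have "norm w < d"
    using N(1) \<open>d > 0\<close> power_less_imp_less_base[of "norm w" 2 d] by simp
  then show thesis
    using that[of t w N] tw max N(1) by (simp add: Q_def F_def)
qed

lemma le_inner_if_square_increments:
  fixes w v :: "'a::euclidean_space"
  assumes w: "norm w < e" and "t > 0"
    and incr: "\<And>s. 0 < s \<Longrightarrow> s < t \<Longrightarrow> norm (w + s *\<^sub>R v) \<le> e \<Longrightarrow> k * s \<le> N * ((w + s *\<^sub>R v) \<bullet> (w + s *\<^sub>R v)) - N * (w \<bullet> w)"
  shows "k \<le> (2 * N) *\<^sub>R w \<bullet> v"
proof -
  have "has_gradient_on (\<lambda>y. (- N) * ((y - 0) \<bullet> (y - 0))) (\<lambda>y. (- N) *\<^sub>R (2 *\<^sub>R (y - 0))) {w}"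
    by (intro has_gradient_on_cmult has_gradient_on_inner_self)
  then have der: "((\<lambda>y. - N * (y \<bullet> y)) has_derivative (\<lambda>h. ((- 2 * N) *\<^sub>R w) \<bullet> h)) (at w)"
    by (simp add: has_gradient_on_def mult.commute)
  have "((\<lambda>s. norm (w + s *\<^sub>R v)) \<longlongrightarrow> norm (w + 0 *\<^sub>R v)) (at_right 0)" by (intro tendsto_intros)
  then have "\<forall>\<^sub>F s in at_right 0. norm (w + s *\<^sub>R v) < e" using w by (intro order_tendstoD) auto
  moreover have "\<forall>\<^sub>F s in at_right 0. s < t" using \<open>t > 0\<close> by (rule order_tendstoD[OF tendsto_ident_at])
  ultimately have "\<forall>\<^sub>F s in at_right 0. - N * ((w + s *\<^sub>R v) \<bullet> (w + s *\<^sub>R v)) - - N * (w \<bullet> w) \<le> s * - k"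
    using eventually_at_right_less[of 0] by eventually_elim (use incr in \<open>force simp: mult.commute\<close>)
  from inner_derivative_le_if_increments_le[OF der this] have "((- 2 * N) *\<^sub>R w) \<bullet> v \<le> - k" .
  then show ?thesis by simp
qed

text \<open>
  Doubling of variables: maximise \<open>U y - N |y - p|\<^sup>2 - k t\<close> over the points \<open>p = z + t v\<close> of the
  segment and the \<open>y\<close> near \<open>p\<close>. The derivative in \<open>t\<close> of the penalty is the gradient in \<open>y\<close> of the
  test function, applied to \<open>v\<close>.
\<close>

lemma viscosity_mean_value:
  fixes U :: "'a::euclidean_space \<Rightarrow> real"
  assumes B: "open B" "closed_segment z (z + r *\<^sub>R v) \<subseteq> B" and U: "continuous_on B U"
    and "r > 0" and slope: "U (z + r *\<^sub>R v) - U z > r * \<kappa>"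
  obtains a N y where "y \<in> B" "\<kappa> < (2 * N) *\<^sub>R (y - a) \<bullet> v"
    "\<forall>\<^sub>F y' in nhds y. U y' - N * ((y' - a) \<bullet> (y' - a)) \<le> U y - N * ((y - a) \<bullet> (y - a))"
proof -
  define \<Delta> where "\<Delta> = U (z + r *\<^sub>R v) - U z - r * \<kappa>"
  define k where "k = \<kappa> + \<Delta> / (2 * r)"
  have \<Delta>: "\<Delta> > 0" "\<kappa> < k" "U (z + r *\<^sub>R v) - k * r = U z + \<Delta> / 2"
    using slope \<open>r > 0\<close> by (auto simp: \<Delta>_def k_def field_simps)
  obtain e where "e > 0" and tube: "\<And>t w. t \<in> {0..r} \<Longrightarrow> w \<in> cball 0 e \<Longrightarrow> z + t *\<^sub>R v + w \<in> B"
    using open_segment_neighbourhood[OF B \<open>r > 0\<close>] by blast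
  have "isCont U z" using U B by (simp add: continuous_on_eq_continuous_at subset_iff)
  then obtain d where "d > 0" and d: "\<And>y. dist y z < d \<Longrightarrow> \<bar>U y - U z\<bar> < \<Delta> / 2"
    unfolding continuous_at_eps_delta dist_real_def using half_gt_zero[OF \<Delta>(1)] by metis
  obtain N t w where t: "t \<in> {0..r}" and w: "norm w \<le> e" "norm w < min e d"
    and max: "\<And>t' w'. t' \<in> {0..r} \<Longrightarrow> norm w' \<le> e \<Longrightarrow>
      U (z + t' *\<^sub>R v + w') - N * (w' \<bullet> w') - k * t' \<le> U (z + t *\<^sub>R v + w) - N * (w \<bullet> w) - k * t"
    and "N > 0"
    using penalized_maximum_near_segment[OF U _ \<open>e > 0\<close> _ tube,
        where k = k and d = "min e d"] \<open>r > 0\<close> \<open>d > 0\<close> \<open>e > 0\<close> by (metis less_imp_le min_less_iff_conj)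
  have "t \<noteq> 0"
  proof
    assume "t = 0"
    then have "U z + \<Delta> / 2 \<le> U (z + w) - N * (w \<bullet> w)"
      using max[of r 0] \<Delta>(3) \<open>r > 0\<close> \<open>e > 0\<close> by simp
    moreover have "\<bar>U (z + w) - U z\<bar> < \<Delta> / 2" using w by (intro d) (simp add: dist_norm)
    moreover have "N * (w \<bullet> w) \<ge> 0" using \<open>N > 0\<close> by simp
    ultimately show False by linarith
  qed
  let ?p = "z + t *\<^sub>R v"
  have "k \<le> (2 * N) *\<^sub>R w \<bullet> v"
  proof (rule le_inner_if_square_increments)
    show "norm w < e" "t > 0" using w t \<open>t \<noteq> 0\<close> by auto
    show "k * s \<le> N * ((w + s *\<^sub>R v) \<bullet> (w + s *\<^sub>R v)) - N * (w \<bullet> w)" if "0 < s" "s < t" "norm (w + s *\<^sub>R v) \<le> e" for s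
      using max[of "t - s" "w + s *\<^sub>R v"] that t by (simp add: algebra_simps)
  qed
  moreover have "\<forall>\<^sub>F y' in nhds (?p + w). y' \<in> ball ?p e"
    using w by (intro eventually_nhds_in_open) (auto simp: dist_norm)
  then have "\<forall>\<^sub>F y' in nhds (?p + w). U y' - N * ((y' - ?p) \<bullet> (y' - ?p)) \<le> U (?p + w) - N * (w \<bullet> w)"
  proof eventually_elim
    case (elim y')
    then show ?case using max[OF t, of "y' - ?p"] by (simp add: dist_norm norm_minus_commute)
  qed
  moreover have "?p + w \<in> B" using tube t w by simp
  ultimately show thesis using that[of "?p + w" N ?p] \<Delta>(2) by simp
qed

subsection \<open>Monotone functions are differentiable almost everywhere\<close>

text \<open>
  Vitali covering shows that the points near which the slopes of a monotone function exceed \<open>q\<close> and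
  also fall below some \<open>p < q\<close> form a null set.
\<close>

definition steep :: "(real \<Rightarrow> real) \<Rightarrow> real \<Rightarrow> real set" where
  "steep F q = (\<Inter>n. \<Union>{{u<..<v} |u v.
     u < v \<and> v - u < inverse (real (Suc n)) \<and> F v - F u > q * (v - u)})"

lemma steep_borel [measurable]: "steep F q \<in> sets borel"
  unfolding steep_def by (rule sets.countable_INT'') (auto intro!: borel_open open_Union)

lemma steepD:
  assumes "x \<in> steep F q" "e > 0"
  obtains u v where "u < x" "x < v" "v - u < e" "F v - F u > q * (v - u)"
proof -
  obtain n where "inverse (real (Suc n)) < e" using reals_Archimedean[OF \<open>e > 0\<close>] by blast
  moreover have "x \<in> \<Union>{{u<..<v} |u v.
      u < v \<and> v - u < inverse (real (Suc n)) \<and> F v - F u > q * (v - u)}"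
    using assms(1) by (auto simp: steep_def)
  ultimately show thesis using that by (auto intro: less_trans)
qed

definition slope_le_near :: "(real \<Rightarrow> real) \<Rightarrow> real \<Rightarrow> real \<Rightarrow> bool" where
  "slope_le_near F x q \<longleftrightarrow>
     (\<exists>e>0. \<forall>u v. u \<le> x \<longrightarrow> x \<le> v \<longrightarrow> v - u < e \<longrightarrow> F v - F u \<le> q * (v - u))"

lemma slope_le_near_mono:
  assumes "slope_le_near F x p" "p \<le> q" shows "slope_le_near F x q"
proof -
  have "p * (v - u) \<le> q * (v - u)" if "u \<le> x" "x \<le> v" for u v
    using assms(2) that by (intro mult_right_mono) auto
  then show ?thesis using assms(1) unfolding slope_le_near_def by (meson order_trans)
qed

lemma has_real_derivative_if_slopes_near:
  assumes above: "\<And>\<epsilon>. \<epsilon> > 0 \<Longrightarrow> slope_le_near F x (D + \<epsilon>)"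
    and below: "\<And>\<epsilon>. \<epsilon> > 0 \<Longrightarrow> slope_le_near (\<lambda>x. - F x) x (\<epsilon> - D)"
  shows "(F has_real_derivative D) (at x)"
proof -
  have "\<exists>e>0. \<forall>y. norm (y - x) < e \<longrightarrow> norm (F y - F x - D * (y - x)) \<le> \<epsilon> * norm (y - x)"
    if \<epsilon>: "\<epsilon> > 0" for \<epsilon>
  proof -
    obtain e e' where "e > 0" "e' > 0"
      and e: "\<And>u v. u \<le> x \<Longrightarrow> x \<le> v \<Longrightarrow> v - u < e \<Longrightarrow> F v - F u \<le> (D + \<epsilon>) * (v - u)"
      and e': "\<And>u v. u \<le> x \<Longrightarrow> x \<le> v \<Longrightarrow> v - u < e' \<Longrightarrow> - F v - - F u \<le> (\<epsilon> - D) * (v - u)"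
      using above[OF \<epsilon>] below[OF \<epsilon>] unfolding slope_le_near_def by meson
    have straddle: "\<bar>F v - F u - D * (v - u)\<bar> \<le> \<epsilon> * (v - u)"
      if "u \<le> x" "x \<le> v" "v - u < min e e'" for u v
      using e[of u v] e'[of u v] that by (simp add: abs_le_iff algebra_simps)
    have "norm (F y - F x - D * (y - x)) \<le> \<epsilon> * norm (y - x)" if "norm (y - x) < min e e'" for y
      using straddle[of x y] straddle[of y x] that
      by (cases "x \<le> y") (auto simp: abs_le_iff algebra_simps)
    then show ?thesis using \<open>e > 0\<close> \<open>e' > 0\<close> by (intro exI[of _ "min e e'"]) simp
  qed
  then have "(F has_derivative (\<lambda>h. D * h)) (at x)"
    unfolding has_derivative_at_alt by (simp add: bounded_linear_mult_right)
  then show ?thesis by (simp add: has_field_derivative_def)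
qed

lemma slope_le_near_if_not_steep:
  assumes "x \<notin> steep F q" and cont: "continuous_on UNIV F"
  shows "slope_le_near F x q"
proof -
  obtain n where n: "x \<notin> \<Union>{{u<..<v} |u v.
      u < v \<and> v - u < inverse (real (Suc n)) \<and> F v - F u > q * (v - u)}"
    using assms(1) by (auto simp: steep_def)
  have strict: "F v - F u \<le> q * (v - u)"
    if "u < x" "x < v" "v - u < inverse (real (Suc n))" for u v
    using n that by (smt (verit) UnionI greaterThanLessThan_iff mem_Collect_eq)
  have "F v - F u \<le> q * (v - u)" if uv: "u \<le> x" "x \<le> v" "v - u < inverse (real (Suc n))" for u v
  proof -
    have F: "((\<lambda>s. F (f s)) \<longlongrightarrow> F (f 0)) (at_right 0)"
      if "(f \<longlongrightarrow> f 0) (at_right 0)" for f :: "real \<Rightarrow> real"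
      using continuous_on_tendsto_compose[OF cont that] by simp
    have "\<forall>\<^sub>F s in at_right 0. s < (inverse (real (Suc n)) - (v - u)) / 2"
      using uv by (intro order_tendstoD[OF tendsto_ident_at]) auto
    then have "\<forall>\<^sub>F s in at_right 0. F (v + s) - F (u - s) \<le> q * ((v + s) - (u - s))"
      using eventually_at_right_less[of 0]
    proof eventually_elim
      case (elim s)
      then show ?case using uv by (intro strict) auto
    qed
    moreover have "((\<lambda>s. F (v + s) - F (u - s)) \<longlongrightarrow> F (v + 0) - F (u - 0)) (at_right 0)"
      by (intro tendsto_diff F tendsto_intros)
    moreover have "((\<lambda>s. q * ((v + s) - (u - s))) \<longlongrightarrow> q * ((v + 0) - (u - 0))) (at_right 0)"
      by (intro tendsto_intros)
    ultimately show ?thesis using tendsto_le[of "at_right (0::real)"] by force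
  qed
  then show ?thesis
    unfolding slope_le_near_def by (intro exI[of _ "inverse (real (Suc n))"]) simp
qed

lemma Vitali_covering_intervals:
  fixes S :: "real set"
  assumes S: "\<And>x e. x \<in> S \<Longrightarrow> e > 0 \<Longrightarrow> \<exists>u v. u < x \<and> x < v \<and> v - u < e \<and> P u v"
    and Ob: "open Ob" "S \<subseteq> Ob"
  obtains C where "countable C" "\<And>u v. (u, v) \<in> C \<Longrightarrow> u < v \<and> {u..v} \<subseteq> Ob \<and> P u v"
    "disjoint_family_on (\<lambda>(u, v). {u..v}) C" "negligible (S - (\<Union>(u, v)\<in>C. {u..v}))"
proof -
  define K where "K = {(u, v). u < v \<and> {u..v} \<subseteq> Ob \<and> P u v}"
  have cball: "cball ((fst i + snd i) / 2) ((snd i - fst i) / 2) = {fst i..snd i}"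
    for i :: "real \<times> real"
    by (auto simp: cball_def dist_real_def abs_if field_simps split: if_splits)
  obtain C where C: "countable C" "C \<subseteq> K"
     "pairwise (\<lambda>i j. disjnt (cball ((fst i + snd i) / 2) ((snd i - fst i) / 2))
        (cball ((fst j + snd j) / 2) ((snd j - fst j) / 2))) C"
     "negligible (S - (\<Union>i\<in>C. cball ((fst i + snd i) / 2) ((snd i - fst i) / 2)))"
  proof (rule Vitali_covering_theorem_cballs[of K "\<lambda>i. (snd i - fst i) / 2" S
        "\<lambda>i. (fst i + snd i) / 2"])
    fix x d :: real assume x: "x \<in> S" and "0 < d"
    obtain e where e: "e > 0" "ball x e \<subseteq> Ob"
      using Ob x by (meson open_contains_ball subsetD)
    obtain u v where uv: "u < x" "x < v" "v - u < min d e" "P u v"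
      using S[OF x, of "min d e"] \<open>0 < d\<close> \<open>e > 0\<close> by auto
    have "{u..v} \<subseteq> ball x e" using uv by (auto simp: dist_real_def)
    then have "(u, v) \<in> K" using uv e by (auto simp: K_def)
    then show "\<exists>i. i \<in> K \<and> x \<in> cball ((fst i + snd i) / 2) ((snd i - fst i) / 2) \<and>
        (snd i - fst i) / 2 < d"
      unfolding cball using uv by (intro exI[of _ "(u, v)"]) auto
  qed (auto simp: K_def)
  show thesis
  proof (rule that[OF C(1)])
    show "u < v \<and> {u..v} \<subseteq> Ob \<and> P u v" if "(u, v) \<in> C" for u v
      using that C(2) by (auto simp: K_def)
    show "disjoint_family_on (\<lambda>(u, v). {u..v}) C"
      using C(3) unfolding cball disjoint_family_on_def pairwise_def disjnt_def
      by (auto simp: case_prod_beta)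
    show "negligible (S - (\<Union>(u, v)\<in>C. {u..v}))"
      using C(4) unfolding cball by (simp add: case_prod_beta)
  qed
qed

lemma negligible_Diff_open_intervals:
  fixes E :: "real set"
  assumes C: "countable C" and neg: "negligible (E - (\<Union>(u, v)\<in>C. {u..v}))"
  shows "negligible (E - (\<Union>(u, v)\<in>C. {u<..<v}))"
proof (rule negligible_subset)
  have "negligible (fst ` C \<union> snd ` C)"
    using C unfolding negligible_iff_null_sets
    by (intro null_sets_completionI countable_imp_null_set_lborel) auto
  then show "negligible ((E - (\<Union>(u, v)\<in>C. {u..v})) \<union> (fst ` C \<union> snd ` C))"
    using neg by (rule negligible_Un[rotated])
  have "x \<in> fst ` C \<union> snd ` C" if "(u, v) \<in> C" "x \<in> {u..v}" "x \<notin> {u<..<v}" for x u v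
  proof -
    have "x = u \<or> x = v" using that(2,3) by auto
    then show ?thesis using that(1) by force
  qed
  then show "E - (\<Union>(u, v)\<in>C. {u<..<v}) \<subseteq> (E - (\<Union>(u, v)\<in>C. {u..v})) \<union> (fst ` C \<union> snd ` C)"
    by blast
qed

lemma emeasure_disjoint_Union_mono:
  assumes C: "countable C" "disjoint_family_on A C"
    and M: "\<And>i. i \<in> C \<Longrightarrow> A i \<in> sets M" and N: "\<And>i. i \<in> C \<Longrightarrow> A i \<in> sets N"
    and le: "\<And>i. i \<in> C \<Longrightarrow> p * emeasure M (A i) \<le> q * emeasure N (A i)"
  shows "p * emeasure M (\<Union>i\<in>C. A i) \<le> q * emeasure N (\<Union>i\<in>C. A i)"
proof -
  have "p * emeasure M (\<Union>i\<in>C. A i) = (\<integral>\<^sup>+i. p * emeasure M (A i) \<partial>count_space C)"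
    using C M by (simp add: emeasure_UN_countable nn_integral_cmult)
  also have "\<dots> \<le> (\<integral>\<^sup>+i. q * emeasure N (A i) \<partial>count_space C)"
    using le by (intro nn_integral_mono) auto
  also have "\<dots> = q * emeasure N (\<Union>i\<in>C. A i)"
    using C N by (simp add: emeasure_UN_countable nn_integral_cmult)
  finally show ?thesis .
qed

lemma emeasure_lborel_mono_negligible:
  fixes A B :: "real set"
  assumes [measurable]: "A \<in> sets borel" "B \<in> sets borel" and "negligible (A - B)"
  shows "emeasure lborel A \<le> emeasure lborel B"
proof (rule emeasure_mono_AE)
  have "A - B \<in> null_sets lborel"
    using assms by (simp add: negligible_iff_null_sets null_sets_def emeasure_completion)
  then show "AE x in lborel. x \<in> A \<longrightarrow> x \<in> B"
    using AE_not_in by fastforce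
qed simp

context
  fixes F :: "real \<Rightarrow> real"
  assumes mono: "\<And>x y. x \<le> y \<Longrightarrow> F x \<le> F y" and cont: "continuous_on UNIV F"
begin

lemma emeasure_interval_measure_cont_Icc:
  "u \<le> v \<Longrightarrow> emeasure (interval_measure F) {u..v} = ennreal (F v - F u)"
  by (rule emeasure_interval_measure_Icc[OF _ mono cont])

lemma emeasure_steep_le:
  assumes Ob: "open Ob" "E \<subseteq> Ob" and E: "E \<in> sets borel" "E \<subseteq> steep F q" and "q \<ge> 0"
  shows "ennreal q * emeasure lborel E \<le> emeasure (interval_measure F) Ob"
proof -
  have "\<exists>u v. u < x \<and> x < v \<and> v - u < e \<and> q * (v - u) < F v - F u" if "x \<in> E" "e > 0" for x e
    using E(2) that by (meson steepD subsetD)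
  from Vitali_covering_intervals[OF this Ob]
  obtain C where C: "countable C" "disjoint_family_on (\<lambda>(u, v). {u..v}) C"
    "\<And>u v. (u, v) \<in> C \<Longrightarrow> u < v \<and> {u..v} \<subseteq> Ob \<and> q * (v - u) < F v - F u"
    "negligible (E - (\<Union>(u, v)\<in>C. {u..v}))" by metis
  let ?U = "\<Union>(u, v)\<in>C. {u..v}"
  have U: "?U \<in> sets borel" using C(1) by (intro sets.countable_UN') auto
  have "ennreal q * emeasure lborel E \<le> ennreal q * emeasure lborel ?U"
    using E(1) U C(4) by (intro mult_left_mono emeasure_lborel_mono_negligible) auto
  also have "\<dots> \<le> 1 * emeasure (interval_measure F) ?U"
  proof (rule emeasure_disjoint_Union_mono[OF C(1,2)], goal_cases)
    case (3 i)
    then have "fst i < snd i" "q * (snd i - fst i) \<le> F (snd i) - F (fst i)"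
      using C(3)[of "fst i" "snd i"] by auto
    then show ?case
      using \<open>q \<ge> 0\<close> by (simp add: case_prod_beta emeasure_interval_measure_cont_Icc ennreal_leI
          flip: ennreal_mult)
  qed auto
  also have "\<dots> \<le> emeasure (interval_measure F) Ob"
    using Ob(1) C(3) by (auto intro!: emeasure_mono)
  finally show ?thesis .
qed

lemma open_cover_not_steep:
  assumes Ob: "open Ob" "E \<subseteq> Ob" and E: "E \<subseteq> steep (\<lambda>x. - F x) (- p)" and "p \<ge> 0"
  obtains V where "open V" "V \<subseteq> Ob" "negligible (E - V)"
    "emeasure (interval_measure F) V \<le> ennreal p * emeasure lborel Ob"
proof -
  have "\<exists>u v. u < x \<and> x < v \<and> v - u < e \<and> F v - F u < p * (v - u)" if "x \<in> E" "e > 0" for x e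
  proof -
    have "x \<in> steep (\<lambda>x. - F x) (- p)" using E that(1) by blast
    then obtain u v where "u < x" "x < v" "v - u < e" "- F v - - F u > - p * (v - u)"
      using \<open>e > 0\<close> by (rule steepD)
    then show ?thesis by (intro exI[of _ u] exI[of _ v]) simp
  qed
  from Vitali_covering_intervals[OF this Ob]
  obtain C where C: "countable C" "disjoint_family_on (\<lambda>(u, v). {u..v}) C"
    "\<And>u v. (u, v) \<in> C \<Longrightarrow> u < v \<and> {u..v} \<subseteq> Ob \<and> F v - F u < p * (v - u)"
    "negligible (E - (\<Union>(u, v)\<in>C. {u..v}))" by metis
  let ?U = "\<Union>(u, v)\<in>C. {u..v}" and ?V = "\<Union>(u, v)\<in>C. {u<..<v}"
  show thesis
  proof (rule that[of ?V])
    show "open ?V" by auto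
    show "?V \<subseteq> Ob" using C(3) by fastforce
    show "negligible (E - ?V)" by (rule negligible_Diff_open_intervals[OF C(1,4)])
    have "?U \<in> sets borel" using C(1) by (intro sets.countable_UN') auto
    moreover have "?V \<subseteq> ?U" by (intro UN_mono) auto
    ultimately have "emeasure (interval_measure F) ?V \<le> 1 * emeasure (interval_measure F) ?U"
      by (simp add: emeasure_mono)
    also have "\<dots> \<le> ennreal p * emeasure lborel ?U"
    proof (rule emeasure_disjoint_Union_mono[OF C(1,2)], goal_cases)
      case (3 i)
      then have "fst i < snd i" "F (snd i) - F (fst i) \<le> p * (snd i - fst i)"
        using C(3)[of "fst i" "snd i"] by auto
      then show ?case
        using \<open>0 \<le> p\<close> by (simp add: case_prod_beta emeasure_interval_measure_cont_Icc ennreal_leI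
            flip: ennreal_mult)
    qed auto
    also have "\<dots> \<le> ennreal p * emeasure lborel Ob"
      using C(3) Ob(1) by (intro mult_left_mono emeasure_mono) auto
    finally show "emeasure (interval_measure F) ?V \<le> ennreal p * emeasure lborel Ob" .
  qed
qed

lemma steep_up_down_null:
  assumes "0 \<le> p" "p < q" "bounded B" "B \<in> sets borel"
  shows "emeasure lborel (steep F q \<inter> steep (\<lambda>x. - F x) (- p) \<inter> B) = 0"
proof -
  define E where "E = steep F q \<inter> steep (\<lambda>x. - F x) (- p) \<inter> B"
  have E[measurable]: "E \<in> sets borel" using assms(4) by (auto simp: E_def)
  have "emeasure lborel E < \<infinity>"
    using assms(3) by (intro emeasure_bounded_finite) (auto simp: E_def intro: bounded_subset)
  then obtain e where e: "emeasure lborel E = ennreal e" "e \<ge> 0"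
    by (metis ennreal_enn2real enn2real_nonneg less_top infinity_ennreal_def)
  have "q * e \<le> p * (e + \<epsilon>)" if "\<epsilon> > 0" for \<epsilon>
  proof -
    obtain Ob where Ob: "open Ob" "E \<subseteq> Ob" "emeasure lborel (Ob - E) < ennreal \<epsilon>"
      using outer_regular_lborel[OF E \<open>\<epsilon> > 0\<close>] by blast
    obtain V where V: "open V" "V \<subseteq> Ob" "negligible (E - V)"
      "emeasure (interval_measure F) V \<le> ennreal p * emeasure lborel Ob"
      by (rule open_cover_not_steep[OF Ob(1,2) _ \<open>0 \<le> p\<close>]) (auto simp: E_def)
    have "ennreal q * emeasure lborel E \<le> ennreal q * emeasure lborel (E \<inter> V)"
      using V by (intro mult_left_mono emeasure_lborel_mono_negligible) (auto simp: Diff_Int)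
    also have "\<dots> \<le> emeasure (interval_measure F) V"
      using V assms by (intro emeasure_steep_le) (auto simp: E_def)
    also have "\<dots> \<le> ennreal p * emeasure lborel Ob" by (rule V)
    also have "emeasure lborel Ob \<le> emeasure lborel E + emeasure lborel (Ob - E)"
      using Ob by (intro order_trans[OF emeasure_mono emeasure_subadditive]) auto
    also have "\<dots> \<le> ennreal (e + \<epsilon>)"
      using Ob(3) e that by (simp add: add_left_mono)
    finally have "ennreal (q * e) \<le> ennreal (p * (e + \<epsilon>))"
      using e assms that by (simp add: mult_left_mono ennreal_mult)
    then show ?thesis using e assms that by simp
  qed
  from this[of "(q - p) * e / (2 * (p + 1))"]
  have "e > 0 \<Longrightarrow> (q - p) * e \<le> p * ((q - p) * e / (2 * (p + 1)))"
    using assms by (simp add: algebra_simps)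
  moreover have "p * x / (2 * (p + 1)) < x" if "x > 0" for x
    using that assms(1) by (simp add: field_simps add_nonneg_pos)
  from this[of "(q - p) * e"] have "e > 0 \<Longrightarrow> p * ((q - p) * e / (2 * (p + 1))) < (q - p) * e"
    using assms by simp
  ultimately have "e = 0" using e(2) by fastforce
  then show ?thesis using e(1) by (simp add: E_def)
qed

lemma Inter_steep_null:
  assumes "a \<ge> 0" shows "emeasure lborel ((\<Inter>n::nat. steep F (real n)) \<inter> {-a<..<a}) = 0"
proof -
  define E where "E = (\<Inter>n::nat. steep F (real n)) \<inter> {-a<..<a}"
  have E: "E \<in> sets borel" unfolding E_def by measurable
  have "emeasure lborel E < \<infinity>"
    by (intro emeasure_bounded_finite) (auto simp: E_def intro: bounded_subset)
  then obtain e where e: "emeasure lborel E = ennreal e" "e \<ge> 0"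
    by (metis ennreal_enn2real enn2real_nonneg less_top infinity_ennreal_def)
  have "real n * e \<le> F a - F (- a)" for n
  proof -
    have "ennreal (real n) * emeasure lborel E \<le> emeasure (interval_measure F) {-a<..<a}"
      by (rule emeasure_steep_le) (use E in \<open>auto simp: E_def\<close>)
    also have "\<dots> \<le> emeasure (interval_measure F) {-a..a}"
      by (intro emeasure_mono) auto
    finally show ?thesis
      using e assms mono[of "- a" a]
      by (simp add: emeasure_interval_measure_cont_Icc flip: ennreal_mult)
  qed
  then have "e = 0"
    using e(2) by (meson linorder_not_le order_less_le reals_Archimedean3)
  then show ?thesis using e by (simp add: E_def)
qed

lemma differentiable_if_not_steep:
  assumes n: "x \<notin> steep F (real n)"
    and pinched: "\<And>p q. p \<in> \<rat> \<Longrightarrow> q \<in> \<rat> \<Longrightarrow> 0 \<le> p \<Longrightarrow> p < q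
      \<Longrightarrow> x \<notin> steep F q \<inter> steep (\<lambda>x. - F x) (- p)"
  shows "\<exists>D. (F has_real_derivative D) (at x)"
proof -
  define S where "S = {q. q \<ge> 0 \<and> x \<notin> steep F q}"
  have S: "real n \<in> S" "bdd_below S" using n by (auto simp: S_def bdd_below_def)
  have "(F has_real_derivative Inf S) (at x)"
  proof (rule has_real_derivative_if_slopes_near)
    fix e :: real assume "e > 0"
    then obtain q where "q \<in> S" "q < Inf S + e"
      using cInf_lessD[of S "Inf S + e"] S by (metis empty_iff less_add_same_cancel1)
    then show "slope_le_near F x (Inf S + e)"
      using slope_le_near_mono[OF slope_le_near_if_not_steep[OF _ cont]] by (auto simp: S_def)
  next
    fix e :: real assume "e > 0"
    show "slope_le_near (\<lambda>x. - F x) x (e - Inf S)"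
    proof (cases "Inf S - e < 0")
      case True
      have "- F v - - F u \<le> (e - Inf S) * (v - u)" if "u \<le> x" "x \<le> v" for u v
        using mono[of u v] that mult_nonneg_nonneg[of "e - Inf S" "v - u"] True by linarith
      then show ?thesis unfolding slope_le_near_def by (intro exI[of _ 1]) auto
    next
      case False
      obtain q where q: "q \<in> \<rat>" "Inf S - e < q" "q < Inf S"
        using Rats_dense_in_real[of "Inf S - e" "Inf S"] \<open>e > 0\<close> by auto
      obtain p where p: "p \<in> \<rat>" "Inf S - e < p" "p < q"
        using Rats_dense_in_real[of "Inf S - e" q] q by auto
      have "q \<notin> S" using cInf_lower[OF _ S(2), of q] q by auto
      then have "x \<in> steep F q" using q False by (auto simp: S_def)
      then have "x \<notin> steep (\<lambda>x. - F x) (- p)" using pinched[of p q] p q False by auto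
      from slope_le_near_mono[OF slope_le_near_if_not_steep[OF this continuous_on_minus[OF cont]]]
      show ?thesis using p(2) by simp
    qed
  qed
  then show ?thesis by blast
qed

theorem mono_differentiable_ae: "negligible {x. \<nexists>D. (F has_real_derivative D) (at x)}"
proof -
  let ?J = "\<lambda>k::nat. {- real k<..<real k}" and ?PQ = "{(p, q). p \<in> \<rat> \<and> q \<in> \<rat> \<and> 0 \<le> p \<and> p < q}"
  define N where "N = (\<Union>k. (\<Inter>n::nat. steep F (real n)) \<inter> ?J k) \<union>
    (\<Union>k. \<Union>(p, q)\<in>?PQ. steep F q \<inter> steep (\<lambda>x. - F x) (- p) \<inter> ?J k)"
  have "countable ?PQ"
    by (rule countable_subset[of _ "\<rat> \<times> \<rat>"]) (auto simp: countable_rat)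
  have "N \<in> null_sets lborel"
    unfolding N_def
  proof (intro null_sets.Un null_sets_UN null_sets_UN'[OF \<open>countable ?PQ\<close>])
    show "(\<Inter>n::nat. steep F (real n)) \<inter> ?J k \<in> null_sets lborel" for k
      using Inter_steep_null[of "real k"] by (auto simp: null_sets_def)
    show "(case i of (p, q) \<Rightarrow> steep F q \<inter> steep (\<lambda>x. - F x) (- p) \<inter> ?J k) \<in> null_sets lborel"
      if "i \<in> ?PQ" for i k
      using that steep_up_down_null[of "fst i" "snd i" "?J k"] by (auto simp: null_sets_def)
  qed
  then have "negligible N"
    using null_sets_completionI[of N lborel] by (simp add: negligible_iff_null_sets)
  moreover have "\<exists>D. (F has_real_derivative D) (at x)" if "x \<notin> N" for x
  proof -
    obtain k :: nat where "\<bar>x\<bar> < real k" using reals_Archimedean2 by blast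
    then have k: "x \<in> ?J k" by auto
    then obtain n :: nat where "x \<notin> steep F (real n)" using \<open>x \<notin> N\<close> by (auto simp: N_def)
    moreover have "x \<notin> steep F q \<inter> steep (\<lambda>x. - F x) (- p)"
      if "p \<in> \<rat>" "q \<in> \<rat>" "0 \<le> p" "p < q" for p q
      using \<open>x \<notin> N\<close> k that unfolding N_def by blast
    ultimately show ?thesis by (rule differentiable_if_not_steep)
  qed
  then have "{x. \<nexists>D. (F has_real_derivative D) (at x)} \<subseteq> N" by blast
  ultimately show ?thesis by (rule negligible_subset)
qed

end

subsection \<open>Absolutely continuous functions\<close>

definition intervals_in :: "real \<Rightarrow> real \<Rightarrow> (real \<times> real) set \<Rightarrow> bool" where
  "intervals_in a b D \<longleftrightarrow> finite D \<and> (\<forall>(r, s)\<in>D. a \<le> r \<and> r \<le> s \<and> s \<le> b) \<and>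
     pairwise (\<lambda>(r, s) (r', s'). {r<..<s} \<inter> {r'<..<s'} = {}) D"

abbreviation total_length :: "(real \<times> real) set \<Rightarrow> real" where
  "total_length D \<equiv> (\<Sum>(r, s)\<in>D. s - r)"

abbreviation variation :: "(real \<Rightarrow> 'a::metric_space) \<Rightarrow> (real \<times> real) set \<Rightarrow> real" where
  "variation f D \<equiv> (\<Sum>(r, s)\<in>D. dist (f r) (f s))"

lemma abs_continuous_on_iff:
  "abs_continuous_on a b f \<longleftrightarrow>
     (\<forall>e>0. \<exists>d>0. \<forall>D. intervals_in a b D \<and> total_length D < d \<longrightarrow> variation f D < e)"
  unfolding abs_continuous_on_def intervals_in_def by (simp add: conj_assoc)

lemma abs_continuous_onE:
  assumes "abs_continuous_on a b f" "e > 0"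
  obtains d where "d > 0"
    "\<And>D. intervals_in a b D \<Longrightarrow> total_length D < d \<Longrightarrow> variation f D < e"
  using assms unfolding abs_continuous_on_iff by meson

lemma intervals_inD:
  assumes "intervals_in a b D"
  shows "finite D" "(r, s) \<in> D \<Longrightarrow> a \<le> r \<and> r \<le> s \<and> s \<le> b"
  using assms by (auto simp: intervals_in_def)

lemma intervals_in_subset: "intervals_in a b D \<Longrightarrow> a' \<le> a \<Longrightarrow> b \<le> b' \<Longrightarrow> intervals_in a' b' D"
  unfolding intervals_in_def by fastforce

lemma total_length_le_emeasure:
  assumes D: "intervals_in a b D" and U: "U \<in> sets borel" "emeasure lborel U \<le> ennreal l" "l \<ge> 0"
    and sub: "\<And>r s. (r, s) \<in> D \<Longrightarrow> {r<..<s} \<subseteq> U"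
  shows "total_length D \<le> l"
proof -
  have fin: "finite D" and le: "\<And>i. i \<in> D \<Longrightarrow> fst i \<le> snd i"
    using D by (auto simp: intervals_in_def)
  have "ennreal (total_length D) = (\<Sum>i\<in>D. emeasure lborel {fst i<..<snd i})"
    using le by (subst sum_ennreal[symmetric]) (auto simp: case_prod_beta intro!: sum.cong)
  also have "\<dots> = emeasure lborel (\<Union>i\<in>D. {fst i<..<snd i})"
    using D fin by (intro sum_emeasure)
      (auto simp: intervals_in_def disjoint_family_on_def pairwise_def case_prod_beta)
  also have "\<dots> \<le> emeasure lborel U"
    using sub U by (intro emeasure_mono UN_least)
      (auto simp del: greaterThanLessThan_subseteq_greaterThanLessThan)
  also note U(2)
  finally show ?thesis using U(3) by simp
qed

lemma total_length_le: "intervals_in a b D \<Longrightarrow> a \<le> b \<Longrightarrow> total_length D \<le> b - a"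
  by (rule total_length_le_emeasure[of a b D "{a..b}"]) (auto dest: intervals_inD)

lemma intervals_in_image:
  fixes \<phi> :: "'i \<Rightarrow> real \<times> real" and F :: "real \<times> real \<Rightarrow> real"
  assumes fin: "finite I"
    and le: "\<And>i. i \<in> I \<Longrightarrow> a \<le> fst (\<phi> i) \<and> fst (\<phi> i) \<le> snd (\<phi> i) \<and> snd (\<phi> i) \<le> b"
    and disj: "\<And>i j. i \<in> I \<Longrightarrow> j \<in> I \<Longrightarrow> i \<noteq> j
      \<Longrightarrow> {fst (\<phi> i)<..<snd (\<phi> i)} \<inter> {fst (\<phi> j)<..<snd (\<phi> j)} = {}"
  shows "intervals_in a b (\<phi> ` I)"
    and "(\<And>r. F (r, r) = 0) \<Longrightarrow> sum F (\<phi> ` I) = (\<Sum>i\<in>I. F (\<phi> i))"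
proof -
  have "pairwise (\<lambda>(r, s) (r', s'). {r<..<s} \<inter> {r'<..<s'} = {}) (\<phi> ` I)"
    unfolding pairwise_def using disj by (simp add: case_prod_beta) blast
  then show "intervals_in a b (\<phi> ` I)"
    using fin le by (auto simp: intervals_in_def case_prod_beta)
  assume F: "\<And>r. F (r, r) = 0"
  show "sum F (\<phi> ` I) = (\<Sum>i\<in>I. F (\<phi> i))"
  proof (subst sum.reindex_nontrivial[OF fin])
    fix i j assume ij: "i \<in> I" "j \<in> I" "i \<noteq> j" "\<phi> i = \<phi> j"
    then have "{fst (\<phi> i)<..<snd (\<phi> i)} = {}" using disj[of i j] by auto
    then have "fst (\<phi> i) = snd (\<phi> i)" using le[OF ij(1)] by (auto simp: not_less)
    then show "F (\<phi> i) = 0" using F[of "fst (\<phi> i)"] by (metis prod.collapse)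
  qed simp
qed

lemma intervals_in_mono_image:
  fixes \<phi> :: "real \<Rightarrow> real" and F :: "real \<times> real \<Rightarrow> real"
  assumes D: "intervals_in a b D" and mono: "\<And>r s. r \<le> s \<Longrightarrow> \<phi> r \<le> \<phi> s"
  shows "intervals_in (\<phi> a) (\<phi> b) (map_prod \<phi> \<phi> ` D)"
    and "(\<And>r. F (r, r) = 0) \<Longrightarrow> sum F (map_prod \<phi> \<phi> ` D) = (\<Sum>(r, s)\<in>D. F (\<phi> r, \<phi> s))"
proof -
  have le: "\<phi> a \<le> \<phi> r \<and> \<phi> r \<le> \<phi> s \<and> \<phi> s \<le> \<phi> b" if "(r, s) \<in> D" for r s
    using intervals_inD(2)[OF D that] mono by blast
  have disj: "{\<phi> r<..<\<phi> s} \<inter> {\<phi> r'<..<\<phi> s'} = {}"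
    if "(r, s) \<in> D" "(r', s') \<in> D" "(r, s) \<noteq> (r', s')" for r s r' s'
  proof -
    have "{r<..<s} \<inter> {r'<..<s'} = {}"
      using D that unfolding intervals_in_def pairwise_def by fast
    then have "s \<le> r' \<or> s' \<le> r \<or> s \<le> r \<or> s' \<le> r'" by (auto simp: min_def max_def split: if_splits)
    then show ?thesis using mono[of s r'] mono[of s' r] mono[of s r] mono[of s' r'] by auto
  qed
  note image = intervals_in_image[OF intervals_inD(1)[OF D], of "\<phi> a" "map_prod \<phi> \<phi>" "\<phi> b"]
  show "intervals_in (\<phi> a) (\<phi> b) (map_prod \<phi> \<phi> ` D)"
    using le disj by (intro image(1)) (auto simp: prod_eq_iff)
  show "sum F (map_prod \<phi> \<phi> ` D) = (\<Sum>(r, s)\<in>D. F (\<phi> r, \<phi> s))" if "\<And>r. F (r, r) = 0"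
    using le disj that by (subst image(2)) (auto simp: prod_eq_iff map_prod_def case_prod_beta)
qed

lemma intervals_in_split:
  fixes f :: "real \<Rightarrow> 'a::metric_space"
  assumes D: "intervals_in a b D" and m: "a \<le> m" "m \<le> b"
  obtains D1 D2 where "intervals_in a m D1" "intervals_in m b D2"
    "total_length D1 \<le> total_length D" "total_length D2 \<le> total_length D"
    "variation f D \<le> variation f D1 + variation f D2"
proof -
  let ?D1 = "map_prod (min m) (min m) ` D" and ?D2 = "map_prod (max m) (max m) ` D"
  have "intervals_in (min m a) (min m b) ?D1" "intervals_in (max m a) (max m b) ?D2"
    by (intro intervals_in_mono_image(1)[OF D]; auto)+
  then have "intervals_in a m ?D1" "intervals_in m b ?D2" using m
    by (simp_all add: min_absorb1 min_absorb2 max_absorb1 max_absorb2)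
  have sum: "(\<Sum>(r, s)\<in>?D1. g r s) = (\<Sum>(r, s)\<in>D. g (min m r) (min m s))"
    "(\<Sum>(r, s)\<in>?D2. g r s) = (\<Sum>(r, s)\<in>D. g (max m r) (max m s))"
    if "\<And>r. g r r = 0" for g :: "real \<Rightarrow> real \<Rightarrow> real"
    using intervals_in_mono_image(2)[OF D, of "min m" "\<lambda>(r, s). g r s"]
      intervals_in_mono_image(2)[OF D, of "max m" "\<lambda>(r, s). g r s"] that by auto
  have "dist (f r) (f s) \<le> dist (f (min m r)) (f (min m s)) + dist (f (max m r)) (f (max m s))"
    if "(r, s) \<in> D" for r s
    using intervals_inD(2)[OF D that] dist_triangle[of "f r" "f s" "f m"]
    by (auto simp: min_def max_def)
  then have "variation f D \<le> variation f ?D1 + variation f ?D2"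
    unfolding sum[of "\<lambda>r s. dist (f r) (f s)", OF dist_self]
    by (auto simp: case_prod_beta simp flip: sum.distrib intro!: sum_mono)
  moreover have "total_length ?D1 \<le> total_length D" "total_length ?D2 \<le> total_length D"
    using intervals_inD(2)[OF D]
    by (subst sum; fastforce simp: case_prod_beta min_def max_def intro!: sum_mono)+
  ultimately show thesis
    using that \<open>intervals_in a m ?D1\<close> \<open>intervals_in m b ?D2\<close> by blast
qed

lemma abs_continuous_on_join:
  assumes f: "abs_continuous_on a m f" "abs_continuous_on m b f" and m: "a \<le> m" "m \<le> b"
  shows "abs_continuous_on a b f"
  unfolding abs_continuous_on_iff
proof (intro allI impI)
  fix e :: real assume "e > 0"
  obtain d1 where d1: "d1 > 0"
    "\<And>D. intervals_in a m D \<Longrightarrow> total_length D < d1 \<Longrightarrow> variation f D < e / 2"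
    using abs_continuous_onE[OF f(1) half_gt_zero[OF \<open>e > 0\<close>]] by blast
  obtain d2 where d2: "d2 > 0"
    "\<And>D. intervals_in m b D \<Longrightarrow> total_length D < d2 \<Longrightarrow> variation f D < e / 2"
    using abs_continuous_onE[OF f(2) half_gt_zero[OF \<open>e > 0\<close>]] by blast
  have "variation f D < e" if D: "intervals_in a b D" "total_length D < min d1 d2" for D
  proof -
    obtain D1 D2 where "intervals_in a m D1" "intervals_in m b D2"
      "total_length D1 \<le> total_length D" "total_length D2 \<le> total_length D"
      "variation f D \<le> variation f D1 + variation f D2"
      using intervals_in_split[OF D(1) m] by blast
    then show ?thesis using d1(2)[of D1] d2(2)[of D2] D(2) by auto
  qed
  then show "\<exists>d>0. \<forall>D. intervals_in a b D \<and> total_length D < d \<longrightarrow> variation f D < e"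
    using d1(1) d2(1) by (intro exI[of _ "min d1 d2"]) auto
qed

lemma abs_continuous_on_imp_continuous_on:
  fixes f :: "real \<Rightarrow> 'a::metric_space"
  assumes f: "abs_continuous_on a b f"
  shows "continuous_on {a..b} f"
  unfolding continuous_on_iff
proof (intro ballI allI impI)
  fix x e :: real assume x: "x \<in> {a..b}" and "e > 0"
  obtain d where d: "d > 0"
    "\<And>D. intervals_in a b D \<Longrightarrow> total_length D < d \<Longrightarrow> variation f D < e"
    using abs_continuous_onE[OF f \<open>e > 0\<close>] by blast
  have "dist (f y) (f x) < e" if y: "y \<in> {a..b}" "dist y x < d" for y
  proof -
    have "dist (f (min x y)) (f (max x y)) < e"
      using d(2)[of "{(min x y, max x y)}"] x y
      by (auto simp: intervals_in_def dist_real_def min_def max_def split: if_splits)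
    then show ?thesis by (auto simp: min_def max_def dist_commute split: if_splits)
  qed
  then show "\<exists>d>0. \<forall>y\<in>{a..b}. dist y x < d \<longrightarrow> dist (f y) (f x) < e" using d(1) by blast
qed

lemma abs_continuous_on_if_variation_le:
  fixes f :: "real \<Rightarrow> 'a::metric_space" and g :: "real \<Rightarrow> 'b::metric_space"
  assumes f: "abs_continuous_on a' b' f"
    and le: "\<And>D. intervals_in a b D \<Longrightarrow>
      \<exists>D'. intervals_in a' b' D' \<and> total_length D' \<le> total_length D \<and> variation g D \<le> C * variation f D'"
  shows "abs_continuous_on a b g"
  unfolding abs_continuous_on_iff
proof (intro allI impI)
  fix e :: real assume "e > 0"
  then have "e / (\<bar>C\<bar> + 1) > 0" by (simp add: add_nonneg_pos)
  then obtain d where d: "d > 0"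
    "\<And>D. intervals_in a' b' D \<Longrightarrow> total_length D < d \<Longrightarrow> variation f D < e / (\<bar>C\<bar> + 1)"
    using abs_continuous_onE[OF f] by blast
  have "variation g D < e" if D: "intervals_in a b D" "total_length D < d" for D
  proof -
    obtain D' where D': "intervals_in a' b' D'" "total_length D' \<le> total_length D"
      "variation g D \<le> C * variation f D'" using le[OF D(1)] by blast
    have "variation g D \<le> (\<bar>C\<bar> + 1) * variation f D'"
      by (rule order_trans[OF D'(3)]) (auto intro!: mult_right_mono sum_nonneg)
    also have "\<dots> < (\<bar>C\<bar> + 1) * (e / (\<bar>C\<bar> + 1))"
      using d(2)[OF D'(1)] D'(2) D(2) by (intro mult_strict_left_mono) auto
    finally show ?thesis by simp
  qed
  then show "\<exists>d>0. \<forall>D. intervals_in a b D \<and> total_length D < d \<longrightarrow> variation g D < e"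
    using d(1) by blast
qed

lemma abs_continuous_on_lipschitz_compose:
  fixes f :: "real \<Rightarrow> 'a::metric_space" and g :: "real \<Rightarrow> 'b::metric_space"
  assumes f: "abs_continuous_on a b f"
    and g: "\<And>r s. r \<in> {a..b} \<Longrightarrow> s \<in> {a..b} \<Longrightarrow> dist (g r) (g s) \<le> C * dist (f r) (f s)"
  shows "abs_continuous_on a b g"
proof (rule abs_continuous_on_if_variation_le[OF f])
  fix D assume D: "intervals_in a b D"
  have "variation g D \<le> C * variation f D"
    unfolding sum_distrib_left
  proof (rule sum_mono, clarify)
    fix r s assume "(r, s) \<in> D"
    then show "dist (g r) (g s) \<le> C * dist (f r) (f s)"
      using intervals_inD(2)[OF D] by (intro g) force+
  qed
  then show "\<exists>D'. intervals_in a b D' \<and> total_length D' \<le> total_length D \<and>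
      variation g D \<le> C * variation f D'" using D by blast
qed

lemma abs_continuous_on_cong:
  assumes "abs_continuous_on a b f" "\<And>s. s \<in> {a..b} \<Longrightarrow> f s = g s"
  shows "abs_continuous_on a b g"
  using assms by (intro abs_continuous_on_lipschitz_compose[OF assms(1), where C = 1]) auto

lemma abs_continuous_on_lipschitz:
  fixes f :: "real \<Rightarrow> 'a::metric_space"
  assumes "\<And>r s. r \<in> {a..b} \<Longrightarrow> s \<in> {a..b} \<Longrightarrow> dist (f r) (f s) \<le> C * dist r s"
  shows "abs_continuous_on a b f"
proof (rule abs_continuous_on_lipschitz_compose[OF _ assms])
  have "variation (\<lambda>s. s) D = total_length D" if "intervals_in a b D" for D
    using intervals_inD(2)[OF that] by (intro sum.cong) (force simp: dist_real_def)+
  then show "abs_continuous_on a b (\<lambda>s::real. s)" unfolding abs_continuous_on_iff by auto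
qed

lemma abs_continuous_on_shift:
  assumes "abs_continuous_on a b f"
  shows "abs_continuous_on (a + t) (b + t) (\<lambda>s. f (s - t))"
proof (rule abs_continuous_on_if_variation_le[OF assms])
  fix D assume D: "intervals_in (a + t) (b + t) D"
  let ?D' = "map_prod (\<lambda>s. s - t) (\<lambda>s. s - t) ` D"
  have "intervals_in a b ?D'"
    using intervals_in_mono_image(1)[OF D, of "\<lambda>s. s - t"] by simp
  moreover have "sum F ?D' = (\<Sum>(r, s)\<in>D. F (r - t, s - t))" if "\<And>r. F (r, r) = 0" for F :: "_ \<Rightarrow> real"
    using intervals_in_mono_image(2)[OF D, of "\<lambda>s. s - t" F] that by simp
  from this[of "\<lambda>(r, s). s - r"] this[of "\<lambda>(r, s). dist (f r) (f s)"]
  have "total_length ?D' = total_length D" "variation f ?D' = variation (\<lambda>s. f (s - t)) D"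
    by simp_all
  ultimately show "\<exists>D'. intervals_in a b D' \<and> total_length D' \<le> total_length D \<and>
      variation (\<lambda>s. f (s - t)) D \<le> 1 * variation f D'" by force
qed

lemma abs_continuous_on_bounded_variation:
  fixes f :: "real \<Rightarrow> 'a::metric_space"
  assumes f: "abs_continuous_on a b f" and "a \<le> b"
  obtains B where "\<And>D. intervals_in a b D \<Longrightarrow> variation f D \<le> B"
proof -
  obtain d where d: "d > 0"
    "\<And>D. intervals_in a b D \<Longrightarrow> total_length D < d \<Longrightarrow> variation f D < 1"
    using abs_continuous_onE[OF f zero_less_one] by blast
  have "variation f D \<le> real n"
    if "a \<le> x" "x \<le> b" "x \<le> a + real n * (d / 2)" "intervals_in a x D" for n x D
    using that
  proof (induction n arbitrary: x D)
    case 0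
    then have "i \<in> D \<Longrightarrow> fst i = a \<and> snd i = a" for i
      by (force simp: intervals_in_def)
    then have "variation f D = 0"
      by (intro sum.neutral) force
    then show ?case by simp
  next
    case (Suc n)
    define m where "m = max a (x - d / 2)"
    have m: "a \<le> m" "m \<le> x" "m \<le> a + real n * (d / 2)" "x - m < d"
      using Suc.prems d(1) by (auto simp: m_def max_def algebra_simps add_divide_distrib)
    obtain D1 D2 where D: "intervals_in a m D1" "intervals_in m x D2"
      "variation f D \<le> variation f D1 + variation f D2"
      using intervals_in_split[OF Suc.prems(4) m(1,2), of f] by blast
    have "variation f D2 < 1"
      using m Suc.prems total_length_le[OF D(2)]
      by (intro d(2) intervals_in_subset[OF D(2)]) auto
    moreover have "variation f D1 \<le> real n"
      using Suc.prems m by (intro Suc.IH[OF _ _ _ D(1)]) auto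
    ultimately show ?case using D(3) by simp
  qed
  moreover obtain n where "(b - a) / (d / 2) < real n" using reals_Archimedean2 by blast
  then have "b \<le> a + real n * (d / 2)" using d(1) by (simp add: field_simps)
  ultimately show thesis using that \<open>a \<le> b\<close> by blast
qed

definition total_variation :: "(real \<Rightarrow> 'a::metric_space) \<Rightarrow> real \<Rightarrow> real \<Rightarrow> real" where
  "total_variation f a x = (SUP D\<in>{D. intervals_in a x D}. variation f D)"

context
  fixes f :: "real \<Rightarrow> 'a::metric_space" and a b :: real
  assumes f: "abs_continuous_on a b f" and "a \<le> b"
begin

lemma variation_le_total_variation:
  assumes "intervals_in a x D" "x \<le> b" shows "variation f D \<le> total_variation f a x"
proof -
  obtain B where "\<And>D. intervals_in a b D \<Longrightarrow> variation f D \<le> B"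
    using abs_continuous_on_bounded_variation[OF f \<open>a \<le> b\<close>] by blast
  then have "bdd_above (variation f ` {D. intervals_in a x D})"
    using assms(2) by (intro bdd_aboveI2[of _ _ B]) (auto intro: intervals_in_subset)
  then show ?thesis unfolding total_variation_def using assms(1) by (intro cSUP_upper) auto
qed

lemma total_variation_le:
  assumes "\<And>D. intervals_in a x D \<Longrightarrow> variation f D \<le> B" shows "total_variation f a x \<le> B"
proof -
  have "intervals_in a x {}" by (simp add: intervals_in_def)
  then show ?thesis unfolding total_variation_def by (intro cSUP_least) (use assms in auto)
qed

lemma dist_le_total_variation_diff:
  assumes "a \<le> x" "x \<le> y" "y \<le> b"
  shows "dist (f x) (f y) \<le> total_variation f a y - total_variation f a x"
proof (cases "x = y")
  case False
  then have "x < y" using assms(2) by simp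
  have "total_variation f a x \<le> total_variation f a y - dist (f x) (f y)"
  proof (rule total_variation_le)
    fix D assume D: "intervals_in a x D"
    have new: "(x, y) \<notin> D" using intervals_inD(2)[OF D] \<open>x < y\<close> by force
    have "intervals_in a y (insert (x, y) D)"
      using D assms unfolding intervals_in_def pairwise_insert by auto
    from variation_le_total_variation[OF this assms(3)]
    show "variation f D \<le> total_variation f a y - dist (f x) (f y)"
      using new intervals_inD(1)[OF D] by simp
  qed
  then show ?thesis by simp
qed simp

lemma continuous_on_total_variation: "continuous_on {a..b} (total_variation f a)"
  unfolding continuous_on_iff
proof (intro ballI allI impI)
  fix x e :: real assume x: "x \<in> {a..b}" and "e > 0"
  obtain d where d: "d > 0"
    "\<And>D. intervals_in a b D \<Longrightarrow> total_length D < d \<Longrightarrow> variation f D < e / 2"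
    using abs_continuous_onE[OF f half_gt_zero[OF \<open>e > 0\<close>]] by blast
  have close: "\<bar>total_variation f a v - total_variation f a u\<bar> < e"
    if uv: "a \<le> u" "u \<le> v" "v \<le> b" "v - u < d" for u v
  proof -
    have "total_variation f a v \<le> total_variation f a u + e / 2"
    proof (rule total_variation_le)
      fix D assume "intervals_in a v D"
      then obtain D1 D2 where D: "intervals_in a u D1" "intervals_in u v D2"
        "variation f D \<le> variation f D1 + variation f D2"
        using intervals_in_split[OF _ uv(1,2)] by blast
      have "variation f D2 < e / 2"
        using uv total_length_le[OF D(2)] by (intro d(2) intervals_in_subset[OF D(2)]) auto
      then show "variation f D \<le> total_variation f a u + e / 2"
        using D(3) variation_le_total_variation[OF D(1)] uv by simp
    qed
    then show ?thesis
      using dist_le_total_variation_diff[OF uv(1-3)] zero_le_dist[of "f u" "f v"] \<open>e > 0\<close>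
      by linarith
  qed
  have "dist (total_variation f a y) (total_variation f a x) < e"
    if "y \<in> {a..b}" "dist y x < d" for y
    using close[of x y] close[of y x] x that by (cases "x \<le> y") (auto simp: dist_real_def)
  then show "\<exists>d>0. \<forall>y\<in>{a..b}. dist y x < d \<longrightarrow>
      dist (total_variation f a y) (total_variation f a x) < e" using d(1) by blast
qed

end

lemma abs_continuous_on_differentiable_ae_real:
  fixes f :: "real \<Rightarrow> real"
  assumes f: "abs_continuous_on a b f" and "a \<le> b"
  obtains N where "negligible N" "\<And>x. x \<in> {a<..<b} - N \<Longrightarrow> f differentiable (at x)"
proof -
  let ?clamp = "\<lambda>x. max a (min b x)"
  define V where "V x = total_variation f a (?clamp x)" for x
  define W where "W x = V x - f (?clamp x)" for x
  have clamp: "continuous_on UNIV ?clamp" "range ?clamp \<subseteq> {a..b}"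
    using \<open>a \<le> b\<close> by (auto intro!: continuous_intros)
  have contV: "continuous_on UNIV V"
    unfolding V_def by (rule continuous_on_compose2[OF continuous_on_total_variation[OF assms] clamp])
  have contW: "continuous_on UNIV W"
    unfolding W_def
    by (intro continuous_on_diff contV
        continuous_on_compose2[OF abs_continuous_on_imp_continuous_on[OF f] clamp])
  have inc: "\<bar>f (?clamp y) - f (?clamp x)\<bar> \<le> V y - V x" if "x \<le> y" for x y
    using dist_le_total_variation_diff[OF assms, of "?clamp x" "?clamp y"] that \<open>a \<le> b\<close>
    by (auto simp: V_def dist_real_def abs_minus_commute)
  have mono: "V x \<le> V y" "W x \<le> W y" if "x \<le> y" for x y
    using inc[OF that] by (auto simp: W_def)
  let ?N = "\<lambda>F. {x. \<nexists>D. (F has_real_derivative D) (at x)}"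
  show thesis
  proof (rule that[of "?N V \<union> ?N W"])
    show "negligible (?N V \<union> ?N W)"
      by (intro negligible_Un mono_differentiable_ae mono contV contW)
    fix x assume x: "x \<in> {a<..<b} - (?N V \<union> ?N W)"
    then obtain D E where "(V has_real_derivative D) (at x)" "(W has_real_derivative E) (at x)"
      by auto
    then have "((\<lambda>x. V x - W x) has_real_derivative (D - E)) (at x)" by (rule DERIV_diff)
    then have "(f has_real_derivative (D - E)) (at x)"
      using x by (elim has_field_derivative_transform_within_open[where S = "{a<..<b}"])
        (auto simp: W_def)
    then show "f differentiable (at x)" by (auto simp: real_differentiable_def)
  qed
qed

lemma abs_continuous_on_differentiable_ae:
  fixes f :: "real \<Rightarrow> 'a::euclidean_space"
  assumes f: "abs_continuous_on a b f" and "a \<le> b"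
  obtains N where "negligible N" "\<And>x. x \<in> {a<..<b} - N \<Longrightarrow> f differentiable (at x)"
proof -
  have "\<exists>N. negligible N \<and> (\<forall>x\<in>{a<..<b} - N. (\<lambda>s. f s \<bullet> i) differentiable (at x))"
    if "i \<in> Basis" for i
  proof -
    have "dist (f r \<bullet> i) (f s \<bullet> i) \<le> 1 * dist (f r) (f s)" for r s
      using Basis_le_norm[OF that, of "f r - f s"] by (simp add: dist_norm inner_diff_left)
    then have "abs_continuous_on a b (\<lambda>s. f s \<bullet> i)"
      by (rule abs_continuous_on_lipschitz_compose[OF f])
    then show ?thesis using abs_continuous_on_differentiable_ae_real[OF _ \<open>a \<le> b\<close>] by metis
  qed
  then obtain N where N: "\<And>i. i \<in> Basis \<Longrightarrow> negligible (N i)"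
    "\<And>i x. i \<in> Basis \<Longrightarrow> x \<in> {a<..<b} - N i \<Longrightarrow> (\<lambda>s. f s \<bullet> i) differentiable (at x)"
    by metis
  show thesis
  proof (rule that[of "\<Union>i\<in>Basis. N i"])
    show "negligible (\<Union>i\<in>Basis. N i)" using N(1) by (intro negligible_Union) auto
    fix x assume "x \<in> {a<..<b} - (\<Union>i\<in>Basis. N i)"
    then show "f differentiable (at x)"
      using N(2) by (subst differentiable_componentwise_within) auto
  qed
qed

subsection \<open>Integration of derivative bounds\<close>

lemma increment_le_near_derivative:
  fixes F :: "real \<Rightarrow> real"
  assumes "(F has_real_derivative D) (at s)" "D \<le> c" "e > 0"
  shows "\<exists>r>0. \<forall>u v. s \<in> {u..v} \<longrightarrow> {u..v} \<subseteq> ball s r \<longrightarrow> F v - F u \<le> (c + e) * (v - u)"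
proof -
  have "(F has_derivative (\<lambda>h. D * h)) (at s)"
    using assms(1) by (simp add: has_field_derivative_def)
  then obtain r where r: "r > 0"
    "\<And>y. norm (y - s) < r \<Longrightarrow> norm (F y - F s - D * (y - s)) \<le> e * norm (y - s)"
    using assms(3) unfolding has_derivative_at_alt by blast
  have "F v - F u \<le> (c + e) * (v - u)" if uv: "s \<in> {u..v}" "{u..v} \<subseteq> ball s r" for u v
  proof -
    have "u \<in> {u..v}" "v \<in> {u..v}" using uv(1) by auto
    then have "u \<in> ball s r" "v \<in> ball s r" using uv(2) by blast+
    then have "\<bar>F v - F s - D * (v - s)\<bar> \<le> e * (v - s)" "\<bar>F u - F s - D * (u - s)\<bar> \<le> e * (s - u)"
      using r(2)[of v] r(2)[of u] uv by (auto simp: dist_real_def)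
    then have "F v - F u \<le> (D + e) * (v - u)" by (auto simp: abs_le_iff algebra_simps)
    also have "\<dots> \<le> (c + e) * (v - u)" using assms(2) uv by (intro mult_right_mono) auto
    finally show ?thesis .
  qed
  then show ?thesis using r(1) by blast
qed

lemma negligible_open_cover:
  fixes N :: "'a::euclidean_space set"
  assumes N: "negligible N" and "e > 0"
  obtains T where "open T" "N \<subseteq> T" "emeasure lborel T \<le> ennreal e"
proof -
  have null: "N \<in> null_sets lebesgue" using N by (simp add: negligible_iff_null_sets)
  then obtain T where T: "open T" "N \<subseteq> T" "emeasure lebesgue (T - N) < ennreal e"
    using sets_lebesgue_outer_open[of N e] \<open>e > 0\<close> by (metis null_setsD2)
  have "emeasure lborel T = emeasure lebesgue T"
    using T(1) by (simp add: emeasure_completion)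
  also have "\<dots> = emeasure lebesgue (T - N)"
    using null T(1) by (intro emeasure_Diff_null_set[symmetric]) auto
  finally show thesis using T that by simp
qed

lemma tagged_division_of_Icc:
  fixes a b :: real
  assumes "p tagged_division_of {a..b}" "(x, K) \<in> p"
  shows "K = {Inf K..Sup K}" "Inf K \<le> Sup K" "a \<le> Inf K" "Sup K \<le> b" "x \<in> {Inf K..Sup K}"
proof -
  note p = tagged_division_ofD(2-4)[OF assms]
  obtain u v where K: "K = {u..v}" using p(3) by auto
  moreover have "u \<le> v" using p(1) K by auto
  moreover from this have "Inf K = u" "Sup K = v" using K by auto
  ultimately show "K = {Inf K..Sup K}" "Inf K \<le> Sup K" "a \<le> Inf K" "Sup K \<le> b" "x \<in> {Inf K..Sup K}"
    using p(1,2) by auto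
qed

lemma abs_continuous_on_small_over_null_set:
  assumes f: "abs_continuous_on a b f" and N: "negligible N" and "e > 0"
  shows "\<exists>T. open T \<and> N \<subseteq> T \<and> (\<forall>p q. p tagged_division_of {a..b} \<longrightarrow> q \<subseteq> p \<longrightarrow>
    (\<forall>i\<in>q. snd i \<subseteq> T) \<longrightarrow> (\<Sum>(x, K)\<in>q. dist (f (Inf K)) (f (Sup K))) < e)"
proof -
  obtain d where d: "d > 0"
    "\<And>D. intervals_in a b D \<Longrightarrow> total_length D < d \<Longrightarrow> variation f D < e"
    using abs_continuous_onE[OF f \<open>e > 0\<close>] by blast
  obtain T where T: "open T" "N \<subseteq> T" "emeasure lborel T \<le> ennreal (d / 2)"
    using negligible_open_cover[OF N half_gt_zero[OF d(1)]] by blast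
  define \<phi> where "\<phi> i = (Inf (snd i), Sup (snd i))" for i :: "real \<times> real set"
  have "(\<Sum>(x, K)\<in>q. dist (f (Inf K)) (f (Sup K))) < e"
    if p: "p tagged_division_of {a..b}" and q: "q \<subseteq> p" "\<forall>i\<in>q. snd i \<subseteq> T" for p q
  proof -
    note Icc = tagged_division_of_Icc[OF p subsetD[OF q(1)]]
    have le: "a \<le> fst (\<phi> i) \<and> fst (\<phi> i) \<le> snd (\<phi> i) \<and> snd (\<phi> i) \<le> b" if "i \<in> q" for i
      using Icc[of "fst i" "snd i"] that by (simp add: \<phi>_def)
    have int: "{fst (\<phi> i)<..<snd (\<phi> i)} = interior (snd i)" if "i \<in> q" for i
      using Icc(1)[of "fst i" "snd i"] that
      by (metis \<phi>_def fst_conv snd_conv interior_atLeastAtMost_real prod.collapse)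
    have disj: "{fst (\<phi> i)<..<snd (\<phi> i)} \<inter> {fst (\<phi> j)<..<snd (\<phi> j)} = {}"
      if "i \<in> q" "j \<in> q" "i \<noteq> j" for i j
      using tagged_division_ofD(5)[OF p, of "fst i" "snd i" "fst j" "snd j"] that q(1)
        int[of i] int[of j] by (auto simp: prod_eq_iff)
    have "finite q" using finite_subset[OF q(1)] p by blast
    note image = intervals_in_image[OF this le disj]
    have "total_length (\<phi> ` q) \<le> d / 2"
    proof (rule total_length_le_emeasure[OF image(1) _ T(3)])
      fix r s assume "(r, s) \<in> \<phi> ` q"
      then obtain i where i: "i \<in> q" "(r, s) = \<phi> i" by auto
      have "interior (snd i) \<subseteq> T"
        using q(2) i(1) interior_subset by fast
      then show "{r<..<s} \<subseteq> T" using int[OF i(1)] i(2) by (metis fst_conv snd_conv)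
    qed (use T d in auto)
    then have "variation f (\<phi> ` q) < e" using d by (intro d(2) image(1)) auto
    also have "variation f (\<phi> ` q) = (\<Sum>(x, K)\<in>q. dist (f (Inf K)) (f (Sup K)))"
      by (subst image(2)) (auto simp: \<phi>_def case_prod_beta)
    finally show ?thesis .
  qed
  then show ?thesis using T(1,2) by blast
qed

text \<open>
  In a fine tagged division, the tags outside of the exceptional null set are controlled by the
  derivative, and the remaining intervals by absolute continuity.
\<close>

lemma tagged_sum_increments_le:
  fixes F g :: "real \<Rightarrow> real"
  assumes p: "p tagged_division_of {a..b}" and "a \<le> b" "e \<ge> 0"
    and regular: "\<And>x u v. (x, {u..v}) \<in> p \<Longrightarrow> x \<notin> N \<Longrightarrow> u \<le> v \<Longrightarrow> F v - F u \<le> (g x + e) * (v - u)"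
    and exceptional: "\<And>x. x \<in> N \<Longrightarrow> g x = 0"
  shows "F b - F a \<le> (\<Sum>(x, K)\<in>p. measure lborel K *\<^sub>R g x) + e * (b - a)
    + (\<Sum>(x, K)\<in>{i \<in> p. fst i \<in> N}. dist (F (Inf K)) (F (Sup K)))"
proof -
  have "finite p" using p by blast
  have "F b - F a = (\<Sum>(x, K)\<in>p. F (Sup K) - F (Inf K))"
    using additive_tagged_division_1[OF \<open>a \<le> b\<close> p, of F] by simp
  also have "\<dots> \<le> (\<Sum>(x, K)\<in>p. (measure lborel K *\<^sub>R g x + e * measure lborel K)
      + (if x \<in> N then dist (F (Inf K)) (F (Sup K)) else 0))"
  proof (rule sum_mono, clarify)
    fix x K assume xK: "(x, K) \<in> p"
    note K = tagged_division_of_Icc[OF p xK]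
    have length: "measure lborel K = Sup K - Inf K" using K(1,2) by (metis content_real)
    show "F (Sup K) - F (Inf K) \<le> (measure lborel K *\<^sub>R g x + e * measure lborel K)
        + (if x \<in> N then dist (F (Inf K)) (F (Sup K)) else 0)"
    proof (cases "x \<in> N")
      case True
      have "0 \<le> e * (Sup K - Inf K)" using K(2) \<open>e \<ge> 0\<close> by simp
      then show ?thesis using True exceptional by (simp add: length dist_real_def)
    next
      case False
      then show ?thesis
        using regular[of x "Inf K" "Sup K"] xK K(1,2) by (simp add: length algebra_simps)
    qed
  qed
  also have "\<dots> = (\<Sum>(x, K)\<in>p. measure lborel K *\<^sub>R g x) + e * (\<Sum>(x, K)\<in>p. measure lborel K)
      + (\<Sum>(x, K)\<in>{i \<in> p. fst i \<in> N}. dist (F (Inf K)) (F (Sup K)))"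
    using \<open>finite p\<close>
    by (simp add: sum.distrib case_prod_beta sum_distrib_left sum.inter_filter)
  also have "(\<Sum>(x, K)\<in>p. measure lborel K) = b - a"
    using additive_content_tagged_division[of p a b] p \<open>a \<le> b\<close> by simp
  finally show ?thesis .
qed

lemma increment_gauge:
  fixes F g :: "real \<Rightarrow> real"
  assumes D: "\<And>s. s \<in> {a..b} - N \<Longrightarrow> \<exists>D. (F has_real_derivative D) (at s) \<and> D \<le> g s"
    and "e > 0" and T: "open T" "N \<subseteq> T"
  shows "\<exists>\<gamma>. gauge \<gamma> \<and> (\<forall>s\<in>N. \<gamma> s \<subseteq> T) \<and> (\<forall>s\<in>{a..b} - N. \<forall>u v. s \<in> {u..v} \<longrightarrow> {u..v} \<subseteq> \<gamma> s
    \<longrightarrow> F v - F u \<le> (g s + e) * (v - u))"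
proof -
  have "\<exists>r>0. \<forall>u v. s \<in> {u..v} \<longrightarrow> {u..v} \<subseteq> ball s r \<longrightarrow> F v - F u \<le> (g s + e) * (v - u)" if "s \<in> {a..b} - N" for s
    using D[OF that] increment_le_near_derivative[OF _ _ \<open>e > 0\<close>] by blast
  then obtain r where "\<And>s. s \<in> {a..b} - N \<Longrightarrow> r s > 0" "\<And>s u v. s \<in> {a..b} - N \<Longrightarrow> s \<in> {u..v}
      \<Longrightarrow> {u..v} \<subseteq> ball s (r s) \<Longrightarrow> F v - F u \<le> (g s + e) * (v - u)" by metis
  then show ?thesis
    using T by (intro exI[of _ "\<lambda>s. if s \<in> N then T else if s \<in> {a..b} then ball s (r s) else UNIV"]) (auto simp: gauge_def)
qed

lemma abs_continuous_on_le_integral: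
  fixes F g :: "real \<Rightarrow> real"
  assumes F: "abs_continuous_on a b F" and "a \<le> b" and N: "negligible N"
    and D: "\<And>s. s \<in> {a..b} - N \<Longrightarrow> \<exists>D. (F has_real_derivative D) (at s) \<and> D \<le> g s"
    and g: "g integrable_on {a..b}"
  shows "F b - F a \<le> integral {a..b} g"
proof (rule field_le_epsilon)
  fix e :: real assume "e > 0"
  define e' where "e' = e / (2 + (b - a))"
  have e': "e' > 0" "e' * (2 + (b - a)) = e" using \<open>e > 0\<close> \<open>a \<le> b\<close> by (simp_all add: e'_def)
  define g' where "g' s = (if s \<in> N then 0 else g s)" for s
  have "(g' has_integral integral {a..b} g) {a..b}"
    by (rule has_integral_spike[OF N _ integrable_integral[OF g]]) (simp add: g'_def)
  then have "\<exists>\<gamma>. gauge \<gamma> \<and> (\<forall>p. p tagged_division_of {a..b} \<and> \<gamma> fine p \<longrightarrow>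
      norm ((\<Sum>(x, K)\<in>p. measure lborel K *\<^sub>R g' x) - integral {a..b} g) < e')"
    unfolding has_integral_real using e'(1) by (elim allE[of _ e']) simp
  then obtain \<gamma> where \<gamma>: "gauge \<gamma>" "\<forall>p. p tagged_division_of {a..b} \<and> \<gamma> fine p \<longrightarrow>
      norm ((\<Sum>(x, K)\<in>p. measure lborel K *\<^sub>R g' x) - integral {a..b} g) < e'"
    by (elim exE conjE) (rule that)
  obtain T where T: "open T" "N \<subseteq> T"
    "\<forall>p q. p tagged_division_of {a..b} \<longrightarrow> q \<subseteq> p \<longrightarrow> (\<forall>i\<in>q. snd i \<subseteq> T) \<longrightarrow>
      (\<Sum>(x, K)\<in>q. dist (F (Inf K)) (F (Sup K))) < e'"
    using abs_continuous_on_small_over_null_set[OF F N e'(1)] by (elim exE conjE) (rule that)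
  obtain \<gamma>' where "gauge \<gamma>'" and \<gamma>': "\<And>s. s \<in> N \<Longrightarrow> \<gamma>' s \<subseteq> T"
    "\<And>s u v. s \<in> {a..b} - N \<Longrightarrow> s \<in> {u..v} \<Longrightarrow> {u..v} \<subseteq> \<gamma>' s \<Longrightarrow> F v - F u \<le> (g s + e') * (v - u)"
    using increment_gauge[OF D e'(1) T(1,2)] by metis
  then obtain p where p: "p tagged_division_of {a..b}" and fine: "\<gamma> fine p" "\<gamma>' fine p"
    using fine_division_exists_real[OF gauge_Int[OF \<gamma>(1) \<open>gauge \<gamma>'\<close>]] unfolding fine_Int by metis
  have "F b - F a \<le> (\<Sum>(x, K)\<in>p. measure lborel K *\<^sub>R g' x) + e' * (b - a)
      + (\<Sum>(x, K)\<in>{i \<in> p. fst i \<in> N}. dist (F (Inf K)) (F (Sup K)))"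
  proof (rule tagged_sum_increments_le[OF p \<open>a \<le> b\<close>])
    fix x u v assume xK: "(x, {u..v}) \<in> p" and "x \<notin> N" "u \<le> v"
    then have "x \<in> {a..b} - N" "x \<in> {u..v}" using tagged_division_ofD(2,3)[OF p xK] by auto
    then show "F v - F u \<le> (g' x + e') * (v - u)" using \<gamma>'(2) fineD[OF fine(2) xK] by (simp add: g'_def)
  qed (use e'(1) in \<open>auto simp: g'_def\<close>)
  moreover have "(\<Sum>(x, K)\<in>{i \<in> p. fst i \<in> N}. dist (F (Inf K)) (F (Sup K))) < e'"
  proof (rule T(3)[rule_format, OF p])
    show "snd i \<subseteq> T" if "i \<in> {i \<in> p. fst i \<in> N}" for i
      using that fineD[OF fine(2), of "fst i" "snd i"] \<gamma>'(1)[of "fst i"] by auto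
  qed auto
  moreover have "(\<Sum>(x, K)\<in>p. measure lborel K *\<^sub>R g' x) \<le> integral {a..b} g + e'"
    using \<gamma>(2)[rule_format, OF conjI[OF p fine(1)]] by simp
  ultimately show "F b - F a \<le> integral {a..b} g + e"
    using e'(2) by (simp add: algebra_simps)
qed

subsection \<open>Weak compactness of probability measures on a compact set\<close>

text \<open>
  A not necessarily continuous injection into the reals whose inverse is continuous: the ternary
  digits of the code of \<open>y\<close> tell which sets of a countable basis contain \<open>y\<close>. It reduces the
  compactness of measures to Helly's theorem on the real line.
\<close>

definition ternary :: "(nat \<Rightarrow> bool) \<Rightarrow> real" where
  "ternary P = (\<Sum>k. of_bool (P k) * 2 / 3 ^ Suc k)"

lemma sums_two_thirds: "(\<lambda>k. 2 / 3 ^ Suc k :: real) sums 1"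
  using sums_mult2[OF geometric_sums[of "1 / 3 :: real"], of "2 / 3"]
  by (simp add: power_one_over field_simps)

lemma summable_ternary: "summable (\<lambda>k. of_bool (P k) * 2 / 3 ^ Suc k :: real)"
  by (rule summable_comparison_test'[OF sums_summable[OF sums_two_thirds], of 0]) auto

lemma ternary_bounds: "ternary P \<in> {0..1}"
proof -
  have "ternary P \<le> (\<Sum>k. 2 / 3 ^ Suc k)"
    unfolding ternary_def by (intro suminf_le summable_ternary sums_summable[OF sums_two_thirds]) auto
  moreover have "ternary P \<ge> 0" unfolding ternary_def by (intro suminf_nonneg summable_ternary) auto
  ultimately show ?thesis using sums_unique[OF sums_two_thirds] by simp
qed

lemma ternary_split:
  "ternary P = (\<Sum>k<n. of_bool (P k) * 2 / 3 ^ Suc k) + ternary (\<lambda>k. P (k + n)) / 3 ^ n"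
proof -
  have "ternary (\<lambda>k. P (k + n)) / 3 ^ n = (\<Sum>k. of_bool (P (k + n)) * 2 / 3 ^ Suc (k + n))"
    unfolding ternary_def using suminf_divide[OF summable_ternary, of "\<lambda>k. P (k + n)" "3 ^ n"]
    by (simp add: power_add ac_simps)
  then show ?thesis
    using suminf_split_initial_segment[OF summable_ternary, of P n] by (simp add: ternary_def)
qed

lemma ternary_close_imp_digit_eq:
  assumes "\<bar>ternary P - ternary Q\<bar> < 1 / 3 ^ K" "k < K"
  shows "P k = Q k"
proof (rule ccontr)
  assume "P k \<noteq> Q k"
  then obtain j where j: "P j \<noteq> Q j" "j \<le> k" "\<And>i. i < j \<Longrightarrow> P i = Q i"
    using exists_least_iff[of "\<lambda>j. P j \<noteq> Q j"] by (metis not_le)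
  define tail where "tail R = ternary (\<lambda>i. R (i + Suc j))" for R
  have "(\<Sum>i<j. of_bool (P i) * 2 / 3 ^ Suc i) = (\<Sum>i<j. of_bool (Q i) * 2 / 3 ^ Suc i :: real)"
    using j(3) by (intro sum.cong) auto
  then have "ternary P - ternary Q = ((of_bool (P j) - of_bool (Q j)) * 2 + (tail P - tail Q)) / 3 ^ Suc j"
    unfolding ternary_split[of P "Suc j"] ternary_split[of Q "Suc j"] tail_def
    by (simp add: field_simps)
  moreover have "\<bar>tail P - tail Q\<bar> \<le> 1"
    using ternary_bounds[of "\<lambda>i. P (i + Suc j)"] ternary_bounds[of "\<lambda>i. Q (i + Suc j)"]
    unfolding tail_def atLeastAtMost_iff by linarith
  then have "1 \<le> \<bar>(of_bool (P j) - of_bool (Q j)) * 2 + (tail P - tail Q)\<bar>"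
    using j(1) by (cases "P j") auto
  ultimately have "1 / 3 ^ Suc j \<le> \<bar>ternary P - ternary Q\<bar>"
    by (simp add: abs_divide divide_right_mono)
  moreover have "(1::real) / 3 ^ K \<le> 1 / 3 ^ Suc j"
    using j(2) assms(2) by (intro divide_left_mono power_increasing) auto
  ultimately show False using assms(1) by simp
qed

lemma ex_basis_sequence:
  "\<exists>A :: nat \<Rightarrow> 'a::second_countable_topology set. (\<forall>k. open (A k)) \<and>
    (\<forall>S x. open S \<longrightarrow> x \<in> S \<longrightarrow> (\<exists>k. x \<in> A k \<and> A k \<subseteq> S))"
proof -
  obtain \<B> :: "'a set set" where \<B>: "countable \<B>" "topological_basis \<B>"
    using ex_countable_basis by blast
  have range: "range (from_nat_into (insert {} \<B>)) = insert {} \<B>"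
    using \<B>(1) by (intro range_from_nat_into) auto
  show ?thesis
  proof (intro exI[of _ "from_nat_into (insert {} \<B>)"] conjI allI impI)
    show "open (from_nat_into (insert {} \<B>) k)" for k
      using topological_basis_open[OF \<B>(2)] range by (metis insert_iff open_empty rangeI)
    show "\<exists>k. x \<in> from_nat_into (insert {} \<B>) k \<and> from_nat_into (insert {} \<B>) k \<subseteq> S" if "open S" "x \<in> S" for x S
      using topological_basisE[OF \<B>(2) that] range by (metis insert_iff rangeE)
  qed
qed

lemma compact_coding:
  fixes D :: "'a::{metric_space, second_countable_topology} set"
  assumes "compact D"
  obtains s :: "'a \<Rightarrow> real" where "\<And>y. s y \<in> {0..1}"
    "\<And>e. e > 0 \<Longrightarrow> \<exists>d>0. \<forall>y\<in>D. \<forall>y'\<in>D. \<bar>s y - s y'\<bar> < d \<longrightarrow> dist y y' < e"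
proof -
  obtain A :: "nat \<Rightarrow> 'a set" where open_A: "\<And>k. open (A k)"
    and basis: "\<And>S x. open S \<Longrightarrow> x \<in> S \<Longrightarrow> \<exists>k. x \<in> A k \<and> A k \<subseteq> S"
    using ex_basis_sequence[where 'a = 'a] by blast
  define s where "s y = ternary (\<lambda>k. y \<in> A k)" for y
  show thesis
  proof (rule that[of s])
    show "s y \<in> {0..1}" for y unfolding s_def by (rule ternary_bounds)
    fix e :: real assume "e > 0"
    define small where "small = {k. \<exists>x. A k \<subseteq> ball x (e / 2)}"
    have "D \<subseteq> (\<Union>k\<in>small. A k)"
    proof
      fix y
      obtain k where "y \<in> A k" "A k \<subseteq> ball y (e / 2)" using basis[OF open_ball, of y y "e / 2"] \<open>e > 0\<close> by auto
      then show "y \<in> (\<Union>k\<in>small. A k)" by (auto simp: small_def)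
    qed
    then obtain J where J: "J \<subseteq> small" "finite J" "D \<subseteq> (\<Union>k\<in>J. A k)"
      by (rule compactE_image[of D small A, OF assms open_A])
    then obtain K where K: "\<And>k. k \<in> J \<Longrightarrow> k < K"
      using finite_nat_set_iff_bounded[of J] by auto
    have "dist y y' < e" if y: "y \<in> D" "\<bar>s y - s y'\<bar> < 1 / 3 ^ K" for y y'
    proof -
      obtain k where k: "k \<in> J" "y \<in> A k" using J(3) y(1) by blast
      moreover have "y' \<in> A k"
        using ternary_close_imp_digit_eq[OF y(2)[unfolded s_def] K[OF k(1)]] k(2) by simp
      moreover obtain x where "A k \<subseteq> ball x (e / 2)" using J(1) k(1) by (auto simp: small_def)
      ultimately have "dist x y < e / 2" "dist x y' < e / 2" by auto
      then show ?thesis by (metis dist_commute dist_triangle_half_l)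
    qed
    then show "\<exists>d>0. \<forall>y\<in>D. \<forall>y'\<in>D. \<bar>s y - s y'\<bar> < d \<longrightarrow> dist y y' < e"
      by (intro exI[of _ "1 / 3 ^ K"]) simp
  qed
qed

lemma compact_coding_decoding:
  fixes D :: "'a::{complete_space, second_countable_topology} set"
  assumes D: "compact D"
  obtains s :: "'a \<Rightarrow> real" and C q where "\<And>y. s y \<in> {0..1}" "closed C" "s ` D \<subseteq> C"
    "continuous_on C q" "q ` C \<subseteq> D" "\<And>y. y \<in> D \<Longrightarrow> q (s y) = y"
proof -
  obtain s :: "'a \<Rightarrow> real" where s: "\<And>y. s y \<in> {0..1}"
    "\<And>e. e > 0 \<Longrightarrow> \<exists>d>0. \<forall>y\<in>D. \<forall>y'\<in>D. \<bar>s y - s y'\<bar> < d \<longrightarrow> dist y y' < e"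
    using compact_coding[OF D] by blast
  have "inj_on s D"
  proof (rule inj_onI, rule ccontr)
    fix x y assume "x \<in> D" "y \<in> D" "s x = s y" "x \<noteq> y"
    then show False using s(2)[of "dist x y"] by force
  qed
  then have inv: "inv_into D s (s y) = y" if "y \<in> D" for y using that by simp
  have "uniformly_continuous_on (s ` D) (inv_into D s)"
    unfolding uniformly_continuous_on_def
  proof (intro allI impI)
    fix e :: real assume "e > 0"
    then obtain d where "d > 0" "\<forall>y\<in>D. \<forall>y'\<in>D. \<bar>s y - s y'\<bar> < d \<longrightarrow> dist y y' < e" using s(2) by blast
    then show "\<exists>d>0. \<forall>x\<in>s ` D. \<forall>x'\<in>s ` D. dist x' x < d \<longrightarrow> dist (inv_into D s x') (inv_into D s x) < e"
      by (intro exI[of _ d]) (auto simp: inv dist_real_def)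
  qed
  then obtain q where q: "uniformly_continuous_on (closure (s ` D)) q" "\<And>x. x \<in> s ` D \<Longrightarrow> inv_into D s x = q x"
    using uniformly_continuous_on_extension_on_closure by metis
  have cont: "continuous_on (closure (s ` D)) q" by (rule uniformly_continuous_imp_continuous[OF q(1)])
  have qs: "q (s y) = y" if "y \<in> D" for y using q(2)[of "s y"] inv[OF that] that by simp
  have "q ` closure (s ` D) \<subseteq> closure (q ` s ` D)"
    using continuous_image_closure_subset[OF cont order_refl] .
  also have "q ` s ` D = D" using qs by force
  finally have "q ` closure (s ` D) \<subseteq> D" using D by (simp add: compact_imp_closed)
  with s(1) qs cont show thesis by (intro that[of s "closure (s ` D)" q]) (auto simp: closure_subset)
qed

definition weakly_converges :: "(nat \<Rightarrow> real pmf) \<Rightarrow> real measure \<Rightarrow> bool" where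
  "weakly_converges p M \<longleftrightarrow> (\<forall>g :: real \<Rightarrow> real. continuous_on UNIV g \<longrightarrow> bounded (range g)
     \<longrightarrow> (\<lambda>n. measure_pmf.expectation (p n) g) \<longlonglongrightarrow> (\<integral>x. g x \<partial>M))"

definition probability_on :: "'a::topological_space set \<Rightarrow> 'a measure \<Rightarrow> bool" where
  "probability_on D \<nu> \<longleftrightarrow> prob_space \<nu> \<and> sets \<nu> = sets borel \<and> (AE y in \<nu>. y \<in> D)"

lemma probability_onD:
  "probability_on D \<nu> \<Longrightarrow> prob_space \<nu>" "probability_on D \<nu> \<Longrightarrow> sets \<nu> = sets borel" "probability_on D \<nu> \<Longrightarrow> AE y in \<nu>. y \<in> D"
  by (simp_all add: probability_on_def)

lemma real_pmf_weak_limit: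
  fixes p :: "nat \<Rightarrow> real pmf"
  assumes bounded: "\<And>n. set_pmf (p n) \<subseteq> {a..b}"
  obtains r :: "nat \<Rightarrow> nat" and M where "strict_mono r" "real_distribution M" "weakly_converges (\<lambda>n. p (r n)) M"
proof -
  define \<mu> where "\<mu> n = distr (measure_pmf (p n)) borel id" for n
  have prob: "real_distribution (\<mu> n)" for n
  proof -
    interpret prob_space "\<mu> n" unfolding \<mu>_def by (rule measure_pmf.prob_space_distr) simp
    show ?thesis by unfold_locales (auto simp: \<mu>_def)
  qed
  have "measure (\<mu> n) {a - 1<..b} = 1" for n
  proof -
    have "measure (\<mu> n) {a - 1<..b} = measure (measure_pmf (p n)) {a - 1<..b}"
      unfolding \<mu>_def by (subst measure_distr) auto
    also have "\<dots> = 1"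
      using bounded[of n] by (subst measure_pmf.prob_eq_1) (force simp: AE_measure_pmf_iff)+
    finally show ?thesis .
  qed
  moreover have "a \<le> b"
    using bounded[of 0] set_pmf_not_empty[of "p 0"] by (metis atLeastatMost_empty_iff subset_empty)
  ultimately have "\<exists>a b. a < b \<and> (\<forall>n. 1 - e < measure (\<mu> n) {a<..b})" if "e > 0" for e
    using that by (intro exI[of _ "a - 1"] exI[of _ b]) simp
  then have "tight \<mu>" unfolding tight_def using prob by blast
  then obtain r M where r: "strict_mono (r :: nat \<Rightarrow> nat)" "real_distribution M" "weak_conv_m (\<mu> \<circ> id \<circ> r) M"
    using tight_imp_convergent_subsubsequence[of \<mu> id] by (auto simp: strict_mono_id)
  interpret M: real_distribution M by fact
  have "(\<lambda>n. measure_pmf.expectation (p (r n)) g) \<longlonglongrightarrow> (\<integral>x. g x \<partial>M)"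
    if g: "continuous_on UNIV g" "bounded (range g)" for g :: "real \<Rightarrow> real"
  proof -
    obtain B where B: "\<And>x. norm (g x) \<le> B" using g(2) by (auto simp: bounded_iff)
    have "(\<lambda>n. integral\<^sup>L ((\<mu> \<circ> id \<circ> r) n) g) \<longlonglongrightarrow> integral\<^sup>L M g"
      by (rule weak_conv_imp_integral_bdd_continuous_conv[OF _ r(2) r(3)])
        (use g(1) prob B in \<open>auto simp: continuous_on_eq_continuous_at\<close>)
    moreover have "integral\<^sup>L (\<mu> n) g = measure_pmf.expectation (p n) g" for n
      unfolding \<mu>_def using g(1) by (subst integral_distr) (auto intro: borel_measurable_continuous_onI)
    ultimately show ?thesis by simp
  qed
  then show thesis using that[OF r(1,2)] by (simp add: weakly_converges_def)
qed

lemma (in real_distribution) AE_closed_if_pmf_weak_limit: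
  fixes p :: "nat \<Rightarrow> real pmf"
  assumes "closed C" and supp: "\<And>n. set_pmf (p n) \<subseteq> C"
    and lim: "weakly_converges p M"
  shows "AE x in M. x \<in> C"
proof -
  have cont: "continuous_on UNIV (\<lambda>x. min 1 (infdist x C))" by (intro continuous_intros)
  have "measure_pmf.expectation (p n) (\<lambda>x. min 1 (infdist x C)) = 0" for n
    using supp[of n] by (subst integral_cong_AE[where g = "\<lambda>_. 0"]) (auto simp: AE_measure_pmf_iff)
  then have "(\<integral>x. min 1 (infdist x C) \<partial>M) = 0"
    using lim cont unfolding weakly_converges_def by (fastforce simp: infdist_nonneg bounded_iff exI[of _ 1] LIMSEQ_const_iff)
  moreover have "integrable M (\<lambda>x. min 1 (infdist x C))"
    by (rule integrable_const_bound[of _ 1])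
      (auto simp: infdist_nonneg borel_measurable_continuous_onI[OF cont])
  ultimately have "AE x in M. min 1 (infdist x C) = 0"
    by (subst (asm) integral_nonneg_eq_0_iff_AE) (auto simp: infdist_nonneg)
  moreover have "C \<noteq> {}" using supp[of 0] set_pmf_not_empty[of "p 0"] by auto
  ultimately show ?thesis
    by (elim eventually_mono) (use in_closed_iff_infdist_zero[OF \<open>closed C\<close>] in \<open>simp add: min_def split: if_splits\<close>)
qed

lemma (in real_distribution) pmf_weak_limit_on_closed:
  fixes f :: "real \<Rightarrow> real" and p :: "nat \<Rightarrow> real pmf"
  assumes "closed C" and supp: "\<And>n. set_pmf (p n) \<subseteq> C"
    and lim: "weakly_converges p M"
    and f: "continuous_on C f" "bounded (f ` C)"
  shows "(\<lambda>n. measure_pmf.expectation (p n) f) \<longlonglongrightarrow> (\<integral>x. indicator C x *\<^sub>R f x \<partial>M)"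
proof -
  obtain B where B: "B \<ge> 0" "\<And>x. x \<in> C \<Longrightarrow> norm (f x) \<le> B"
    using f(2) unfolding bounded_pos by (metis imageI less_imp_le)
  obtain g where g: "continuous_on UNIV g" "\<And>x. x \<in> C \<Longrightarrow> g x = f x" "\<And>x. norm (g x) \<le> B"
    by (rule Tietze[of C f UNIV B]) (use assms(1) f(1) B in auto)
  have "bounded (range g)" using g(3) by (auto simp: bounded_iff)
  then have "(\<lambda>n. measure_pmf.expectation (p n) g) \<longlonglongrightarrow> (\<integral>x. g x \<partial>M)"
    using lim g(1) by (simp add: weakly_converges_def)
  moreover have "measure_pmf.expectation (p n) g = measure_pmf.expectation (p n) f" for n
    using supp[of n] by (intro integral_cong_AE) (auto simp: AE_measure_pmf_iff g(2))
  moreover have "AE x in M. x \<in> C" by (rule AE_closed_if_pmf_weak_limit[OF assms(1) supp lim])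
  then have "(\<integral>x. g x \<partial>M) = (\<integral>x. indicator C x *\<^sub>R f x \<partial>M)"
  proof (intro integral_cong_AE)
    assume "AE x in M. x \<in> C"
    then show "AE x in M. g x = indicator C x *\<^sub>R f x" by eventually_elim (simp add: g(2))
    show "(\<lambda>x. indicator C x *\<^sub>R f x) \<in> borel_measurable M"
      using borel_measurable_continuous_on_indicator[OF borel_closed[OF assms(1)] f(1)] by simp
  qed (use g(1) in \<open>simp add: borel_measurable_continuous_onI\<close>)
  ultimately show ?thesis by simp
qed

lemma integral_distr_compact:
  fixes f :: "'a::euclidean_space \<Rightarrow> real"
  assumes "compact D" "continuous_on D f" and q: "q \<in> borel_measurable M" "\<And>x. q x \<in> D"
    and g: "g \<in> borel_measurable M" "AE x in M. f (q x) = g x"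
  shows "(\<integral>y. indicator D y *\<^sub>R f y \<partial>distr M borel q) = (\<integral>x. g x \<partial>M)"
proof -
  have f: "(\<lambda>y. indicator D y *\<^sub>R f y) \<in> borel_measurable borel"
    using assms(1,2) by (intro borel_measurable_continuous_on_indicator) (auto simp: compact_imp_closed)
  have "(\<integral>y. indicator D y *\<^sub>R f y \<partial>distr M borel q) = (\<integral>x. indicator D (q x) *\<^sub>R f (q x) \<partial>M)"
    by (rule integral_distr[OF q(1) f])
  also have "\<dots> = (\<integral>x. g x \<partial>M)"
    using measurable_compose[OF q(1) f] g q(2) by (intro integral_cong_AE) auto
  finally show ?thesis .
qed

theorem pmf_weak_limit:
  fixes D :: "'a::euclidean_space set" and p :: "nat \<Rightarrow> 'a pmf"
  assumes D: "compact D" and p: "\<And>n. set_pmf (p n) \<subseteq> D"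
  obtains r :: "nat \<Rightarrow> nat" and \<nu> :: "'a measure" where "strict_mono r" "probability_on D \<nu>"
    "\<And>f :: 'a \<Rightarrow> real. continuous_on D f
      \<Longrightarrow> (\<lambda>n. measure_pmf.expectation (p (r n)) f) \<longlonglongrightarrow> (\<integral>y. indicator D y *\<^sub>R f y \<partial>\<nu>)"
proof -
  obtain s :: "'a \<Rightarrow> real" and C q where s: "\<And>y. s y \<in> {0..1}" and C: "closed C" "s ` D \<subseteq> C"
    and q: "continuous_on C q" "q ` C \<subseteq> D" "\<And>y. y \<in> D \<Longrightarrow> q (s y) = y"
    using compact_coding_decoding[OF D] by metis
  have supp: "set_pmf (map_pmf s (p n)) \<subseteq> {0..1}" "set_pmf (map_pmf s (p n)) \<subseteq> C" for n
    using s p[of n] C(2) by fastforce+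
  obtain r :: "nat \<Rightarrow> nat" and M where r: "strict_mono r" "real_distribution M"
    and lim: "weakly_converges (\<lambda>n. map_pmf s (p (r n))) M"
    by (rule real_pmf_weak_limit[of "\<lambda>n. map_pmf s (p n)", OF supp(1)]) (rule that)
  interpret M: real_distribution M by fact
  have AE_C: "AE x in M. x \<in> C" by (rule M.AE_closed_if_pmf_weak_limit[OF C(1) supp(2) lim])
  obtain y0 where "y0 \<in> D" using p[of 0] set_pmf_not_empty[of "p 0"] by auto
  define q' where "q' x = (if x \<in> C then q x else y0)" for x
  have q'[measurable]: "q' \<in> borel_measurable borel"
    unfolding q'_def using C(1) q(1) by (intro borel_measurable_continuous_on_if) auto
  have q'D: "q' x \<in> D" for x using q(2) \<open>y0 \<in> D\<close> by (auto simp: q'_def)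
  show thesis
  proof (rule that[OF r(1), of "distr M borel q'"])
    have "AE y in distr M borel q'. y \<in> D" using D
      by (subst AE_distr_iff) (auto simp: q'D compact_imp_closed)
    then show "probability_on D (distr M borel q')" by (simp add: probability_on_def M.prob_space_distr)
    fix f :: "'a \<Rightarrow> real" assume f: "continuous_on D f"
    note fq = continuous_on_compose2[OF f q(1,2)]
    have "bounded ((\<lambda>x. f (q x)) ` C)"
      using compact_imp_bounded[OF compact_continuous_image[OF f D]] by (rule bounded_subset) (use q(2) in blast)
    from M.pmf_weak_limit_on_closed[OF C(1) supp(2) lim fq this]
    have "(\<lambda>n. measure_pmf.expectation (map_pmf s (p (r n))) (\<lambda>x. f (q x)))
        \<longlonglongrightarrow> (\<integral>x. indicator C x *\<^sub>R f (q x) \<partial>M)" (is "_ \<longlonglongrightarrow> ?I") .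
    moreover have "measure_pmf.expectation (map_pmf s (p n)) (\<lambda>x. f (q x)) = measure_pmf.expectation (p n) f" for n
      unfolding integral_map_pmf using p[of n]
      by (intro integral_cong_AE) (auto simp: AE_measure_pmf_iff q(3) subset_iff)
    moreover have "(\<integral>y. indicator D y *\<^sub>R f y \<partial>distr M borel q') = ?I"
    proof (rule integral_distr_compact[OF D f])
      show "AE x in M. f (q' x) = indicator C x *\<^sub>R f (q x)" using AE_C by eventually_elim (simp add: q'_def)
      show "(\<lambda>x. indicator C x *\<^sub>R f (q x)) \<in> borel_measurable M"
        using borel_measurable_continuous_on_indicator[OF borel_closed[OF C(1)] fq] by simp
    qed (simp_all add: q'D)
    ultimately show "(\<lambda>n. measure_pmf.expectation (p (r n)) f)
        \<longlonglongrightarrow> (\<integral>y. indicator D y *\<^sub>R f y \<partial>distr M borel q')" by simp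
  qed
qed

subsection \<open>A theorem of the alternative\<close>

lemma (in prob_space) abs_integral_le_const:
  fixes f :: "'a \<Rightarrow> real"
  assumes "AE x in M. \<bar>f x\<bar> \<le> B"
  shows "\<bar>\<integral>x. f x \<partial>M\<bar> \<le> B"
proof (cases "integrable M f")
  case True
  have "\<bar>\<integral>x. f x \<partial>M\<bar> \<le> (\<integral>x. \<bar>f x\<bar> \<partial>M)" by (rule integral_abs_bound)
  also have "\<dots> \<le> B" using True assms by (intro integral_le_const integrable_abs)
  finally show ?thesis .
next
  case False
  have "AE x in M. 0 \<le> B" using assms by eventually_elim simp
  then show ?thesis using False by (simp add: not_integrable_integral_eq)
qed

lemma pmf_mixture_expectation:
  fixes \<psi> :: "'a \<Rightarrow> real"
  assumes "finite (set_pmf \<tau>)" "t \<in> {0..1}"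
  shows "measure_pmf.expectation (bernoulli_pmf t \<bind> (\<lambda>b. if b then return_pmf y else \<tau>)) \<psi>
    = t * \<psi> y + (1 - t) * measure_pmf.expectation \<tau> \<psi>"
  using assms by (subst pmf_expectation_bind[of UNIV]) (auto simp: UNIV_bool)

lemma inner_ge_if_mixture_ge:
  fixes p b :: "'i \<Rightarrow> real"
  assumes B: "\<And>j. j \<in> J \<Longrightarrow> \<bar>p j\<bar> \<le> B" "\<And>j. j \<in> J \<Longrightarrow> \<bar>b j\<bar> \<le> B"
    and t: "0 < t" "t * (real (card J) * (2 * B)\<^sup>2) \<le> d / 2"
    and b: "d \<le> (\<Sum>j\<in>J. (b j)\<^sup>2)" "(\<Sum>j\<in>J. (b j)\<^sup>2) < d + t * d / 2"
    and mixture: "d \<le> (\<Sum>j\<in>J. (t * p j + (1 - t) * b j)\<^sup>2)"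
  shows "d / 2 \<le> (\<Sum>j\<in>J. b j * p j)"
proof -
  note mixture
  also have "(\<Sum>j\<in>J. (t * p j + (1 - t) * b j)\<^sup>2)
      = (\<Sum>j\<in>J. (1 - 2 * t) * (b j)\<^sup>2 + 2 * t * (b j * p j) + t\<^sup>2 * (p j - b j)\<^sup>2)"
    by (intro sum.cong refl) (simp add: power2_eq_square algebra_simps)
  also have "\<dots> = (1 - 2 * t) * (\<Sum>j\<in>J. (b j)\<^sup>2) + 2 * t * (\<Sum>j\<in>J. b j * p j) + t\<^sup>2 * (\<Sum>j\<in>J. (p j - b j)\<^sup>2)"
    by (simp add: sum.distrib sum_distrib_left)
  finally have "2 * (t * (\<Sum>j\<in>J. (b j)\<^sup>2)) \<le> (\<Sum>j\<in>J. (b j)\<^sup>2) - d + 2 * (t * (\<Sum>j\<in>J. b j * p j))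
      + t\<^sup>2 * (\<Sum>j\<in>J. (p j - b j)\<^sup>2)" by (simp add: algebra_simps)
  moreover have "t\<^sup>2 * (\<Sum>j\<in>J. (p j - b j)\<^sup>2) \<le> t * (d / 2)"
  proof -
    have "(p j - b j)\<^sup>2 \<le> (2 * B)\<^sup>2" if "j \<in> J" for j
      using B[OF that] by (intro power2_le_iff_abs_le[THEN iffD2]) auto
    then have "(\<Sum>j\<in>J. (p j - b j)\<^sup>2) \<le> real (card J) * (2 * B)\<^sup>2" by (rule sum_bounded_above)
    then have "t * (\<Sum>j\<in>J. (p j - b j)\<^sup>2) \<le> d / 2" using t by (smt (verit) mult_left_mono)
    then show ?thesis using mult_left_mono[of _ "d / 2" t] t(1) by (simp add: power2_eq_square mult.assoc)
  qed
  moreover have "t * d \<le> t * (\<Sum>j\<in>J. (b j)\<^sup>2)" using b(1) t(1) by simp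
  ultimately have "t * (d / 2) \<le> t * (\<Sum>j\<in>J. b j * p j)" using b(2) by simp
  then show ?thesis using t(1) by (simp add: mult_le_cancel_left)
qed

text \<open>
  Almost minimise the length of the vector of the expectations: if the infimum is positive, then the
  almost minimal vector itself separates.
\<close>

lemma pmf_alternative:
  fixes \<psi> :: "'i \<Rightarrow> 'a \<Rightarrow> real"
  assumes D: "D \<noteq> {}" and B: "\<And>j y. j \<in> J \<Longrightarrow> y \<in> D \<Longrightarrow> \<bar>\<psi> j y\<bar> \<le> B"
    and no: "\<And>\<beta> \<delta>. \<delta> > 0 \<Longrightarrow> \<exists>y\<in>D. (\<Sum>j\<in>J. \<beta> j * \<psi> j y) < \<delta>" and "e > 0"
  shows "\<exists>\<tau>. set_pmf \<tau> \<subseteq> D \<and> (\<Sum>j\<in>J. (measure_pmf.expectation \<tau> (\<psi> j))\<^sup>2) < e"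
proof (rule ccontr)
  assume no_pmf: "\<not> ?thesis"
  define N where "N \<tau> = (\<Sum>j\<in>J. (measure_pmf.expectation \<tau> (\<psi> j))\<^sup>2)" for \<tau>
  define \<T> where "\<T> = {\<tau>. finite (set_pmf \<tau>) \<and> set_pmf \<tau> \<subseteq> D}"
  obtain y0 where "y0 \<in> D" using D by blast
  then have "return_pmf y0 \<in> \<T>" by (simp add: \<T>_def)
  then have "\<T> \<noteq> {}" by blast
  define d where "d = Inf (N ` \<T>)"
  have bdd: "bdd_below (N ` \<T>)" by (auto simp: N_def bdd_below_def intro!: exI[of _ 0] sum_nonneg)
  have d_le: "d \<le> N \<tau>" if "\<tau> \<in> \<T>" for \<tau> unfolding d_def by (intro cInf_lower bdd imageI that)
  have "N \<tau> \<ge> e" if "\<tau> \<in> \<T>" for \<tau>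
    using no_pmf that unfolding \<T>_def N_def by force
  then have "d \<ge> e" unfolding d_def using \<open>\<T> \<noteq> {}\<close> by (intro cInf_greatest) auto
  then have "d > 0" using \<open>e > 0\<close> by simp
  define C where "C = real (card J) * (2 * B)\<^sup>2"
  define t where "t = min 1 (d / (2 * (C + 1)))"
  have "C \<ge> 0" by (simp add: C_def)
  then have t: "0 < t" "t \<le> 1" using \<open>d > 0\<close> by (auto simp: t_def)
  have "t \<le> d / 2 / (C + 1)" by (simp add: t_def)
  then have "t * (C + 1) \<le> d / 2" using \<open>C \<ge> 0\<close> pos_le_divide_eq[of "C + 1" t "d / 2"] by simp
  then have tC: "t * C \<le> d / 2" using t(1) by (simp add: distrib_left)
  obtain \<tau> where \<tau>: "\<tau> \<in> \<T>" "N \<tau> < d + t * d / 2"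
    using cInf_lessD[of "N ` \<T>" "d + t * d / 2"] \<open>\<T> \<noteq> {}\<close> t \<open>d > 0\<close> by (auto simp: d_def)
  define \<beta> where "\<beta> j = measure_pmf.expectation \<tau> (\<psi> j)" for j
  have \<beta>_le: "\<bar>\<beta> j\<bar> \<le> B" if "j \<in> J" for j
    unfolding \<beta>_def using B[OF that] \<tau>(1)
    by (intro measure_pmf.abs_integral_le_const) (auto simp: AE_measure_pmf_iff \<T>_def)
  have "d / 2 \<le> (\<Sum>j\<in>J. \<beta> j * \<psi> j y)" if y: "y \<in> D" for y
  proof -
    let ?k = "bernoulli_pmf t \<bind> (\<lambda>b. if b then return_pmf y else \<tau>)"
    have "set_pmf ?k \<subseteq> insert y (set_pmf \<tau>)" by (auto simp: set_bind_pmf split: if_splits)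
    then have "?k \<in> \<T>" using \<tau>(1) y by (auto simp: \<T>_def intro: finite_subset)
    then have "d \<le> N ?k" by (rule d_le)
    also have "N ?k = (\<Sum>j\<in>J. (t * \<psi> j y + (1 - t) * \<beta> j)\<^sup>2)"
      unfolding N_def \<beta>_def using \<tau>(1) t by (simp add: \<T>_def pmf_mixture_expectation)
    finally show ?thesis
      using B y \<beta>_le t(1) tC d_le[OF \<tau>(1)] \<tau>(2)
      by (intro inner_ge_if_mixture_ge[where B = B and t = t]) (auto simp: N_def \<beta>_def C_def)
  qed
  then show False using no[of "d / 2" \<beta>] \<open>d > 0\<close> by force
qed

lemma compact_ex_net_list:
  fixes D :: "'a::heine_borel set"
  assumes "compact D" "r > 0"
  shows "\<exists>xs. set xs \<subseteq> D \<and> (\<forall>y\<in>D. \<exists>x\<in>set xs. dist x y < r)"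
proof -
  obtain T where T: "T \<subseteq> D" "finite T" "D \<subseteq> (\<Union>x\<in>T. ball x r)"
    by (rule compactE_image[OF assms(1), of D "\<lambda>x. ball x r"]) (use assms(2) in force)+
  moreover obtain xs where "set xs = T" using finite_list[OF T(2)] by blast
  ultimately show ?thesis by (intro exI[of _ xs]) fastforce
qed

lemma ex_nat_code_sup_close:
  fixes D :: "'a::heine_borel set" and E :: "('a \<Rightarrow> real) set"
  assumes D: "compact D" and cont: "\<And>f. f \<in> E \<Longrightarrow> continuous_on D f" and "e > 0"
  shows "\<exists>code :: ('a \<Rightarrow> real) \<Rightarrow> nat. \<forall>f\<in>E. \<forall>g\<in>E. code f = code g \<longrightarrow> (\<forall>y\<in>D. \<bar>f y - g y\<bar> \<le> e)"
proof -
  define d where "d = e / 3"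
  have "d > 0" using \<open>e > 0\<close> by (simp add: d_def)
  have "\<exists>xs. set xs \<subseteq> D \<and> (\<forall>y\<in>D. \<exists>x\<in>set xs. dist x y < 1 / real (Suc m))" for m
    by (rule compact_ex_net_list[OF D]) simp
  then obtain net where net: "\<And>m. set (net m) \<subseteq> D"
    "\<And>m y. y \<in> D \<Longrightarrow> \<exists>x\<in>set (net m). dist x y < 1 / real (Suc m)" by metis
  have "\<exists>m. \<forall>x\<in>D. \<forall>y\<in>D. dist x y < 1 / real (Suc m) \<longrightarrow> \<bar>f x - f y\<bar> < d" if "f \<in> E" for f
  proof -
    have "uniformly_continuous_on D f" by (rule compact_uniformly_continuous[OF cont[OF that] D])
    then obtain r where "r > 0" "\<forall>x\<in>D. \<forall>y\<in>D. dist y x < r \<longrightarrow> dist (f y) (f x) < d"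
      unfolding uniformly_continuous_on_def using \<open>d > 0\<close> by blast
    moreover obtain m where "1 / real (Suc m) < r"
      using reals_Archimedean[OF \<open>r > 0\<close>] by (auto simp: inverse_eq_divide)
    ultimately show ?thesis by (intro exI[of _ m]) (force simp: dist_real_def)
  qed
  then obtain modulus where modulus: "\<And>f x y. f \<in> E \<Longrightarrow> x \<in> D \<Longrightarrow> y \<in> D
      \<Longrightarrow> dist x y < 1 / real (Suc (modulus f)) \<Longrightarrow> \<bar>f x - f y\<bar> < d" by metis
  define code where
    "code f = to_nat (modulus f, map (\<lambda>x. \<lfloor>f x / d\<rfloor>) (net (modulus f)))" for f
  have "\<bar>f y - g y\<bar> \<le> e" if fg: "f \<in> E" "g \<in> E" "code f = code g" "y \<in> D" for f g y
  proof -
    have m: "modulus f = modulus g" using fg(3) by (simp add: code_def)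
    obtain x where x: "x \<in> set (net (modulus f))" "dist x y < 1 / real (Suc (modulus f))"
      using net(2)[OF \<open>y \<in> D\<close>] by blast
    then have "\<bar>f x - f y\<bar> < d" "\<bar>g x - g y\<bar> < d"
      using modulus fg net(1) m by (metis subsetD)+
    moreover have "\<lfloor>f x / d\<rfloor> = \<lfloor>g x / d\<rfloor>" using fg(3) x(1) m by (simp add: code_def)
    then have "\<bar>(f x - g x) / d\<bar> < 1" unfolding diff_divide_distrib by linarith
    then have "\<bar>f x - g x\<bar> < d" using \<open>d > 0\<close> by (simp add: abs_divide)
    ultimately show ?thesis unfolding d_def by linarith
  qed
  then show ?thesis by blast
qed

lemma countable_sup_dense_subset:
  fixes D :: "'a::heine_borel set" and E :: "('a \<Rightarrow> real) set"
  assumes D: "compact D" and "E \<noteq> {}" and cont: "\<And>f. f \<in> E \<Longrightarrow> continuous_on D f"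
  obtains F :: "nat \<Rightarrow> 'a \<Rightarrow> real" where "\<And>n. F n \<in> E"
    "\<And>f e. f \<in> E \<Longrightarrow> e > 0 \<Longrightarrow> \<exists>n. \<forall>y\<in>D. \<bar>f y - F n y\<bar> \<le> e"
proof -
  have "\<exists>code :: ('a \<Rightarrow> real) \<Rightarrow> nat.
      \<forall>f\<in>E. \<forall>g\<in>E. code f = code g \<longrightarrow> (\<forall>y\<in>D. \<bar>f y - g y\<bar> \<le> 1 / real (Suc n))" for n
    by (rule ex_nat_code_sup_close[OF D cont]) auto
  then obtain code :: "nat \<Rightarrow> ('a \<Rightarrow> real) \<Rightarrow> nat" where code: "\<And>n f g y. f \<in> E \<Longrightarrow> g \<in> E
      \<Longrightarrow> code n f = code n g \<Longrightarrow> y \<in> D \<Longrightarrow> \<bar>f y - g y\<bar> \<le> 1 / real (Suc n)" by metis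
  have "\<exists>f\<in>E. (\<exists>g\<in>E. code n g = k) \<longrightarrow> code n f = k" for n k using \<open>E \<noteq> {}\<close> by blast
  then obtain pick where pick: "\<And>n k. pick n k \<in> E"
    "\<And>n k. \<exists>g\<in>E. code n g = k \<Longrightarrow> code n (pick n k) = k" by metis
  show thesis
  proof (rule that[of "\<lambda>n. case_prod pick (prod_decode n)"])
    show "case_prod pick (prod_decode n) \<in> E" for n using pick(1) by (simp add: case_prod_unfold)
    fix f and e :: real assume f: "f \<in> E" and "e > 0"
    obtain n where n: "1 / real (Suc n) < e" using reals_Archimedean[OF \<open>e > 0\<close>] by (auto simp: inverse_eq_divide)
    have "\<bar>f y - pick n (code n f) y\<bar> \<le> e" if "y \<in> D" for y
      using code[OF f pick(1) _ that, of n n "code n f"] pick(2)[of n "code n f"] f n by force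
    then show "\<exists>n. \<forall>y\<in>D. \<bar>f y - case_prod pick (prod_decode n) y\<bar> \<le> e"
      by (intro exI[of _ "prod_encode (n, code n f)"]) simp
  qed
qed

lemma sum_in_linear_family:
  fixes E :: "('a \<Rightarrow> real) set"
  fixes k :: nat
  assumes "(\<lambda>_. 0) \<in> E" and "\<And>f g c. f \<in> E \<Longrightarrow> g \<in> E \<Longrightarrow> (\<lambda>y. f y + c * g y) \<in> E"
    and "\<And>j. F j \<in> E"
  shows "(\<lambda>y. \<Sum>j<k. \<beta> j * F j y) \<in> E"
  by (induction k) (use assms in simp_all)

lemma pmf_expectations_tendsto_0:
  fixes F :: "nat \<Rightarrow> 'a \<Rightarrow> real"
  assumes D: "D \<noteq> {}" and bdd: "\<And>j. \<exists>B. \<forall>y\<in>D. \<bar>F j y\<bar> \<le> B"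
    and no: "\<And>k \<beta> d. d > 0 \<Longrightarrow> \<exists>y\<in>D. (\<Sum>j<k. \<beta> j * F j y) < d"
  obtains p :: "nat \<Rightarrow> 'a pmf" where "\<And>n. set_pmf (p n) \<subseteq> D"
    "\<And>j. (\<lambda>n. measure_pmf.expectation (p n) (F j)) \<longlonglongrightarrow> 0"
proof -
  obtain B where B: "\<And>j y. y \<in> D \<Longrightarrow> \<bar>F j y\<bar> \<le> B j" using bdd by metis
  have "\<exists>\<tau>. set_pmf \<tau> \<subseteq> D \<and> (\<Sum>j<k. (measure_pmf.expectation \<tau> (F j))\<^sup>2) < 1 / real (Suc k)" for k
  proof (rule pmf_alternative[of D "{..<k}" F "\<Sum>j<k. \<bar>B j\<bar>" "1 / real (Suc k)"])
    show "\<bar>F j y\<bar> \<le> (\<Sum>j<k. \<bar>B j\<bar>)" if "j \<in> {..<k}" "y \<in> D" for j y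
    proof -
      have "\<bar>F j y\<bar> \<le> \<bar>B j\<bar>" using B[OF that(2), of j] by simp
      also have "\<dots> \<le> (\<Sum>j<k. \<bar>B j\<bar>)" using that(1) by (intro member_le_sum) auto
      finally show ?thesis .
    qed
  qed (use D no in auto)
  then obtain p where p: "\<And>k. set_pmf (p k) \<subseteq> D"
    "\<And>k. (\<Sum>j<k. (measure_pmf.expectation (p k) (F j))\<^sup>2) < 1 / real (Suc k)" by metis
  have "(\<lambda>k. measure_pmf.expectation (p k) (F j)) \<longlonglongrightarrow> 0" for j
  proof -
    have "\<forall>\<^sub>F k in sequentially. (measure_pmf.expectation (p k) (F j))\<^sup>2 \<le> 1 / real (Suc k)"
      using eventually_gt_at_top[of j]
    proof eventually_elim
      case (elim k)
      have "(measure_pmf.expectation (p k) (F j))\<^sup>2 \<le> (\<Sum>j<k. (measure_pmf.expectation (p k) (F j))\<^sup>2)"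
        using elim by (intro member_le_sum) auto
      then show ?case using p(2)[of k] by linarith
    qed
    then have "(\<lambda>k. (measure_pmf.expectation (p k) (F j))\<^sup>2) \<longlonglongrightarrow> 0"
      by (rule tendsto_sandwich[OF _ _ tendsto_const LIMSEQ_Suc[OF lim_1_over_n], rotated]) simp
    from tendsto_real_sqrt[OF this] show ?thesis by (simp add: tendsto_rabs_zero_iff)
  qed
  with p(1) show thesis by (rule that)
qed

lemma integrable_if_probability_on:
  fixes f :: "'a::euclidean_space \<Rightarrow> real"
  assumes "probability_on C M" "compact D" "continuous_on D f"
  shows "integrable M (\<lambda>y. indicator D y *\<^sub>R f y)"
proof -
  interpret prob_space M by (rule probability_onD[OF assms(1)])
  obtain B where B: "\<forall>y\<in>D. \<bar>f y\<bar> \<le> B"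
    using compact_imp_bounded[OF compact_continuous_image[OF assms(3,2)]]
    unfolding bounded_iff by (metis imageI real_norm_def)
  have "(\<lambda>y. indicator D y *\<^sub>R f y) \<in> borel_measurable M"
    using borel_measurable_continuous_on_indicator[OF borel_closed[OF compact_imp_closed[OF assms(2)]] assms(3)] probability_onD(2)[OF assms(1)]
    by (simp cong: measurable_cong_sets)
  then show ?thesis
    using B by (intro integrable_const_bound[of _ "max 0 B"]) (auto simp: indicator_def intro!: AE_I2)
qed

theorem positive_or_annihilated:
  fixes D :: "'a::euclidean_space set" and E :: "('a \<Rightarrow> real) set"
  assumes D: "compact D" "D \<noteq> {}" and cont: "\<And>f. f \<in> E \<Longrightarrow> continuous_on D f"
    and zero: "(\<lambda>_. 0) \<in> E" and lin: "\<And>f g c. f \<in> E \<Longrightarrow> g \<in> E \<Longrightarrow> (\<lambda>y. f y + c * g y) \<in> E"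
  shows "(\<exists>f\<in>E. \<exists>d>0. \<forall>y\<in>D. f y \<ge> d) \<or> (\<exists>\<nu>. probability_on D \<nu> \<and> (\<forall>f\<in>E. (\<integral>y. indicator D y *\<^sub>R f y \<partial>\<nu>) = 0))"
proof (rule disjCI)
  assume no_annihilator: "\<not> (\<exists>\<nu>. probability_on D \<nu> \<and> (\<forall>f\<in>E. (\<integral>y. indicator D y *\<^sub>R f y \<partial>\<nu>) = 0))"
  show "\<exists>f\<in>E. \<exists>d>0. \<forall>y\<in>D. f y \<ge> d"
  proof (rule ccontr)
    assume no: "\<not> (\<exists>f\<in>E. \<exists>d>0. \<forall>y\<in>D. f y \<ge> d)"
    obtain F :: "nat \<Rightarrow> 'a \<Rightarrow> real" where F: "\<And>j. F j \<in> E"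
      and dense: "\<And>f e. f \<in> E \<Longrightarrow> e > 0 \<Longrightarrow> \<exists>j. \<forall>y\<in>D. \<bar>f y - F j y\<bar> \<le> e"
      by (rule countable_sup_dense_subset[OF D(1) _ cont]) (use zero in \<open>auto intro: that\<close>)
    have "\<exists>B. \<forall>y\<in>D. \<bar>F j y\<bar> \<le> B" for j
      using compact_imp_bounded[OF compact_continuous_image[OF cont[OF F] D(1)]]
      unfolding bounded_iff by (metis imageI real_norm_def)
    moreover have "\<exists>y\<in>D. (\<Sum>j<k. \<beta> j * F j y) < d" if "d > 0" for k \<beta> d
      using no that sum_in_linear_family[where k = k and \<beta> = \<beta>, OF zero lin F] by (meson not_le)
    ultimately obtain p :: "nat \<Rightarrow> 'a pmf" where p: "\<And>n. set_pmf (p n) \<subseteq> D"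
      and lim0: "\<And>j. (\<lambda>n. measure_pmf.expectation (p n) (F j)) \<longlonglongrightarrow> 0"
      by (rule pmf_expectations_tendsto_0[OF D(2)]) (assumption, rule that)
    obtain r :: "nat \<Rightarrow> nat" and \<nu> where r: "strict_mono r" and \<nu>: "probability_on D \<nu>"
      and lim: "\<And>f :: 'a \<Rightarrow> real. continuous_on D f
        \<Longrightarrow> (\<lambda>n. measure_pmf.expectation (p (r n)) f) \<longlonglongrightarrow> (\<integral>y. indicator D y *\<^sub>R f y \<partial>\<nu>)"
      by (rule pmf_weak_limit[where p = p, OF D(1) p]) (rule that)
    have F0: "(\<integral>y. indicator D y *\<^sub>R F j y \<partial>\<nu>) = 0" for j
      using LIMSEQ_unique[OF lim[OF cont[OF F]] LIMSEQ_subseq_LIMSEQ[OF lim0 r, unfolded o_def]] .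
    interpret \<nu>: prob_space \<nu> by (rule probability_onD(1)[OF \<nu>])
    note int = integrable_if_probability_on[OF \<nu> D(1) cont]
    have "(\<integral>y. indicator D y *\<^sub>R f y \<partial>\<nu>) = 0" if f: "f \<in> E" for f
    proof -
      have "\<bar>\<integral>y. indicator D y *\<^sub>R f y \<partial>\<nu>\<bar> \<le> 0 + e" if "e > 0" for e
      proof -
        obtain j where "\<And>y. y \<in> D \<Longrightarrow> \<bar>f y - F j y\<bar> \<le> e" using dense[OF f \<open>e > 0\<close>] by blast
        then have "\<bar>\<integral>y. indicator D y *\<^sub>R f y - indicator D y *\<^sub>R F j y \<partial>\<nu>\<bar> \<le> e"
          using probability_onD(3)[OF \<nu>] by (intro \<nu>.abs_integral_le_const) (auto elim: eventually_mono)
        then show ?thesis using F0[of j] int[OF f] int[OF F[of j]] by simp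
      qed
      then show ?thesis using field_le_epsilon by (metis abs_le_zero_iff)
    qed
    then show False using no_annihilator \<nu> by blast
  qed
qed

subsection \<open>Charts\<close>

locale manifold =
  fixes A :: "('m::t2_space, 'e::euclidean_space) chart set"
    and g :: "'m \<Rightarrow> ('m, 'e) tvec \<Rightarrow> ('m, 'e) tvec \<Rightarrow> real"
  assumes manifold: "closed_connected_riemannian_manifold A g"
begin

lemma atlas: "smooth_atlas A" and metric: "riemannian_metric A g"
  and compact_M: "compact (UNIV :: 'm set)" and connected_M: "connected (UNIV :: 'm set)"
  using manifold by (auto simp: closed_connected_riemannian_manifold_def)

lemma chart_ex: "\<exists>c\<in>A. x \<in> cdom c"
  using atlas by (auto simp: smooth_atlas_def)

lemma chart_at: "chart_at A x \<in> A" "x \<in> cdom (chart_at A x)"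
proof -
  have "\<exists>c. c \<in> A \<and> x \<in> cdom c" using chart_ex by blast
  from someI_ex[OF this] show "chart_at A x \<in> A" "x \<in> cdom (chart_at A x)"
    unfolding chart_at_def by blast+
qed

context
  fixes c assumes c: "c \<in> A"
begin

lemma open_cdom: "open (cdom c)" and open_cimage: "open (cimage c)"
  and chart_homeo: "homeomorphism (cdom c) (cimage c) (cmap c) (cinv c)"
  using atlas c by (auto simp: smooth_atlas_def)

lemma cinv_cmap: "x \<in> cdom c \<Longrightarrow> cinv c (cmap c x) = x"
  and cmap_cinv: "z \<in> cimage c \<Longrightarrow> cmap c (cinv c z) = z"
  and cinv_in: "z \<in> cimage c \<Longrightarrow> cinv c z \<in> cdom c"
  and cont_cmap: "continuous_on (cdom c) (cmap c)"
  and cont_cinv: "continuous_on (cimage c) (cinv c)"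
  using chart_homeo by (auto simp: homeomorphism_def)

lemma open_cinv_image:
  assumes "open S" "S \<subseteq> cimage c" shows "open (cinv c ` S)"
proof -
  have "cinv c ` S = cdom c \<inter> cmap c -` S"
    using assms(2) cinv_cmap cmap_cinv cinv_in by (force simp: image_iff)
  then show ?thesis
    using continuous_on_open_vimage[OF open_cdom, of "cmap c"] cont_cmap assms(1) by (simp add: Int_commute)
qed

lemma open_cinv_vimage: "open B \<Longrightarrow> open (cimage c \<inter> cinv c -` B)"
  using continuous_on_open_vimage[OF open_cimage, of "cinv c"] cont_cinv by (simp add: Int_commute[of "cimage c"])

lemma compact_cinv_image: "compact K \<Longrightarrow> K \<subseteq> cimage c \<Longrightarrow> compact (cinv c ` K)"
  using cont_cinv by (meson compact_continuous_image continuous_on_subset)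

lemma eventually_cinv:
  assumes "x \<in> cdom c" "\<forall>\<^sub>F y in nhds x. P y"
  shows "\<forall>\<^sub>F z in nhds (cmap c x). P (cinv c z)"
proof -
  obtain S where S: "open S" "x \<in> S" "\<And>y. y \<in> S \<Longrightarrow> P y"
    using assms(2) by (auto simp: eventually_nhds)
  have "open (cimage c \<inter> cinv c -` S)" using S(1) by (rule open_cinv_vimage)
  moreover have "cmap c x \<in> cimage c \<inter> cinv c -` S" using assms(1) S(2) by (simp add: cinv_cmap)
  ultimately show ?thesis unfolding eventually_nhds using S(3) by blast
qed

lemma eventually_cmap:
  assumes "x \<in> cdom c" "\<forall>\<^sub>F z in nhds (cmap c x). P z"
  shows "\<forall>\<^sub>F y in nhds x. y \<in> cdom c \<and> P (cmap c y)"
proof -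
  obtain S where S: "open S" "cmap c x \<in> S" "\<And>z. z \<in> S \<Longrightarrow> P z"
    using assms(2) by (auto simp: eventually_nhds)
  have "open (cinv c ` (S \<inter> cimage c))"
    using S(1) open_cimage by (intro open_cinv_image) auto
  moreover have "x \<in> cinv c ` (S \<inter> cimage c)"
    using S(2) assms(1) cinv_cmap by (metis IntI image_eqI)
  ultimately show ?thesis
    unfolding eventually_nhds using S(3) cmap_cinv cinv_in
    by (intro exI[of _ "cinv c ` (S \<inter> cimage c)"]) auto
qed

end

lemma transition:
  assumes "c \<in> A" "d \<in> A"
  shows "Ck_on 1 (cmap d \<circ> cinv c) (cmap c ` (cdom c \<inter> cdom d))"
    and "open (cmap c ` (cdom c \<inter> cdom d))"
proof -
  show "Ck_on 1 (cmap d \<circ> cinv c) (cmap c ` (cdom c \<inter> cdom d))"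
    using atlas assms unfolding smooth_atlas_def smooth_on_def by blast
  have "cmap c ` (cdom c \<inter> cdom d) = cimage c \<inter> cinv c -` cdom d"
    using cinv_cmap[OF assms(1)] cinv_in[OF assms(1)] cmap_cinv[OF assms(1)] by (force simp: image_iff)
  then show "open (cmap c ` (cdom c \<inter> cdom d))"
    using open_cinv_vimage[OF assms(1) open_cdom[OF assms(2)]] by simp
qed

abbreviation "transition_deriv c d x \<equiv> frechet_derivative (cmap d \<circ> cinv c) (at (cmap c x))"

lemma transition_derivative:
  assumes "c \<in> A" "d \<in> A" "x \<in> cdom c" "x \<in> cdom d"
  shows "(cmap d \<circ> cinv c has_derivative transition_deriv c d x) (at (cmap c x))"
proof -
  have "cmap c x \<in> cmap c ` (cdom c \<inter> cdom d)" using assms by auto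
  then have "cmap d \<circ> cinv c differentiable (at (cmap c x))"
    using transition(1)[OF assms(1,2)] by (auto simp: One_nat_def)
  then show ?thesis by (simp add: frechet_derivative_works)
qed

lemma linear_transition_deriv: "c \<in> A \<Longrightarrow> d \<in> A \<Longrightarrow> x \<in> cdom c \<Longrightarrow> x \<in> cdom d \<Longrightarrow> linear (transition_deriv c d x)"
  using transition_derivative has_derivative_linear by blast

lemma transition_deriv_self:
  assumes "c \<in> A" "x \<in> cdom c" shows "transition_deriv c c x w = w"
proof -
  have "((\<lambda>z. z) has_derivative (\<lambda>v. v)) (at (cmap c x))" by simp
  then have "(cmap c \<circ> cinv c has_derivative (\<lambda>v. v)) (at (cmap c x))"
    by (rule has_derivative_transform_within_open[OF _ open_cimage[OF assms(1)]])
      (use assms cmap_cinv in auto)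
  then show ?thesis using frechet_derivative_at by metis
qed

lemma has_derivative_change_chart:
  assumes "c \<in> A" "d \<in> A" "x \<in> cdom c" "x \<in> cdom d"
    and "(h \<circ> cinv d has_derivative h') (at (cmap d x))"
  shows "(h \<circ> cinv c has_derivative h' \<circ> transition_deriv c d x) (at (cmap c x))"
proof (rule has_derivative_transform_within_open[OF _ transition(2)[OF assms(1,2)]])
  have "(h \<circ> cinv d has_derivative h') (at ((cmap d \<circ> cinv c) (cmap c x)))"
    using assms by (simp add: cinv_cmap)
  from diff_chain_at[OF transition_derivative[OF assms(1-4)] this]
  show "((h \<circ> cinv d) \<circ> (cmap d \<circ> cinv c) has_derivative h' \<circ> transition_deriv c d x) (at (cmap c x))" .
qed (use assms in \<open>auto simp: cinv_cmap\<close>)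

lemma transition_deriv_comp:
  assumes "c \<in> A" "d \<in> A" "e \<in> A" "x \<in> cdom c" "x \<in> cdom d" "x \<in> cdom e"
  shows "transition_deriv d e x (transition_deriv c d x w) = transition_deriv c e x w"
  using frechet_derivative_at[OF has_derivative_change_chart[OF assms(1,2,4,5) transition_derivative[OF assms(2,3,5,6)]]]
  by (metis comp_apply)

subsection \<open>Tangent vectors and covectors in coordinates\<close>

lemma tvec_of_eq: "d \<in> A \<Longrightarrow> x \<in> cdom d \<Longrightarrow> tvec_of A c x w d = transition_deriv c d x w"
  and tvec_of_zero: "\<not> (d \<in> A \<and> x \<in> cdom d) \<Longrightarrow> tvec_of A c x w d = 0"
  unfolding tvec_of_def by simp_all argo+

lemma tangent_spaceD:
  assumes "v \<in> tangent_space A x"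
  shows "\<not> (c \<in> A \<and> x \<in> cdom c) \<Longrightarrow> v c = 0"
    and "c \<in> A \<Longrightarrow> d \<in> A \<Longrightarrow> x \<in> cdom c \<Longrightarrow> x \<in> cdom d \<Longrightarrow> v d = transition_deriv c d x (v c)"
  using assms unfolding tangent_space_def by blast+

lemma tangent_spaceI:
  assumes "\<And>c. \<not> (c \<in> A \<and> x \<in> cdom c) \<Longrightarrow> v c = 0"
    and "\<And>c d. c \<in> A \<Longrightarrow> d \<in> A \<Longrightarrow> x \<in> cdom c \<Longrightarrow> x \<in> cdom d \<Longrightarrow> v d = transition_deriv c d x (v c)"
  shows "v \<in> tangent_space A x"
  using assms unfolding tangent_space_def by blast

lemma tvec_of_self: "c \<in> A \<Longrightarrow> x \<in> cdom c \<Longrightarrow> tvec_of A c x w c = w"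
  by (simp add: tvec_of_eq transition_deriv_self)

lemma tvec_of_in: "c \<in> A \<Longrightarrow> x \<in> cdom c \<Longrightarrow> tvec_of A c x w \<in> tangent_space A x"
  by (rule tangent_spaceI, erule tvec_of_zero) (simp only: tvec_of_eq transition_deriv_comp)

lemma tvec_of_coords: "c \<in> A \<Longrightarrow> x \<in> cdom c \<Longrightarrow> v \<in> tangent_space A x \<Longrightarrow> tvec_of A c x (v c) = v"
proof (rule ext)
  fix d assume "c \<in> A" "x \<in> cdom c" "v \<in> tangent_space A x"
  then show "tvec_of A c x (v c) d = v d"
    by (metis tvec_of_zero tvec_of_eq tangent_spaceD)
qed

lemma tvec_of_linear:
  "c \<in> A \<Longrightarrow> x \<in> cdom c \<Longrightarrow> tvec_of A c x (a *\<^sub>R v + b *\<^sub>R w)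
    = (\<lambda>d. a *\<^sub>R tvec_of A c x v d + b *\<^sub>R tvec_of A c x w d)"
proof (rule ext)
  fix d assume c: "c \<in> A" "x \<in> cdom c"
  show "tvec_of A c x (a *\<^sub>R v + b *\<^sub>R w) d = a *\<^sub>R tvec_of A c x v d + b *\<^sub>R tvec_of A c x w d"
  proof (cases "d \<in> A \<and> x \<in> cdom d")
    case True
    then have "linear (transition_deriv c d x)" using c linear_transition_deriv by blast
    then show ?thesis using True by (simp add: tvec_of_eq linear_add linear_scale)
  next
    case False
    then show ?thesis using tvec_of_zero[OF False] by simp
  qed
qed

lemma tangent_space_add:
  assumes "v \<in> tangent_space A x" "u \<in> tangent_space A x"
  shows "(\<lambda>d. v d + u d) \<in> tangent_space A x"
proof (rule tangent_spaceI)
  fix c d assume cd: "c \<in> A" "d \<in> A" "x \<in> cdom c" "x \<in> cdom d"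
  show "v d + u d = transition_deriv c d x (v c + u c)"
    using tangent_spaceD(2)[OF assms(1) cd] tangent_spaceD(2)[OF assms(2) cd] linear_add[OF linear_transition_deriv[OF cd]] by simp
qed (use tangent_spaceD(1)[OF assms(1)] tangent_spaceD(1)[OF assms(2)] in force)

lemma zero_in_tangent_space: "(\<lambda>_. 0) \<in> tangent_space A x"
  by (rule tangent_spaceI) (simp_all add: linear_0 linear_transition_deriv)

lemma tvec_of_0: "c \<in> A \<Longrightarrow> x \<in> cdom c \<Longrightarrow> tvec_of A c x 0 = (\<lambda>_. 0)"
  using tvec_of_linear[of c x 0 0 0 0] by simp

lemma tangent_space_scale:
  assumes "v \<in> tangent_space A x"
  shows "(\<lambda>d. a *\<^sub>R v d) \<in> tangent_space A x"
proof (rule tangent_spaceI)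
  fix c d assume cd: "c \<in> A" "d \<in> A" "x \<in> cdom c" "x \<in> cdom d"
  show "a *\<^sub>R v d = transition_deriv c d x (a *\<^sub>R v c)"
    using tangent_spaceD(2)[OF assms(1) cd] linear_scale[OF linear_transition_deriv[OF cd]] by simp
qed (use tangent_spaceD(1)[OF assms] in force)

lemma metric_bilinear:
  assumes c: "c \<in> A" "x \<in> cdom c"
  shows "bilinear (\<lambda>v w. g x (tvec_of A c x v) (tvec_of A c x w))"
proof -
  let ?B = "\<lambda>v w. g x (tvec_of A c x v) (tvec_of A c x w)"
  have lin: "?B (a *\<^sub>R u + b *\<^sub>R v) w = a * ?B u w + b * ?B v w" for a b u v w
    using metric tvec_of_in[OF c] unfolding tvec_of_linear[OF c] riemannian_metric_def by blast
  have sym: "?B v w = ?B w v" for v w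
    using metric tvec_of_in[OF c] unfolding riemannian_metric_def by blast
  have "linear (\<lambda>v. ?B v w)" for w
    using lin[of 1 _ 1 _ w] lin[of _ _ 0 0 w] by (intro linearI) auto
  then show ?thesis unfolding bilinear_def using sym by (metis (no_types, lifting) ext)
qed

lemma covec_of_in: "c \<in> A \<Longrightarrow> x \<in> cdom c \<Longrightarrow> covec_of A c x w \<in> cotangent_space A x"
proof -
  assume c: "c \<in> A" "x \<in> cdom c"
  show ?thesis
    unfolding cotangent_space_def covec_of_def
    by (intro CollectI conjI allI ballI impI)
      (simp_all add: tangent_space_add tangent_space_scale inner_add_right)
qed

lemma covec_of_apply: "c \<in> A \<Longrightarrow> x \<in> cdom c \<Longrightarrow> covec_of A c x w (tvec_of A c x v) = w \<bullet> v"
  by (simp add: covec_of_def tvec_of_in tvec_of_self)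

lemma cotangent_space_eq:
  assumes c: "c \<in> A" "x \<in> cdom c"
  shows "cotangent_space A x = range (covec_of A c x)"
proof (intro equalityI subsetI)
  fix p assume p: "p \<in> cotangent_space A x"
  define q where "q v = p (tvec_of A c x v)" for v
  have "linear q"
  proof (rule linearI)
    fix v u :: 'e and a :: real
    show "q (v + u) = q v + q u"
      using p c tvec_of_linear[OF c, of 1 v 1 u] by (auto simp: q_def cotangent_space_def tvec_of_in)
    show "q (a *\<^sub>R v) = a *\<^sub>R q v"
      using p c tvec_of_linear[OF c, of a v 0 0] by (auto simp: q_def cotangent_space_def tvec_of_in)
  qed
  note inner_q = inner_riesz_vector[OF this]
  have "p = covec_of A c x (riesz_vector q)"
  proof
    fix v show "p v = covec_of A c x (riesz_vector q) v"
    proof (cases "v \<in> tangent_space A x")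
      case True
      then show ?thesis using inner_q[of "v c"] by (simp add: q_def covec_of_def tvec_of_coords[OF c])
    next
      case False
      then show ?thesis using p by (simp add: covec_of_def cotangent_space_def)
    qed
  qed
  then show "p \<in> range (covec_of A c x)" by blast
qed (use covec_of_in[OF c] in blast)

lemma topspace_cotangent_bundle: "topspace (cotangent_bundle A) = Sigma UNIV (cotangent_space A)"
proof -
  have "{(z, w). z \<in> cimage c \<and> (cinv c z, covec_of A c (cinv c z) w) \<in> Sigma UNIV (cotangent_space A)}
      = cimage c \<times> UNIV" if "c \<in> A" for c
    using that covec_of_in[OF that cinv_in[OF that]] by blast
  then have "openin (cotangent_bundle A) (Sigma UNIV (cotangent_space A))"
    by (subst openin_cotangent_bundle[OF atlas]) (auto intro: open_Times open_cimage)
  then show ?thesis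
    using openin_subset[of "cotangent_bundle A"] openin_cotangent_bundle[OF atlas, THEN iffD1, OF openin_topspace]
    by blast
qed

lemma topspace_tangent_bundle: "topspace (tangent_bundle A) = Sigma UNIV (tangent_space A)"
proof -
  have "{(z, w). z \<in> cimage c \<and> (cinv c z, tvec_of A c (cinv c z) w) \<in> Sigma UNIV (tangent_space A)}
      = cimage c \<times> UNIV" if "c \<in> A" for c
    using that tvec_of_in[OF that cinv_in[OF that]] by blast
  then have "openin (tangent_bundle A) (Sigma UNIV (tangent_space A))"
    by (subst openin_tangent_bundle[OF atlas]) (auto intro: open_Times open_cimage)
  then show ?thesis
    using openin_subset[of "tangent_bundle A"] openin_tangent_bundle[OF atlas, THEN iffD1, OF openin_topspace]
    by blast
qed

subsection \<open>Continuously differentiable functions and their differentials\<close>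

abbreviation "C1 \<equiv> C1_manifold A"

lemma C1_iff: "f \<in> C1 \<longleftrightarrow> (\<forall>c\<in>A. has_gradient_on (f \<circ> cinv c) (gradient (f \<circ> cinv c)) (cimage c))"
  by (simp add: C1_manifold_def Ck_on_1_iff_has_gradient_on del: One_nat_def)

lemma C1I: "(\<And>c. c \<in> A \<Longrightarrow> \<exists>D. has_gradient_on (f \<circ> cinv c) D (cimage c)) \<Longrightarrow> f \<in> C1"
  unfolding C1_iff using has_gradient_on_gradient(1) by blast

lemma C1D: "f \<in> C1 \<Longrightarrow> c \<in> A \<Longrightarrow> has_gradient_on (f \<circ> cinv c) (gradient (f \<circ> cinv c)) (cimage c)"
  by (simp add: C1_iff)

lemma C1_continuous: "f \<in> C1 \<Longrightarrow> continuous_on UNIV f"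
proof -
  assume f: "f \<in> C1"
  have "isCont f x" for x
  proof -
    obtain c where c: "c \<in> A" "x \<in> cdom c" using chart_ex by blast
    have "continuous_on (cdom c) (\<lambda>y. (f \<circ> cinv c) (cmap c y))"
      by (rule continuous_on_compose2[OF has_gradient_on_imp_continuous_on[OF C1D[OF f c(1)]] cont_cmap[OF c(1)]]) simp
    then have "continuous_on (cdom c) f"
      by (rule continuous_on_cong[THEN iffD1, OF refl, rotated]) (simp add: cinv_cmap c)
    then show ?thesis using open_cdom[OF c(1)] c(2) by (simp add: continuous_on_eq_continuous_at)
  qed
  then show ?thesis by (simp add: continuous_at_imp_continuous_on)
qed

abbreviation "chart_gradient f c x \<equiv> gradient (f \<circ> cinv c) (cmap c x)"

lemma C1_has_derivative:
  "f \<in> C1 \<Longrightarrow> c \<in> A \<Longrightarrow> x \<in> cdom c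
    \<Longrightarrow> (f \<circ> cinv c has_derivative (\<lambda>v. chart_gradient f c x \<bullet> v)) (at (cmap c x))"
  by (rule has_gradient_onD[OF C1D]) auto

lemma chart_gradient_change_chart:
  assumes f: "f \<in> C1" and c: "c \<in> A" "x \<in> cdom c" and d: "d \<in> A" "x \<in> cdom d"
  shows "chart_gradient f c x \<bullet> v = chart_gradient f d x \<bullet> transition_deriv c d x v"
  using has_derivative_unique[OF C1_has_derivative[OF f c]
      has_derivative_change_chart[OF c(1) d(1) c(2) d(2) C1_has_derivative[OF f d]]]
  by (metis comp_apply)

lemma differential_eq_covec_of:
  assumes f: "f \<in> C1" and c: "c \<in> A" "x \<in> cdom c"
  shows "differential A f x = covec_of A c x (chart_gradient f c x)"
proof
  fix v
  have "frechet_derivative (f \<circ> cinv (chart_at A x)) (at (cmap (chart_at A x) x)) w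
      = chart_gradient f (chart_at A x) x \<bullet> w" for w
    by (simp flip: frechet_derivative_at[OF C1_has_derivative[OF f chart_at]])
  moreover have "v (chart_at A x) = transition_deriv c (chart_at A x) x (v c)" if "v \<in> tangent_space A x"
    by (rule tangent_spaceD(2)[OF that c(1) chart_at(1) c(2) chart_at(2)])
  ultimately show "differential A f x v = covec_of A c x (chart_gradient f c x) v"
    by (simp add: differential_def Let_def covec_of_def chart_gradient_change_chart[OF f c chart_at])
qed

lemma differential_in: "f \<in> C1 \<Longrightarrow> differential A f x \<in> cotangent_space A x"
  using differential_eq_covec_of[OF _ chart_at] covec_of_in[OF chart_at] by simp

lemma differential_apply:
  "f \<in> C1 \<Longrightarrow> c \<in> A \<Longrightarrow> x \<in> cdom c \<Longrightarrow> v \<in> tangent_space A x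
    \<Longrightarrow> differential A f x v = chart_gradient f c x \<bullet> v c"
  by (simp add: differential_eq_covec_of covec_of_def)

lemma differential_zero: "f \<in> C1 \<Longrightarrow> differential A f x (\<lambda>_. 0) = 0"
  by (simp add: differential_apply[OF _ chart_at zero_in_tangent_space])

lemma differential_eqI:
  assumes "f \<in> C1" "c \<in> A" "x \<in> cdom c" "(f \<circ> cinv c has_derivative (\<lambda>v. d \<bullet> v)) (at (cmap c x))"
  shows "differential A f x = covec_of A c x d"
  using differential_eq_covec_of[OF assms(1-3)] gradient_eqI[OF assms(4)] by simp

lemma C1_const: "(\<lambda>_. a) \<in> C1"
  by (rule C1I) (auto simp: o_def intro: has_gradient_on_const)

lemma C1_add: "f \<in> C1 \<Longrightarrow> h \<in> C1 \<Longrightarrow> (\<lambda>x. f x + h x) \<in> C1"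
  by (rule C1I) (use has_gradient_on_add[OF C1D C1D, of f _ h] in \<open>auto simp: o_def\<close>)

lemma C1_mult: "f \<in> C1 \<Longrightarrow> h \<in> C1 \<Longrightarrow> (\<lambda>x. f x * h x) \<in> C1"
  by (rule C1I) (use has_gradient_on_mult[OF C1D C1D, of f _ h] in \<open>auto simp: o_def\<close>)

lemma C1_cmult: "f \<in> C1 \<Longrightarrow> (\<lambda>x. a * f x) \<in> C1"
  by (rule C1_mult[OF C1_const])

lemma C1_sum: "finite I \<Longrightarrow> (\<And>i. i \<in> I \<Longrightarrow> f i \<in> C1) \<Longrightarrow> (\<lambda>x. \<Sum>i\<in>I. f i x) \<in> C1"
  by (induction I rule: finite_induct) (auto intro: C1_const C1_add)

lemma C1_compose_real:
  fixes \<theta> \<theta>' :: "real \<Rightarrow> real"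
  assumes "f \<in> C1" "\<And>x. (\<theta> has_real_derivative \<theta>' (f x)) (at (f x))" "continuous_on (range f) \<theta>'"
  shows "(\<lambda>x. \<theta> (f x)) \<in> C1"
proof (rule C1I)
  fix c assume c: "c \<in> A"
  have "has_gradient_on (\<lambda>x. \<theta> ((f \<circ> cinv c) x)) (\<lambda>x. \<theta>' ((f \<circ> cinv c) x) *\<^sub>R gradient (f \<circ> cinv c) x) (cimage c)"
    using assms by (intro has_gradient_on_compose_real C1D c) (auto intro: continuous_on_subset)
  then show "\<exists>D. has_gradient_on ((\<lambda>x. \<theta> (f x)) \<circ> cinv c) D (cimage c)" by (auto simp: o_def)
qed

context
  fixes v :: "('m, 'e) tvec" and x :: 'm assumes v: "v \<in> tangent_space A x"
begin

lemma differential_const: "differential A (\<lambda>_. a) x v = 0"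
proof -
  have "gradient ((\<lambda>_. a) \<circ> cinv (chart_at A x)) (cmap (chart_at A x) x) = 0"
    by (rule gradient_eqI) (simp add: o_def)
  then show ?thesis by (simp add: differential_apply[OF C1_const chart_at v])
qed

lemma differential_add:
  assumes "f \<in> C1" "h \<in> C1"
  shows "differential A (\<lambda>x. f x + h x) x v = differential A f x v + differential A h x v"
proof -
  have "gradient ((\<lambda>x. f x + h x) \<circ> cinv (chart_at A x)) (cmap (chart_at A x) x)
      = chart_gradient f (chart_at A x) x + chart_gradient h (chart_at A x) x"
    using has_derivative_add[OF C1_has_derivative[OF assms(1) chart_at] C1_has_derivative[OF assms(2) chart_at]]
    by (intro gradient_eqI) (simp add: o_def inner_add_left)
  then show ?thesis
    by (simp add: differential_apply[OF C1_add chart_at v] differential_apply[OF _ chart_at v] assms inner_add_left)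
qed

lemma differential_mult:
  assumes "f \<in> C1" "h \<in> C1"
  shows "differential A (\<lambda>x. f x * h x) x v = f x * differential A h x v + h x * differential A f x v"
proof -
  let ?c = "chart_at A x"
  have "((\<lambda>x. f x * h x) \<circ> cinv ?c has_derivative
      (\<lambda>v. (f x *\<^sub>R chart_gradient h ?c x + h x *\<^sub>R chart_gradient f ?c x) \<bullet> v)) (at (cmap ?c x))"
    using has_derivative_mult[OF C1_has_derivative[OF assms(1) chart_at] C1_has_derivative[OF assms(2) chart_at]] chart_at
    by (simp add: o_def inner_add_left cinv_cmap algebra_simps)
  from gradient_eqI[OF this] show ?thesis
    by (simp add: differential_apply[OF C1_mult chart_at v] differential_apply[OF _ chart_at v] assms inner_add_left)
qed

lemma differential_cmult: "f \<in> C1 \<Longrightarrow> differential A (\<lambda>x. a * f x) x v = a * differential A f x v"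
  using differential_mult[OF C1_const[of a]] differential_const[of a] by simp

lemma differential_sum:
  "finite I \<Longrightarrow> (\<And>i. i \<in> I \<Longrightarrow> f i \<in> C1)
    \<Longrightarrow> differential A (\<lambda>x. \<Sum>i\<in>I. f i x) x v = (\<Sum>i\<in>I. differential A (f i) x v)"
proof (induction I rule: finite_induct)
  case (insert i I)
  then show ?case using differential_add[of "f i" "\<lambda>x. \<Sum>i\<in>I. f i x"] by (simp add: C1_sum)
qed (simp add: differential_const)

lemma differential_compose_real:
  fixes \<theta> \<theta>' :: "real \<Rightarrow> real"
  assumes f: "f \<in> C1" "\<And>x. (\<theta> has_real_derivative \<theta>' (f x)) (at (f x))" "continuous_on (range f) \<theta>'"
  shows "differential A (\<lambda>x. \<theta> (f x)) x v = \<theta>' (f x) * differential A f x v"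
proof -
  let ?c = "chart_at A x"
  have "(\<theta> has_derivative (\<lambda>h. \<theta>' (f x) * h)) (at ((f \<circ> cinv ?c) (cmap ?c x)))"
    using assms(2)[of x] chart_at by (simp add: has_field_derivative_def cinv_cmap)
  from diff_chain_at[OF C1_has_derivative[OF f(1) chart_at] this]
  have "((\<lambda>x. \<theta> (f x)) \<circ> cinv ?c has_derivative (\<lambda>v. (\<theta>' (f x) *\<^sub>R chart_gradient f ?c x) \<bullet> v)) (at (cmap ?c x))"
    by (simp add: o_def)
  from gradient_eqI[OF this] show ?thesis
    by (simp add: differential_apply[OF C1_compose_real[OF f] chart_at v] differential_apply[OF _ chart_at v] f)
qed

end

lemma differential_eq_if_touching:
  assumes f: "f \<in> C1" "k \<in> C1" and touch: "\<forall>\<^sub>F y in nhds x. f y - k y \<le> f x - k x"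
  shows "differential A f x = differential A k x"
proof
  fix v
  show "differential A f x v = differential A k x v"
  proof (cases "v \<in> tangent_space A x")
    case True
    define q where "q y = f y + (- 1) * k y" for y
    have q: "q \<in> C1" unfolding q_def by (intro C1_add C1_cmult f)
    let ?c = "chart_at A x"
    have "\<forall>\<^sub>F z in nhds (cmap ?c x). f (cinv ?c z) - k (cinv ?c z) \<le> f x - k x"
      by (rule eventually_cinv[OF chart_at touch])
    then obtain T where T: "open T" "cmap ?c x \<in> T" "\<And>z. z \<in> T \<Longrightarrow> f (cinv ?c z) - k (cinv ?c z) \<le> f x - k x"
      unfolding eventually_nhds by blast
    have "(\<lambda>v. chart_gradient q ?c x \<bullet> v) = (\<lambda>v. 0)"
    proof (rule differential_zero_maxmin[OF T(2,1) C1_has_derivative[OF q chart_at]])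
      show "(\<forall>y\<in>T. (q \<circ> cinv ?c) y \<le> (q \<circ> cinv ?c) (cmap ?c x)) \<or> (\<forall>y\<in>T. (q \<circ> cinv ?c) (cmap ?c x) \<le> (q \<circ> cinv ?c) y)"
        using T(3) by (simp add: q_def cinv_cmap[OF chart_at])
    qed
    then have "differential A q x v = 0" using differential_apply[OF q chart_at True] by metis
    then show ?thesis
      unfolding q_def differential_add[OF True f(1) C1_cmult[OF f(2)]] differential_cmult[OF True f(2)] by simp
  qed (simp add: differential_def)
qed

definition chart_extension :: "('m, 'e) chart \<Rightarrow> ('e \<Rightarrow> real) \<Rightarrow> 'm \<Rightarrow> real" where
  "chart_extension c F x = (if x \<in> cdom c then F (cmap c x) else 0)"

lemma has_gradient_on_chart_extension:
  assumes c: "c \<in> A" and d: "d \<in> A" and "open S" "S \<subseteq> cimage c" and F: "has_gradient_on F D S"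
    and U: "U = cimage d \<inter> cinv d -` (cinv c ` S)"
  shows "\<exists>E. has_gradient_on (chart_extension c F \<circ> cinv d) E U"
proof -
  have "open U"
    unfolding U by (intro open_cinv_vimage[OF d] open_cinv_image[OF c] assms)
  have in_U: "cinv d y \<in> cdom c" "cinv d y \<in> cdom d" "cmap c (cinv d y) \<in> S" "y \<in> cimage d" if "y \<in> U" for y
    using that assms(4) cinv_in[OF c] cmap_cinv[OF c] cinv_in[OF d] by (auto simp: U subset_iff)
  have "y \<in> cmap d ` (cdom d \<inter> cdom c)" if "y \<in> U" for y
    using in_U[OF that] cmap_cinv[OF d] by (intro image_eqI[of y _ "cinv d y"]) auto
  then have "Ck_on 1 (cmap c \<circ> cinv d) U"
    using transition(1)[OF d c] by (auto simp: Ck_on_1_iff intro: continuous_on_subset)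
  then obtain E where "has_gradient_on (F \<circ> (cmap c \<circ> cinv d)) E U"
    using has_gradient_on_compose_Ck_on_1[OF _ F, of "cmap c \<circ> cinv d" U] in_U(3) by auto
  then have "has_gradient_on (chart_extension c F \<circ> cinv d) E U"
    by (rule has_gradient_on_cong[OF _ \<open>open U\<close>]) (use in_U in \<open>auto simp: chart_extension_def\<close>)
  then show ?thesis by blast
qed

lemma chart_extension_C1:
  assumes c: "c \<in> A" and K: "compact K" "K \<subseteq> S" "open S" "S \<subseteq> cimage c"
    and F: "has_gradient_on F D S" "\<And>z. z \<notin> K \<Longrightarrow> F z = 0"
  shows "chart_extension c F \<in> C1"
proof (rule C1I)
  fix d assume d: "d \<in> A"
  let ?f = "chart_extension c F \<circ> cinv d"
  have "\<exists>U D. open U \<and> z \<in> U \<and> has_gradient_on ?f D U" if z: "z \<in> cimage d" for z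
  proof (cases "cinv d z \<in> cinv c ` S")
    case True
    then show ?thesis
      using has_gradient_on_chart_extension[OF c d K(3,4) F(1) refl] z
        open_cinv_vimage[OF d open_cinv_image[OF c K(3,4)]] by blast
  next
    case False
    define U where "U = cimage d \<inter> cinv d -` (- cinv c ` K)"
    have "closed (cinv c ` K)"
      using compact_cinv_image[OF c K(1)] K by (intro compact_imp_closed) auto
    then have "open U"
      unfolding U_def by (intro open_cinv_vimage[OF d]) (simp add: open_Compl)
    have "?f y = 0" if "y \<in> U" for y
      using that cinv_cmap[OF c, of "cinv d y"] F(2)[of "cmap c (cinv d y)"]
      by (cases "cinv d y \<in> cdom c") (force simp: U_def chart_extension_def)+
    then have "has_gradient_on ?f (\<lambda>_. 0) U"
      by (intro has_gradient_on_cong[OF has_gradient_on_const[of 0] \<open>open U\<close>]) auto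
    moreover have "z \<in> U" using False z K(2) by (auto simp: U_def)
    ultimately show ?thesis using \<open>open U\<close> by blast
  qed
  then show "\<exists>D. has_gradient_on ?f D (cimage d)" using has_gradient_on_local by blast
qed

lemma local_function_extends:
  assumes c: "c \<in> A" and z: "cball z s \<subseteq> cimage c" and F: "has_gradient_on F D (ball z s)" and r: "0 < r" "r < s"
  obtains f where "f \<in> C1" "\<And>y. y \<in> cball z r \<Longrightarrow> f (cinv c y) = F y"
    "\<And>y. y \<in> ball z r \<Longrightarrow> differential A f (cinv c y) = covec_of A c (cinv c y) (D y)"
proof -
  define t where "t = (r + s) / 2"
  have t: "r < t" "t < s" using r by (auto simp: t_def)
  obtain E where E: "has_gradient_on (bump z r t) E (ball z s)" using has_gradient_on_bump by blast
  define H where "H y = bump z r t y * F y" for y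
  define f where "f = chart_extension c H"
  have f: "f \<in> C1"
    unfolding f_def
  proof (rule chart_extension_C1[OF c])
    show "compact (cball z t)" by simp
    show "cball z t \<subseteq> ball z s" using t by auto
    show "ball z s \<subseteq> cimage c" using z by (meson ball_subset_cball subset_trans)
    show "has_gradient_on H (\<lambda>y. bump z r t y *\<^sub>R D y + F y *\<^sub>R E y) (ball z s)"
      unfolding H_def by (rule has_gradient_on_mult[OF E F])
    show "H y = 0" if "y \<notin> cball z t" for y
      using that bump_eq_0[of r t z y] r t by (simp add: H_def)
  qed simp
  have cin: "y \<in> cimage c" if "y \<in> cball z r" for y using that z t by (auto simp: subset_iff)
  have eq: "f (cinv c y) = F y" if y: "y \<in> cball z r" for y
    using cin[OF y] cinv_in[OF c] cmap_cinv[OF c] bump_eq_1[of r t z y] y r t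
    by (simp add: f_def chart_extension_def H_def)
  show thesis
  proof (rule that[OF f])
    fix y assume y: "y \<in> ball z r"
    have "(F has_derivative (\<lambda>v. D y \<bullet> v)) (at y)" using F y r by (auto simp: has_gradient_on_def)
    then have "(f \<circ> cinv c has_derivative (\<lambda>v. D y \<bullet> v)) (at y)"
      by (rule has_derivative_transform_within_open[OF _ open_ball y]) (simp add: eq)
    moreover have "cmap c (cinv c y) = y" "cinv c y \<in> cdom c"
      using cin[of y] y cmap_cinv[OF c] cinv_in[OF c] by auto
    ultimately show "differential A f (cinv c y) = covec_of A c (cinv c y) (D y)"
      by (intro differential_eqI[OF f c]) auto
  qed (rule eq)
qed

lemma chart_ball_ex:
  obtains c s where "c \<in> A" "x \<in> cdom c" "s > 0" "cball (cmap c x) s \<subseteq> cimage c"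
proof -
  obtain c where c: "c \<in> A" "x \<in> cdom c" using chart_ex by blast
  then obtain s where "s > 0" "cball (cmap c x) s \<subseteq> cimage c"
    using open_cimage[OF c(1)] by (meson imageI open_contains_cball)
  then show thesis using that c by blast
qed

end

subsection \<open>Continuous families of convex superlinear functions\<close>

definition legendre :: "('a::real_inner \<Rightarrow> real) \<Rightarrow> 'a \<Rightarrow> real" where
  "legendre f v = (SUP w. w \<bullet> v - f w)"

lemma inner_le_norm_bound: "norm v \<le> R \<Longrightarrow> w \<bullet> v \<le> R * norm w"
  by (metis mult.commute mult_left_mono norm_cauchy_schwarz norm_ge_zero order_trans)

lemma inner_scaleR_inverse_norm: "w \<noteq> 0 \<Longrightarrow> w \<bullet> (w /\<^sub>R norm w) = norm w"
  by (simp add: power2_eq_square flip: power2_norm_eq_inner)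

lemma convex_on_UNIV_grows_if_grows_on_sphere:
  fixes f :: "'a::real_normed_vector \<Rightarrow> real"
  assumes "convex_on UNIV f" and sphere: "\<And>w. norm w = \<rho> \<Longrightarrow> f w - f 0 \<ge> k * \<rho>" and "0 < \<rho>" "\<rho> \<le> norm w"
  shows "f w - f 0 \<ge> k * norm w"
proof -
  define t where "t = \<rho> / norm w"
  have w: "norm w > 0" using assms(3,4) by linarith
  then have t: "0 < t" "t \<le> 1" "norm (t *\<^sub>R w) = \<rho>" using assms(3,4) by (auto simp: t_def)
  have "f ((1 - t) *\<^sub>R 0 + t *\<^sub>R w) \<le> (1 - t) * f 0 + t * f w"
    using t by (intro convex_onD[OF assms(1)]) auto
  then have "k * \<rho> \<le> t * (f w - f 0)" using sphere[OF t(3)] by (simp add: algebra_simps)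
  moreover have "\<rho> = t * norm w" using w by (simp add: t_def)
  ultimately have "t * (k * norm w) \<le> t * (f w - f 0)" by (simp add: mult.left_commute)
  then show ?thesis using t(1) by (simp add: mult_le_cancel_left)
qed

locale convex_superlinear_family =
  fixes U :: "'a::heine_borel set" and H :: "'a \<Rightarrow> 'b::euclidean_space \<Rightarrow> real"
  assumes open_base: "open U"
    and H_continuous: "continuous_on (U \<times> UNIV) (\<lambda>(z, w). H z w)"
    and H_convex: "\<And>z. z \<in> U \<Longrightarrow> convex_on UNIV (H z)"
    and H_superlinear: "\<And>z K. z \<in> U \<Longrightarrow> K \<ge> 0 \<Longrightarrow> \<exists>R. \<forall>w. norm w > R \<longrightarrow> H z w \<ge> K * norm w"
begin

lemma H_bounded:
  assumes K: "compact K" "K \<subseteq> U"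
  shows "\<exists>B>0. \<forall>z\<in>K. \<forall>w. norm w \<le> \<rho> \<longrightarrow> \<bar>H z w\<bar> \<le> B"
proof -
  have cont: "continuous_on (K \<times> cball 0 \<rho>) (\<lambda>(z, w). H z w)"
    by (rule continuous_on_subset[OF H_continuous]) (use K in auto)
  have "compact (K \<times> cball (0::'b) \<rho>)" by (intro compact_Times compact_cball K)
  then obtain B where "B > 0" "\<forall>z\<in>K. \<forall>w\<in>cball 0 \<rho>. \<bar>H z w\<bar> \<le> B"
    using compact_imp_bounded[OF compact_continuous_image[OF cont]] by (auto simp: bounded_pos)
  then show ?thesis by auto
qed

lemma H_uniform:
  assumes K: "compact K" "K \<subseteq> U" and "e > 0"
  shows "\<exists>d>0. \<forall>z\<in>K. \<forall>z'\<in>K. \<forall>w. norm w \<le> \<rho> \<longrightarrow> dist z z' < d \<longrightarrow> \<bar>H z w - H z' w\<bar> < e"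
proof -
  have "continuous_on (K \<times> cball 0 \<rho>) (\<lambda>(z, w). H z w)"
    by (rule continuous_on_subset[OF H_continuous]) (use K in auto)
  then have "uniformly_continuous_on (K \<times> cball 0 \<rho>) (\<lambda>(z, w). H z w)"
    by (intro compact_uniformly_continuous compact_Times compact_cball K)
  then obtain d where "d > 0"
    "\<forall>p\<in>K \<times> cball 0 \<rho>. \<forall>q\<in>K \<times> cball 0 \<rho>. dist q p < d \<longrightarrow> dist (case q of (z, w) \<Rightarrow> H z w) (case p of (z, w) \<Rightarrow> H z w) < e"
    unfolding uniformly_continuous_on_def using \<open>e > 0\<close> by blast
  then show ?thesis by (intro exI[of _ d]) (auto simp: dist_Pair_Pair dist_real_def)
qed

lemma H_superlinear_near:
  assumes z0: "z0 \<in> U" and "k \<ge> 0"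
  shows "\<exists>\<delta>>0. \<exists>C. \<forall>z\<in>cball z0 \<delta>. \<forall>w. H z w \<ge> k * norm w - C"
proof -
  define K where "K = k + 1 + \<bar>H z0 0\<bar>"
  obtain R where R: "\<And>w. norm w > R \<Longrightarrow> H z0 w \<ge> K * norm w"
    using H_superlinear[OF z0, of K] \<open>k \<ge> 0\<close> by (auto simp: K_def)
  define \<rho> where "\<rho> = max R 0 + 1"
  have \<rho>: "\<rho> > R" "\<rho> \<ge> 1" by (auto simp: \<rho>_def)
  obtain s where s: "s > 0" "cball z0 s \<subseteq> U" using open_base z0 by (meson open_contains_cball)
  obtain d where d: "d > 0" "\<And>z w. z \<in> cball z0 s \<Longrightarrow> norm w \<le> \<rho> \<Longrightarrow> dist z z0 < d \<Longrightarrow> \<bar>H z w - H z0 w\<bar> < 1 / 2"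
    using H_uniform[OF compact_cball s(2), of "1 / 2" \<rho>] s(1) by (metis centre_in_cball half_gt_zero less_imp_le zero_less_one)
  obtain B where B: "\<And>z w. z \<in> cball z0 s \<Longrightarrow> norm w \<le> \<rho> \<Longrightarrow> \<bar>H z w\<bar> \<le> B"
    using H_bounded[OF compact_cball s(2)] by blast
  have "H z w \<ge> k * norm w - (B + k * \<rho>)" if "z \<in> cball z0 (min s (d / 2))" for z w
  proof -
    have z: "z \<in> cball z0 s" "z \<in> U" "dist z z0 < d" using that s d(1) by (auto simp: dist_commute)
    have on_sphere: "H z u - H z 0 \<ge> k * \<rho>" if u: "norm u = \<rho>" for u
    proof -
      have "H z0 u \<ge> k * \<rho> + \<rho> + \<bar>H z0 0\<bar> * \<rho>" using R[of u] u \<rho> by (simp add: K_def algebra_simps)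
      moreover have "\<bar>H z0 0\<bar> * \<rho> \<ge> \<bar>H z0 0\<bar>" using \<rho>(2) by (simp add: mult_le_cancel_left1)
      moreover have "\<bar>H z u - H z0 u\<bar> < 1 / 2" "\<bar>H z 0 - H z0 0\<bar> < 1 / 2"
        using d(2)[OF z(1) _ z(3)] u \<rho>(2) by auto
      ultimately show ?thesis using \<rho>(2) by linarith
    qed
    have "k * norm w - k * \<rho> \<le> 0" if "norm w \<le> \<rho>" using mult_left_mono[OF that \<open>k \<ge> 0\<close>] by simp
    moreover have "k * \<rho> \<ge> 0" using \<open>k \<ge> 0\<close> \<rho> by simp
    ultimately show ?thesis
      using B[OF z(1), of w] B[OF z(1), of 0] \<rho>(2)
        convex_on_UNIV_grows_if_grows_on_sphere[OF H_convex[OF z(2)] on_sphere, of w]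
      by (cases "norm w \<le> \<rho>") auto
  qed
  then show ?thesis using s(1) d(1) by (intro exI[of _ "min s (d / 2)"] conjI exI[of _ "B + k * \<rho>"]) auto
qed

lemma H_superlinear_compact:
  assumes K: "compact K" "K \<subseteq> U" and "k \<ge> 0"
  shows "\<exists>C. \<forall>z\<in>K. \<forall>w. H z w \<ge> k * norm w - C"
proof -
  have "\<forall>z0\<in>K. \<exists>\<delta>>0. \<exists>C. \<forall>z\<in>cball z0 \<delta>. \<forall>w. H z w \<ge> k * norm w - C"
    using H_superlinear_near[OF _ \<open>k \<ge> 0\<close>] K(2) by blast
  then obtain \<delta> C where \<delta>: "\<And>z0. z0 \<in> K \<Longrightarrow> \<delta> z0 > 0"
    "\<And>z0 z w. z0 \<in> K \<Longrightarrow> z \<in> cball z0 (\<delta> z0) \<Longrightarrow> H z w \<ge> k * norm w - C z0" by metis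
  obtain T where T: "T \<subseteq> K" "finite T" "K \<subseteq> (\<Union>z0\<in>T. ball z0 (\<delta> z0))"
    by (rule compactE_image[OF K(1), of K "\<lambda>z0. ball z0 (\<delta> z0)"]) (use \<delta>(1) in force)+
  have "H z w \<ge> k * norm w - (\<Sum>z0\<in>T. \<bar>C z0\<bar>)" if z: "z \<in> K" for z w
  proof -
    obtain z0 where z0: "z0 \<in> T" "z \<in> ball z0 (\<delta> z0)" using T(3) z by blast
    then have "H z w \<ge> k * norm w - C z0" using \<delta>(2) T(1) by auto
    moreover have "C z0 \<le> (\<Sum>z0\<in>T. \<bar>C z0\<bar>)"
      using member_le_sum[of z0 T "\<lambda>z. \<bar>C z\<bar>"] z0(1) T(2) by simp
    ultimately show ?thesis by linarith
  qed
  then show ?thesis by blast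
qed

lemma inner_le_legendre:
  assumes "z \<in> U"
  shows "w \<bullet> v \<le> legendre (H z) v + H z w"
proof -
  obtain C where "\<And>w. H z w \<ge> norm v * norm w - C"
    using H_superlinear_compact[of "{z}" "norm v"] assms by auto
  then have "bdd_above (range (\<lambda>w. w \<bullet> v - H z w))"
    using inner_le_norm_bound[of v "norm v"] by (intro bdd_aboveI2[of _ _ C]) (smt (verit) order_refl)
  from cSUP_upper[OF UNIV_I this, of w] show ?thesis by (simp add: legendre_def)
qed

lemma legendre_le: "(\<And>w. w \<bullet> v - H z w \<le> a) \<Longrightarrow> legendre (H z) v \<le> a"
  by (simp add: legendre_def cSUP_least)

lemma legendre_bounded_above:
  assumes K: "compact K" "K \<subseteq> U"
  shows "\<exists>B. \<forall>z\<in>K. \<forall>v. norm v \<le> R \<longrightarrow> legendre (H z) v \<le> B"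
proof -
  obtain C where "\<And>z w. z \<in> K \<Longrightarrow> H z w \<ge> \<bar>R\<bar> * norm w - C"
    using H_superlinear_compact[OF K, of "\<bar>R\<bar>"] by auto
  then have "legendre (H z) v \<le> C" if "z \<in> K" "norm v \<le> R" for z v
    using that inner_le_norm_bound[of v "\<bar>R\<bar>"] by (intro legendre_le) (smt (verit))
  then show ?thesis by blast
qed

lemma legendre_uniform:
  assumes K: "compact K" "K \<subseteq> U" and "e > 0"
  shows "\<exists>\<delta>>0. \<forall>z\<in>K. \<forall>z'\<in>K. \<forall>v v'. norm v \<le> R \<longrightarrow> norm v' \<le> R \<longrightarrow> dist z z' < \<delta> \<longrightarrow> dist v v' < \<delta>
    \<longrightarrow> legendre (H z) v \<le> legendre (H z') v' + e"
proof -
  obtain C where C: "\<And>z w. z \<in> K \<Longrightarrow> H z w \<ge> (\<bar>R\<bar> + 1) * norm w - C"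
    using H_superlinear_compact[OF K, of "\<bar>R\<bar> + 1"] by auto
  obtain B where B: "\<And>z. z \<in> K \<Longrightarrow> \<bar>H z 0\<bar> \<le> B"
    using H_bounded[OF K, of 0] by (metis norm_zero order_refl)
  define \<rho> where "\<rho> = max 1 (C + B)"
  then have "\<rho> > 0" by simp
  obtain d where d: "d > 0"
    "\<And>z z' w. z \<in> K \<Longrightarrow> z' \<in> K \<Longrightarrow> norm w \<le> \<rho> \<Longrightarrow> dist z z' < d \<Longrightarrow> \<bar>H z w - H z' w\<bar> < e / 2"
    using H_uniform[OF K, of "e / 2" \<rho>] \<open>e > 0\<close> by auto
  have "legendre (H z) v \<le> legendre (H z') v' + e"
    if z: "z \<in> K" "z' \<in> K" "dist z z' < d" and v: "norm v \<le> R" "norm (v - v') \<le> e / (2 * \<rho>)" for z z' v v'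
  proof (rule legendre_le)
    fix w
    have z': "z' \<in> U" using z K by auto
    show "w \<bullet> v - H z w \<le> legendre (H z') v' + e"
    proof (cases "norm w \<le> \<rho>")
      case True
      have "w \<bullet> v - w \<bullet> v' \<le> e / (2 * \<rho>) * norm w"
        using inner_le_norm_bound[OF v(2), of w] by (simp add: inner_diff_right)
      also have "\<dots> \<le> e / (2 * \<rho>) * \<rho>" using True \<open>e > 0\<close> \<open>\<rho> > 0\<close> by (intro mult_left_mono) auto
      finally have "w \<bullet> v - w \<bullet> v' \<le> e / 2" using \<open>\<rho> > 0\<close> by simp
      then show ?thesis using inner_le_legendre[OF z', of w v'] d(2)[OF z(1,2) True z(3)] by linarith
    next
      case False
      have "w \<bullet> v - H z w \<le> C - norm w"
        using C[OF z(1), of w] inner_le_norm_bound[OF order_trans[OF v(1) abs_ge_self], of w] by (simp add: algebra_simps)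
      also have "\<dots> \<le> - B" using False by (simp add: \<rho>_def)
      also have "\<dots> \<le> legendre (H z') v'" using B[OF z(2)] inner_le_legendre[OF z', of 0 v'] by auto
      finally show ?thesis using \<open>e > 0\<close> by simp
    qed
  qed
  then show ?thesis
    using d(1) \<open>e > 0\<close> \<open>\<rho> > 0\<close> by (intro exI[of _ "min d (e / (2 * \<rho>))"]) (simp add: dist_norm)
qed

lemma legendre_continuous: "continuous_on (U \<times> UNIV) (\<lambda>(z, v). legendre (H z) v)"
proof (rule continuous_at_imp_continuous_on, rule ballI)
  fix p assume "p \<in> U \<times> (UNIV :: 'b set)"
  then obtain z0 v0 where p: "p = (z0, v0)" "z0 \<in> U" by auto
  from p(2) obtain s where s: "s > 0" "cball z0 s \<subseteq> U" using open_base by (meson open_contains_cball)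
  define V where "V = ball (0::'b) (norm v0 + 1)"
  have "continuous_on (ball z0 s \<times> V) (\<lambda>(z, v). legendre (H z) v)"
    unfolding continuous_on_iff
  proof (intro ballI allI impI)
    fix p e assume p: "p \<in> ball z0 s \<times> V" and "e > (0::real)"
    obtain \<delta> where \<delta>: "\<delta> > 0" "\<And>z z' v v'. z \<in> cball z0 s \<Longrightarrow> z' \<in> cball z0 s \<Longrightarrow> norm v \<le> norm v0 + 1 \<Longrightarrow> norm v' \<le> norm v0 + 1
      \<Longrightarrow> dist z z' < \<delta> \<Longrightarrow> dist v v' < \<delta> \<Longrightarrow> legendre (H z) v \<le> legendre (H z') v' + e / 2"
      using legendre_uniform[OF compact_cball s(2) half_gt_zero[OF \<open>e > 0\<close>], of "norm v0 + 1"] by blast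
    have "dist (legendre (H z) v) (legendre (H (fst p)) (snd p)) < e"
      if q: "z \<in> ball z0 s" "v \<in> V" "dist (z, v) p < \<delta>" for z v
    proof -
      have "dist z (fst p) < \<delta>" "dist v (snd p) < \<delta>"
        using q(3) dist_fst_le[of "(z, v)" p] dist_snd_le[of "(z, v)" p] by auto
      then have "legendre (H z) v \<le> legendre (H (fst p)) (snd p) + e / 2"
        "legendre (H (fst p)) (snd p) \<le> legendre (H z) v + e / 2"
        using p q by (auto intro!: \<delta>(2) simp: dist_commute V_def)
      then show ?thesis using \<open>e > 0\<close> by (auto simp: dist_real_def)
    qed
    then show "\<exists>d>0. \<forall>q\<in>ball z0 s \<times> V. dist q p < d
        \<longrightarrow> dist (case q of (z, v) \<Rightarrow> legendre (H z) v) (case p of (z, v) \<Rightarrow> legendre (H z) v) < e"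
      using \<delta>(1) by (intro exI[of _ \<delta>]) (auto simp: case_prod_beta)
  qed
  then show "isCont (\<lambda>(z, v). legendre (H z) v) p"
    using s(1) by (simp add: continuous_on_eq_continuous_at open_Times p(1) V_def)
qed

lemma Fenchel_attained:
  assumes z: "z \<in> U"
  obtains v where "legendre (H z) v + H z w = w \<bullet> v" "\<And>q. H z q \<ge> H z w + v \<bullet> (q - w)"
proof -
  obtain v where v: "\<And>q. H z q \<ge> H z w + v \<bullet> (q - w)"
    using convex_on_UNIV_imp_subgradient[OF H_convex[OF z]] by blast
  have "q \<bullet> v - H z q \<le> w \<bullet> v - H z w" for q
    using v[of q] by (simp add: inner_diff_right inner_commute)
  then have "legendre (H z) v \<le> w \<bullet> v - H z w" by (rule legendre_le)
  then have "legendre (H z) v + H z w = w \<bullet> v" using inner_le_legendre[OF z, of w v] by simp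
  then show thesis using that v by blast
qed

lemma H_le_iff: "z \<in> U \<Longrightarrow> H z w \<le> a \<longleftrightarrow> (\<forall>v. w \<bullet> v \<le> legendre (H z) v + a)"
  using inner_le_legendre[of z w] Fenchel_attained[of z w] by (smt (verit))

text \<open>
  It suffices to test velocities in a bounded set: those of norm at most \<open>1\<close> bound \<open>w\<close>, and then the
  subgradients at \<open>w\<close> are bounded.
\<close>

lemma H_le_if_bounded_velocities:
  assumes K: "compact K" "K \<subseteq> U"
  shows "\<exists>R>0. \<forall>b\<le>a. \<forall>z\<in>K. \<forall>w. (\<forall>v. norm v \<le> R \<longrightarrow> w \<bullet> v \<le> legendre (H z) v + b) \<longrightarrow> H z w \<le> b"
proof -
  obtain B where B: "\<And>z v. z \<in> K \<Longrightarrow> norm v \<le> 1 \<Longrightarrow> legendre (H z) v \<le> B"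
    using legendre_bounded_above[OF K] by blast
  obtain B' where B': "B' > 0" "\<And>z w. z \<in> K \<Longrightarrow> norm w \<le> max 0 (B + a) + 1 \<Longrightarrow> \<bar>H z w\<bar> \<le> B'"
    using H_bounded[OF K] by blast
  have "H z w \<le> b" if "b \<le> a" and z: "z \<in> K"
    and test: "\<And>v. norm v \<le> max 1 (2 * B') \<Longrightarrow> w \<bullet> v \<le> legendre (H z) v + b" for z w b
  proof -
    have zU: "z \<in> U" using z K by auto
    have w: "norm w \<le> max 0 (B + a)"
    proof (cases "w = 0")
      case False
      then have "norm (w /\<^sub>R norm w) = 1" by simp
      then have "w \<bullet> (w /\<^sub>R norm w) \<le> legendre (H z) (w /\<^sub>R norm w) + b" "legendre (H z) (w /\<^sub>R norm w) \<le> B"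
        by (metis test max.cobounded1, metis B[OF z] order_refl)
      then show ?thesis using \<open>b \<le> a\<close> unfolding inner_scaleR_inverse_norm[OF False] by linarith
    qed simp
    obtain v where v: "legendre (H z) v + H z w = w \<bullet> v" "\<And>q. H z q \<ge> H z w + v \<bullet> (q - w)"
      using Fenchel_attained[OF zU] by blast
    have "norm v \<le> 2 * B'"
    proof (cases "v = 0")
      case False
      let ?q = "w + v /\<^sub>R norm v"
      have "norm ?q \<le> max 0 (B + a) + 1" using w False norm_triangle_ineq[of w "v /\<^sub>R norm v"] by simp
      then have "\<bar>H z ?q\<bar> \<le> B'" "\<bar>H z w\<bar> \<le> B'" using w by (auto intro: B'(2)[OF z])
      then show ?thesis using v(2)[of ?q] inner_scaleR_inverse_norm[OF False] by (simp add: abs_le_iff)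
    qed (use B' in simp)
    from test[OF max.coboundedI2[OF this]] show ?thesis using v(1) by linarith
  qed
  then show ?thesis by (intro exI[of _ "max 1 (2 * B')"]) auto
qed

end

lemma positively_homogeneous_bounds:
  fixes N :: "'a::euclidean_space \<Rightarrow> real"
  assumes "continuous_on UNIV N" and hom: "\<And>t v. t \<ge> 0 \<Longrightarrow> N (t *\<^sub>R v) = t * N v" and pos: "\<And>v. v \<noteq> 0 \<Longrightarrow> N v > 0"
  shows "\<exists>a>0. \<exists>b>0. \<forall>v. a * norm v \<le> N v \<and> N v \<le> b * norm v"
proof -
  have cont: "continuous_on (sphere 0 1) N" by (rule continuous_on_subset[OF assms(1)]) simp
  obtain v0 where v0: "v0 \<in> sphere 0 1" "\<And>v. v \<in> sphere 0 1 \<Longrightarrow> N v0 \<le> N v"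
    using continuous_attains_inf[OF compact_sphere _ cont] by auto
  obtain v1 where v1: "v1 \<in> sphere 0 1" "\<And>v. v \<in> sphere 0 1 \<Longrightarrow> N v \<le> N v1"
    using continuous_attains_sup[OF compact_sphere _ cont] by auto
  have "N v0 * norm v \<le> N v \<and> N v \<le> N v1 * norm v" for v
  proof (cases "v = 0")
    case True
    then show ?thesis using hom[of 0 v] by simp
  next
    case False
    then have "N v = norm v * N (v /\<^sub>R norm v)" using hom[of "norm v" "v /\<^sub>R norm v"] by simp
    then show ?thesis
      using False v0(2)[of "v /\<^sub>R norm v"] v1(2)[of "v /\<^sub>R norm v"] by (simp add: mult.commute mult_right_mono)
  qed
  moreover have "v0 \<noteq> 0" "v1 \<noteq> 0" using v0(1) v1(1) by auto
  ultimately show ?thesis using pos by blast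
qed

subsection \<open>Hamiltonian and Lagrangian in coordinates\<close>

locale hamiltonian = manifold A g
  for A :: "('m::t2_space, 'e::euclidean_space) chart set"
    and g :: "'m \<Rightarrow> ('m, 'e) tvec \<Rightarrow> ('m, 'e) tvec \<Rightarrow> real" +
  fixes G :: "'m \<Rightarrow> ('m, 'e) covec \<Rightarrow> real"
  assumes G_continuous: "continuous_hamiltonian A G"
    and G_convex: "convex_hamiltonian A G"
    and G_superlinear: "superlinear_hamiltonian A g G"
begin

abbreviation "L \<equiv> lagrangian A G"

definition G_loc :: "('m, 'e) chart \<Rightarrow> 'e \<Rightarrow> 'e \<Rightarrow> real" where
  "G_loc c z w = G (cinv c z) (covec_of A c (cinv c z) w)"

abbreviation "L_loc c z \<equiv> legendre (G_loc c z)"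

lemma G_differential: "f \<in> C1 \<Longrightarrow> c \<in> A \<Longrightarrow> x \<in> cdom c \<Longrightarrow> G x (differential A f x) = G_loc c (cmap c x) (chart_gradient f c x)"
  by (simp add: G_loc_def differential_eq_covec_of cinv_cmap)

lemma G_loc_continuous:
  assumes c: "c \<in> A" shows "continuous_on (cimage c \<times> UNIV) (\<lambda>(z, w). G_loc c z w)"
  unfolding continuous_on_open_vimage[OF open_Times[OF open_cimage[OF c] open_UNIV]]
proof (intro allI impI)
  fix B :: "real set" assume "open B"
  then have "openin (cotangent_bundle A) {p \<in> topspace (cotangent_bundle A). (case p of (x, p) \<Rightarrow> G x p) \<in> B}"
    using G_continuous unfolding continuous_hamiltonian_def continuous_map by simp
  then have "open {(z, w). z \<in> cimage c \<and> (cinv c z, covec_of A c (cinv c z) w)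
      \<in> {p \<in> topspace (cotangent_bundle A). (case p of (x, p) \<Rightarrow> G x p) \<in> B}}"
    using openin_cotangent_bundle[OF atlas] c by blast
  also have "{(z, w). z \<in> cimage c \<and> (cinv c z, covec_of A c (cinv c z) w)
      \<in> {p \<in> topspace (cotangent_bundle A). (case p of (x, p) \<Rightarrow> G x p) \<in> B}}
      = (\<lambda>(z, w). G_loc c z w) -` B \<inter> cimage c \<times> UNIV"
    using covec_of_in[OF c cinv_in[OF c]] by (auto simp: topspace_cotangent_bundle G_loc_def)
  finally show "open ((\<lambda>(z, w). G_loc c z w) -` B \<inter> cimage c \<times> UNIV)" .
qed

lemma G_loc_continuous_compose:
  assumes "c \<in> A" "continuous_on S f" "continuous_on S h" "f ` S \<subseteq> cimage c"
  shows "continuous_on S (\<lambda>x. G_loc c (f x) (h x))"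
  using continuous_on_compose2[OF G_loc_continuous[OF assms(1)] continuous_on_Pair[OF assms(2,3)]] assms(4)
  by auto

lemma G_loc_convex:
  assumes c: "c \<in> A" "z \<in> cimage c" shows "convex_on UNIV (G_loc c z)"
proof (rule convex_onI)
  fix t :: real and x y :: 'e assume t: "0 < t" "t < 1"
  have eq: "covec_of A c (cinv c z) ((1 - t) *\<^sub>R x + t *\<^sub>R y)
      = (\<lambda>v. (1 - t) * covec_of A c (cinv c z) x v + t * covec_of A c (cinv c z) y v)"
    by (rule ext) (simp add: covec_of_def inner_add_left)
  show "G_loc c z ((1 - t) *\<^sub>R x + t *\<^sub>R y) \<le> (1 - t) * G_loc c z x + t * G_loc c z y"
    unfolding G_loc_def eq using G_convex t covec_of_in[OF c(1) cinv_in[OF c]]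
    unfolding convex_hamiltonian_def by simp
qed simp

lemma tnorm_bounds:
  assumes c: "c \<in> A" "x \<in> cdom c"
  shows "\<exists>a>0. \<exists>b>0. \<forall>v. a * norm v \<le> tnorm g x (tvec_of A c x v) \<and> tnorm g x (tvec_of A c x v) \<le> b * norm v"
proof (rule positively_homogeneous_bounds)
  define B where "B v w = g x (tvec_of A c x v) (tvec_of A c x w)" for v w
  have bilinear: "bilinear B" unfolding B_def by (rule metric_bilinear[OF c])
  have tnorm: "tnorm g x (tvec_of A c x v) = sqrt (B v v)" for v by (simp add: tnorm_def B_def)
  show "continuous_on UNIV (\<lambda>v. tnorm g x (tvec_of A c x v))"
    unfolding tnorm by (intro continuous_on_real_sqrt continuous_on_id
        bounded_bilinear.continuous_on[OF bilinear_conv_bounded_bilinear[THEN iffD1, OF bilinear]])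
  show "tnorm g x (tvec_of A c x (t *\<^sub>R v)) = t * tnorm g x (tvec_of A c x v)" if "t \<ge> 0" for t v
    using that by (simp add: tnorm bilinear_lmul[OF bilinear] bilinear_rmul[OF bilinear] real_sqrt_mult flip: mult.assoc)
  fix v :: 'e assume "v \<noteq> 0"
  then have "tvec_of A c x v \<noteq> (\<lambda>_. 0)" using tvec_of_self[OF c, of v] by metis
  then show "tnorm g x (tvec_of A c x v) > 0"
    using metric tvec_of_in[OF c] unfolding tnorm_def riemannian_metric_def by simp
qed

lemma norm_le_conorm:
  assumes c: "c \<in> A" "x \<in> cdom c"
  shows "\<exists>b>0. \<forall>w. norm w \<le> b * conorm A g x (covec_of A c x w)"
proof -
  obtain a b where ab: "a > 0" "b > 0" "\<And>v. a * norm v \<le> tnorm g x (tvec_of A c x v)"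
    "\<And>v. tnorm g x (tvec_of A c x v) \<le> b * norm v"
    using tnorm_bounds[OF c] by blast
  have "norm w \<le> b * conorm A g x (covec_of A c x w)" for w
  proof -
    define v where "v = inverse b *\<^sub>R (w /\<^sub>R norm w)"
    have "norm v \<le> 1 / b" using ab(2) by (cases "w = 0") (simp_all add: v_def divide_inverse)
    then have "b * norm v \<le> 1" using ab(2) by (simp add: field_simps)
    then have "tnorm g x (tvec_of A c x v) \<le> 1" using ab(4)[of v] by linarith
    moreover have "norm w = b * covec_of A c x w (tvec_of A c x v)"
      using ab(2) by (cases "w = 0") (simp_all add: covec_of_apply[OF c] v_def power2_eq_square flip: power2_norm_eq_inner)
    moreover have "bdd_above (covec_of A c x w ` {v \<in> tangent_space A x. tnorm g x v \<le> 1})"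
    proof (rule bdd_aboveI2)
      fix v assume v: "v \<in> {v \<in> tangent_space A x. tnorm g x v \<le> 1}"
      then have "a * norm (v c) \<le> 1" using ab(3)[of "v c"] tvec_of_coords[OF c, of v] by simp
      then have "norm (v c) \<le> 1 / a" using ab(1) by (simp add: field_simps)
      then show "covec_of A c x w v \<le> 1 / a * norm w" using v inner_le_norm_bound[of "v c" "1 / a"] by (simp add: covec_of_def)
    qed
    ultimately show ?thesis
      unfolding conorm_def using tvec_of_in[OF c, of v] ab(2) by (auto intro!: mult_left_mono cSUP_upper)
  qed
  then show ?thesis using ab(2) by blast
qed

lemma G_loc_superlinear:
  assumes c: "c \<in> A" "z \<in> cimage c" and "K \<ge> 0"
  shows "\<exists>R. \<forall>w. norm w > R \<longrightarrow> G_loc c z w \<ge> K * norm w"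
proof -
  define x where "x = cinv c z"
  have x: "x \<in> cdom c" using cinv_in[OF c] by (simp add: x_def)
  obtain b where b: "b > 0" "\<And>w. norm w \<le> b * conorm A g x (covec_of A c x w)"
    using norm_le_conorm[OF c(1) x] by blast
  obtain R where R: "\<And>p. p \<in> cotangent_space A x \<Longrightarrow> conorm A g x p > R \<Longrightarrow> G x p / conorm A g x p \<ge> K * b"
    using G_superlinear unfolding superlinear_hamiltonian_def by blast
  have "G_loc c z w \<ge> K * norm w" if w: "norm w > b * max R 0" for w
  proof -
    define N where "N = conorm A g x (covec_of A c x w)"
    have "b * max R 0 < b * N" using w b(2)[of w] by (simp add: N_def)
    then have N: "N > R" "N > 0" using b(1) by auto
    then have "G_loc c z w \<ge> K * b * N"
      using R[OF covec_of_in[OF c(1) x], of w] by (simp add: N_def G_loc_def x_def pos_le_divide_eq)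
    moreover have "K * norm w \<le> K * (b * N)" using b(2)[of w] \<open>K \<ge> 0\<close> by (intro mult_left_mono) (auto simp: N_def)
    ultimately show ?thesis by (simp add: mult.assoc)
  qed
  then show ?thesis by blast
qed

lemma convex_superlinear_family_G_loc: "c \<in> A \<Longrightarrow> convex_superlinear_family (cimage c) (G_loc c)"
  by unfold_locales (auto intro: open_cimage G_loc_continuous G_loc_convex G_loc_superlinear)

context
  fixes c assumes c: "c \<in> A"
begin

interpretation convex_superlinear_family "cimage c" "G_loc c"
  by (rule convex_superlinear_family_G_loc[OF c])

lemmas inner_le_L_loc = inner_le_legendre
  and L_loc_bounded_above = legendre_bounded_above
  and L_loc_uniform = legendre_uniform
  and L_loc_continuous = legendre_continuous
  and G_loc_le_iff = H_le_iff
  and G_loc_le_if_bounded_velocities = H_le_if_bounded_velocities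

lemma L_loc_continuous_compose:
  assumes "continuous_on S f" "continuous_on S h" "f ` S \<subseteq> cimage c"
  shows "continuous_on S (\<lambda>x. L_loc c (f x) (h x))"
  using continuous_on_compose2[OF L_loc_continuous continuous_on_Pair[OF assms(1,2)]] assms(3) by auto

end

lemma L_tvec_of:
  assumes c: "c \<in> A" "x \<in> cdom c"
  shows "L x (tvec_of A c x v) = L_loc c (cmap c x) v"
  unfolding lagrangian_def legendre_def cotangent_space_eq[OF c] image_image
  by (simp add: covec_of_apply[OF c] G_loc_def cinv_cmap[OF c])

lemma L_eq_L_loc: "c \<in> A \<Longrightarrow> x \<in> cdom c \<Longrightarrow> v \<in> tangent_space A x \<Longrightarrow> L x v = L_loc c (cmap c x) (v c)"
  using L_tvec_of[of c x "v c"] by (simp add: tvec_of_coords)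

lemma G_le_iff:
  assumes f: "f \<in> C1"
  shows "G x (differential A f x) \<le> a \<longleftrightarrow> (\<forall>v\<in>tangent_space A x. differential A f x v \<le> L x v + a)"
proof -
  obtain c where c: "c \<in> A" "x \<in> cdom c" using chart_ex by blast
  then have z: "cmap c x \<in> cimage c" by auto
  have "(\<forall>v. chart_gradient f c x \<bullet> v \<le> L_loc c (cmap c x) v + a) \<longleftrightarrow> (\<forall>v\<in>tangent_space A x. differential A f x v \<le> L x v + a)"
    using tvec_of_in[OF c] tvec_of_self[OF c] by (metis differential_apply[OF f c] L_eq_L_loc[OF c])
  then show ?thesis by (simp add: G_differential[OF f c] G_loc_le_iff[OF c(1) z])
qed

lemma differential_le_L: "f \<in> C1 \<Longrightarrow> v \<in> tangent_space A x \<Longrightarrow> differential A f x v \<le> L x v + G x (differential A f x)"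
  using G_le_iff by blast

lemma G_differential_continuous:
  assumes f: "f \<in> C1" shows "continuous_on UNIV (\<lambda>x. G x (differential A f x))"
proof (rule continuous_at_imp_continuous_on, rule ballI)
  fix x
  obtain c where c: "c \<in> A" "x \<in> cdom c" using chart_ex by blast
  have "continuous_on (cdom c) (\<lambda>y. G_loc c (cmap c y) (chart_gradient f c y))"
  proof (rule G_loc_continuous_compose[OF c(1) cont_cmap[OF c(1)]])
    have "continuous_on (cimage c) (gradient (f \<circ> cinv c))" using C1D[OF f c(1)] by (simp add: has_gradient_on_def)
    then show "continuous_on (cdom c) (\<lambda>y. chart_gradient f c y)"
      by (rule continuous_on_compose2[OF _ cont_cmap[OF c(1)]]) auto
  qed auto
  then have "continuous_on (cdom c) (\<lambda>x. G x (differential A f x))"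
    by (rule continuous_on_cong[THEN iffD1, OF refl, rotated]) (simp add: G_differential[OF f c(1)])
  then show "isCont (\<lambda>x. G x (differential A f x)) x"
    using open_cdom[OF c(1)] c(2) by (simp add: continuous_on_eq_continuous_at)
qed

lemma continuous_bounded:
  assumes "continuous_on UNIV (f :: 'm \<Rightarrow> real)"
  obtains B where "B > 0" "\<And>x. \<bar>f x\<bar> \<le> B"
  using compact_imp_bounded[OF compact_continuous_image[OF assms compact_M]] by (auto simp: bounded_pos)

lemma positive_outside_open:
  assumes V: "open V" and f: "continuous_on UNIV (f :: 'm \<Rightarrow> real)" and pos: "\<And>x. x \<notin> V \<Longrightarrow> f x > 0"
  obtains \<eta> where "\<eta> > 0" "\<And>x. x \<notin> V \<Longrightarrow> \<eta> \<le> f x"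
proof (cases "- V = {}")
  case True
  then show thesis using that[of 1] by auto
next
  case False
  have "compact (- V)" using V compact_Int_closed[OF compact_M, of "- V"] by (simp add: closed_def)
  then obtain y where "y \<in> - V" "\<And>x. x \<in> - V \<Longrightarrow> f y \<le> f x"
    using continuous_attains_inf[OF _ False continuous_on_subset[OF f]] by blast
  then show thesis using that[of "f y"] pos by simp
qed

end

subsection \<open>Viscosity subsolutions along segments\<close>

definition viscosity_subsolution ::
  "('m::topological_space, 'e::euclidean_space) chart set \<Rightarrow> ('m \<Rightarrow> ('m, 'e) covec \<Rightarrow> real)
    \<Rightarrow> real \<Rightarrow> ('m \<Rightarrow> real) \<Rightarrow> bool" where
  "viscosity_subsolution A G a u \<longleftrightarrow> continuous_on UNIV u \<and>
     (\<forall>f\<in>C1_manifold A. \<forall>x.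
        (\<forall>\<^sub>F y in nhds x. u y - f y \<le> u x - f x) \<longrightarrow> G x (differential A f x) \<le> a)"

lemma viscosity_subsolution_continuous: "viscosity_subsolution A G a u \<Longrightarrow> continuous_on UNIV u"
  by (simp add: viscosity_subsolution_def)

context hamiltonian
begin

abbreviation "subsolution \<equiv> viscosity_subsolution A G"

lemma subsolution_in_chart:
  assumes u: "subsolution a u" and c: "c \<in> A" and F: "open S" "S \<subseteq> cimage c" "z \<in> S" "has_gradient_on F D S"
    and max: "\<forall>\<^sub>F y in nhds z. u (cinv c y) - F y \<le> u (cinv c z) - F z"
  shows "G_loc c z (D z) \<le> a"
proof -
  obtain s where s: "s > 0" "cball z s \<subseteq> S" using F(1,3) by (meson open_contains_cball)
  have sc: "cball z s \<subseteq> cimage c" using s F by blast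
  have "has_gradient_on F D (ball z s)" by (rule has_gradient_on_subset[OF F(4)]) (use s in auto)
  then obtain f where f: "f \<in> C1" "\<And>y. y \<in> cball z (s / 2) \<Longrightarrow> f (cinv c y) = F y"
    "\<And>y. y \<in> ball z (s / 2) \<Longrightarrow> differential A f (cinv c y) = covec_of A c (cinv c y) (D y)"
    using local_function_extends[OF c sc, of F D "s / 2"] s(1) by auto
  define x where "x = cinv c z"
  have x: "x \<in> cdom c" "cmap c x = z"
    using F(2,3) cinv_in[OF c] cmap_cinv[OF c] by (auto simp: x_def)
  have "\<forall>\<^sub>F y in nhds (cmap c x). y \<in> ball z (s / 2) \<and> u (cinv c y) - F y \<le> u (cinv c z) - F z"
    unfolding x(2) using s(1) by (intro eventually_conj[OF eventually_nhds_in_open max]) auto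
  from eventually_cmap[OF c x(1) this]
  have "\<forall>\<^sub>F y in nhds x. u y - f y \<le> u x - f x"
  proof eventually_elim
    case (elim y)
    then show ?case
      using f(2)[of "cmap c y"] f(2)[of z] s(1) cinv_cmap[OF c, of y] by (simp add: x_def)
  qed
  then have "G x (differential A f x) \<le> a" using u f(1) by (simp add: viscosity_subsolution_def)
  then show ?thesis using f(3)[of z] s(1) by (simp add: x_def G_loc_def)
qed

lemma subsolution_segment:
  assumes u: "subsolution a u" and c: "c \<in> A" and B: "open B" "B \<subseteq> cimage c" "closed_segment z (z + r *\<^sub>R v) \<subseteq> B"
    and "r > 0" and k: "\<And>y. y \<in> B \<Longrightarrow> L_loc c y v + a \<le> k"
  shows "u (cinv c (z + r *\<^sub>R v)) - u (cinv c z) \<le> r * k"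
proof (rule ccontr)
  assume "\<not> ?thesis"
  then have slope: "u (cinv c (z + r *\<^sub>R v)) - u (cinv c z) > r * k" by simp
  have cont: "continuous_on B (\<lambda>y. u (cinv c y))"
    by (rule continuous_on_compose2[OF viscosity_subsolution_continuous[OF u] continuous_on_subset[OF cont_cinv[OF c] B(2)]]) simp
  obtain p N y where y: "y \<in> B" "k < (2 * N) *\<^sub>R (y - p) \<bullet> v"
    and max: "\<forall>\<^sub>F y' in nhds y. u (cinv c y') - N * ((y' - p) \<bullet> (y' - p)) \<le> u (cinv c y) - N * ((y - p) \<bullet> (y - p))"
    by (rule viscosity_mean_value[OF B(1,3) cont \<open>r > 0\<close> slope])
  have "G_loc c y (N *\<^sub>R (2 *\<^sub>R (y - p))) \<le> a"
    by (rule subsolution_in_chart[OF u c B(1,2) y(1) has_gradient_on_cmult[OF has_gradient_on_inner_self] max])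
  moreover have "N *\<^sub>R (2 *\<^sub>R (y - p)) \<bullet> v \<le> L_loc c y v + G_loc c y (N *\<^sub>R (2 *\<^sub>R (y - p)))"
    using inner_le_L_loc[OF c] B(2) y(1) by blast
  ultimately show False using k[OF y(1)] y(2) by (simp add: mult.commute)
qed

subsection \<open>Smooth approximation of viscosity subsolutions\<close>

lemma gradient_mollify_le:
  assumes w: "subsolution a w" and c: "c \<in> A" and B: "ball y \<rho> \<subseteq> cimage c" and "0 < e" "e < \<rho>"
    and W: "continuous_on UNIV W" "\<And>y'. y' \<in> ball y \<rho> \<Longrightarrow> W y' = w (cinv c y')"
    and k: "\<And>y'. y' \<in> ball y \<rho> \<Longrightarrow> L_loc c y' v + a \<le> k"
  shows "gradient (mollify e W) y \<bullet> v \<le> k"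
proof (rule inner_derivative_le_if_increments_le)
  show "(mollify e W has_derivative (\<lambda>h. gradient (mollify e W) y \<bullet> h)) (at y)"
    using has_gradient_onD[OF has_gradient_on_mollify[OF \<open>0 < e\<close> W(1), of UNIV]] by simp
  have "((\<lambda>t. norm (t *\<^sub>R v)) \<longlongrightarrow> norm (0 *\<^sub>R v)) (at_right 0)" by (intro tendsto_intros)
  then have "\<forall>\<^sub>F t in at_right 0. norm (t *\<^sub>R v) < \<rho> - e"
    using \<open>e < \<rho>\<close> by (intro order_tendstoD(2)[of _ "norm (0 *\<^sub>R v)"]) auto
  then show "\<forall>\<^sub>F t in at_right 0. mollify e W (y + t *\<^sub>R v) - mollify e W y \<le> t * k"
    using eventually_at_right_less[of 0]
  proof eventually_elim
    case (elim t)
    have "W (y + t *\<^sub>R v - \<zeta>) \<le> W (y - \<zeta>) + t * k" if \<zeta>: "norm \<zeta> \<le> e" for \<zeta>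
    proof -
      have "y - \<zeta> \<in> ball y \<rho>" "y - \<zeta> + t *\<^sub>R v \<in> ball y \<rho>"
        using \<zeta> elim(1) \<open>e < \<rho>\<close> norm_triangle_ineq4[of \<zeta> "t *\<^sub>R v"] by (auto simp: dist_norm algebra_simps)
      moreover from this have "closed_segment (y - \<zeta>) (y - \<zeta> + t *\<^sub>R v) \<subseteq> ball y \<rho>"
        by (simp add: closed_segment_subset)
      ultimately show ?thesis
        using subsolution_segment[OF w c open_ball B _ elim(2) k, of "y - \<zeta>"] W(2) by (auto simp: algebra_simps)
    qed
    from mollify_le[OF \<open>0 < e\<close> W(1) W(1) this] show ?case by simp
  qed
qed

lemma smooth_approximation_local:
  assumes w: "subsolution a w" and c: "c \<in> A" and r: "r > 0" "cball z0 (3 * r) \<subseteq> cimage c" and "\<eta> > 0"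
  obtains f where "f \<in> C1" "\<And>y. y \<in> cball z0 r \<Longrightarrow> \<bar>f (cinv c y) - w (cinv c y)\<bar> \<le> \<eta>"
    "\<And>y. y \<in> cball z0 r \<Longrightarrow> G (cinv c y) (differential A f (cinv c y)) \<le> a + \<eta>"
proof -
  define K where "K = cball z0 (3 * r)"
  have K: "compact K" "K \<subseteq> cimage c" using r by (auto simp: K_def)
  obtain R where R: "\<And>z p. z \<in> K \<Longrightarrow> (\<And>v. norm v \<le> R \<Longrightarrow> p \<bullet> v \<le> L_loc c z v + (a + \<eta>)) \<Longrightarrow> G_loc c z p \<le> a + \<eta>"
    using G_loc_le_if_bounded_velocities[OF c K, of "a + \<eta>"] by blast
  obtain \<delta> where \<delta>: "\<delta> > 0" "\<And>z z' v. z \<in> K \<Longrightarrow> z' \<in> K \<Longrightarrow> norm v \<le> R \<Longrightarrow> dist z z' < \<delta> \<Longrightarrow> L_loc c z v \<le> L_loc c z' v + \<eta>"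
    using L_loc_uniform[OF c K \<open>\<eta> > 0\<close>, of R] by (metis dist_self)
  have "continuous_on K (\<lambda>y. w (cinv c y))"
    by (rule continuous_on_compose2[OF viscosity_subsolution_continuous[OF w] continuous_on_subset[OF cont_cinv[OF c] K(2)]]) simp
  then obtain W where W: "continuous_on UNIV W" "\<And>y. y \<in> K \<Longrightarrow> W y = w (cinv c y)"
    using Tietze_unbounded[of K "\<lambda>y. w (cinv c y)" UNIV] by (auto simp: K_def)
  obtain \<delta>' where \<delta>': "\<delta>' > 0" "\<And>y y'. y \<in> K \<Longrightarrow> y' \<in> K \<Longrightarrow> dist y' y < \<delta>' \<Longrightarrow> \<bar>W y' - W y\<bar> < \<eta>"
    using compact_uniformly_continuous[OF continuous_on_subset[OF W(1)] K(1)] \<open>\<eta> > 0\<close>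
    unfolding uniformly_continuous_on_def dist_real_def by (metis subset_UNIV)
  define \<rho> where "\<rho> = min \<delta> r"
  define e where "e = min (\<rho> / 2) (\<delta>' / 2)"
  have e: "e > 0" "e < \<rho>" "e < \<delta>'" "\<rho> \<le> \<delta>" "\<rho> \<le> r" using \<delta> \<delta>' r by (auto simp: \<rho>_def e_def)
  have near: "y' \<in> K" if "y \<in> cball z0 r" "dist y y' \<le> \<rho>" for y y'
    using that e(5) r dist_triangle[of z0 y' y] by (auto simp: K_def)
  define F where "F = mollify e W"
  have F: "has_gradient_on F (gradient F) S" for S unfolding F_def by (rule has_gradient_on_mollify[OF e(1) W(1)])
  obtain f where f: "f \<in> C1" "\<And>y. y \<in> cball z0 (2 * r) \<Longrightarrow> f (cinv c y) = F y"
    "\<And>y. y \<in> ball z0 (2 * r) \<Longrightarrow> differential A f (cinv c y) = covec_of A c (cinv c y) (gradient F y)"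
    using local_function_extends[OF c r(2) F, of "2 * r"] r(1) by auto
  show thesis
  proof (rule that[OF f(1)])
    fix y assume y: "y \<in> cball z0 r"
    have yK: "y \<in> K" using near[OF y, of y] e by simp
    have "\<bar>W (y - \<zeta>) - w (cinv c y)\<bar> \<le> \<eta>" if "norm \<zeta> \<le> e" for \<zeta>
      using \<delta>'(2)[OF yK near[OF y], of "y - \<zeta>"] that e W(2)[OF yK] by (simp add: dist_norm)
    from abs_mollify_diff_le[OF e(1) W(1) this]
    show "\<bar>f (cinv c y) - w (cinv c y)\<bar> \<le> \<eta>" using f(2)[of y] y r by (simp add: F_def)
    have "G_loc c y (gradient F y) \<le> a + \<eta>"
    proof (rule R[OF yK])
      fix v :: 'e assume v: "norm v \<le> R"
      show "gradient F y \<bullet> v \<le> L_loc c y v + (a + \<eta>)"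
        unfolding F_def
      proof (rule gradient_mollify_le[OF w c _ e(1,2) W(1)])
        show "ball y \<rho> \<subseteq> cimage c" using near[OF y] K(2) by auto
        show "W y' = w (cinv c y')" if "y' \<in> ball y \<rho>" for y' using that near[OF y, of y'] W(2) by simp
        show "L_loc c y' v + a \<le> L_loc c y v + (a + \<eta>)" if "y' \<in> ball y \<rho>" for y'
          using that \<delta>(2)[OF near[OF y] yK v, of y'] e(4) by (simp add: dist_commute)
      qed
    qed
    then show "G (cinv c y) (differential A f (cinv c y)) \<le> a + \<eta>" using f(3)[of y] y r by (simp add: G_loc_def)
  qed
qed

definition chart_radius :: "'m \<Rightarrow> real" where
  "chart_radius x = (SOME r. r > 0 \<and> cball (cmap (chart_at A x) x) (3 * r) \<subseteq> cimage (chart_at A x))"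

definition chart_ball :: "real \<Rightarrow> 'm \<Rightarrow> 'm set" where
  "chart_ball t x = cinv (chart_at A x) ` cball (cmap (chart_at A x) x) (t * chart_radius x)"

lemma chart_radius: "chart_radius x > 0" "cball (cmap (chart_at A x) x) (3 * chart_radius x) \<subseteq> cimage (chart_at A x)"
proof -
  obtain s where "s > 0" "cball (cmap (chart_at A x) x) s \<subseteq> cimage (chart_at A x)"
    using open_cimage[OF chart_at(1)] chart_at(2) by (meson imageI open_contains_cball)
  then have "\<exists>r>0. cball (cmap (chart_at A x) x) (3 * r) \<subseteq> cimage (chart_at A x)" by (intro exI[of _ "s / 3"]) simp
  from someI_ex[OF this]
  show "chart_radius x > 0" "cball (cmap (chart_at A x) x) (3 * chart_radius x) \<subseteq> cimage (chart_at A x)"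
    by (simp_all add: chart_radius_def)
qed

lemma finite_chart_ball_cover: "\<exists>I. finite I \<and> (\<forall>x. \<exists>i\<in>I. x \<in> chart_ball (1 / 2) i)"
proof -
  define U where "U i = cinv (chart_at A i) ` ball (cmap (chart_at A i) i) (1 / 2 * chart_radius i)" for i
  have "open (U i)" for i
  proof -
    have "ball (cmap (chart_at A i) i) (1 / 2 * chart_radius i) \<subseteq> cball (cmap (chart_at A i) i) (3 * chart_radius i)"
      using chart_radius(1)[of i] by auto
    then show ?thesis unfolding U_def using chart_radius(2)[of i] by (intro open_cinv_image chart_at(1)) auto
  qed
  moreover have "i \<in> U i" for i
    unfolding U_def using cinv_cmap[OF chart_at] chart_radius(1)[of i]
    by (intro image_eqI[of _ _ "cmap (chart_at A i) i"]) auto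
  ultimately obtain I where "finite I" "UNIV \<subseteq> (\<Union>i\<in>I. U i)"
    using compactE_image[OF compact_M, of UNIV U] by (metis UNIV_I UN_I subsetI)
  moreover have "U i \<subseteq> chart_ball (1 / 2) i" for i unfolding U_def chart_ball_def by (intro image_mono ball_subset_cball)
  ultimately show ?thesis by (intro exI[of _ I]) blast
qed

definition chart_bump :: "('m, 'e) chart \<Rightarrow> 'm \<Rightarrow> real \<Rightarrow> real \<Rightarrow> 'm \<Rightarrow> real" where
  "chart_bump c x s r = chart_extension c (bump (cmap c x) s r)"

lemma chart_bump_bounds: "chart_bump c x s r y \<ge> 0" "chart_bump c x s r y \<le> 1"
  by (simp_all add: chart_bump_def chart_extension_def bump_bounds)

context
  fixes c x and s r :: real
  assumes c: "c \<in> A" and s: "0 \<le> s" "s < r" and r: "cball (cmap c x) (3 * r) \<subseteq> cimage c"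
begin

lemma chart_bump_C1: "chart_bump c x s r \<in> C1"
proof -
  obtain D where "has_gradient_on (bump (cmap c x) s r) D (ball (cmap c x) (2 * r))"
    using has_gradient_on_bump by blast
  then show ?thesis
    unfolding chart_bump_def
  proof (rule chart_extension_C1[OF c compact_cball, rotated 3])
    show "cball (cmap c x) r \<subseteq> ball (cmap c x) (2 * r)" using s by auto
    have "ball (cmap c x) (2 * r) \<subseteq> cball (cmap c x) (3 * r)" using s by auto
    then show "ball (cmap c x) (2 * r) \<subseteq> cimage c" using r by blast
  qed (use s in \<open>auto intro: bump_eq_0\<close>)
qed

lemma chart_bump_eq_1:
  assumes "y \<in> cinv c ` cball (cmap c x) s" shows "chart_bump c x s r y = 1"
proof -
  obtain z where z: "y = cinv c z" "z \<in> cball (cmap c x) s" using assms by blast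
  moreover have "cball (cmap c x) s \<subseteq> cball (cmap c x) (3 * r)" using s by auto
  ultimately have "z \<in> cimage c" using r by blast
  then have "y \<in> cdom c" "cmap c y = z" using z cinv_in[OF c] cmap_cinv[OF c] by auto
  then show ?thesis using z s by (simp add: chart_bump_def chart_extension_def bump_eq_1)
qed

lemma chart_bump_less_1:
  assumes "y \<notin> cinv c ` cball (cmap c x) s" shows "chart_bump c x s r y < 1"
proof (cases "y \<in> cdom c")
  case True
  then have "cmap c y \<notin> cball (cmap c x) s" using assms cinv_cmap[OF c True] by (metis image_eqI)
  then show ?thesis using s True by (simp add: chart_bump_def chart_extension_def bump_less_1)
qed (simp add: chart_bump_def chart_extension_def)

lemma chart_bump_eq_0:
  assumes "y \<notin> cinv c ` cball (cmap c x) r" shows "chart_bump c x s r y = 0"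
proof (cases "y \<in> cdom c")
  case True
  then have "cmap c y \<notin> cball (cmap c x) r" using assms cinv_cmap[OF c True] by (metis image_eqI)
  then show ?thesis using s True by (simp add: chart_bump_def chart_extension_def bump_eq_0)
qed (simp add: chart_bump_def chart_extension_def)

end

lemma C1_inverse:
  assumes "f \<in> C1" "\<And>x. f x \<ge> 1" shows "(\<lambda>x. inverse (f x)) \<in> C1"
proof (rule C1_compose_real[OF assms(1), of inverse "\<lambda>t. - (inverse t ^ 2)"])
  show "(inverse has_real_derivative - ((inverse (f x))\<^sup>2)) (at (f x))" for x
    using DERIV_inverse[of "f x" UNIV] assms(2)[of x] by (simp add: numeral_2_eq_2)
  show "continuous_on (range f) (\<lambda>t. - ((inverse t)\<^sup>2))"
    using assms(2) by (intro continuous_intros) (metis imageE not_one_le_zero)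
qed

lemma partition_of_unity:
  obtains I :: "'m set" and \<xi> :: "'m \<Rightarrow> 'm \<Rightarrow> real"
  where "finite I" "\<And>i. \<xi> i \<in> C1" "\<And>i x. \<xi> i x \<ge> 0" "\<And>x. (\<Sum>i\<in>I. \<xi> i x) = 1"
    "\<And>i x. x \<notin> chart_ball 1 i \<Longrightarrow> \<xi> i x = 0"
proof -
  obtain I where I: "finite I" and cover: "\<And>x. \<exists>i\<in>I. x \<in> chart_ball (1 / 2) i" using finite_chart_ball_cover by blast
  define \<eta> where "\<eta> i = chart_bump (chart_at A i) i (1 / 2 * chart_radius i) (chart_radius i)" for i
  have r: "0 \<le> 1 / 2 * chart_radius i" "1 / 2 * chart_radius i < chart_radius i" for i using chart_radius(1)[of i] by auto
  note bump = chart_at(1) r chart_radius(2)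
  define H where "H x = (\<Sum>i\<in>I. \<eta> i x)" for x
  have \<eta>: "\<eta> i \<in> C1" for i unfolding \<eta>_def by (rule chart_bump_C1[OF bump])
  then have H: "H \<in> C1" unfolding H_def using I by (intro C1_sum)
  have H_ge: "H x \<ge> 1" for x
  proof -
    obtain i where i: "i \<in> I" "\<eta> i x = 1"
      using cover[of x] chart_bump_eq_1[OF bump] unfolding \<eta>_def chart_ball_def by blast
    have "\<eta> i x \<le> H x"
      unfolding H_def by (rule member_le_sum[OF i(1) _ I]) (simp add: \<eta>_def chart_bump_bounds(1))
    then show ?thesis using i(2) by simp
  qed
  show thesis
  proof (rule that[OF I, of "\<lambda>i x. \<eta> i x * inverse (H x)"])
    show "(\<lambda>x. \<eta> i x * inverse (H x)) \<in> C1" for i by (rule C1_mult[OF \<eta> C1_inverse[OF H H_ge]])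
    show "\<eta> i x * inverse (H x) \<ge> 0" for i x using chart_bump_bounds(1) H_ge[of x] by (simp add: \<eta>_def)
    show "(\<Sum>i\<in>I. \<eta> i x * inverse (H x)) = 1" for x
      using H_ge[of x] by (simp flip: sum_distrib_right H_def)
    show "\<eta> i x * inverse (H x) = 0" if "x \<notin> chart_ball 1 i" for i x
      using chart_bump_eq_0[OF bump] that by (simp add: \<eta>_def chart_ball_def)
  qed
qed

lemma abs_differential_le_L:
  assumes f: "f \<in> C1"
  shows "\<exists>C. \<forall>x. \<forall>v\<in>tangent_space A x. \<bar>differential A f x v\<bar> \<le> L x v + C"
proof -
  have f': "(\<lambda>x. (- 1) * f x) \<in> C1" by (rule C1_cmult[OF f])
  obtain B where B: "\<And>x. \<bar>G x (differential A f x)\<bar> \<le> B"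
    using continuous_bounded[OF G_differential_continuous[OF f]] by blast
  obtain B' where B': "\<And>x. \<bar>G x (differential A (\<lambda>x. (- 1) * f x) x)\<bar> \<le> B'"
    using continuous_bounded[OF G_differential_continuous[OF f']] by blast
  have "\<bar>differential A f x v\<bar> \<le> L x v + max B B'" if v: "v \<in> tangent_space A x" for x v
    using differential_le_L[OF f v] differential_le_L[OF f' v] B[of x] B'[of x] differential_cmult[OF v f, of "- 1"]
    unfolding abs_le_iff by linarith
  then show ?thesis by blast
qed

lemma abs_differential_le_L_finite:
  assumes I: "finite I" and f: "\<And>i. f i \<in> C1"
  shows "\<exists>C\<ge>0. \<forall>i\<in>I. \<forall>x. \<forall>v\<in>tangent_space A x. \<bar>differential A (f i) x v\<bar> \<le> L x v + C"
proof -
  obtain C where C: "\<And>i x v. v \<in> tangent_space A x \<Longrightarrow> \<bar>differential A (f i) x v\<bar> \<le> L x v + C i"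
    using abs_differential_le_L[OF f] by metis
  have "\<bar>differential A (f i) x v\<bar> \<le> L x v + (\<Sum>i\<in>I. \<bar>C i\<bar>)" if "i \<in> I" "v \<in> tangent_space A x" for i x v
    using C[OF that(2), of i] member_le_sum[OF that(1), of "\<lambda>i. \<bar>C i\<bar>"] I by simp
  then show ?thesis by (intro exI[of _ "\<Sum>i\<in>I. \<bar>C i\<bar>"]) (simp add: sum_nonneg)
qed

lemma glue_close:
  fixes \<xi> f :: "'i \<Rightarrow> 'm \<Rightarrow> real"
  assumes \<xi>: "\<And>i x. i \<in> I \<Longrightarrow> \<xi> i x \<ge> 0" "\<And>x. (\<Sum>i\<in>I. \<xi> i x) = 1"
    and close: "\<And>i x. i \<in> I \<Longrightarrow> \<xi> i x \<noteq> 0 \<Longrightarrow> \<bar>f i x - w x\<bar> \<le> \<eta>"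
  shows "\<bar>(\<Sum>i\<in>I. \<xi> i x * f i x) - w x\<bar> \<le> \<eta>"
proof -
  have "(\<Sum>i\<in>I. \<xi> i x * f i x) - w x = (\<Sum>i\<in>I. \<xi> i x * (f i x - w x))"
    using \<xi>(2)[of x] by (simp add: right_diff_distrib sum_subtractf flip: sum_distrib_right)
  also have "\<bar>\<dots>\<bar> \<le> (\<Sum>i\<in>I. \<bar>\<xi> i x * (f i x - w x)\<bar>)" by (rule sum_abs)
  also have "\<dots> \<le> (\<Sum>i\<in>I. \<xi> i x * \<eta>)"
  proof (rule sum_mono)
    fix i assume "i \<in> I"
    then show "\<bar>\<xi> i x * (f i x - w x)\<bar> \<le> \<xi> i x * \<eta>"
      using close[of i x] \<xi>(1)[of i x] by (cases "\<xi> i x = 0") (auto simp: abs_mult intro!: mult_left_mono)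
  qed
  also have "\<dots> = \<eta>" using \<xi>(2)[of x] by (simp flip: sum_distrib_right)
  finally show ?thesis .
qed

lemma glue_differential_le:
  fixes \<xi> f :: "'i \<Rightarrow> 'm \<Rightarrow> real"
  assumes I: "finite I" and \<xi>: "\<And>i. i \<in> I \<Longrightarrow> \<xi> i \<in> C1" "\<And>i x. i \<in> I \<Longrightarrow> \<xi> i x \<ge> 0" "\<And>x. (\<Sum>i\<in>I. \<xi> i x) = 1"
    and d\<xi>: "\<And>i x v. i \<in> I \<Longrightarrow> v \<in> tangent_space A x \<Longrightarrow> \<bar>differential A (\<xi> i) x v\<bar> \<le> L x v + C"
    and f: "\<And>i. i \<in> I \<Longrightarrow> f i \<in> C1"
    and close: "\<And>i x. i \<in> I \<Longrightarrow> \<xi> i x \<noteq> 0 \<Longrightarrow> \<bar>f i x - w x\<bar> \<le> \<eta> \<and> G x (differential A (f i) x) \<le> b"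
    and v: "v \<in> tangent_space A x" and "\<eta> \<ge> 0"
  shows "differential A (\<lambda>x. \<Sum>i\<in>I. \<xi> i x * f i x) x v \<le> (L x v + b) + real (card I) * \<eta> * (L x v + C)"
proof -
  have "(\<Sum>i\<in>I. differential A (\<xi> i) x v) = 0"
    using differential_sum[OF v I, of \<xi>] \<xi>(1) differential_const[OF v, of 1] by (simp add: \<xi>(3))
  moreover have "differential A (\<lambda>x. \<Sum>i\<in>I. \<xi> i x * f i x) x v
      = (\<Sum>i\<in>I. \<xi> i x * differential A (f i) x v + f i x * differential A (\<xi> i) x v)"
    using I \<xi>(1) f by (simp add: differential_sum[OF v] C1_mult differential_mult[OF v])
  ultimately have "differential A (\<lambda>x. \<Sum>i\<in>I. \<xi> i x * f i x) x v
      = (\<Sum>i\<in>I. \<xi> i x * differential A (f i) x v + (f i x - w x) * differential A (\<xi> i) x v)"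
    by (simp add: sum.distrib left_diff_distrib sum_subtractf flip: sum_distrib_left)
  also have "\<dots> \<le> (\<Sum>i\<in>I. \<xi> i x * (L x v + b) + \<eta> * (L x v + C))"
  proof (rule sum_mono)
    fix i assume i: "i \<in> I"
    show "\<xi> i x * differential A (f i) x v + (f i x - w x) * differential A (\<xi> i) x v
        \<le> \<xi> i x * (L x v + b) + \<eta> * (L x v + C)"
    proof (cases "\<xi> i x = 0")
      case True
      then have "differential A (\<lambda>_. 0) x = differential A (\<xi> i) x"
        using \<xi>(2)[OF i] by (intro differential_eq_if_touching[OF C1_const \<xi>(1)[OF i]] always_eventually) simp
      then have "differential A (\<xi> i) x v = 0" using differential_const[OF v, of 0] by simp
      then show ?thesis using True d\<xi>[OF i v] \<open>\<eta> \<ge> 0\<close> by simp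
    next
      case False
      then have "differential A (f i) x v \<le> L x v + b" using close[OF i False] differential_le_L[OF f[OF i] v] by linarith
      moreover have "(f i x - w x) * differential A (\<xi> i) x v \<le> \<bar>f i x - w x\<bar> * \<bar>differential A (\<xi> i) x v\<bar>"
        by (metis abs_ge_self abs_mult)
      moreover have "\<dots> \<le> \<eta> * (L x v + C)" using close[OF i False] d\<xi>[OF i v] \<open>\<eta> \<ge> 0\<close> by (intro mult_mono) auto
      ultimately show ?thesis using mult_left_mono[OF _ \<xi>(2)[OF i], of "differential A (f i) x v" "L x v + b" x] by linarith
    qed
  qed
  also have "\<dots> = (L x v + b) + real (card I) * \<eta> * (L x v + C)"
    using \<xi>(3)[of x] by (simp add: sum.distrib flip: sum_distrib_right)
  finally show ?thesis .
qed

text \<open>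
  Gluing costs a small multiple of the Lagrangian, which a dilation by a factor close to \<open>1\<close> absorbs.
\<close>

lemma dilation_absorbs_L:
  assumes f: "f \<in> C1" and "\<tau> \<ge> 0" and w: "\<And>x. \<bar>w x\<bar> \<le> B" "\<And>x. \<bar>f x - w x\<bar> \<le> \<eta>"
    and df: "\<And>x v. v \<in> tangent_space A x \<Longrightarrow> differential A f x v \<le> (L x v + (a + \<eta>)) + \<tau> * (L x v + C)"
    and e: "\<eta> + \<tau> * B \<le> e" "\<eta> + \<tau> * (C + \<bar>a\<bar>) \<le> e"
  shows "\<exists>h\<in>C1. (\<forall>x. \<bar>h x - w x\<bar> \<le> e) \<and> (\<forall>x. G x (differential A h x) \<le> a + e)"
proof (intro bexI conjI allI)
  define h where "h x = inverse (1 + \<tau>) * f x" for x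
  show h: "h \<in> C1" unfolding h_def by (rule C1_cmult[OF f])
  have "\<eta> \<ge> 0" "B \<ge> 0" using order_trans[OF abs_ge_zero w(1)] order_trans[OF abs_ge_zero w(2)] by blast+
  then have "e \<ge> 0" using e(1) \<open>\<tau> \<ge> 0\<close> by (meson add_nonneg_nonneg mult_nonneg_nonneg order_trans)
  show "\<bar>h x - w x\<bar> \<le> e" for x
  proof -
    have "h x - w x = inverse (1 + \<tau>) * ((f x - w x) - \<tau> * w x)"
      using \<open>\<tau> \<ge> 0\<close> by (simp add: h_def field_simps)
    also have "\<bar>\<dots>\<bar> \<le> 1 * \<bar>(f x - w x) - \<tau> * w x\<bar>"
      unfolding abs_mult using \<open>\<tau> \<ge> 0\<close> by (intro mult_right_mono) (auto simp: inverse_le_1_iff)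
    also have "\<bar>\<tau> * w x\<bar> \<le> \<tau> * B" using \<open>\<tau> \<ge> 0\<close> w(1)[of x] by (simp add: abs_mult mult_left_mono)
    then have "\<bar>(f x - w x) - \<tau> * w x\<bar> \<le> \<eta> + \<tau> * B" using w(2)[of x] by linarith
    finally show ?thesis using e(1) by simp
  qed
  show "G x (differential A h x) \<le> a + e" for x
    unfolding G_le_iff[OF h]
  proof
    fix v assume v: "v \<in> tangent_space A x"
    have "\<tau> * (a + \<bar>a\<bar>) \<ge> 0" "\<tau> * e \<ge> 0" using \<open>\<tau> \<ge> 0\<close> \<open>e \<ge> 0\<close> by auto
    then have "(L x v + (a + \<eta>)) + \<tau> * (L x v + C) \<le> (1 + \<tau>) * (L x v + (a + e))"
      using e(2) by (simp add: algebra_simps)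
    then have "differential A f x v \<le> (1 + \<tau>) * (L x v + (a + e))" using df[OF v] by linarith
    then have "inverse (1 + \<tau>) * differential A f x v \<le> L x v + (a + e)"
      using \<open>\<tau> \<ge> 0\<close> by (simp add: field_simps)
    then show "differential A h x v \<le> L x v + (a + e)"
      unfolding h_def differential_cmult[OF v f] .
  qed
qed

theorem smooth_approximation:
  assumes w: "subsolution a w" and "e > 0"
  obtains f where "f \<in> C1" "\<And>x. \<bar>f x - w x\<bar> \<le> e" "\<And>x. G x (differential A f x) \<le> a + e"
proof -
  obtain I and \<xi> :: "'m \<Rightarrow> 'm \<Rightarrow> real" where I: "finite I"
    and \<xi>: "\<And>i. \<xi> i \<in> C1" "\<And>i x. \<xi> i x \<ge> 0" "\<And>x. (\<Sum>i\<in>I. \<xi> i x) = 1" "\<And>i x. x \<notin> chart_ball 1 i \<Longrightarrow> \<xi> i x = 0"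
    by (rule partition_of_unity) (rule that)
  obtain B where B: "B > 0" "\<And>x. \<bar>w x\<bar> \<le> B"
    using continuous_bounded[OF viscosity_subsolution_continuous[OF w]] by blast
  obtain C where C: "C \<ge> 0" "\<And>i x v. i \<in> I \<Longrightarrow> v \<in> tangent_space A x \<Longrightarrow> \<bar>differential A (\<xi> i) x v\<bar> \<le> L x v + C"
    using abs_differential_le_L_finite[OF I, of \<xi>] \<xi>(1) by blast
  define Q where "Q = 1 + real (card I) * (C + \<bar>a\<bar> + B)"
  have "Q \<ge> 1" using B(1) C(1) by (simp add: Q_def)
  define \<eta> where "\<eta> = e / Q"
  have "\<eta> > 0" "\<eta> * Q = e" using \<open>e > 0\<close> \<open>Q \<ge> 1\<close> by (simp_all add: \<eta>_def)
  then have \<eta>: "\<eta> > 0" "\<eta> + real (card I) * \<eta> * (C + \<bar>a\<bar> + B) = e"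
    by (simp_all add: Q_def algebra_simps)
  have "\<exists>f\<in>C1. \<forall>x\<in>chart_ball 1 i. \<bar>f x - w x\<bar> \<le> \<eta> \<and> G x (differential A f x) \<le> a + \<eta>" for i
    by (rule smooth_approximation_local[OF w chart_at(1)[of i] chart_radius[of i] \<eta>(1)], rule bexI[rotated], assumption) (auto simp: chart_ball_def)
  then obtain f where f: "\<And>i. f i \<in> C1" "\<And>i x. x \<in> chart_ball 1 i \<Longrightarrow> \<bar>f i x - w x\<bar> \<le> \<eta> \<and> G x (differential A (f i) x) \<le> a + \<eta>"
    by metis
  then have local: "\<bar>f i x - w x\<bar> \<le> \<eta> \<and> G x (differential A (f i) x) \<le> a + \<eta>" if "\<xi> i x \<noteq> 0" for i x
    using \<xi>(4) that by blast
  define \<tau> where "\<tau> = real (card I) * \<eta>"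
  have "\<tau> * B \<ge> 0" "\<tau> * (C + \<bar>a\<bar>) \<ge> 0" "\<tau> \<ge> 0" using \<eta>(1) B(1) C(1) by (auto simp: \<tau>_def)
  moreover from this have "\<eta> + \<tau> * B \<le> e" "\<eta> + \<tau> * (C + \<bar>a\<bar>) \<le> e"
    using \<eta>(2) by (simp_all add: \<tau>_def algebra_simps)
  moreover have "(\<lambda>x. \<Sum>i\<in>I. \<xi> i x * f i x) \<in> C1" using I \<xi>(1) f(1) by (intro C1_sum C1_mult)
  moreover have "\<bar>(\<Sum>i\<in>I. \<xi> i x * f i x) - w x\<bar> \<le> \<eta>" for x
    by (rule glue_close) (use \<xi>(2,3) local in auto)
  moreover have "differential A (\<lambda>x. \<Sum>i\<in>I. \<xi> i x * f i x) x v \<le> (L x v + (a + \<eta>)) + \<tau> * (L x v + C)"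
    if "v \<in> tangent_space A x" for x v
    unfolding \<tau>_def by (rule glue_differential_le[where w = w, OF I _ _ \<xi>(3) C(2) _ _ that]) (use \<xi>(1,2) f(1) local \<eta>(1) in auto)
  ultimately have "\<exists>h\<in>C1. (\<forall>x. \<bar>h x - w x\<bar> \<le> e) \<and> (\<forall>x. G x (differential A h x) \<le> a + e)"
    by (intro dilation_absorbs_L[OF _ _ B(2)])
  then show thesis using that by blast
qed

subsection \<open>The action along absolutely continuous curves\<close>

lemma has_vector_derivative_along_curve:
  assumes c: "c \<in> A" "\<gamma> s \<in> cdom c" and cont: "isCont \<gamma> s"
    and w: "(cmap c \<circ> \<gamma> has_vector_derivative w) (at s)"
    and h: "(h \<circ> cinv c has_derivative h') (at (cmap c (\<gamma> s)))"
  shows "(h \<circ> \<gamma> has_vector_derivative h' w) (at s)"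
proof -
  have "((h \<circ> cinv c) \<circ> (cmap c \<circ> \<gamma>) has_derivative (\<lambda>x. h' (x *\<^sub>R w))) (at s)"
    using diff_chain_at[OF w[unfolded has_vector_derivative_def], of "h \<circ> cinv c" h'] h by (simp add: o_def)
  then have "((h \<circ> cinv c) \<circ> (cmap c \<circ> \<gamma>) has_vector_derivative h' w) (at s)"
    unfolding has_vector_derivative_def linear_scale[OF has_derivative_linear[OF h]] .
  note deriv = this
  have "\<forall>\<^sub>F u in nhds s. \<gamma> u \<in> cdom c"
    using cont open_cdom[OF c(1)] c(2) by (simp add: isCont_def tendsto_def eventually_nhds_conv_at)
  then obtain S where S: "open S" "s \<in> S" "\<And>u. u \<in> S \<Longrightarrow> \<gamma> u \<in> cdom c" by (auto simp: eventually_nhds)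
  show ?thesis
    by (rule has_vector_derivative_transform_within_open[OF deriv S(1,2)]) (simp add: cinv_cmap[OF c(1) S(3)])
qed

lemma velocity_eq_tvec_of:
  assumes c: "c \<in> A" "\<gamma> s \<in> cdom c" and "isCont \<gamma> s" "(cmap c \<circ> \<gamma> has_vector_derivative w) (at s)"
  shows "velocity A \<gamma> s = tvec_of A c (\<gamma> s) w"
proof
  fix d
  show "velocity A \<gamma> s d = tvec_of A c (\<gamma> s) w d"
  proof (cases "d \<in> A \<and> \<gamma> s \<in> cdom d")
    case True
    then have "(cmap d \<circ> \<gamma> has_vector_derivative transition_deriv c d (\<gamma> s) w) (at s)"
      by (intro has_vector_derivative_along_curve[OF assms] transition_derivative c) auto
    then show ?thesis using True by (simp add: velocity_def tvec_of_eq vector_derivative_at)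
  next
    case False
    then show ?thesis unfolding velocity_def using tvec_of_zero[OF False] by (simp only: if_False)
  qed
qed

lemma C1_has_derivative_along_curve:
  assumes f: "f \<in> C1" and c: "c \<in> A" "\<gamma> s \<in> cdom c" and \<gamma>: "isCont \<gamma> s" "(cmap c \<circ> \<gamma> has_vector_derivative w) (at s)"
  shows "velocity A \<gamma> s \<in> tangent_space A (\<gamma> s)"
    and "(f \<circ> \<gamma> has_real_derivative differential A f (\<gamma> s) (velocity A \<gamma> s)) (at s)"
  using has_vector_derivative_along_curve[OF c \<gamma> C1_has_derivative[OF f c]] tvec_of_in[OF c]
  by (simp_all add: velocity_eq_tvec_of[OF c \<gamma>] differential_eq_covec_of[OF f c] covec_of_apply[OF c]
      has_real_derivative_iff_has_vector_derivative)

abbreviation "L_along \<gamma> s \<equiv> L (\<gamma> s) (velocity A \<gamma> s)"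

lemma C1_increment_le_in_chart:
  assumes f: "f \<in> C1" "\<And>x v. v \<in> tangent_space A x \<Longrightarrow> differential A f x v \<le> L x v + a"
    and \<gamma>: "abs_continuous_curve A t \<gamma>" and uv: "0 \<le> u" "u \<le> v" "v \<le> t"
    and c: "c \<in> A" and K: "compact K" "convex K" "K \<subseteq> cimage c"
    and in_K: "\<And>s. s \<in> {u..v} \<Longrightarrow> \<gamma> s \<in> cdom c \<and> cmap c (\<gamma> s) \<in> K" and int: "L_along \<gamma> integrable_on {u..v}"
  shows "f (\<gamma> v) - f (\<gamma> u) \<le> integral {u..v} (L_along \<gamma>) + a * (v - u)"
proof -
  have "\<gamma> ` {u..v} \<subseteq> cdom c" using in_K by blast
  then have ac: "abs_continuous_on u v (cmap c \<circ> \<gamma>)"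
    using \<gamma> c uv unfolding abs_continuous_curve_def by blast
  have "Ck_on 1 (f \<circ> cinv c) (cimage c)" using f(1) c by (simp add: C1_manifold_def)
  then obtain C where "C-lipschitz_on K (f \<circ> cinv c)" using Ck_on_1_imp_lipschitz_on[OF _ K] by blast
  then have ac_f: "abs_continuous_on u v (f \<circ> \<gamma>)"
    using in_K lipschitz_onD[of C K "f \<circ> cinv c"]
    by (intro abs_continuous_on_lipschitz_compose[OF ac, of _ C]) (force simp: cinv_cmap[OF c])
  obtain N where N: "negligible N" "\<And>s. s \<in> {u<..<v} - N \<Longrightarrow> (cmap c \<circ> \<gamma>) differentiable (at s)"
    using abs_continuous_on_differentiable_ae[OF ac uv(2)] by blast
  have "\<exists>D. (f \<circ> \<gamma> has_real_derivative D) (at s) \<and> D \<le> L_along \<gamma> s + a" if s: "s \<in> {u..v} - (N \<union> {u, v})" for s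
  proof -
    have s': "s \<in> {u<..<v}" "s \<in> {u<..<v} - N" using s by auto
    have "continuous_on {u<..<v} \<gamma>"
      using \<gamma> uv by (auto simp: abs_continuous_curve_def intro: continuous_on_subset)
    then have "isCont \<gamma> s" using s'(1) by (simp add: continuous_on_eq_continuous_at)
    moreover have "(cmap c \<circ> \<gamma> has_vector_derivative vector_derivative (cmap c \<circ> \<gamma>) (at s)) (at s)"
      using N(2)[OF s'(2)] by (simp add: vector_derivative_works)
    ultimately show ?thesis
      using C1_has_derivative_along_curve[OF f(1) c] f(2) in_K s by (metis DiffD1)
  qed
  then have "(f \<circ> \<gamma>) v - (f \<circ> \<gamma>) u \<le> integral {u..v} (\<lambda>s. L_along \<gamma> s + a)"
    using N(1) by (intro abs_continuous_on_le_integral[OF ac_f uv(2), of "N \<union> {u, v}"])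
      (auto intro: integrable_add int negligible_Un)
  also have "\<dots> = integral {u..v} (L_along \<gamma>) + a * (v - u)"
    using uv(2) by (subst integral_add[OF int]) auto
  finally show ?thesis by simp
qed

lemma curve_near_in_chart:
  assumes \<gamma>: "continuous_on {0..t} \<gamma>" and x: "x \<in> {0..t}"
  shows "\<exists>c\<in>A. \<exists>K. compact K \<and> convex K \<and> K \<subseteq> cimage c \<and>
    (\<exists>d>0. \<forall>s\<in>{0..t}. dist s x < d \<longrightarrow> \<gamma> s \<in> cdom c \<and> cmap c (\<gamma> s) \<in> K)"
proof -
  obtain c \<rho> where c: "c \<in> A" "\<gamma> x \<in> cdom c" "\<rho> > 0" "cball (cmap c (\<gamma> x)) \<rho> \<subseteq> cimage c"
    by (rule chart_ball_ex)
  define U where "U = cinv c ` ball (cmap c (\<gamma> x)) \<rho>"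
  have ball: "ball (cmap c (\<gamma> x)) \<rho> \<subseteq> cimage c" using c(4) by auto
  then have "open U" unfolding U_def by (intro open_cinv_image[OF c(1)]) auto
  moreover have x_in: "\<gamma> x \<in> U" unfolding U_def using c(3) cinv_cmap[OF c(1,2)] by (metis centre_in_ball image_eqI)
  moreover have "(\<gamma> \<longlongrightarrow> \<gamma> x) (at x within {0..t})" using \<gamma> x by (simp add: continuous_on)
  ultimately have "\<forall>\<^sub>F s in at x within {0..t}. \<gamma> s \<in> U" by (intro topological_tendstoD)
  then obtain d where "d > 0" and d: "\<And>s. s \<in> {0..t} \<Longrightarrow> s \<noteq> x \<Longrightarrow> dist s x < d \<Longrightarrow> \<gamma> s \<in> U"
    unfolding eventually_at by blast
  have "\<gamma> s \<in> cdom c \<and> cmap c (\<gamma> s) \<in> cball (cmap c (\<gamma> x)) \<rho>" if "s \<in> {0..t}" "dist s x < d" for s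
  proof -
    have "\<gamma> s \<in> U" using d[OF that(1) _ that(2)] x_in by blast
    then obtain y where y: "y \<in> ball (cmap c (\<gamma> x)) \<rho>" "\<gamma> s = cinv c y" unfolding U_def by blast
    then show ?thesis using ball cinv_in[OF c(1), of y] cmap_cinv[OF c(1), of y] by auto
  qed
  then show ?thesis using c \<open>d > 0\<close>
    by (intro bexI[of _ c] exI[of _ "cball (cmap c (\<gamma> x)) \<rho>"] conjI exI[of _ d]) auto
qed

lemma C1_increment_le:
  assumes f: "f \<in> C1" "\<And>x v. v \<in> tangent_space A x \<Longrightarrow> differential A f x v \<le> L x v + a"
    and \<gamma>: "abs_continuous_curve A t \<gamma>" and "t \<ge> 0" and int: "L_along \<gamma> integrable_on {0..t}"
  shows "f (\<gamma> t) - f (\<gamma> 0) \<le> integral {0..t} (L_along \<gamma>) + a * t"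
proof -
  define le where "le u v \<longleftrightarrow> (0 \<le> u \<and> v \<le> t \<longrightarrow>
    f (\<gamma> v) - f (\<gamma> u) \<le> integral {u..v} (L_along \<gamma>) + a * (v - u))" for u v
  have sub: "L_along \<gamma> integrable_on {u..v}" if "0 \<le> u" "v \<le> t" for u v
    by (rule integrable_on_subinterval[OF int]) (use that in auto)
  have "le 0 t"
  proof (rule Bolzano[OF \<open>t \<ge> 0\<close>, of le])
    fix u m v assume uv: "u \<le> m" "m \<le> v" and "le u m" "le m v"
    then show "le u v"
      using Henstock_Kurzweil_Integration.integral_combine[OF uv sub]
      by (auto simp: le_def algebra_simps)
  next
    fix x assume "0 \<le> x" "x \<le> t"
    then obtain c K d where c: "c \<in> A" "compact K" "convex K" "K \<subseteq> cimage c" and "d > 0"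
      and near: "\<And>s. s \<in> {0..t} \<Longrightarrow> dist s x < d \<Longrightarrow> \<gamma> s \<in> cdom c \<and> cmap c (\<gamma> s) \<in> K"
      using curve_near_in_chart[of t \<gamma> x] \<gamma> by (auto simp: abs_continuous_curve_def)
    have "le u v" if "u \<le> x" "x \<le> v" "v - u < d" for u v
      unfolding le_def
      using that by (intro impI C1_increment_le_in_chart[OF f \<gamma> _ _ _ c near] sub) (auto simp: dist_real_def)
    then show "\<exists>d>0. \<forall>u v. u \<le> x \<and> x \<le> v \<and> v - u < d \<longrightarrow> le u v" using \<open>d > 0\<close> by blast
  qed
  then show ?thesis using \<open>t \<ge> 0\<close> by (simp add: le_def)
qed

definition reach :: "real \<Rightarrow> 'm \<Rightarrow> 'm \<Rightarrow> real \<Rightarrow> bool" where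
  "reach t x y k \<longleftrightarrow> minimal_action A G t x y < ereal k"

lemma reachE:
  assumes "reach t x y k"
  obtains \<gamma> where "abs_continuous_curve A t \<gamma>" "\<gamma> 0 = x" "\<gamma> t = y"
    "L_along \<gamma> absolutely_integrable_on {0..t}"
    "integral {0..t} (L_along \<gamma>) < k"
proof -
  obtain \<gamma> where \<gamma>: "abs_continuous_curve A t \<gamma>" "\<gamma> 0 = x" "\<gamma> t = y" "action A G t \<gamma> < ereal k"
    using assms unfolding reach_def minimal_action_def INF_less_iff by auto
  then show thesis using that[OF \<gamma>(1-3)] by (auto simp: action_def split: if_splits)
qed

lemma reachI:
  assumes "abs_continuous_curve A t \<gamma>" "\<gamma> 0 = x" "\<gamma> t = y"
    "L_along \<gamma> absolutely_integrable_on {0..t}"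
    "integral {0..t} (L_along \<gamma>) < k"
  shows "reach t x y k"
  unfolding reach_def minimal_action_def INF_less_iff using assms by (intro bexI[of _ \<gamma>]) (auto simp: action_def)

lemma reach_mono: "reach t x y k \<Longrightarrow> k \<le> l \<Longrightarrow> reach t x y l"
  unfolding reach_def by (meson ereal_less_eq(3) order_less_le_trans)

lemma C1_reach:
  assumes "f \<in> C1" "\<And>x. G x (differential A f x) \<le> a" "t \<ge> 0" "reach t x y k"
  shows "f y - f x < k + a * t"
proof -
  obtain \<gamma> where \<gamma>: "abs_continuous_curve A t \<gamma>" "\<gamma> 0 = x" "\<gamma> t = y"
    "L_along \<gamma> absolutely_integrable_on {0..t}"
    "integral {0..t} (L_along \<gamma>) < k"
    using reachE[OF assms(4)] by blast
  have "f (\<gamma> t) - f (\<gamma> 0) \<le> integral {0..t} (L_along \<gamma>) + a * t"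
    using assms G_le_iff[OF assms(1)] \<gamma>(1,4)
    by (intro C1_increment_le) (auto intro: set_lebesgue_integral_eq_integral(1))
  then show ?thesis using \<gamma> by simp
qed

lemma subsolution_reach:
  assumes w: "subsolution a w" and "t \<ge> 0" "reach t x y k"
  shows "w y - w x \<le> k + a * t"
proof (rule field_le_epsilon)
  fix e :: real assume "e > 0"
  define \<epsilon> where "\<epsilon> = e / (2 + t)"
  have \<epsilon>: "\<epsilon> > 0" "\<epsilon> * (2 + t) = e" using \<open>e > 0\<close> \<open>t \<ge> 0\<close> by (auto simp: \<epsilon>_def)
  obtain f where f: "f \<in> C1" "\<And>x. \<bar>f x - w x\<bar> \<le> \<epsilon>" "\<And>x. G x (differential A f x) \<le> a + \<epsilon>"
    using smooth_approximation[OF w \<epsilon>(1)] by blast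
  have "f y - f x < k + (a + \<epsilon>) * t" by (rule C1_reach[OF f(1,3) assms(2,3)])
  then show "w y - w x \<le> k + a * t + e"
    using f(2)[of x] f(2)[of y] \<epsilon>(2) by (simp add: algebra_simps)
qed

context
  fixes c :: "('m, 'e) chart" and z v :: 'e and r :: real and \<gamma> :: "real \<Rightarrow> 'm"
  assumes c: "c \<in> A" and segment: "\<And>s. s \<in> {0..r} \<Longrightarrow> z + s *\<^sub>R v \<in> cimage c"
    and \<gamma>: "\<gamma> = (\<lambda>s. cinv c (z + s *\<^sub>R v))"
begin

lemma chart_line_isCont: "s \<in> {0..r} \<Longrightarrow> isCont \<gamma> s"
proof -
  assume "s \<in> {0..r}"
  then have "isCont (cinv c) (z + s *\<^sub>R v)"
    using continuous_on_interior[OF cont_cinv[OF c]] interior_open[OF open_cimage[OF c]] segment by blast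
  then show ?thesis
    unfolding \<gamma> by (intro isCont_o2[where f = "\<lambda>s. z + s *\<^sub>R v" and g = "cinv c"] continuous_intros)
qed

lemma chart_line_abs_continuous: "abs_continuous_curve A r \<gamma>"
  unfolding abs_continuous_curve_def
proof (intro conjI ballI allI impI)
  show "continuous_on {0..r} \<gamma>" using chart_line_isCont by (simp add: continuous_at_imp_continuous_on)
  fix d p q assume d: "d \<in> A" and pq: "0 \<le> p" "p \<le> q" "q \<le> r" and im: "\<gamma> ` {p..q} \<subseteq> cdom d"
  let ?line = "\<lambda>s. z + s *\<^sub>R v"
  have "?line s \<in> cmap c ` (cdom c \<inter> cdom d)" if "s \<in> {p..q}" for s
  proof -
    have "?line s \<in> cimage c" "cinv c (?line s) \<in> cdom d" using that pq im segment by (auto simp: \<gamma>)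
    then show ?thesis using cinv_in[OF c] cmap_cinv[OF c] by (metis IntI imageI)
  qed
  moreover have "compact (?line ` {p..q})" by (intro compact_continuous_image continuous_intros) auto
  moreover have "?line ` {p..q} = (+) z ` (\<lambda>s. s *\<^sub>R v) ` {p..q}" by auto
  then have "convex (?line ` {p..q})"
    by (simp only:) (intro convex_translation convex_linear_image linear_scaleR_left convex_real_interval)
  ultimately obtain C where C: "C-lipschitz_on (?line ` {p..q}) (cmap d \<circ> cinv c)"
    using Ck_on_1_imp_lipschitz_on[OF transition(1)[OF c d]] by blast
  have "dist ((cmap d \<circ> \<gamma>) s) ((cmap d \<circ> \<gamma>) s') \<le> C * norm v * dist s s'" if "s \<in> {p..q}" "s' \<in> {p..q}" for s s'
    using lipschitz_onD[OF C imageI[OF that(1)] imageI[OF that(2)]]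
    by (simp add: \<gamma> dist_norm mult.assoc mult.commute[of "norm v"] flip: scaleR_diff_left)
  then show "abs_continuous_on p q (cmap d \<circ> \<gamma>)" by (rule abs_continuous_on_lipschitz)
qed

lemma L_along_chart_line:
  assumes s: "s \<in> {0..r}" shows "L_along \<gamma> s = L_loc c (z + s *\<^sub>R v) v"
proof -
  have dom: "\<gamma> s \<in> cdom c" "cmap c (\<gamma> s) = z + s *\<^sub>R v"
    using segment[OF s] cinv_in[OF c] cmap_cinv[OF c] by (auto simp: \<gamma>)
  have "(cmap c \<circ> \<gamma> has_vector_derivative v) (at s)"
  proof (rule has_vector_derivative_transform_within_open)
    show "((\<lambda>s. z + s *\<^sub>R v) has_vector_derivative v) (at s)"
      by (auto intro!: derivative_eq_intros simp: has_vector_derivative_def)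
    show "open ((\<lambda>s. z + s *\<^sub>R v) -` cimage c)"
      by (intro open_vimage open_cimage[OF c] continuous_intros)
  qed (use segment[OF s] cmap_cinv[OF c] in \<open>auto simp: \<gamma>\<close>)
  from velocity_eq_tvec_of[OF c dom(1) chart_line_isCont[OF s] this]
  show ?thesis by (simp add: L_tvec_of[OF c dom(1)] dom(2))
qed

lemma reach_chart_line:
  assumes "r \<ge> 0" and \<kappa>: "\<And>s. s \<in> {0..r} \<Longrightarrow> L_loc c (z + s *\<^sub>R v) v \<le> \<kappa>" and k: "r * \<kappa> < k"
  shows "reach r (cinv c z) (cinv c (z + r *\<^sub>R v)) k"
proof (rule reachI[OF chart_line_abs_continuous])
  have cont: "continuous_on {0..r} (\<lambda>s. L_loc c (z + s *\<^sub>R v) v)"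
    using segment by (intro L_loc_continuous_compose[OF c] continuous_intros) auto
  show "L_along \<gamma> absolutely_integrable_on {0..r}"
    by (rule absolutely_integrable_spike[OF absolutely_integrable_continuous_real[OF cont] negligible_empty])
      (simp add: L_along_chart_line)
  have "integral {0..r} (L_along \<gamma>) = integral {0..r} (\<lambda>s. L_loc c (z + s *\<^sub>R v) v)"
    by (rule integral_cong) (simp add: L_along_chart_line)
  also have "\<dots> \<le> integral {0..r} (\<lambda>s. \<kappa>)"
    by (rule integral_le) (use \<kappa> integrable_continuous_real[OF cont] in auto)
  finally show "integral {0..r} (L_along \<gamma>) < k" using k \<open>r \<ge> 0\<close> by simp
qed (simp_all add: \<gamma>)

end

subsection \<open>Concatenation\<close>

lemma velocity_cong:
  assumes "\<forall>\<^sub>F u in nhds s. \<alpha> u = \<beta> u" shows "velocity A \<alpha> s = velocity A \<beta> s"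
proof -
  have "vector_derivative (cmap d \<circ> \<alpha>) (at s) = vector_derivative (cmap d \<circ> \<beta>) (at s)" for d :: "('m, 'e) chart"
    using assms by (intro vector_derivative_cong_eq) (auto elim: eventually_mono)
  then show ?thesis using eventually_nhds_x_imp_x[OF assms] by (auto simp: velocity_def fun_eq_iff)
qed

lemma has_vector_derivative_translate:
  "((\<lambda>u. f (u + a)) has_vector_derivative w) (at s) \<longleftrightarrow> (f has_vector_derivative w) (at (s + a))"
proof -
  have translate: "((\<lambda>u. f (u + a)) has_vector_derivative w) (at s)" if "(f has_vector_derivative w) (at (s + a))"
    for f and a s :: real
  proof -
    have "((\<lambda>u. u + a) has_vector_derivative 1) (at s)" by (auto intro!: derivative_eq_intros)
    from vector_diff_chain_at[OF this that] show ?thesis by (simp add: o_def)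
  qed
  from translate[of f s a] translate[of "\<lambda>u. f (u + a)" "s + a" "- a"] show ?thesis by auto
qed

lemma velocity_translate: "velocity A (\<lambda>u. \<gamma> (u + a)) s = velocity A \<gamma> (s + a)"
proof -
  have "vector_derivative (cmap c \<circ> (\<lambda>u. \<gamma> (u + a))) (at s) = vector_derivative (cmap c \<circ> \<gamma>) (at (s + a))"
    for c :: "('m, 'e) chart"
    using has_vector_derivative_translate[of "cmap c \<circ> \<gamma>" a _ s] by (simp add: vector_derivative_def o_def)
  then show ?thesis by (auto simp: velocity_def fun_eq_iff)
qed

lemma abs_continuous_curve_cong:
  assumes "abs_continuous_curve A t \<alpha>" "\<And>u. u \<in> {0..t} \<Longrightarrow> \<alpha> u = \<gamma> u"
  shows "abs_continuous_curve A t \<gamma>"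
  unfolding abs_continuous_curve_def
proof (intro conjI ballI allI impI)
  show "continuous_on {0..t} \<gamma>"
    using assms by (intro continuous_on_eq[of "{0..t}" \<alpha> \<gamma>]) (auto simp: abs_continuous_curve_def)
  fix c a b assume ab: "c \<in> A" "0 \<le> a" "a \<le> b" "b \<le> t" and "\<gamma> ` {a..b} \<subseteq> cdom c"
  then have "\<alpha> ` {a..b} \<subseteq> cdom c" using assms(2) by force
  then have "abs_continuous_on a b (cmap c \<circ> \<alpha>)" using assms(1) ab by (simp add: abs_continuous_curve_def)
  then show "abs_continuous_on a b (cmap c \<circ> \<gamma>)" by (rule abs_continuous_on_cong) (use ab assms(2) in auto)
qed

lemma abs_continuous_curve_join:
  assumes "s \<ge> 0" "t \<ge> 0" and \<alpha>: "abs_continuous_curve A s \<gamma>" and \<beta>: "abs_continuous_curve A t (\<lambda>u. \<gamma> (u + s))"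
  shows "abs_continuous_curve A (s + t) \<gamma>"
  unfolding abs_continuous_curve_def
proof (intro conjI ballI allI impI)
  have "continuous_on {0..t} (\<lambda>u. \<gamma> (u + s))" using \<beta> by (simp add: abs_continuous_curve_def)
  then have "continuous_on {s..s + t} (\<lambda>u. \<gamma> (u - s + s))"
    by (rule continuous_on_compose2[where f = "\<lambda>u. u - s"]) (auto intro: continuous_intros)
  moreover have "continuous_on {0..s} \<gamma>" using \<alpha> by (simp add: abs_continuous_curve_def)
  moreover have "{0..s + t} = {0..s} \<union> {s..s + t}" using assms(1,2) by auto
  ultimately show "continuous_on {0..s + t} \<gamma>" by (simp add: continuous_on_closed_Un)
next
  fix d a b assume d: "d \<in> A" and ab: "0 \<le> a" "a \<le> b" "b \<le> s + t" and im: "\<gamma> ` {a..b} \<subseteq> cdom d"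
  have left: "abs_continuous_on a' b' (cmap d \<circ> \<gamma>)" if "a \<le> a'" "a' \<le> b'" "b' \<le> b" "b' \<le> s" for a' b'
  proof -
    have "\<gamma> ` {a'..b'} \<subseteq> cdom d" using im that by (force simp: image_subset_iff)
    then show ?thesis using \<alpha> d that ab unfolding abs_continuous_curve_def by auto
  qed
  have right: "abs_continuous_on a' b' (cmap d \<circ> \<gamma>)" if "a \<le> a'" "a' \<le> b'" "b' \<le> b" "s \<le> a'" for a' b'
  proof -
    have "(\<lambda>u. \<gamma> (u + s)) ` {a' - s..b' - s} \<subseteq> cdom d" using im that by (force simp: image_subset_iff)
    moreover have "0 \<le> a' - s" "a' - s \<le> b' - s" "b' - s \<le> t" using that ab by auto
    ultimately have "abs_continuous_on (a' - s) (b' - s) (cmap d \<circ> (\<lambda>u. \<gamma> (u + s)))"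
      using \<beta> d unfolding abs_continuous_curve_def by blast
    from abs_continuous_on_shift[OF this, of s] show ?thesis by (simp add: o_def)
  qed
  consider "b \<le> s" | "s \<le> a" | "a \<le> s" "s \<le> b" by linarith
  then show "abs_continuous_on a b (cmap d \<circ> \<gamma>)"
    using left[of a b] right[of a b] abs_continuous_on_join[OF left[of a s] right[of s b]] ab by cases auto
qed

lemma absolutely_integrable_translate:
  fixes q :: "real \<Rightarrow> real"
  assumes "q absolutely_integrable_on {0..t}"
  shows "(\<lambda>u. q (u - s)) absolutely_integrable_on {s..s + t}" "integral {s..s + t} (\<lambda>u. q (u - s)) = integral {0..t} q"
proof -
  have shift: "((\<lambda>u. p (u - s)) has_integral J) {s..s + t}" if "(p has_integral J) {0..t}" for p :: "real \<Rightarrow> real" and J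
    using has_integral_shift_real_ivl[OF that, of "- s"] by (simp add: add.commute)
  show "(\<lambda>u. q (u - s)) absolutely_integrable_on {s..s + t}"
    using assms shift[of q] shift[of "\<lambda>u. norm (q u)"] unfolding absolutely_integrable_on_def integrable_on_def by blast
  show "integral {s..s + t} (\<lambda>u. q (u - s)) = integral {0..t} q"
    using assms by (intro integral_unique shift integrable_integral) (simp add: absolutely_integrable_on_def)
qed

lemma absolutely_integrable_join:
  fixes f p q :: "real \<Rightarrow> real"
  assumes "0 \<le> s" "0 \<le> t" and p: "p absolutely_integrable_on {0..s}" and q: "q absolutely_integrable_on {0..t}"
    and f: "\<And>u. u \<in> {0<..<s} \<Longrightarrow> f u = p u" "\<And>u. u \<in> {0<..<t} \<Longrightarrow> f (u + s) = q u"
  shows "f absolutely_integrable_on {0..s + t}" "integral {0..s + t} f = integral {0..s} p + integral {0..t} q"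
proof -
  have neg: "negligible {0, s}" "negligible {s, s + t}" by (auto intro: negligible_finite)
  have left: "f u = p u" if "u \<in> {0..s} - {0, s}" for u using that f(1) by auto
  have right: "f u = q (u - s)" if "u \<in> {s..s + t} - {s, s + t}" for u using that f(2)[of "u - s"] by auto
  note q' = absolutely_integrable_translate[OF q, of s]
  show ai: "f absolutely_integrable_on {0..s + t}"
    using assms(1,2) absolutely_integrable_spike[OF p neg(1) left] absolutely_integrable_spike[OF q'(1) neg(2) right]
    by (intro absolutely_integrable_on_combine[of 0 s f "s + t"]) auto
  have "integral {0..s + t} f = integral {0..s} f + integral {s..s + t} f"
    using assms(1,2) ai by (intro Henstock_Kurzweil_Integration.integral_combine[symmetric]) (auto simp: absolutely_integrable_on_def)
  then show "integral {0..s + t} f = integral {0..s} p + integral {0..t} q"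
    using integral_spike[OF neg(1), of "{0..s}" p f] integral_spike[OF neg(2), of "{s..s + t}" "\<lambda>u. q (u - s)" f] left right q'(2)
    by simp
qed

lemma reach_trans:
  assumes "reach s x y k" "reach t y z l" and st: "s \<ge> 0" "t \<ge> 0"
  shows "reach (s + t) x z (k + l)"
proof -
  obtain \<alpha> where \<alpha>: "abs_continuous_curve A s \<alpha>" "\<alpha> 0 = x" "\<alpha> s = y"
    "L_along \<alpha> absolutely_integrable_on {0..s}" "integral {0..s} (L_along \<alpha>) < k"
    using reachE[OF assms(1)] by blast
  obtain \<beta> where \<beta>: "abs_continuous_curve A t \<beta>" "\<beta> 0 = y" "\<beta> t = z"
    "L_along \<beta> absolutely_integrable_on {0..t}" "integral {0..t} (L_along \<beta>) < l"
    using reachE[OF assms(2)] by blast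
  define \<gamma> where "\<gamma> u = (if u \<le> s then \<alpha> u else \<beta> (u - s))" for u
  have left: "\<gamma> u = \<alpha> u" if "u \<le> s" for u using that by (simp add: \<gamma>_def)
  have right: "\<gamma> (u + s) = \<beta> u" if "u \<ge> 0" for u using that \<alpha>(3) \<beta>(2) by (cases "u = 0") (auto simp: \<gamma>_def)
  have "abs_continuous_curve A (s + t) \<gamma>"
    using left right by (intro abs_continuous_curve_join[OF st] abs_continuous_curve_cong[OF \<alpha>(1)] abs_continuous_curve_cong[OF \<beta>(1)]) auto
  moreover have "L_along \<gamma> u = L_along \<alpha> u" if "u \<in> {0<..<s}" for u
  proof -
    have "\<forall>\<^sub>F u in nhds u. \<gamma> u = \<alpha> u"
      using that left by (intro eventually_mono[OF eventually_nhds_in_open[of "{0<..<s}"]]) auto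
    then show ?thesis using that left by (simp add: velocity_cong)
  qed
  moreover have "L_along \<gamma> (u + s) = L_along \<beta> u" if "u \<in> {0<..<t}" for u
  proof -
    have "\<forall>\<^sub>F u in nhds u. \<gamma> (u + s) = \<beta> u"
      using that right by (intro eventually_mono[OF eventually_nhds_in_open[of "{0<..<t}"]]) auto
    from velocity_cong[OF this] show ?thesis using that right by (simp add: velocity_translate)
  qed
  ultimately show ?thesis
    using absolutely_integrable_join[OF st \<alpha>(4) \<beta>(4), of "L_along \<gamma>"] left[of 0] right[of t] st \<alpha> \<beta>
    by (intro reachI[of _ \<gamma>]) (auto simp: add.commute)
qed

subsection \<open>Short curves\<close>

lemma reach_line_eventually:
  assumes c: "c \<in> A" "z \<in> cimage c" and "\<eta> > 0"
  shows "\<forall>\<^sub>F r in at_right 0. z - r *\<^sub>R v \<in> cimage c \<and> reach r (cinv c (z - r *\<^sub>R v)) (cinv c z) (r * (L_loc c z v + \<eta>))"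
proof -
  obtain s where s: "s > 0" "cball z s \<subseteq> cimage c" using open_cimage[OF c(1)] c(2) by (meson open_contains_cball)
  obtain \<delta> where \<delta>: "\<delta> > 0" "\<And>y y' v' v''. y \<in> cball z s \<Longrightarrow> y' \<in> cball z s \<Longrightarrow> norm v' \<le> norm v \<Longrightarrow> norm v'' \<le> norm v
    \<Longrightarrow> dist y y' < \<delta> \<Longrightarrow> dist v' v'' < \<delta> \<Longrightarrow> L_loc c y v' \<le> L_loc c y' v'' + \<eta> / 2"
    using L_loc_uniform[OF c(1) compact_cball s(2) half_gt_zero[OF \<open>\<eta> > 0\<close>]] by blast
  define m where "m = min s \<delta> / (norm v + 1)"
  have "m > 0" using s \<delta> by (simp add: m_def add_nonneg_pos)
  then have "\<forall>\<^sub>F r in at_right 0. r < m" by (intro eventually_at_rightI[of 0 m]) auto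
  then show ?thesis using eventually_at_right_less[of 0]
  proof eventually_elim
    case (elim r)
    have "r * (norm v + 1) < min s \<delta>"
      using elim by (simp add: m_def pos_less_divide_eq add_nonneg_pos del: min_less_iff_conj)
    moreover have "r * norm v \<le> r * (norm v + 1)" using elim by (intro mult_left_mono) auto
    ultimately have rv: "r * norm v < s" "r * norm v < \<delta>" by auto
    have seg: "z - r *\<^sub>R v + t *\<^sub>R v \<in> cball z s" "dist (z - r *\<^sub>R v + t *\<^sub>R v) z < \<delta>" if "t \<in> {0..r}" for t
    proof -
      have "z - r *\<^sub>R v + t *\<^sub>R v - z = - ((r - t) *\<^sub>R v)" by (simp add: algebra_simps)
      then have "dist (z - r *\<^sub>R v + t *\<^sub>R v) z = (r - t) * norm v"
        unfolding dist_norm using that by (metis abs_of_nonneg atLeastAtMost_iff diff_ge_0_iff_ge norm_minus_cancel norm_scaleR)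
      also have "\<dots> \<le> r * norm v" using that by (intro mult_right_mono) auto
      finally show "z - r *\<^sub>R v + t *\<^sub>R v \<in> cball z s" "dist (z - r *\<^sub>R v + t *\<^sub>R v) z < \<delta>"
        using rv by (auto simp: dist_commute)
    qed
    have "reach r (cinv c (z - r *\<^sub>R v)) (cinv c (z - r *\<^sub>R v + r *\<^sub>R v)) (r * (L_loc c z v + \<eta>))"
    proof (rule reach_chart_line[OF c(1) _ refl])
      show "z - r *\<^sub>R v + t *\<^sub>R v \<in> cimage c" if "t \<in> {0..r}" for t using seg(1)[OF that] s(2) by blast
      show "L_loc c (z - r *\<^sub>R v + t *\<^sub>R v) v \<le> L_loc c z v + \<eta> / 2" if "t \<in> {0..r}" for t
        using seg[OF that] \<delta>(1) s(1) by (intro \<delta>(2)) auto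
      show "r * (L_loc c z v + \<eta> / 2) < r * (L_loc c z v + \<eta>)" using elim \<open>\<eta> > 0\<close> by simp
    qed (use elim in simp)
    moreover have "z - r *\<^sub>R v \<in> cimage c" using seg(1)[of 0] elim s(2) by auto
    ultimately show ?case by simp
  qed
qed

lemma reach_rest:
  obtains k0 where "\<And>r. r > 0 \<Longrightarrow> reach r x x (r * k0)"
proof -
  obtain c where c: "c \<in> A" "x \<in> cdom c" using chart_ex by blast
  let ?z = "cmap c x"
  have "reach r x x (r * (L_loc c ?z 0 + 1))" if "r > 0" for r
    using reach_chart_line[OF c(1) _ refl, of r ?z 0 "L_loc c ?z 0" "r * (L_loc c ?z 0 + 1)"] that c cinv_cmap[OF c] by simp
  then show thesis using that by blast
qed

lemma reach_local:
  obtains c \<rho> C where "c \<in> A" "x \<in> cdom c" "\<rho> > 0" "cball (cmap c x) \<rho> \<subseteq> cimage c" "C > 0"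
    "\<And>y z. y \<in> ball (cmap c x) \<rho> \<Longrightarrow> z \<in> ball (cmap c x) \<rho> \<Longrightarrow> y \<noteq> z
      \<Longrightarrow> reach (dist y z) (cinv c y) (cinv c z) (C * dist y z)"
proof -
  obtain c \<rho> where c: "c \<in> A" "x \<in> cdom c" "\<rho> > 0" "cball (cmap c x) \<rho> \<subseteq> cimage c"
    using chart_ball_ex by blast
  obtain B where B: "\<And>z v. z \<in> cball (cmap c x) \<rho> \<Longrightarrow> norm v \<le> 1 \<Longrightarrow> L_loc c z v \<le> B"
    using L_loc_bounded_above[OF c(1) compact_cball c(4)] by blast
  define C where "C = \<bar>B\<bar> + 1"
  show thesis
  proof (rule that[OF c])
    show "C > 0" by (simp add: C_def)
    fix y z assume yz: "y \<in> ball (cmap c x) \<rho>" "z \<in> ball (cmap c x) \<rho>" "y \<noteq> z"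
    define r where "r = dist y z"
    define v where "v = (1 / r) *\<^sub>R (z - y)"
    have r: "r > 0" using yz by (simp add: r_def)
    have v: "norm v = 1" "y + r *\<^sub>R v = z" using r by (auto simp: v_def r_def dist_norm norm_minus_commute)
    have seg: "y + t *\<^sub>R v \<in> ball (cmap c x) \<rho>" if "t \<in> {0..r}" for t
    proof -
      have "y + t *\<^sub>R v = (1 - t / r) *\<^sub>R y + (t / r) *\<^sub>R z" using r by (simp add: v_def algebra_simps)
      moreover have "0 \<le> t / r" "t / r \<le> 1" using that r by auto
      ultimately show ?thesis
        using convexD_alt[OF convex_ball yz(1,2), of "t / r"] by simp
    qed
    have "reach r (cinv c y) (cinv c (y + r *\<^sub>R v)) (C * r)"
    proof (rule reach_chart_line[OF c(1) _ refl])
      show "y + t *\<^sub>R v \<in> cimage c" if "t \<in> {0..r}" for t using seg[OF that] c(4) by auto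
      show "L_loc c (y + t *\<^sub>R v) v \<le> B" if "t \<in> {0..r}" for t using seg[OF that] v by (intro B) auto
      show "r * B < C * r" using r by (simp add: C_def)
    qed (use r in simp)
    then show "reach (dist y z) (cinv c y) (cinv c z) (C * dist y z)" by (simp only: v(2) r_def[symmetric])
  qed
qed

lemma reach_connected: "\<exists>r>0. \<exists>k. reach r x y k"
proof -
  define joined where "joined p q \<longleftrightarrow> (\<exists>r>0. \<exists>k. reach r p q k) \<and> (\<exists>r>0. \<exists>k. reach r q p k)" for p q
  have "joined x y"
  proof (rule connected_equivalence_relation[OF connected_M])
    show "joined p r" if "joined p q" "joined q r" for p q r
      using that reach_trans unfolding joined_def by (meson add_pos_pos less_imp_le)
    fix p
    obtain c \<rho> C where c: "c \<in> A" "p \<in> cdom c" "\<rho> > 0" "cball (cmap c p) \<rho> \<subseteq> cimage c"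
      and reach: "\<And>y z. y \<in> ball (cmap c p) \<rho> \<Longrightarrow> z \<in> ball (cmap c p) \<rho> \<Longrightarrow> y \<noteq> z
        \<Longrightarrow> reach (dist y z) (cinv c y) (cinv c z) (C * dist y z)"
      by (rule reach_local) (rule that)
    have p: "cinv c (cmap c p) = p" "cmap c p \<in> ball (cmap c p) \<rho>" using cinv_cmap[OF c(1,2)] c(3) by auto
    have "joined p (cinv c z)" if "z \<in> ball (cmap c p) \<rho>" for z
    proof (cases "z = cmap c p")
      case True
      obtain k where "\<And>r. r > 0 \<Longrightarrow> reach r p p (r * k)" using reach_rest by blast
      then show ?thesis using True p(1) zero_less_one unfolding joined_def by metis
    next
      case False
      then show ?thesis
        using reach[OF that p(2)] reach[OF p(2) that] p(1) unfolding joined_def by (metis zero_less_dist_iff)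
    qed
    moreover have "open (cinv c ` ball (cmap c p) \<rho>)" using c(4) by (intro open_cinv_image[OF c(1)]) auto
    moreover have "p \<in> cinv c ` ball (cmap c p) \<rho>" using p by (metis image_eqI)
    ultimately show "\<exists>T. openin (top_of_set UNIV) T \<and> p \<in> T \<and> (\<forall>q\<in>T. joined p q)"
      by (intro exI[of _ "cinv c ` ball (cmap c p) \<rho>"]) auto
  qed (auto simp: joined_def)
  then show ?thesis by (simp add: joined_def)
qed

lemma continuous_on_manifold_iff:
  fixes u :: "'m \<Rightarrow> 'b::topological_space"
  assumes "\<And>x. \<exists>c\<in>A. x \<in> cdom c \<and> isCont (u \<circ> cinv c) (cmap c x)"
  shows "continuous_on UNIV u"
proof (rule continuous_at_imp_continuous_on, rule ballI)
  fix x
  obtain c where c: "c \<in> A" "x \<in> cdom c" "isCont (u \<circ> cinv c) (cmap c x)" using assms by blast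
  have "isCont (cmap c) x"
    using cont_cmap[OF c(1)] open_cdom[OF c(1)] c(2) by (simp add: continuous_on_eq_continuous_at)
  from isCont_o2[OF this c(3)] have "isCont (\<lambda>y. u (cinv c (cmap c y))) x" by (simp add: o_def)
  moreover have "\<forall>\<^sub>F y in nhds x. u (cinv c (cmap c y)) = u y"
    using open_cdom[OF c(1)] c(2) cinv_cmap[OF c(1)] by (intro eventually_mono[OF eventually_nhds_in_open]) auto
  ultimately show "isCont u x" by (simp add: isCont_cong)
qed

lemma continuous_if_reach_bound:
  fixes u :: "'m \<Rightarrow> real"
  assumes "r0 > 0" "B \<ge> 0" and bound: "\<And>r x y k. 0 < r \<Longrightarrow> r \<le> r0 \<Longrightarrow> reach r x y k \<Longrightarrow> u y - u x \<le> B * (\<bar>k\<bar> + r)"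
  shows "continuous_on UNIV u"
proof (rule continuous_on_manifold_iff)
  fix x
  obtain c \<rho> C where c: "c \<in> A" "x \<in> cdom c" "\<rho> > 0" "cball (cmap c x) \<rho> \<subseteq> cimage c" "C > 0"
    "\<And>p q. p \<in> ball (cmap c x) \<rho> \<Longrightarrow> q \<in> ball (cmap c x) \<rho> \<Longrightarrow> p \<noteq> q
      \<Longrightarrow> reach (dist p q) (cinv c p) (cinv c q) (C * dist p q)"
    by (rule reach_local) (rule that)
  define \<rho>' where "\<rho>' = min \<rho> (r0 / 2)"
  have \<rho>': "\<rho>' > 0" "\<rho>' \<le> \<rho>" "\<rho>' \<le> r0 / 2" using c \<open>r0 > 0\<close> by (auto simp: \<rho>'_def)
  have le: "u (cinv c q) - u (cinv c p) \<le> B * (C + 1) * dist p q"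
    if "p \<in> ball (cmap c x) \<rho>'" "q \<in> ball (cmap c x) \<rho>'" for p q
  proof (cases "p = q")
    case False
    have "dist p q < r0" using that \<rho>' dist_triangle[of p q "cmap c x"] by (simp add: dist_commute)
    then have "u (cinv c q) - u (cinv c p) \<le> B * (\<bar>C * dist p q\<bar> + dist p q)"
      using that \<rho>' False by (intro bound c(6)) auto
    then show ?thesis using c(5) by (simp add: abs_mult algebra_simps)
  qed simp
  have "(B * (C + 1))-lipschitz_on (ball (cmap c x) \<rho>') (u \<circ> cinv c)"
  proof (rule lipschitz_onI)
    fix p q assume pq: "p \<in> ball (cmap c x) \<rho>'" "q \<in> ball (cmap c x) \<rho>'"
    show "dist ((u \<circ> cinv c) p) ((u \<circ> cinv c) q) \<le> B * (C + 1) * dist p q"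
      using le[OF pq] le[OF pq(2,1)] by (simp add: dist_real_def abs_le_iff dist_commute[of q p])
  qed (use \<open>B \<ge> 0\<close> c(5) in auto)
  from lipschitz_on_continuous_on[OF this] have "isCont (u \<circ> cinv c) (cmap c x)"
    using \<rho>'(1) by (simp add: continuous_on_eq_continuous_at del: o_apply)
  then show "\<exists>c\<in>A. x \<in> cdom c \<and> isCont (u \<circ> cinv c) (cmap c x)" using c(1,2) by blast
qed

subsection \<open>The critical value\<close>

abbreviation "cG \<equiv> critical_value A G"

lemma critical_C1:
  assumes "e > 0" obtains f where "f \<in> C1" "\<And>x. G x (differential A f x) \<le> cG + e"
proof -
  have "C1 \<noteq> {}" using C1_const by blast
  then obtain f where f: "f \<in> C1" "(SUP x. G x (differential A f x)) < cG + e"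
    using cInf_lessD[of "(\<lambda>f. SUP x. G x (differential A f x)) ` C1" "cG + e"] \<open>e > 0\<close>
    by (auto simp: critical_value_def)
  have "bdd_above (range (\<lambda>x. G x (differential A f x)))"
    using continuous_bounded[OF G_differential_continuous[OF f(1)]] by (metis abs_le_D1 bdd_aboveI2)
  then have "G x (differential A f x) \<le> cG + e" for x
    using cSUP_upper[of x UNIV "\<lambda>x. G x (differential A f x)"] f(2) by simp
  then show thesis using that f(1) by blast
qed

lemma critical_le:
  assumes "f \<in> C1" "\<And>x. G x (differential A f x) \<le> a" shows "cG \<le> a"
proof -
  have "bdd_below ((\<lambda>f. SUP x. G x (differential A f x)) ` C1)"
  proof (rule bdd_belowI2)
    fix h assume h: "h \<in> C1"
    define x0 :: 'm where "x0 = undefined"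
    have "0 \<le> L x0 (\<lambda>_. 0) + G x0 (differential A h x0)"
      using differential_le_L[OF h zero_in_tangent_space, of x0] differential_zero[OF h, of x0] by simp
    moreover have "bdd_above (range (\<lambda>x. G x (differential A h x)))"
      using continuous_bounded[OF G_differential_continuous[OF h]] by (metis abs_le_D1 bdd_aboveI2)
    then have "G x0 (differential A h x0) \<le> (SUP x. G x (differential A h x))" by (intro cSUP_upper) auto
    ultimately show "- L x0 (\<lambda>_. 0) \<le> (SUP x. G x (differential A h x))" by linarith
  qed
  then have "cG \<le> (SUP x. G x (differential A f x))"
    unfolding critical_value_def by (rule cINF_lower[OF _ assms(1)])
  also have "\<dots> \<le> a" using assms(2) by (intro cSUP_least) auto
  finally show ?thesis .
qed

lemma L_zero_ge: "L x (\<lambda>_. 0) + cG \<ge> 0"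
proof (rule field_le_epsilon)
  fix e :: real assume "e > 0"
  obtain f where f: "f \<in> C1" "\<And>x. G x (differential A f x) \<le> cG + e" using critical_C1[OF \<open>e > 0\<close>] by blast
  then show "0 \<le> L x (\<lambda>_. 0) + cG + e"
    using differential_le_L[OF f(1) zero_in_tangent_space, of x] differential_zero[OF f(1), of x] f(2)[of x] by linarith
qed

subsection \<open>Subsolutions with a margin\<close>

lemma continuous_map_cotangent_bundle_fst: "continuous_map (cotangent_bundle A) euclidean fst"
proof -
  have "openin (cotangent_bundle A) {p \<in> topspace (cotangent_bundle A). fst p \<in> U}" if "open U" for U
    unfolding openin_cotangent_bundle[OF atlas]
  proof (intro conjI ballI)
    fix c assume c: "c \<in> A"
    have "{(z, w). z \<in> cimage c \<and> (cinv c z, covec_of A c (cinv c z) w) \<in> {p \<in> topspace (cotangent_bundle A). fst p \<in> U}}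
        = (cimage c \<inter> cinv c -` U) \<times> UNIV"
      using covec_of_in[OF c cinv_in[OF c]] by (auto simp: topspace_cotangent_bundle)
    then show "open {(z, w). z \<in> cimage c \<and> (cinv c z, covec_of A c (cinv c z) w) \<in> {p \<in> topspace (cotangent_bundle A). fst p \<in> U}}"
      using open_Times[OF open_cinv_vimage[OF c that] open_UNIV] by simp
  qed (auto simp: topspace_cotangent_bundle)
  then show ?thesis unfolding continuous_map by simp
qed

lemma hamiltonian_add:
  assumes b: "continuous_on UNIV b"
  shows "hamiltonian A g (\<lambda>x p. G x p + b x)"
proof (unfold_locales)
  have "continuous_map euclidean euclideanreal b" using b by simp
  from continuous_map_compose[OF continuous_map_cotangent_bundle_fst this]
  have "continuous_map (cotangent_bundle A) euclideanreal (\<lambda>p. b (fst p))" by (simp add: o_def)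
  from continuous_map_add[OF G_continuous[unfolded continuous_hamiltonian_def] this]
  show "continuous_hamiltonian A (\<lambda>x p. G x p + b x)"
    unfolding continuous_hamiltonian_def by (simp add: case_prod_unfold)
next
  show "convex_hamiltonian A (\<lambda>x p. G x p + b x)"
    unfolding convex_hamiltonian_def
  proof (intro allI ballI)
    fix x p q and t :: real assume pq: "p \<in> cotangent_space A x" "q \<in> cotangent_space A x" "t \<in> {0..1}"
    have "G x (\<lambda>v. (1 - t) * p v + t * q v) \<le> (1 - t) * G x p + t * G x q"
      using G_convex pq unfolding convex_hamiltonian_def by blast
    then show "G x (\<lambda>v. (1 - t) * p v + t * q v) + b x \<le> (1 - t) * (G x p + b x) + t * (G x q + b x)"
      by (simp add: algebra_simps)
  qed
  show "superlinear_hamiltonian A g (\<lambda>x p. G x p + b x)"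
    unfolding superlinear_hamiltonian_def
  proof (intro allI)
    fix x K
    obtain R where R: "\<And>p. p \<in> cotangent_space A x \<Longrightarrow> conorm A g x p > R \<Longrightarrow> G x p / conorm A g x p \<ge> K + 1"
      using G_superlinear unfolding superlinear_hamiltonian_def by blast
    have "(G x p + b x) / conorm A g x p \<ge> K" if p: "p \<in> cotangent_space A x" "conorm A g x p > max R \<bar>b x\<bar>" for p
    proof -
      have "b x / conorm A g x p \<ge> - 1" using p(2) by (simp add: divide_simps) linarith
      then show ?thesis using R[OF p(1)] p(2) by (simp add: add_divide_distrib)
    qed
    then show "\<exists>R. \<forall>p\<in>cotangent_space A x. conorm A g x p > R \<longrightarrow> (G x p + b x) / conorm A g x p \<ge> K" by blast
  qed
qed

lemma subsolution_if_increments: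
  assumes cont: "continuous_on UNIV u"
    and inc: "\<And>c x v \<eta>. c \<in> A \<Longrightarrow> x \<in> cdom c \<Longrightarrow> \<eta> > 0 \<Longrightarrow> \<forall>\<^sub>F r in at_right 0. cmap c x - r *\<^sub>R v \<in> cimage c \<and>
      u x - u (cinv c (cmap c x - r *\<^sub>R v)) \<le> r * (L_loc c (cmap c x) v + a - b x + \<eta>)"
  shows "viscosity_subsolution A (\<lambda>x p. G x p + b x) a u"
  unfolding viscosity_subsolution_def
proof (intro conjI cont ballI allI impI)
  fix f x assume f: "f \<in> C1" and touch: "\<forall>\<^sub>F y in nhds x. u y - f y \<le> u x - f x"
  obtain c where c: "c \<in> A" "x \<in> cdom c" using chart_ex by blast
  have z: "cmap c x \<in> cimage c" using c by blast
  have "chart_gradient f c x \<bullet> v \<le> L_loc c (cmap c x) v + (a - b x)" for v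
  proof (rule field_le_epsilon)
    fix \<eta> :: real assume "\<eta> > 0"
    have "((\<lambda>z. - (f \<circ> cinv c) z) has_derivative (\<lambda>h. - (chart_gradient f c x \<bullet> h))) (at (cmap c x))"
      using has_gradient_onD[OF C1D[OF f c(1)] z] by (rule has_derivative_minus)
    then have der: "((\<lambda>z. - (f \<circ> cinv c) z) has_derivative (\<lambda>h. (- chart_gradient f c x) \<bullet> h)) (at (cmap c x))" by simp
    have lim: "((\<lambda>r. cmap c x - r *\<^sub>R v) \<longlongrightarrow> cmap c x) (at_right 0)"
      by (rule tendsto_eq_intros | simp)+
    have "\<forall>\<^sub>F z in nhds (cmap c x). u (cinv c z) - f (cinv c z) \<le> u x - f x"
      by (rule eventually_cinv[OF c touch])
    then have "\<forall>\<^sub>F r in at_right 0. u (cinv c (cmap c x - r *\<^sub>R v)) - f (cinv c (cmap c x - r *\<^sub>R v)) \<le> u x - f x"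
      using lim by (rule eventually_compose_filterlim)
    then have "\<forall>\<^sub>F r in at_right 0. (\<lambda>z. - (f \<circ> cinv c) z) (cmap c x + r *\<^sub>R (- v)) - (\<lambda>z. - (f \<circ> cinv c) z) (cmap c x)
        \<le> r * (L_loc c (cmap c x) v + a - b x + \<eta>)"
      using inc[OF c \<open>\<eta> > 0\<close>, of v]
      by eventually_elim (simp add: cinv_cmap[OF c])
    from inner_derivative_le_if_increments_le[OF der this]
    show "chart_gradient f c x \<bullet> v \<le> L_loc c (cmap c x) v + (a - b x) + \<eta>" by simp
  qed
  then have "G_loc c (cmap c x) (chart_gradient f c x) \<le> a - b x" by (simp add: G_loc_le_iff[OF c(1) z])
  then show "G x (differential A f x) + b x \<le> a" by (simp add: G_differential[OF f c])
qed

subsection \<open>Dominated functions\<close>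

definition dominated :: "('m \<Rightarrow> real) \<Rightarrow> bool" where
  "dominated u \<longleftrightarrow> (\<forall>r>0. \<forall>x y k. reach r x y k \<longrightarrow> u y - u x \<le> k + cG * r)"

lemma dominatedD: "dominated u \<Longrightarrow> r > 0 \<Longrightarrow> reach r x y k \<Longrightarrow> u y - u x \<le> k + cG * r"
  by (simp add: dominated_def)

lemma cost_bound: "r > 0 \<Longrightarrow> k + cG * r \<le> (1 + \<bar>cG\<bar>) * (\<bar>k\<bar> + r)"
proof -
  assume "r > 0"
  have "cG * r \<le> \<bar>cG\<bar> * r" using \<open>r > 0\<close> by (intro mult_right_mono) auto
  moreover have "\<bar>cG\<bar> * \<bar>k\<bar> \<ge> 0" by simp
  ultimately show ?thesis using \<open>r > 0\<close> abs_ge_self[of k] by (simp only: ring_distribs mult_1_left)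
qed

lemma dominated_continuous:
  assumes "dominated u" shows "continuous_on UNIV u"
proof (rule continuous_if_reach_bound[of 1 "1 + \<bar>cG\<bar>"])
  fix r x y k assume "0 < (r::real)" "reach r x y k"
  then show "u y - u x \<le> (1 + \<bar>cG\<bar>) * (\<bar>k\<bar> + r)"
    using dominatedD[OF assms, of r x y k] cost_bound[of r k] by linarith
qed auto

lemma dominated_imp_subsolution:
  assumes "dominated u" shows "subsolution cG u"
proof -
  have "viscosity_subsolution A (\<lambda>x p. G x p + 0) cG u"
  proof (rule subsolution_if_increments[OF dominated_continuous[OF assms]])
    fix c x v and \<eta> :: real assume c: "c \<in> A" "x \<in> cdom c" and "\<eta> > 0"
    then have "cmap c x \<in> cimage c" by blast
    from reach_line_eventually[OF c(1) this \<open>\<eta> > 0\<close>, of v] eventually_at_right_less[of 0]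
    show "\<forall>\<^sub>F r in at_right 0. cmap c x - r *\<^sub>R v \<in> cimage c \<and>
      u x - u (cinv c (cmap c x - r *\<^sub>R v)) \<le> r * (L_loc c (cmap c x) v + cG - 0 + \<eta>)"
    proof eventually_elim
      case (elim r)
      then show ?case
        using dominatedD[OF assms, of r "cinv c (cmap c x - r *\<^sub>R v)" x "r * (L_loc c (cmap c x) v + \<eta>)"]
        by (simp add: cinv_cmap[OF c] algebra_simps)
    qed
  qed
  then show ?thesis by simp
qed

lemma subsolution_imp_dominated: "subsolution cG u \<Longrightarrow> dominated u"
  unfolding dominated_def using subsolution_reach[of cG u] by (simp add: less_imp_le)

subsection \<open>Finite time potentials and the Peierls barrier\<close>

definition potential :: "real \<Rightarrow> 'm \<Rightarrow> 'm \<Rightarrow> real" where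
  "potential s x y = Inf {k + cG * t |k t. t \<ge> s \<and> t > 0 \<and> reach t x y k}"

lemma potential_lower:
  obtains m where "\<And>t k. t > 0 \<Longrightarrow> reach t x y k \<Longrightarrow> m \<le> k + cG * t"
proof -
  obtain r l where r: "r > 0" "reach r y x l" using reach_connected by blast
  have "- (l + cG * r) \<le> k + cG * t" if t: "t > 0" "reach t x y k" for t k
  proof (rule field_le_epsilon)
    fix e :: real assume "e > 0"
    define \<epsilon> where "\<epsilon> = e / (t + r)"
    have \<epsilon>: "\<epsilon> > 0" "\<epsilon> * (t + r) = e" using \<open>e > 0\<close> t r by (auto simp: \<epsilon>_def)
    obtain f where f: "f \<in> C1" "\<And>x. G x (differential A f x) \<le> cG + \<epsilon>" using critical_C1[OF \<epsilon>(1)] by blast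
    have "f y - f x < k + (cG + \<epsilon>) * t" "f x - f y < l + (cG + \<epsilon>) * r"
      using C1_reach[OF f] t r by (auto simp: less_imp_le)
    then show "- (l + cG * r) \<le> k + cG * t + e" using \<epsilon>(2) by (simp add: algebra_simps)
  qed
  then show thesis using that by blast
qed

lemma potential_le: "t \<ge> s \<Longrightarrow> t > 0 \<Longrightarrow> reach t x y k \<Longrightarrow> potential s x y \<le> k + cG * t"
proof -
  assume t: "t \<ge> s" "t > 0" "reach t x y k"
  obtain m where m: "\<And>t k. t > 0 \<Longrightarrow> reach t x y k \<Longrightarrow> m \<le> k + cG * t" using potential_lower by blast
  show ?thesis unfolding potential_def
    by (rule cInf_lower) (use t m in \<open>auto intro!: bdd_belowI[of _ m]\<close>)
qed

lemma potential_set_nonempty: "\<exists>t k. t \<ge> s \<and> t > 0 \<and> reach t x y k"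
proof -
  obtain r l where r: "r > 0" "reach r x y l" using reach_connected by blast
  obtain k0 where "\<And>r. r > 0 \<Longrightarrow> reach r x x (r * k0)" using reach_rest by blast
  then have "reach (max s 1 + r) x y (max s 1 * k0 + l)" using r by (intro reach_trans) auto
  then show ?thesis using r(1) by (intro exI[of _ "max s 1 + r"] exI[of _ "max s 1 * k0 + l"]) auto
qed

lemma potential_lessD: "potential s x y < m \<Longrightarrow> \<exists>t k. t \<ge> s \<and> t > 0 \<and> reach t x y k \<and> k + cG * t < m"
  unfolding potential_def using cInf_lessD[of "{k + cG * t |k t. t \<ge> s \<and> t > 0 \<and> reach t x y k}" m] potential_set_nonempty[of s x y]
  by auto

lemma potential_greatest: "(\<And>t k. t \<ge> s \<Longrightarrow> t > 0 \<Longrightarrow> reach t x y k \<Longrightarrow> m \<le> k + cG * t) \<Longrightarrow> m \<le> potential s x y"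
  unfolding potential_def using potential_set_nonempty[of s x y] by (intro cInf_greatest) auto

lemma potential_mono: "s \<le> s' \<Longrightarrow> potential s x y \<le> potential s' x y"
  by (rule potential_greatest) (auto intro: potential_le)

lemma potential_step_right:
  assumes "r > 0" "reach r y y' l" shows "potential (s + r) x y' \<le> potential s x y + (l + cG * r)"
proof -
  have "potential (s + r) x y' - (l + cG * r) \<le> potential s x y"
  proof (rule potential_greatest)
    fix t k assume t: "t \<ge> s" "t > 0" "reach t x y k"
    have "potential (s + r) x y' \<le> (k + l) + cG * (t + r)"
      using t assms by (intro potential_le reach_trans) auto
    then show "potential (s + r) x y' - (l + cG * r) \<le> k + cG * t" by (simp add: algebra_simps)
  qed
  then show ?thesis by simp
qed

lemma potential_step_left:
  assumes "r > 0" "reach r x' x l" shows "potential (s + r) x' y \<le> (l + cG * r) + potential s x y"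
proof -
  have "potential (s + r) x' y - (l + cG * r) \<le> potential s x y"
  proof (rule potential_greatest)
    fix t k assume t: "t \<ge> s" "t > 0" "reach t x y k"
    have "reach (r + t) x' y (l + k)" using t assms by (intro reach_trans) auto
    then have "potential (s + r) x' y \<le> (l + k) + cG * (r + t)"
      using t assms by (intro potential_le) auto
    then show "potential (s + r) x' y - (l + cG * r) \<le> k + cG * t" by (simp add: algebra_simps)
  qed
  then show ?thesis by simp
qed

lemma potential_dominated: "dominated (potential s x)"
  unfolding dominated_def
proof (intro allI impI)
  fix r y y' l assume "r > (0::real)" "reach r y y' l"
  then show "potential s x y' - potential s x y \<le> l + cG * r" using potential_step_right[of r y y' l s x] potential_mono[of s "s + r" x y'] by simp
qed

lemma dominated_le_potential: "dominated u \<Longrightarrow> u y - u x \<le> potential s x y"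
  by (rule potential_greatest) (rule dominatedD)

definition potential_integral :: "real \<Rightarrow> 'm \<Rightarrow> 'm \<Rightarrow> real" where
  "potential_integral T x y = integral {0..T} (\<lambda>\<tau>. potential \<tau> x y)"

lemma potential_integrable: "(\<lambda>\<tau>. potential (\<tau> + r) x y) integrable_on {a..b}"
  by (intro integrable_on_mono_on mono_onI potential_mono) simp

text \<open>
  The time average of the potentials is a subsolution with a margin: shifting the time in a
  concatenation gains the difference of the potentials at both ends of the time interval.
\<close>

lemma potential_integral_step:
  assumes r: "0 < r" "r \<le> 1" "r \<le> e" and N: "N \<ge> 0" and R: "reach r y y' k"
  shows "potential_integral (N + 1) x y' - potential_integral (N + 1) x y
    \<le> (N + 1 - r) * (k + cG * r) - r * (potential N x y - potential e x y')"
proof -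
  note int = potential_integrable[of 0, simplified]
  let ?I = "\<lambda>a b y. integral {a..b} (\<lambda>\<tau>. potential \<tau> x y)"
  have "potential_integral (N + 1) x y' = ?I 0 r y' + ?I r (N + 1) y'"
    unfolding potential_integral_def using r N Henstock_Kurzweil_Integration.integral_combine[OF _ _ int, of 0 r "N + 1"] by simp
  moreover have "?I 0 r y' \<le> integral {0..r} (\<lambda>\<tau>. potential e x y')"
    using r by (intro integral_le int potential_mono) auto
  moreover have "?I r (N + 1) y' = integral {0..N + 1 - r} (\<lambda>\<tau>. potential (\<tau> + r) x y')"
    using has_integral_shift_real_ivl[OF integrable_integral[OF int[of x y' r "N + 1"]], of r]
    by (intro integral_unique[symmetric]) simp
  moreover have "\<dots> \<le> integral {0..N + 1 - r} (\<lambda>\<tau>. potential \<tau> x y + (k + cG * r))"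
    using potential_step_right[OF r(1) R] by (intro integral_le potential_integrable integrable_add int) auto
  moreover have "\<dots> = ?I 0 (N + 1 - r) y + (N + 1 - r) * (k + cG * r)"
    using r N by (subst integral_add[OF int]) auto
  moreover have "potential_integral (N + 1) x y = ?I 0 (N + 1 - r) y + ?I (N + 1 - r) (N + 1) y"
    unfolding potential_integral_def
    using r N Henstock_Kurzweil_Integration.integral_combine[OF _ _ int, of 0 "N + 1 - r" "N + 1"] by simp
  moreover have "integral {N + 1 - r..N + 1} (\<lambda>\<tau>. potential N x y) \<le> ?I (N + 1 - r) (N + 1) y"
    using r by (intro integral_le int potential_mono) auto
  ultimately show ?thesis using r(1) by (simp add: right_diff_distrib)
qed

lemma potential_integral_continuous:
  assumes "0 < e" "e \<le> N" shows "continuous_on UNIV (potential_integral (N + 1) x)"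
proof (rule continuous_if_reach_bound)
  show "min 1 e > 0" "0 \<le> (N + 1) * (1 + \<bar>cG\<bar>)" using assms by auto
  fix r y y' k assume r: "0 < r" "r \<le> min 1 e" and R: "reach r y y' k"
  have "potential e x y' \<le> potential e x y + (k + cG * r)"
    using potential_step_right[OF r(1) R, of e x] potential_mono[of e "e + r" x y'] r by simp
  then have "- (potential N x y - potential e x y') \<le> k + cG * r" using potential_mono[OF assms(2), of x y] by linarith
  then have "r * (- (potential N x y - potential e x y')) \<le> r * (k + cG * r)" using r by (intro mult_left_mono) auto
  then have "potential_integral (N + 1) x y' - potential_integral (N + 1) x y \<le> (N + 1) * (k + cG * r)"
    using potential_integral_step[OF r(1) _ _ _ R, of e N x] r assms by (simp add: algebra_simps)
  also have "\<dots> \<le> (N + 1) * ((1 + \<bar>cG\<bar>) * (\<bar>k\<bar> + r))"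
    using cost_bound[OF r(1), of k] assms by (intro mult_left_mono) auto
  finally show "potential_integral (N + 1) x y' - potential_integral (N + 1) x y \<le> (N + 1) * (1 + \<bar>cG\<bar>) * (\<bar>k\<bar> + r)"
    by (simp only: mult.assoc)
qed

lemma potential_average_step_eventually:
  assumes e: "0 < e" "e \<le> N" and c: "c \<in> A" "y \<in> cdom c" and "\<eta> > 0"
  fixes v defines "y' \<equiv> \<lambda>r. cinv c (cmap c y - r *\<^sub>R v)"
  shows "\<forall>\<^sub>F r in at_right 0. cmap c y - r *\<^sub>R v \<in> cimage c \<and>
    potential_integral (N + 1) x y - potential_integral (N + 1) x (y' r)
      \<le> r * ((N + 1) * (L_loc c (cmap c y) v + cG + \<eta>) - (potential N x y - potential e x y))"
proof -
  define k where "k = L_loc c (cmap c y) v + \<eta> / 3 + cG"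
  have z: "cmap c y \<in> cimage c" using c by blast
  have lim: "((\<lambda>r. cmap c y - r *\<^sub>R v) \<longlongrightarrow> cmap c y) (at_right 0)"
    by (rule tendsto_eq_intros | simp)+
  have "isCont (potential N x) y" using dominated_continuous[OF potential_dominated] by (simp add: continuous_on_eq_continuous_at)
  then have "\<forall>\<^sub>F y' in nhds y. potential N x y' > potential N x y - (N + 1) * (\<eta> / 3)"
    using \<open>\<eta> > 0\<close> e by (intro order_tendstoD(1)[of _ "potential N x y"]) (auto simp: isCont_def tendsto_at_iff_tendsto_nhds)
  from eventually_compose_filterlim[OF eventually_cinv[OF c this] lim]
  have near: "\<forall>\<^sub>F r in at_right 0. potential N x (y' r) > potential N x y - (N + 1) * (\<eta> / 3)" by (simp add: y'_def)
  have "((\<lambda>r. - r * k) \<longlongrightarrow> - 0 * k) (at_right 0)" by (intro tendsto_intros)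
  then have small: "\<forall>\<^sub>F r in at_right 0. - r * k < (N + 1) * (\<eta> / 3)"
    using \<open>\<eta> > 0\<close> e by (intro order_tendstoD(2)) auto
  have "\<forall>\<^sub>F r in at_right 0. r < min 1 e" using e by (intro eventually_at_rightI[of 0 "min 1 e"]) auto
  moreover have "\<eta> / 3 > 0" using \<open>\<eta> > 0\<close> by simp
  note reach_line_eventually[OF c(1) z this, of v]
  ultimately show ?thesis using near small eventually_at_right_less[of 0]
  proof eventually_elim
    case (elim r)
    then have "potential_integral (N + 1) x y - potential_integral (N + 1) x (y' r)
        \<le> (N + 1 - r) * (r * (L_loc c (cmap c y) v + \<eta> / 3) + cG * r) - r * (potential N x (y' r) - potential e x y)"
      using e by (intro potential_integral_step) (auto simp: y'_def cinv_cmap[OF c])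
    also have "r * (L_loc c (cmap c y) v + \<eta> / 3) + cG * r = r * k" by (simp add: k_def algebra_simps)
    also have "(N + 1 - r) * (r * k) - r * (potential N x (y' r) - potential e x y)
        = r * ((N + 1) * k + (- r * k) - (potential N x (y' r) - potential e x y))"
      by (simp add: algebra_simps)
    also have "\<dots> \<le> r * ((N + 1) * k + (N + 1) * (\<eta> / 3) - (potential N x y - (N + 1) * (\<eta> / 3) - potential e x y))"
      by (rule mult_left_mono) (use elim in linarith)+
    also have "\<dots> = r * ((N + 1) * (L_loc c (cmap c y) v + cG + \<eta>) - (potential N x y - potential e x y))"
      by (simp add: k_def field_simps)
    finally show ?case using elim by blast
  qed
qed

lemma potential_average_subsolution:
  assumes e: "0 < e" "e \<le> N"
  shows "viscosity_subsolution A (\<lambda>y p. G y p + (potential N x y - potential e x y) / (N + 1)) cG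
    (\<lambda>y. potential_integral (N + 1) x y / (N + 1))"
proof (rule subsolution_if_increments)
  show "continuous_on UNIV (\<lambda>y. potential_integral (N + 1) x y / (N + 1))"
    using e by (intro continuous_intros potential_integral_continuous[OF e]) auto
  fix c y v and \<eta> :: real assume prems: "c \<in> A" "y \<in> cdom c" "\<eta> > 0"
  have divide_N_le: "a / (N + 1) - b / (N + 1) \<le> r * (l - d / (N + 1) + \<eta>)"
    if "a - b \<le> r * ((N + 1) * (l + \<eta>) - d)" for a b d l r
  proof -
    have "(a - b) / (N + 1) \<le> r * ((N + 1) * (l + \<eta>) - d) / (N + 1)"
      using that e by (intro divide_right_mono) auto
    also have "\<dots> = r * (l - d / (N + 1) + \<eta>)" using e by (simp add: field_simps)
    finally show ?thesis by (simp add: diff_divide_distrib)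
  qed
  from potential_average_step_eventually[OF e prems, of v x]
  show "\<forall>\<^sub>F r in at_right 0. cmap c y - r *\<^sub>R v \<in> cimage c \<and>
    potential_integral (N + 1) x y / (N + 1) - potential_integral (N + 1) x (cinv c (cmap c y - r *\<^sub>R v)) / (N + 1)
      \<le> r * (L_loc c (cmap c y) v + cG - (potential N x y - potential e x y) / (N + 1) + \<eta>)"
    using divide_N_le by (elim eventually_mono) auto
qed

lemma action_less_iff_reach:
  "minimal_action A G t x y + ereal (cG * t) < ereal m \<longleftrightarrow> reach t x y (m - cG * t)"
  unfolding reach_def by (cases "minimal_action A G t x y") auto

lemma peierls_barrier_le:
  assumes "\<And>s. potential s x y \<le> B" shows "peierls_barrier A G x y \<le> ereal B"
proof (rule ccontr)
  assume "\<not> ?thesis"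
  then obtain m where m: "ereal B < ereal m" "ereal m < peierls_barrier A G x y"
    using ereal_dense2[of "ereal B"] by (metis less_ereal.simps(1) not_le)
  from less_LiminfD[OF m(2)[unfolded peierls_barrier_def]]
  obtain T where T: "\<And>t. t \<ge> T \<Longrightarrow> ereal m < minimal_action A G t x y + ereal (cG * t)"
    by (auto simp: eventually_at_top_linorder)
  obtain t k where t: "t \<ge> T" "t > 0" "reach t x y k" "k + cG * t < m"
    using potential_lessD[of T x y m] assms[of T] m(1) by auto
  then have "minimal_action A G t x y + ereal (cG * t) < ereal m"
    unfolding action_less_iff_reach by (auto intro: reach_mono)
  then show False using T[OF t(1)] by simp
qed

lemma potential_le_peierls_barrier: "ereal (potential s x y) \<le> peierls_barrier A G x y"
  unfolding peierls_barrier_def le_Liminf_iff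
proof (intro allI impI)
  fix q assume "q < ereal (potential s x y)"
  then obtain m where m: "q < ereal m" "m < potential s x y" using ereal_dense2 by force
  have "q < minimal_action A G t x y + ereal (cG * t)" if t: "t \<ge> max s 1" for t
  proof (rule ccontr)
    assume "\<not> ?thesis"
    then have "reach t x y (m - cG * t)" using m(1) by (simp flip: action_less_iff_reach)
    then have "potential s x y \<le> (m - cG * t) + cG * t" using t by (intro potential_le) auto
    then show False using m(2) by simp
  qed
  then show "\<forall>\<^sub>F t in at_top. q < minimal_action A G t x y + ereal (cG * t)"
    unfolding eventually_at_top_linorder by blast
qed

end

subsection \<open>Borel measures of a topology\<close>

lemma space_eq_topspace_if_sets_borel_of: "sets m = sets (borel_of X) \<Longrightarrow> space m = topspace X"
  using sets_eq_imp_space_eq[of m "borel_of X"] by (simp add: borel_of_def space_measure_of_conv)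

lemma openin_imp_sets_borel_of: "openin X U \<Longrightarrow> U \<in> sets (borel_of X)"
  unfolding borel_of_def by (subst sets_measure_of) (auto dest: openin_subset)

lemma closedin_imp_sets_borel_of:
  assumes "closedin X S" shows "S \<in> sets (borel_of X)"
proof -
  have "space (borel_of X) - (topspace X - S) \<in> sets (borel_of X)"
    using assms by (intro sets.compl_sets openin_imp_sets_borel_of) auto
  then show ?thesis
    using closedin_subset[OF assms] by (simp add: space_eq_topspace_if_sets_borel_of[OF refl] double_diff)
qed

lemma continuous_map_imp_borel_measurable:
  fixes F :: "'b \<Rightarrow> 'c::topological_space"
  assumes F: "continuous_map X euclidean F" and m: "sets m = sets (borel_of X)"
  shows "F \<in> borel_measurable m"
proof (rule borel_measurableI)
  fix U :: "'c set" assume "open U"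
  then have "openin X {p \<in> topspace X. F p \<in> U}" using openin_continuous_map_preimage[OF F] by simp
  moreover have "F -` U \<inter> space m = {p \<in> topspace X. F p \<in> U}"
    by (auto simp: space_eq_topspace_if_sets_borel_of[OF m])
  ultimately show "F -` U \<inter> space m \<in> sets m" by (simp add: m openin_imp_sets_borel_of)
qed

lemma measurable_borel_of_extend:
  fixes D :: "'a::topological_space set"
  assumes D: "D \<in> sets borel" "d \<in> D" and q: "continuous_map (top_of_set D) X q"
  shows "(\<lambda>y. if y \<in> D then q y else q d) \<in> borel \<rightarrow>\<^sub>M borel_of X"
  unfolding borel_of_def
proof (rule measurable_measure_of)
  show "{U. openin X U} \<subseteq> Pow (topspace X)" by (auto dest: openin_subset)
  show "(\<lambda>y. if y \<in> D then q y else q d) \<in> space borel \<rightarrow> topspace X"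
    using continuous_map_image_subset_topspace[OF q] D(2) by auto
  fix T assume "T \<in> {U. openin X U}"
  then have "openin (top_of_set D) {y \<in> D. q y \<in> T}" using openin_continuous_map_preimage[OF q] by fastforce
  then obtain U where U: "open U" "{y \<in> D. q y \<in> T} = D \<inter> U" by (auto simp: openin_open)
  then have "{y \<in> D. q y \<in> T} \<in> sets borel" using D(1) by simp
  moreover have "(if q d \<in> T then - D else {}) \<in> sets borel" using borel_comp[OF D(1)] by simp
  moreover have "(\<lambda>y. if y \<in> D then q y else q d) -` T \<inter> space borel = {y \<in> D. q y \<in> T} \<union> (if q d \<in> T then - D else {})"
    by (rule set_eqI) simp
  ultimately show "(\<lambda>y. if y \<in> D then q y else q d) -` T \<inter> space borel \<in> sets borel" by (simp only: sets.Un)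
qed

lemma pushforward_compact:
  fixes D :: "'a::euclidean_space set" and q :: "'a \<Rightarrow> 'b"
  assumes D: "compact D" "D \<noteq> {}" and q: "continuous_map (top_of_set D) X q"
    and \<nu>: "probability_on D \<nu>"
  obtains m where "sets m = sets (borel_of X)" "prob_space m"
    "\<And>F :: 'b \<Rightarrow> real. continuous_map X euclidean F \<Longrightarrow> integrable m F"
    "\<And>F :: 'b \<Rightarrow> real. continuous_map X euclidean F \<Longrightarrow> (\<integral>p. F p \<partial>m) = (\<integral>y. indicator D y *\<^sub>R F (q y) \<partial>\<nu>)"
    "\<And>S. closedin X S \<Longrightarrow> q ` D \<subseteq> S \<Longrightarrow> AE p in m. p \<in> S"
proof -
  obtain d where d: "d \<in> D" using D(2) by blast
  define q' where "q' y = (if y \<in> D then q y else q d)" for y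
  have "D \<in> sets borel" by (rule borel_compact[OF D(1)])
  then have q': "q' \<in> \<nu> \<rightarrow>\<^sub>M borel_of X"
    unfolding q'_def using measurable_borel_of_extend[OF _ d q] measurable_cong_sets[OF probability_onD(2)[OF \<nu>] refl] by blast
  have F_q': "integrable \<nu> (\<lambda>y. F (q' y))" "(\<integral>y. F (q' y) \<partial>\<nu>) = (\<integral>y. indicator D y *\<^sub>R F (q y) \<partial>\<nu>)"
    if F: "continuous_map X euclidean F" for F :: "'b \<Rightarrow> real"
  proof -
    have meas: "(\<lambda>y. F (q' y)) \<in> borel_measurable \<nu>"
      by (rule measurable_compose[OF q' continuous_map_imp_borel_measurable[OF F refl]])
    have "continuous_on D (\<lambda>y. F (q y))" using continuous_map_compose[OF q F] by (simp add: o_def)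
    then have int: "integrable \<nu> (\<lambda>y. indicator D y *\<^sub>R F (q y))"
      using integrable_if_probability_on[OF \<nu> D(1)] by blast
    have AE_eq: "AE y in \<nu>. F (q' y) = indicator D y *\<^sub>R F (q y)"
      using probability_onD(3)[OF \<nu>] by eventually_elim (simp add: q'_def)
    show "integrable \<nu> (\<lambda>y. F (q' y))"
      using int integrable_cong_AE[OF meas borel_measurable_integrable[OF int] AE_eq] by simp
    show "(\<integral>y. F (q' y) \<partial>\<nu>) = (\<integral>y. indicator D y *\<^sub>R F (q y) \<partial>\<nu>)"
      by (rule integral_cong_AE[OF meas borel_measurable_integrable[OF int] AE_eq])
  qed
  define m where "m = distr \<nu> (borel_of X) q'"
  show thesis
  proof (rule that)
    show "sets m = sets (borel_of X)" by (simp add: m_def)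
    show "prob_space m" unfolding m_def by (rule prob_space.prob_space_distr[OF probability_onD(1)[OF \<nu>] q'])
    show "integrable m F" "(\<integral>p. F p \<partial>m) = (\<integral>y. indicator D y *\<^sub>R F (q y) \<partial>\<nu>)"
      if F: "continuous_map X euclidean F" for F :: "'b \<Rightarrow> real"
      using F_q'[OF F] continuous_map_imp_borel_measurable[OF F refl] q'
      by (simp_all add: m_def integrable_distr_eq integral_distr)
    show "AE p in m. p \<in> S" if S: "closedin X S" "q ` D \<subseteq> S" for S
    proof -
      have meas: "{p \<in> space (borel_of X). p \<in> S} \<in> sets (borel_of X)"
        using closedin_imp_sets_borel_of[OF S(1)] sets.sets_into_space by (simp add: Collect_conj_eq Int_absorb1)
      have "q' y \<in> S" for y using S(2) d by (auto simp: q'_def)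
      then show ?thesis unfolding m_def AE_distr_iff[OF q' meas] by simp
    qed
  qed
qed

lemma tagged_union_continuous_map:
  fixes P :: "nat \<Rightarrow> 'a::euclidean_space set"
  assumes P: "\<And>i. i < n \<Longrightarrow> compact (P i)" and q: "\<And>i. i < n \<Longrightarrow> continuous_map (top_of_set (P i)) X (q i)"
  shows "compact (\<Union>i<n. {real i} \<times> P i)"
    and "continuous_map (top_of_set (\<Union>i<n. {real i} \<times> P i)) X (\<lambda>(t, y). q (nat \<lfloor>t\<rfloor>) y)"
proof -
  let ?D = "\<Union>i<n. {real i} \<times> P i"
  show "compact ?D" using P by (intro compact_UN compact_Times) auto
  show "continuous_map (top_of_set ?D) X (\<lambda>(t, y). q (nat \<lfloor>t\<rfloor>) y)"
  proof (rule pasting_lemma_closed[where I = "{..<n}" and T = "\<lambda>i. {real i} \<times> P i" and f = "\<lambda>i p. q i (snd p)"])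
    fix i assume "i \<in> {..<n}"
    then have i: "i < n" by simp
    have "closed ({real i} \<times> P i)" by (intro closed_Times compact_imp_closed P i) auto
    then show "closedin (top_of_set ?D) ({real i} \<times> P i)" using i by (auto intro: closed_subset)
    have "continuous_map (top_of_set ({real i} \<times> P i)) (top_of_set (P i)) snd"
      by (auto intro: continuous_on_snd continuous_on_id)
    from continuous_map_compose[OF this q[OF i]]
    have "continuous_map (top_of_set ({real i} \<times> P i)) X (\<lambda>p. q i (snd p))" by (simp add: o_def)
    moreover have "?D \<inter> {real i} \<times> P i = {real i} \<times> P i" using i by blast
    ultimately show "continuous_map (subtopology (top_of_set ?D) ({real i} \<times> P i)) X (\<lambda>p. q i (snd p))"
      by (simp add: subtopology_subtopology)
  qed auto
qed

context manifold
begin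

subsection \<open>Functions on the tangent bundle\<close>

abbreviation "differential_at f p \<equiv> differential A f (fst p) (snd p)"

definition bundle_point :: "('m, 'e) chart \<Rightarrow> 'e \<times> 'e \<Rightarrow> 'm \<times> ('m, 'e) tvec" where
  "bundle_point c p = (cinv c (fst p), tvec_of A c (cinv c (fst p)) (snd p))"

lemma bundle_point_apply: "bundle_point c (z, v) = (cinv c z, tvec_of A c (cinv c z) v)"
  by (simp add: bundle_point_def)

lemma bundle_point_in: "c \<in> A \<Longrightarrow> p \<in> cimage c \<times> UNIV \<Longrightarrow> bundle_point c p \<in> Sigma UNIV (tangent_space A)"
  unfolding bundle_point_def by (intro SigmaI UNIV_I tvec_of_in cinv_in) (auto simp only: mem_Times_iff)

lemma openin_tangent_bundle_iff:
  "openin (tangent_bundle A) T \<longleftrightarrow>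
    T \<subseteq> Sigma UNIV (tangent_space A) \<and> (\<forall>c\<in>A. open {p \<in> cimage c \<times> UNIV. bundle_point c p \<in> T})"
proof -
  have "{(z, w). z \<in> cimage c \<and> (cinv c z, tvec_of A c (cinv c z) w) \<in> T} = {p \<in> cimage c \<times> UNIV. bundle_point c p \<in> T}" for c
    by (auto simp: bundle_point_apply)
  then show ?thesis unfolding openin_tangent_bundle[OF atlas] by simp
qed

lemma open_bundle_chart: "c \<in> A \<Longrightarrow> open (cimage c \<times> (UNIV :: 'e set))"
  by (intro open_Times open_cimage open_UNIV)

lemma continuous_map_bundle_point:
  assumes c: "c \<in> A" shows "continuous_map (top_of_set (cimage c \<times> UNIV)) (tangent_bundle A) (bundle_point c)"
  unfolding continuous_map_def
proof (intro conjI allI impI)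
  show "bundle_point c \<in> topspace (top_of_set (cimage c \<times> UNIV)) \<rightarrow> topspace (tangent_bundle A)"
    unfolding topspace_tangent_bundle using bundle_point_in[OF c] by auto
  fix T assume "openin (tangent_bundle A) T"
  then have "open {p \<in> cimage c \<times> UNIV. bundle_point c p \<in> T}" using c by (simp only: openin_tangent_bundle_iff)
  then show "openin (top_of_set (cimage c \<times> UNIV)) {p \<in> topspace (top_of_set (cimage c \<times> UNIV)). bundle_point c p \<in> T}"
    unfolding topspace_euclidean_subtopology openin_open_eq[OF open_bundle_chart[OF c]] by blast
qed

lemma continuous_map_tangent_bundle:
  fixes F :: "'m \<times> ('m, 'e) tvec \<Rightarrow> 'b::topological_space"
  assumes F: "\<And>c. c \<in> A \<Longrightarrow> continuous_on (cimage c \<times> UNIV) (\<lambda>p. F (bundle_point c p))"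
  shows "continuous_map (tangent_bundle A) euclidean F"
  unfolding continuous_map_def topspace_tangent_bundle openin_tangent_bundle_iff
proof (intro conjI ballI allI impI)
  fix U :: "'b set" and c assume "openin euclidean U" and c: "c \<in> A"
  then have "open U" by simp
  then have "open ((\<lambda>p. F (bundle_point c p)) -` U \<inter> cimage c \<times> UNIV)"
    using F[OF c] unfolding continuous_on_open_vimage[OF open_bundle_chart[OF c]] by blast
  moreover have "{p \<in> cimage c \<times> UNIV. bundle_point c p \<in> {x \<in> Sigma UNIV (tangent_space A). F x \<in> U}}
      = (\<lambda>p. F (bundle_point c p)) -` U \<inter> cimage c \<times> UNIV"
    using bundle_point_in[OF c] by blast
  ultimately show "open {p \<in> cimage c \<times> UNIV. bundle_point c p \<in> {x \<in> Sigma UNIV (tangent_space A). F x \<in> U}}" by simp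
qed auto

lemma continuous_map_tangent_bundle_fst: "continuous_map (tangent_bundle A) euclidean fst"
proof (rule continuous_map_tangent_bundle)
  fix c assume c: "c \<in> A"
  show "continuous_on (cimage c \<times> UNIV) (\<lambda>p. fst (bundle_point c p))"
    unfolding bundle_point_def fst_conv
    by (rule continuous_on_compose2[OF cont_cinv[OF c] continuous_on_fst[OF continuous_on_id]]) auto
qed

lemma continuous_map_tangent_bundle_base:
  assumes "continuous_on UNIV F" shows "continuous_map (tangent_bundle A) euclidean (\<lambda>p. F (fst p))"
proof -
  have "continuous_map euclidean euclidean F" using assms by simp
  from continuous_map_compose[OF continuous_map_tangent_bundle_fst this] show ?thesis by (simp add: o_def)
qed

lemma differential_at_bundle_point:
  assumes "f \<in> C1" "c \<in> A" "z \<in> cimage c"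
  shows "differential_at f (bundle_point c (z, v)) = gradient (f \<circ> cinv c) z \<bullet> v"
  using assms differential_eq_covec_of[OF assms(1,2) cinv_in] covec_of_apply[OF assms(2) cinv_in]
  by (simp add: bundle_point_apply cmap_cinv)

lemma continuous_map_differential_at:
  assumes f: "f \<in> C1" shows "continuous_map (tangent_bundle A) euclidean (\<lambda>p. differential_at f p)"
proof (rule continuous_map_tangent_bundle)
  fix c assume c: "c \<in> A"
  have "continuous_on (cimage c \<times> (UNIV :: 'e set)) (\<lambda>p. gradient (f \<circ> cinv c) (fst p))"
    using has_gradient_on_continuous[OF C1D[OF f c]]
    by (rule continuous_on_compose2[OF _ continuous_on_fst[OF continuous_on_id]]) auto
  then have "continuous_on (cimage c \<times> (UNIV :: 'e set)) (\<lambda>p. gradient (f \<circ> cinv c) (fst p) \<bullet> snd p)"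
    by (intro continuous_intros)
  then show "continuous_on (cimage c \<times> UNIV) (\<lambda>p. differential_at f (bundle_point c p))"
    by (rule continuous_on_eq) (auto simp: differential_at_bundle_point[OF f c])
qed

lemma metric_expand:
  assumes c: "c \<in> A" "x \<in> cdom c"
  shows "g x (tvec_of A c x v) (tvec_of A c x v)
    = (\<Sum>(i, j)\<in>Basis \<times> Basis. (v \<bullet> i) * (v \<bullet> j) * g x (tvec_of A c x i) (tvec_of A c x j))"
proof -
  define B where "B v w = g x (tvec_of A c x v) (tvec_of A c x w)" for v w
  have B: "bilinear B" unfolding B_def by (rule metric_bilinear[OF c])
  have "B v v = B (\<Sum>i\<in>Basis. (v \<bullet> i) *\<^sub>R i) (\<Sum>i\<in>Basis. (v \<bullet> i) *\<^sub>R i)" by (simp add: euclidean_representation)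
  also have "\<dots> = (\<Sum>(i, j)\<in>Basis \<times> Basis. B ((v \<bullet> i) *\<^sub>R i) ((v \<bullet> j) *\<^sub>R j))" by (rule bilinear_sum[OF B])
  also have "\<dots> = (\<Sum>(i, j)\<in>Basis \<times> Basis. (v \<bullet> i) * (v \<bullet> j) * B i j)"
    by (intro sum.cong) (auto simp: bilinear_lmul[OF B] bilinear_rmul[OF B])
  finally show ?thesis unfolding B_def .
qed

lemma continuous_map_tnorm: "continuous_map (tangent_bundle A) euclidean (\<lambda>p. tnorm g (fst p) (snd p))"
proof (rule continuous_map_tangent_bundle)
  fix c assume c: "c \<in> A"
  define B where "B z v w = g (cinv c z) (tvec_of A c (cinv c z) v) (tvec_of A c (cinv c z) w)" for z v w
  have B: "continuous_on (cimage c \<times> (UNIV :: 'e set)) (\<lambda>p. B (fst p) i j)" for i j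
  proof (rule continuous_on_compose2[OF _ continuous_on_fst[OF continuous_on_id]])
    have "smooth_on (\<lambda>z. B z i j) (cimage c)" using metric c unfolding riemannian_metric_def B_def by blast
    then show "continuous_on (cimage c) (\<lambda>z. B z i j)" unfolding smooth_on_def by (metis Ck_on.simps(1))
  qed auto
  have "continuous_on (cimage c \<times> (UNIV :: 'e set)) (\<lambda>p. sqrt (\<Sum>(i, j)\<in>Basis \<times> Basis. (snd p \<bullet> i) * (snd p \<bullet> j) * B (fst p) i j))"
    unfolding case_prod_unfold by (intro continuous_intros B)
  then show "continuous_on (cimage c \<times> UNIV) (\<lambda>p. tnorm g (fst (bundle_point c p)) (snd (bundle_point c p)))"
    by (rule continuous_on_eq) (auto simp: tnorm_def bundle_point_apply B_def metric_expand[OF c cinv_in[OF c]])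
qed

end

context hamiltonian
begin

abbreviation "L_at p \<equiv> L (fst p) (snd p)"

lemma L_at_bundle_point:
  "c \<in> A \<Longrightarrow> z \<in> cimage c \<Longrightarrow> L_at (bundle_point c (z, v)) = L_loc c z v"
  by (simp add: bundle_point_apply L_tvec_of cinv_in cmap_cinv)

lemma continuous_map_L_at: "continuous_map (tangent_bundle A) euclidean (\<lambda>p. L_at p)"
proof (rule continuous_map_tangent_bundle)
  fix c assume c: "c \<in> A"
  show "continuous_on (cimage c \<times> UNIV) (\<lambda>p. L_at (bundle_point c p))"
    by (rule continuous_on_eq[OF L_loc_continuous[OF c]]) (auto simp: L_at_bundle_point[OF c])
qed

subsection \<open>Mather measures\<close>

abbreviation "mather \<equiv> mather_measure A g G"

context
  fixes m assumes m: "mather m"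
begin

lemma sets_mather: "sets m = sets (borel_of (tangent_bundle A))"
  and prob_mather: "prob_space m"
  using m by (auto simp: mather_measure_def closed_measure_def)

interpretation prob_space m by (rule prob_mather)

lemma tangent_mather: "p \<in> space m \<Longrightarrow> snd p \<in> tangent_space A (fst p)"
  by (auto simp: space_eq_topspace_if_sets_borel_of[OF sets_mather] topspace_tangent_bundle)

lemma fst_measurable_mather: "fst \<in> borel_measurable m"
  by (rule continuous_map_imp_borel_measurable[OF continuous_map_tangent_bundle_fst sets_mather])

lemma base_measurable_mather: "continuous_on UNIV F \<Longrightarrow> (\<lambda>p. F (fst p)) \<in> borel_measurable m"
  by (rule continuous_map_imp_borel_measurable[OF continuous_map_tangent_bundle_base sets_mather])

lemma integrable_base_mather:
  fixes F :: "'m \<Rightarrow> real"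
  assumes F: "continuous_on UNIV F" shows "integrable m (\<lambda>p. F (fst p))"
proof -
  obtain B where "\<And>x. \<bar>F x\<bar> \<le> B" using continuous_bounded[OF F] by blast
  then show ?thesis by (intro integrable_const_bound[of _ B] base_measurable_mather[OF F]) auto
qed

lemma integrable_L_mather: "integrable m (\<lambda>p. L_at p)"
  and integral_L_mather: "(\<integral>p. L_at p \<partial>m) = - cG"
  using m by (simp_all add: mather_measure_def case_prod_unfold)

lemma integrable_L_add_mather: "integrable m (\<lambda>p. L_at p + a)"
  by (intro Bochner_Integration.integrable_add integrable_L_mather integrable_const)

lemma integrable_tnorm_mather: "integrable m (\<lambda>p. tnorm g (fst p) (snd p))"
  using m by (simp add: mather_measure_def closed_measure_def case_prod_unfold)

lemma integral_differential_mather: "f \<in> C1 \<Longrightarrow> (\<integral>p. differential_at f p \<partial>m) = 0"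
  using m by (simp add: mather_measure_def closed_measure_def case_prod_unfold)

lemma integrable_differential_mather:
  assumes f: "f \<in> C1" shows "integrable m (\<lambda>p. differential_at f p)"
proof -
  obtain C where C: "\<And>x v. v \<in> tangent_space A x \<Longrightarrow> \<bar>differential A f x v\<bar> \<le> L x v + C"
    using abs_differential_le_L[OF f] by blast
  show ?thesis
  proof (rule Bochner_Integration.integrable_bound[OF integrable_L_add_mather[of C]])
    show "(\<lambda>p. differential_at f p) \<in> borel_measurable m"
      by (rule continuous_map_imp_borel_measurable[OF continuous_map_differential_at[OF f] sets_mather])
    show "AE p in m. norm (differential_at f p) \<le> norm (L_at p + C)"
      using C[OF tangent_mather] by (intro AE_I2) (simp add: order_trans[OF _ abs_ge_self])
  qed
qed

lemma integrable_mult_mather: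
  assumes F: "continuous_on UNIV F" and H: "integrable m (H :: _ \<Rightarrow> real)"
  shows "integrable m (\<lambda>p. F (fst p) * H p)"
proof -
  obtain B where B: "B > 0" "\<And>x. \<bar>F x\<bar> \<le> B" using continuous_bounded[OF F] by blast
  show ?thesis
  proof (rule Bochner_Integration.integrable_bound)
    show "integrable m (\<lambda>p. B * H p)" using H by simp
    show "(\<lambda>p. F (fst p) * H p) \<in> borel_measurable m"
      using H by (intro borel_measurable_times base_measurable_mather[OF F]) auto
    show "AE p in m. norm (F (fst p) * H p) \<le> norm (B * H p)"
      using B by (auto simp: abs_mult intro!: mult_right_mono)
  qed
qed

lemma margin_null:
  assumes w: "viscosity_subsolution A (\<lambda>x p. G x p + b x) cG w" and b: "continuous_on UNIV b" "\<And>x. b x \<ge> 0"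
  shows "AE p in m. b (fst p) = 0"
proof -
  have int_b: "integrable m (\<lambda>p. b (fst p))" by (rule integrable_base_mather[OF b(1)])
  have "(\<integral>p. b (fst p) \<partial>m) \<le> 0"
  proof (rule field_le_epsilon)
    fix e :: real assume "e > 0"
    obtain f where f: "f \<in> C1" "\<And>x. G x (differential A f x) + b x \<le> cG + e"
      by (rule hamiltonian.smooth_approximation[OF hamiltonian_add[OF b(1)] w \<open>e > 0\<close>]) (rule that)
    have "(\<integral>p. b (fst p) \<partial>m) \<le> (\<integral>p. (L_at p + (cG + e)) - differential_at f p \<partial>m)"
    proof (rule integral_mono[OF int_b])
      show "integrable m (\<lambda>p. (L_at p + (cG + e)) - differential_at f p)"
        by (intro Bochner_Integration.integrable_diff integrable_L_add_mather integrable_differential_mather f)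
      show "b (fst p) \<le> L_at p + (cG + e) - differential_at f p" if "p \<in> space m" for p
        using differential_le_L[OF f(1) tangent_mather[OF that]] f(2)[of "fst p"] by linarith
    qed
    also have "\<dots> = e"
      using integrable_L_mather integrable_differential_mather[OF f(1)] integral_differential_mather[OF f(1)]
      by (simp add: integral_L_mather prob_space)
    finally show "(\<integral>p. b (fst p) \<partial>m) \<le> 0 + e" by simp
  qed
  moreover have "(\<integral>p. b (fst p) \<partial>m) \<ge> 0" using b(2) by (intro integral_nonneg_AE) auto
  ultimately show ?thesis
    using integral_nonneg_eq_0_iff_AE[OF int_b] b(2) by auto
qed

end

subsection \<open>Existence of Mather measures\<close>

lemma compact_chart_cover:
  assumes K: "compact K"
  obtains n and c :: "nat \<Rightarrow> ('m, 'e) chart" and Z where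
    "\<And>i. i < n \<Longrightarrow> c i \<in> A" "\<And>i. i < n \<Longrightarrow> compact (Z i)" "\<And>i. i < n \<Longrightarrow> Z i \<subseteq> cimage (c i)"
    "K = (\<Union>i<n. cinv (c i) ` Z i)"
proof -
  obtain I where I: "finite I" "\<And>x. \<exists>i\<in>I. x \<in> chart_ball (1 / 2) i" using finite_chart_ball_cover by blast
  obtain xs where xs: "set xs = I" using finite_list[OF I(1)] by blast
  define Q where "Q i = cball (cmap (chart_at A i) i) (1 / 2 * chart_radius i)" for i
  define Z where "Z i = Q i \<inter> cinv (chart_at A i) -` K" for i
  have Q: "compact (Q i)" "Q i \<subseteq> cimage (chart_at A i)" for i
    using chart_radius[of i] by (auto simp: Q_def intro!: order_trans[OF subset_cball chart_radius(2)])
  have "compact (Q i \<inter> Z i)" for i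
  proof (rule compact_Int_closed[OF Q(1)])
    show "closed (Z i)"
      using continuous_on_subset[OF cont_cinv[OF chart_at(1)] Q(2)] compact_imp_closed[OF Q(1)] compact_imp_closed[OF K]
      unfolding Z_def by (metis Int_commute continuous_on_closed_vimage)
  qed
  then have Z: "compact (Z i)" for i by (simp add: Z_def flip: Int_assoc)
  have "K = (\<Union>i\<in>set xs. cinv (chart_at A i) ` Z i)"
    using I(2) xs by (fastforce simp: chart_ball_def Q_def Z_def)
  also have "\<dots> = (\<Union>j<length xs. cinv (chart_at A (xs ! j)) ` Z (xs ! j))" by (auto simp: set_conv_nth)
  finally show thesis
    using Q(2) Z chart_at(1) by (intro that[of "length xs" "\<lambda>j. chart_at A (xs ! j)" "\<lambda>j. Z (xs ! j)"]) (auto simp: Z_def)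
qed

lemma G_differential_le_if_bounded_velocities:
  assumes c: "c \<in> A" and Z: "compact Z" "Z \<subseteq> cimage c"
  shows "\<exists>R>0. \<forall>f\<in>C1. \<forall>b\<le>a. \<forall>z\<in>Z.
    (\<forall>v\<in>cball 0 R. differential_at f (bundle_point c (z, v)) \<le> L_at (bundle_point c (z, v)) + b)
    \<longrightarrow> G (cinv c z) (differential A f (cinv c z)) \<le> b"
proof -
  obtain R where R: "R > 0" "\<And>b z w. b \<le> a \<Longrightarrow> z \<in> Z \<Longrightarrow> (\<And>v. norm v \<le> R \<Longrightarrow> w \<bullet> v \<le> L_loc c z v + b) \<Longrightarrow> G_loc c z w \<le> b"
    using G_loc_le_if_bounded_velocities[OF c Z, of a] by blast
  have "G (cinv c z) (differential A f (cinv c z)) \<le> b"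
    if f: "f \<in> C1" and b: "b \<le> a" and z: "z \<in> Z"
      and le: "\<forall>v\<in>cball 0 R. differential_at f (bundle_point c (z, v)) \<le> L_at (bundle_point c (z, v)) + b" for f b z
  proof -
    have z': "z \<in> cimage c" using z Z(2) by blast
    have "G_loc c z (gradient (f \<circ> cinv c) z) \<le> b"
      using le by (intro R(2)[OF b z]) (simp add: differential_at_bundle_point[OF f c z'] L_at_bundle_point[OF c z'])
    then show ?thesis using G_differential[OF f c cinv_in[OF c z']] by (simp add: cmap_cinv[OF c z'])
  qed
  then show ?thesis using R(1) by blast
qed

lemma compact_test_velocities:
  assumes K: "compact K"
  obtains D :: "(real \<times> 'e \<times> 'e) set" and q where
    "compact D" "continuous_map (top_of_set D) (tangent_bundle A) q" "\<And>y. y \<in> D \<Longrightarrow> fst (q y) \<in> K"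
    "\<And>x. x \<in> K \<Longrightarrow> (x, \<lambda>_. 0) \<in> q ` D"
    "\<And>f b x. f \<in> C1 \<Longrightarrow> b \<le> a \<Longrightarrow> \<forall>y\<in>D. differential_at f (q y) \<le> L_at (q y) + b \<Longrightarrow> x \<in> K
      \<Longrightarrow> G x (differential A f x) \<le> b"
proof -
  obtain n and c :: "nat \<Rightarrow> ('m, 'e) chart" and Z where c: "\<And>i. i < n \<Longrightarrow> c i \<in> A"
    and Z: "\<And>i. i < n \<Longrightarrow> compact (Z i)" "\<And>i. i < n \<Longrightarrow> Z i \<subseteq> cimage (c i)" and K_eq: "K = (\<Union>i<n. cinv (c i) ` Z i)"
    by (rule compact_chart_cover[OF K]) (rule that)
  obtain R where R: "\<And>i. i < n \<Longrightarrow> R i > 0"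
    "\<And>i f b z. i < n \<Longrightarrow> f \<in> C1 \<Longrightarrow> b \<le> a \<Longrightarrow> z \<in> Z i
      \<Longrightarrow> (\<forall>v\<in>cball 0 (R i). differential_at f (bundle_point (c i) (z, v)) \<le> L_at (bundle_point (c i) (z, v)) + b)
      \<Longrightarrow> G (cinv (c i) z) (differential A f (cinv (c i) z)) \<le> b"
    using G_differential_le_if_bounded_velocities[OF c Z, of _ a] by metis
  define D where "D = (\<Union>i<n. {real i} \<times> Z i \<times> cball (0 :: 'e) (R i))"
  define q where "q = (\<lambda>(t::real, p). bundle_point (c (nat \<lfloor>t\<rfloor>)) p)"
  have q: "q (real i, p) = bundle_point (c i) p" for i p by (simp add: q_def)
  show thesis
  proof (rule that[of D q])
    have "continuous_map (top_of_set (Z i \<times> cball 0 (R i))) (tangent_bundle A) (bundle_point (c i))" if "i < n" for i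
      using Z(2)[OF that] by (intro continuous_map_from_subtopology_mono[OF continuous_map_bundle_point[OF c[OF that]]]) auto
    note tagged = tagged_union_continuous_map[where P = "\<lambda>i. Z i \<times> cball 0 (R i)", OF compact_Times[OF Z(1) compact_cball] this]
    show "compact D" "continuous_map (top_of_set D) (tangent_bundle A) q"
      unfolding D_def q_def by (rule tagged; assumption)+
    show "fst (q y) \<in> K" if "y \<in> D" for y using that by (force simp: D_def K_eq q bundle_point_def)
  next
    fix x assume "x \<in> K"
    then obtain i z where i: "i < n" and z: "z \<in> Z i" "x = cinv (c i) z" by (auto simp: K_eq)
    show "(x, \<lambda>_. 0) \<in> q ` D"
    proof (rule image_eqI)
      show "(real i, z, 0) \<in> D" using i z R(1)[OF i] by (auto simp: D_def)
      show "(x, \<lambda>_. 0) = q (real i, z, 0)"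
        using Z(2)[OF i] z by (simp add: q bundle_point_apply tvec_of_0[OF c[OF i] cinv_in[OF c[OF i]]] subset_iff)
    qed
    fix f b assume f: "f \<in> C1" and "b \<le> a" and le: "\<forall>y\<in>D. differential_at f (q y) \<le> L_at (q y) + b"
    have "(real i, z, v) \<in> D" if "v \<in> cball 0 (R i)" for v using i z that by (auto simp: D_def)
    then have "\<forall>v\<in>cball 0 (R i). differential_at f (bundle_point (c i) (z, v)) \<le> L_at (bundle_point (c i) (z, v)) + b"
      using le by (metis q)
    then show "G x (differential A f x) \<le> b" unfolding z(2) by (rule R(2)[OF i f \<open>b \<le> a\<close> z(1)])
  qed
qed

lemma mather_if_annihilated:
  fixes D :: "'a::euclidean_space set"
  assumes D: "compact D" "D \<noteq> {}" and q: "continuous_map (top_of_set D) (tangent_bundle A) q"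
    and \<nu>: "probability_on D \<nu>"
    and L0: "(\<integral>y. indicator D y *\<^sub>R (L_at (q y) + cG) \<partial>\<nu>) = 0"
    and closed: "\<And>f. f \<in> C1 \<Longrightarrow> (\<integral>y. indicator D y *\<^sub>R differential_at f (q y) \<partial>\<nu>) = 0"
    and K: "closed K" "\<And>y. y \<in> D \<Longrightarrow> fst (q y) \<in> K"
  shows "\<exists>m. mather m \<and> (AE p in m. fst p \<in> K)"
proof -
  obtain m where m: "sets m = sets (borel_of (tangent_bundle A))" "prob_space m"
    "\<And>F :: _ \<Rightarrow> real. continuous_map (tangent_bundle A) euclidean F \<Longrightarrow> integrable m F"
    "\<And>F :: _ \<Rightarrow> real. continuous_map (tangent_bundle A) euclidean F \<Longrightarrow> (\<integral>p. F p \<partial>m) = (\<integral>y. indicator D y *\<^sub>R F (q y) \<partial>\<nu>)"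
    "\<And>S. closedin (tangent_bundle A) S \<Longrightarrow> q ` D \<subseteq> S \<Longrightarrow> AE p in m. p \<in> S"
    by (rule pushforward_compact[OF D q \<nu>]) (rule that)
  interpret m: prob_space m by (rule m(2))
  have "continuous_map (tangent_bundle A) euclidean (\<lambda>p. L_at p + cG)"
    by (intro continuous_map_add continuous_map_L_at) simp
  then have "(\<integral>p. L_at p + cG \<partial>m) = 0" using m(4) L0 by simp
  then have "(\<integral>p. L_at p \<partial>m) = - cG" using m(3)[OF continuous_map_L_at] by (simp add: m.prob_space)
  then have "mather m"
    unfolding mather_measure_def closed_measure_def
    using m(1,2) m(3)[OF continuous_map_tnorm] m(3)[OF continuous_map_L_at] m(4)[OF continuous_map_differential_at] closed
    by (simp add: case_prod_unfold)
  moreover have "closedin (tangent_bundle A) {p \<in> topspace (tangent_bundle A). fst p \<in> K}"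
    using K(1) by (intro closedin_continuous_map_preimage[OF continuous_map_tangent_bundle_fst]) simp
  then have "AE p in m. p \<in> {p \<in> topspace (tangent_bundle A). fst p \<in> K}"
    by (rule m(5)) (use continuous_map_image_subset_topspace[OF q] K(2) in auto)
  ultimately show ?thesis by (auto elim: eventually_mono)
qed

lemma strict_subsolution_if_positive:
  assumes f: "f \<in> C1" and "d > 0" and x: "(x, \<lambda>_. 0) \<in> q ` D"
    and tangent: "\<And>y. y \<in> D \<Longrightarrow> snd (q y) \<in> tangent_space A (fst (q y))"
    and pos: "\<And>y. y \<in> D \<Longrightarrow> \<beta> * (L_at (q y) + cG) + differential_at f (q y) \<ge> d"
    and test: "\<And>h b x. h \<in> C1 \<Longrightarrow> b \<le> cG \<Longrightarrow> \<forall>y\<in>D. differential_at h (q y) \<le> L_at (q y) + b \<Longrightarrow> x \<in> K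
      \<Longrightarrow> G x (differential A h x) \<le> b"
  shows "\<exists>h\<in>C1. \<exists>d>0. \<forall>x\<in>K. G x (differential A h x) \<le> cG - d"
proof -
  obtain y where "y \<in> D" "q y = (x, \<lambda>_. 0)" using x by force
  then have "\<beta> * (L x (\<lambda>_. 0) + cG) \<ge> d" using pos[of y] differential_zero[OF f] by simp
  then have "\<beta> * (L x (\<lambda>_. 0) + cG) > 0" using \<open>d > 0\<close> by linarith
  then have \<beta>: "\<beta> > 0" using L_zero_ge[of x] by (simp add: zero_less_mult_iff)
  have h: "(\<lambda>x. (- 1 / \<beta>) * f x) \<in> C1" by (rule C1_cmult[OF f])
  have "differential_at (\<lambda>x. (- 1 / \<beta>) * f x) (q y) \<le> L_at (q y) + (cG - d / \<beta>)" if y: "y \<in> D" for y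
    using pos[OF y] \<beta> by (simp only: differential_cmult[OF tangent[OF y] f]) (simp add: field_simps)
  then have "\<forall>y\<in>D. differential_at (\<lambda>x. (- 1 / \<beta>) * f x) (q y) \<le> L_at (q y) + (cG - d / \<beta>)" by blast
  from test[OF h _ this] have "\<forall>x\<in>K. G x (differential A (\<lambda>x. (- 1 / \<beta>) * f x) x) \<le> cG - d / \<beta>"
    using \<open>d > 0\<close> \<beta> by simp
  then show ?thesis using h \<open>d > 0\<close> \<beta> by (intro bexI[OF _ h] exI[of _ "d / \<beta>"]) simp
qed

definition action_family :: "'a::topological_space set \<Rightarrow> ('a \<Rightarrow> 'm \<times> ('m, 'e) tvec) \<Rightarrow> ('a \<Rightarrow> real) set" where
  "action_family D q = {h. \<exists>\<beta>. \<exists>f\<in>C1. continuous_on D h \<and> (\<forall>y\<in>D. h y = \<beta> * (L_at (q y) + cG) + differential_at f (q y))}"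

lemma action_family_continuous: "h \<in> action_family D q \<Longrightarrow> continuous_on D h"
  unfolding action_family_def by blast

context
  fixes D :: "'a::topological_space set" and q
  assumes q: "continuous_map (top_of_set D) (tangent_bundle A) q"
begin

lemma tangent_if_continuous_map: "y \<in> D \<Longrightarrow> snd (q y) \<in> tangent_space A (fst (q y))"
  using continuous_map_image_subset_topspace[OF q] by (force simp: topspace_tangent_bundle)

lemma action_familyI:
  assumes f: "f \<in> C1" and h: "\<And>y. y \<in> D \<Longrightarrow> h y = \<beta> * (L_at (q y) + cG) + differential_at f (q y)"
  shows "h \<in> action_family D q"
proof -
  have compose: "continuous_on D (\<lambda>y. F (q y))" if "continuous_map (tangent_bundle A) euclidean F" for F :: "_ \<Rightarrow> real"
    using continuous_map_compose[OF q that] by (simp add: o_def)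
  have "continuous_on D (\<lambda>y. \<beta> * (L_at (q y) + cG) + differential_at f (q y))"
    by (intro continuous_intros compose continuous_map_L_at continuous_map_differential_at f)
  then have "continuous_on D h" by (rule continuous_on_eq) (simp add: h)
  then show ?thesis using assms unfolding action_family_def by blast
qed

lemma L_in_action_family: "(\<lambda>y. k * (L_at (q y) + cG)) \<in> action_family D q"
  by (rule action_familyI[of "\<lambda>_. 0" _ k]) (simp_all add: C1_const differential_const tangent_if_continuous_map)

lemma differential_in_action_family: "f \<in> C1 \<Longrightarrow> (\<lambda>y. differential_at f (q y)) \<in> action_family D q"
  by (rule action_familyI[of f _ 0]) simp_all

lemma action_family_linear:
  assumes "h \<in> action_family D q" "h' \<in> action_family D q" shows "(\<lambda>y. h y + k * h' y) \<in> action_family D q"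
proof -
  obtain \<beta> f \<beta>' f' where f: "f \<in> C1" "f' \<in> C1"
    and h: "\<forall>y\<in>D. h y = \<beta> * (L_at (q y) + cG) + differential_at f (q y)"
      "\<forall>y\<in>D. h' y = \<beta>' * (L_at (q y) + cG) + differential_at f' (q y)"
    using assms unfolding action_family_def by blast
  show ?thesis
    by (rule action_familyI[OF C1_add[OF f(1) C1_cmult[OF f(2)]], of _ "\<beta> + k * \<beta>'" k])
      (simp add: h differential_add differential_cmult C1_cmult f tangent_if_continuous_map algebra_simps)
qed

end

theorem mather_or_strict_subsolution:
  assumes K: "compact K" "K \<noteq> {}"
  shows "(\<exists>m. mather m \<and> (AE p in m. fst p \<in> K)) \<or> (\<exists>f\<in>C1. \<exists>\<delta>>0. \<forall>x\<in>K. G x (differential A f x) \<le> cG - \<delta>)"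
proof -
  obtain D :: "(real \<times> 'e \<times> 'e) set" and q where D: "compact D" and q: "continuous_map (top_of_set D) (tangent_bundle A) q"
    and q_K: "\<And>y. y \<in> D \<Longrightarrow> fst (q y) \<in> K" and zero: "\<And>x. x \<in> K \<Longrightarrow> (x, \<lambda>_. 0) \<in> q ` D"
    and test: "\<And>f b x. f \<in> C1 \<Longrightarrow> b \<le> cG \<Longrightarrow> \<forall>y\<in>D. differential_at f (q y) \<le> L_at (q y) + b \<Longrightarrow> x \<in> K
      \<Longrightarrow> G x (differential A f x) \<le> b"
    by (rule compact_test_velocities[OF K(1), of cG]) (rule that)
  obtain x where x: "x \<in> K" using K(2) by blast
  then have "D \<noteq> {}" using zero by blast
  consider h d where "h \<in> action_family D q" "d > 0" "\<forall>y\<in>D. h y \<ge> d"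
    | \<nu> where "probability_on D \<nu>" "\<forall>h\<in>action_family D q. (\<integral>y. indicator D y *\<^sub>R h y \<partial>\<nu>) = 0"
    by (rule disjE[OF positive_or_annihilated[OF D \<open>D \<noteq> {}\<close> action_family_continuous _ action_family_linear[OF q]]])
      (assumption, use L_in_action_family[OF q, of 0] in simp, blast+)
  then show ?thesis
  proof cases
    case (1 h d)
    then obtain \<beta> f where f: "f \<in> C1" "\<And>y. y \<in> D \<Longrightarrow> \<beta> * (L_at (q y) + cG) + differential_at f (q y) \<ge> d"
      unfolding action_family_def by force
    show ?thesis
      using strict_subsolution_if_positive[OF f(1) 1(2) zero[OF x] tangent_if_continuous_map[OF q] f(2) test] by blast
  next
    case (2 \<nu>)
    then show ?thesis
      using mather_if_annihilated[OF D \<open>D \<noteq> {}\<close> q _ _ _ compact_imp_closed[OF K(1)] q_K]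
        L_in_action_family[OF q, of 1] differential_in_action_family[OF q] by auto
  qed
qed

lemma mather_ex: "\<exists>m. mather m"
proof -
  have "\<not> (\<exists>f\<in>C1. \<exists>d>0. \<forall>x\<in>UNIV. G x (differential A f x) \<le> cG - d)"
    using critical_le by fastforce
  then show ?thesis using mather_or_strict_subsolution[OF compact_M] by blast
qed

subsection \<open>Finiteness of the Peierls barrier\<close>

lemma potential_stationary:
  assumes m: "mather m" and "e > 0"
  shows "AE p in m. \<forall>n::nat. potential (real n) x (fst p) \<le> potential e x (fst p)"
proof -
  have "AE p in m. potential (real n) x (fst p) \<le> potential e x (fst p)" for n :: nat
  proof -
    define N where "N = max (real n) e"
    have N: "N > 0" "e \<le> N" "real n \<le> N" using \<open>e > 0\<close> by (auto simp: N_def)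
    have "AE p in m. (potential N x (fst p) - potential e x (fst p)) / (N + 1) = 0"
    proof (rule margin_null[OF m potential_average_subsolution[OF \<open>e > 0\<close> N(2)]])
      show "continuous_on UNIV (\<lambda>y. (potential N x y - potential e x y) / (N + 1))"
        using N(1) by (intro continuous_intros dominated_continuous potential_dominated) auto
      show "0 \<le> (potential N x y - potential e x y) / (N + 1)" for y using potential_mono[OF N(2), of x y] N(1) by simp
    qed
    then show ?thesis
    proof eventually_elim
      case (elim p)
      then show ?case using N(1) potential_mono[OF N(3), of x "fst p"] by simp
    qed
  qed
  then show ?thesis by (simp add: AE_all_countable)
qed

lemma potential_bounded: "\<exists>B. \<forall>n::nat. potential (real n) x y \<le> B"
proof -
  obtain m where m: "mather m" using mather_ex by blast
  interpret m: prob_space m by (rule prob_mather[OF m])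
  have "\<exists>p. \<forall>n::nat. potential (real n) x (fst p) \<le> potential 1 x (fst p)"
    using potential_stationary[OF m, of 1 x] m.ae_filter_bot eventually_happens' by fastforce
  then obtain p where p: "\<And>n::nat. potential (real n) x (fst p) \<le> potential 1 x (fst p)" by blast
  obtain r l where r: "r > 0" "reach r (fst p) y l" using reach_connected by blast
  have "potential (real n) x y \<le> potential 1 x (fst p) + (l + cG * r)" for n :: nat
    using potential_mono[of "real n" "real n + r" x y] potential_step_right[OF r, of "real n" x] p[of n] r(1) by linarith
  then show ?thesis by blast
qed

definition barrier :: "'m \<Rightarrow> 'm \<Rightarrow> real" where
  "barrier x y = (SUP n::nat. potential (real n) x y)"

lemma potential_le_barrier: "potential s x y \<le> barrier x y"
proof -
  obtain n :: nat where "s \<le> real n" using real_arch_simple by blast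
  then have "potential s x y \<le> potential (real n) x y" by (rule potential_mono)
  also have "\<dots> \<le> barrier x y"
    unfolding barrier_def using potential_bounded[of x y] by (intro cSUP_upper) (auto simp: bdd_above_def)
  finally show ?thesis .
qed

lemma barrier_le: "(\<And>n::nat. potential (real n) x y \<le> B) \<Longrightarrow> barrier x y \<le> B"
  unfolding barrier_def by (rule cSUP_least) auto

lemma peierls_barrier_eq_barrier: "peierls_barrier A G x y = ereal (barrier x y)"
proof (rule antisym)
  show "peierls_barrier A G x y \<le> ereal (barrier x y)" by (rule peierls_barrier_le[OF potential_le_barrier])
  show "ereal (barrier x y) \<le> peierls_barrier A G x y"
  proof (cases "peierls_barrier A G x y")
    case (real b)
    then have "potential s x y \<le> b" for s using potential_le_peierls_barrier[of s x y] by simp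
    then show ?thesis using barrier_le real by simp
  qed (use potential_le_peierls_barrier[of 0 x y] in auto)
qed

lemma barrier_step_left:
  assumes "r > 0" "reach r x' x l" shows "barrier x' y \<le> (l + cG * r) + barrier x y"
proof (rule barrier_le)
  fix n :: nat
  show "potential (real n) x' y \<le> (l + cG * r) + barrier x y"
    using potential_mono[of "real n" "real n + r" x' y] potential_step_left[OF assms, of "real n" y]
      potential_le_barrier[of "real n" x y] assms(1) by linarith
qed

lemma barrier_dominated: "dominated (barrier x)"
  unfolding dominated_def
proof (intro allI impI)
  fix r y y' l assume r: "r > (0::real)" "reach r y y' l"
  have "barrier x y' \<le> barrier x y + (l + cG * r)"
  proof (rule barrier_le)
    fix n :: nat
    show "potential (real n) x y' \<le> barrier x y + (l + cG * r)"
      using potential_mono[of "real n" "real n + r" x y'] potential_step_right[OF r, of "real n" x]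
        potential_le_barrier[of "real n" x y] r(1) by linarith
  qed
  then show "barrier x y' - barrier x y \<le> l + cG * r" by simp
qed

lemma neg_barrier_dominated: "dominated (\<lambda>x. - barrier x y)"
  unfolding dominated_def
proof (intro allI impI)
  fix r x x' l assume "r > (0::real)" "reach r x x' l"
  then show "- barrier x' y - - barrier x y \<le> l + cG * r" using barrier_step_left[of r x x' l y] by simp
qed

lemma barrier_continuous: "continuous_on UNIV (barrier x)"
  by (rule dominated_continuous[OF barrier_dominated])

lemma barrier_continuous_left: "continuous_on UNIV (\<lambda>x. barrier x y)"
  using continuous_on_minus[OF dominated_continuous[OF neg_barrier_dominated[of y]]] by simp

lemma barrier_triangle: "barrier x z \<le> barrier x y + barrier y z"
proof -
  have "barrier x z - barrier y z \<le> potential 1 x y"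
  proof (rule potential_greatest)
    fix t k assume "t > (0::real)" "reach t x y k"
    from barrier_step_left[OF this, of z] show "barrier x z - barrier y z \<le> k + cG * t" by linarith
  qed
  then show ?thesis using potential_le_barrier[of 1 x y] by linarith
qed

lemma dominated_le_barrier: "dominated u \<Longrightarrow> u y - u x \<le> barrier x y"
  using dominated_le_potential[of u y x 1] potential_le_barrier[of 1 x y] by linarith

lemma barrier_pos_null:
  assumes m: "mather m" and z: "barrier z z > 0"
  shows "\<exists>U. open U \<and> z \<in> U \<and> (AE p in m. fst p \<notin> U)"
proof -
  obtain k where k: "\<And>r. r > 0 \<Longrightarrow> reach r z z (r * k)" using reach_rest by blast
  define q where "q = \<bar>k + cG\<bar> + 1"
  have q: "q > 0" "k + cG \<le> q" by (auto simp: q_def)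
  define e where "e = barrier z z / (2 * q)"
  have e: "e > 0" "e * q < barrier z z" using z q(1) by (simp_all add: e_def)
  have "potential e z z \<le> e * (k + cG)"
    using potential_le[of e e z z "e * k"] k[OF e(1)] e(1) by (simp add: algebra_simps)
  also have "\<dots> \<le> e * q" using e(1) q(2) by (intro mult_left_mono) auto
  finally have "potential e z z < barrier z z" using e(2) by simp
  define U where "U = {x. potential e z x < barrier z x}"
  have "open U"
    unfolding U_def by (intro open_Collect_less dominated_continuous potential_dominated barrier_dominated)
  moreover have "z \<in> U" using \<open>potential e z z < barrier z z\<close> by (simp add: U_def)
  moreover have "AE p in m. fst p \<notin> U"
    using potential_stationary[OF m e(1), of z] by eventually_elim (simp add: U_def not_less barrier_le)
  ultimately show ?thesis by blast
qed

end

subsection \<open>Densities of Mather measures\<close>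

lemma prob_space_density_normalized:
  fixes f :: "'a \<Rightarrow> real"
  assumes f: "integrable M f" "\<And>x. f x \<ge> 0" and pos: "(\<integral>x. f x \<partial>M) > 0"
  shows "prob_space (density M (\<lambda>x. ennreal (f x / (\<integral>x. f x \<partial>M))))"
proof (rule prob_spaceI)
  let ?d = "\<lambda>x. f x / (\<integral>x. f x \<partial>M)"
  have d: "integrable M ?d" "\<And>x. ?d x \<ge> 0" using f pos by simp_all
  have "emeasure (density M (\<lambda>x. ennreal (?d x))) (space M) = (\<integral>\<^sup>+x. ennreal (?d x) * indicator (space M) x \<partial>M)"
    using borel_measurable_integrable[OF d(1)] by (simp add: emeasure_density)
  also have "\<dots> = (\<integral>\<^sup>+x. ennreal (?d x) \<partial>M)" by (intro nn_integral_cong) simp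
  also have "\<dots> = ennreal (\<integral>x. ?d x \<partial>M)" using d by (intro nn_integral_eq_integral) auto
  also have "(\<integral>x. ?d x \<partial>M) = 1" using pos by simp
  finally show "emeasure (density M (\<lambda>x. ennreal (?d x))) (space (density M (\<lambda>x. ennreal (?d x)))) = 1" by simp
qed

context hamiltonian
begin

definition mean :: "('m \<times> ('m, 'e) tvec) measure \<Rightarrow> ('m \<Rightarrow> real) \<Rightarrow> real" where
  "mean m F = (\<integral>p. F (fst p) \<partial>m)"

lemma mean_mult_const: "mean m (\<lambda>x. k x * a) = a * mean m k"
  by (simp add: mean_def mult.commute)

lemma mean_mult_eq_0: "AE p in m. k (fst p) = 0 \<Longrightarrow> mean m (\<lambda>x. k x * F x) = 0"
  unfolding mean_def by (intro integral_eq_zero_AE) (auto elim: eventually_mono)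

lemma mean_nonneg: "(\<And>x. k x \<ge> 0) \<Longrightarrow> mean m k \<ge> 0"
  unfolding mean_def by (intro integral_nonneg_AE) auto

context
  fixes m assumes m: "mather m"
begin

lemma mean_add: "continuous_on UNIV F \<Longrightarrow> continuous_on UNIV H \<Longrightarrow> mean m (\<lambda>x. F x + H x) = mean m F + mean m H"
  unfolding mean_def by (intro Bochner_Integration.integral_add integrable_base_mather[OF m])

lemma mean_mono:
  "continuous_on UNIV F \<Longrightarrow> continuous_on UNIV H \<Longrightarrow> (\<And>x. F x \<le> H x) \<Longrightarrow> mean m F \<le> mean m H"
  unfolding mean_def by (intro integral_mono integrable_base_mather[OF m])

lemma mean_const: "mean m (\<lambda>_. a) = a"
  unfolding mean_def using prob_space.prob_space[OF prob_mather[OF m]] by simp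

lemma mean_cong_AE:
  assumes "continuous_on UNIV F" "continuous_on UNIV H" "AE p in m. F (fst p) = H (fst p)"
  shows "mean m F = mean m H"
  unfolding mean_def using assms base_measurable_mather[OF m] by (intro integral_cong_AE) auto

lemma mean_eq_0_imp_AE:
  assumes "continuous_on UNIV k" "\<And>x. k x \<ge> 0" "mean m k = 0"
  shows "AE p in m. k (fst p) = 0"
  using integral_nonneg_eq_0_iff_AE[OF integrable_base_mather[OF m assms(1)]] assms(2,3) by (simp add: mean_def)

lemma mean_mult_add:
  assumes "continuous_on UNIV k" "continuous_on UNIV F" "continuous_on UNIV H"
  shows "mean m (\<lambda>x. k x * (F x + H x)) = mean m (\<lambda>x. k x * F x) + mean m (\<lambda>x. k x * H x)"
  unfolding distrib_left by (intro mean_add continuous_intros assms)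

lemma mean_mult_split:
  assumes "continuous_on UNIV \<rho>" "continuous_on UNIV \<tau>" "continuous_on UNIV F"
  shows "mean m (\<lambda>x. \<rho> x * F x) = mean m (\<lambda>x. \<tau> x * F x) + mean m (\<lambda>x. (\<rho> x - \<tau> x) * F x)"
  by (subst mean_add[symmetric]) (auto intro!: continuous_intros assms simp flip: distrib_right)

lemma mean_mult_mono:
  assumes "continuous_on UNIV k" "continuous_on UNIV F" "continuous_on UNIV H"
    and "\<And>x. k x \<ge> 0" "\<And>x. k x \<noteq> 0 \<Longrightarrow> F x \<le> H x"
  shows "mean m (\<lambda>x. k x * F x) \<le> mean m (\<lambda>x. k x * H x)"
proof (intro mean_mono continuous_on_mult assms(1-3))
  show "k x * F x \<le> k x * H x" for x
    using assms(4,5)[of x] by (cases "k x = 0") (auto intro: mult_left_mono)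
qed

end

definition closed_density :: "('m \<times> ('m, 'e) tvec) measure \<Rightarrow> ('m \<Rightarrow> real) \<Rightarrow> bool" where
  "closed_density m \<rho> \<longleftrightarrow> continuous_on UNIV \<rho> \<and> (\<forall>x. 0 \<le> \<rho> x \<and> \<rho> x \<le> 1) \<and>
     (\<forall>f\<in>C1. (\<integral>p. \<rho> (fst p) * differential_at f p \<partial>m) = 0)"

definition minimizing_density :: "('m \<times> ('m, 'e) tvec) measure \<Rightarrow> ('m \<Rightarrow> real) \<Rightarrow> bool" where
  "minimizing_density m \<rho> \<longleftrightarrow> closed_density m \<rho> \<and> (\<integral>p. \<rho> (fst p) * (L_at p + cG) \<partial>m) = 0"

lemma closed_densityD:
  assumes "closed_density m \<rho>"
  shows "continuous_on UNIV \<rho>" "\<rho> x \<ge> 0" "\<rho> x \<le> 1" "f \<in> C1 \<Longrightarrow> (\<integral>p. \<rho> (fst p) * differential_at f p \<partial>m) = 0"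
  using assms by (auto simp: closed_density_def)

lemma minimizing_density_one:
  assumes m: "mather m" shows "minimizing_density m (\<lambda>_. 1)"
  using integral_differential_mather[OF m] integrable_L_mather[OF m] integral_L_mather[OF m]
    prob_space.finite_measure[OF prob_mather[OF m]] prob_space.prob_space[OF prob_mather[OF m]]
  by (simp add: minimizing_density_def closed_density_def finite_measure.integrable_const)

lemma minimizing_density_normalize:
  assumes m: "mather m" and \<rho>: "minimizing_density m \<rho>" and pos: "mean m \<rho> > 0"
  obtains m' where "mather m'" "\<And>F. continuous_on UNIV F \<Longrightarrow> mean m' F = mean m (\<lambda>x. \<rho> x * F x) / mean m \<rho>"
proof -
  have closed: "closed_density m \<rho>" and \<rho>L: "(\<integral>p. \<rho> (fst p) * (L_at p + cG) \<partial>m) = 0"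
    using \<rho> by (auto simp: minimizing_density_def)
  note int_\<rho> = integrable_base_mather[OF m closed_densityD(1)[OF closed]]
  define d where "d p = \<rho> (fst p) / mean m \<rho>" for p :: "'m \<times> ('m, 'e) tvec"
  have d: "d \<in> borel_measurable m" "\<And>p. d p \<ge> 0"
    using borel_measurable_integrable[OF int_\<rho>] closed_densityD(2)[OF closed] pos by (simp_all add: d_def[abs_def])
  define m' where "m' = density m (\<lambda>p. ennreal (d p))"
  have "prob_space m'"
    using prob_space_density_normalized[OF int_\<rho> closed_densityD(2)[OF closed]] pos by (simp add: m'_def d_def mean_def)
  then interpret m': prob_space m' .
  have int: "integrable m' H" "(\<integral>p. H p \<partial>m') = (\<integral>p. \<rho> (fst p) * H p \<partial>m) / mean m \<rho>"
    if H: "integrable m H" for H :: "_ \<Rightarrow> real"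
  proof -
    have "integrable m (\<lambda>p. d p *\<^sub>R H p)"
      using integrable_mult_mather[OF m closed_densityD(1)[OF closed] H] by (simp add: d_def)
    then show "integrable m' H" unfolding m'_def using H d by (subst integrable_density) auto
    have "(\<integral>p. H p \<partial>m') = (\<integral>p. d p *\<^sub>R H p \<partial>m)"
      unfolding m'_def using H d by (intro integral_density) auto
    then show "(\<integral>p. H p \<partial>m') = (\<integral>p. \<rho> (fst p) * H p \<partial>m) / mean m \<rho>" by (simp add: d_def)
  qed
  have "(\<integral>p. L_at p + cG \<partial>m') = 0" using int(2)[OF integrable_L_add_mather[OF m, of cG]] \<rho>L by simp
  then have "(\<integral>p. L_at p \<partial>m') = - cG" using int(1)[OF integrable_L_mather[OF m]] by (simp add: m'.prob_space)
  then have "mather m'"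
    unfolding mather_measure_def closed_measure_def
    using sets_mather[OF m] m'.prob_space_axioms int(1)[OF integrable_tnorm_mather[OF m]] int(1)[OF integrable_L_mather[OF m]]
      int(2)[OF integrable_differential_mather[OF m]] closed_densityD(4)[OF closed]
    by (simp add: case_prod_unfold m'_def)
  then show thesis using int(2)[OF integrable_base_mather[OF m]] by (intro that) (simp_all add: mean_def)
qed

subsection \<open>Splitting Mather measures\<close>

context
  fixes m assumes m: "mather m"
begin

lemma integrable_defect: "f \<in> C1 \<Longrightarrow> integrable m (\<lambda>p. L_at p + a - differential_at f p)"
  by (intro Bochner_Integration.integrable_diff integrable_L_add_mather integrable_differential_mather m)

lemma closed_density_defect:
  assumes \<rho>: "closed_density m \<rho>" and f: "f \<in> C1"
  shows "(\<integral>p. \<rho> (fst p) * (L_at p + a - differential_at f p) \<partial>m)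
    = (\<integral>p. \<rho> (fst p) * (L_at p + cG) \<partial>m) + (a - cG) * mean m \<rho>"
proof -
  note int = integrable_mult_mather[OF m closed_densityD(1)[OF \<rho>]]
  have "(\<integral>p. \<rho> (fst p) * (L_at p + a - differential_at f p) \<partial>m)
      = (\<integral>p. (\<rho> (fst p) * (L_at p + cG) + (a - cG) * \<rho> (fst p)) - \<rho> (fst p) * differential_at f p \<partial>m)"
    by (intro Bochner_Integration.integral_cong) (auto simp: algebra_simps)
  also have "\<dots> = (\<integral>p. \<rho> (fst p) * (L_at p + cG) \<partial>m) + (a - cG) * mean m \<rho>"
    using int[OF integrable_L_add_mather[OF m]] int[OF integrable_differential_mather[OF m f]]
      integrable_base_mather[OF m closed_densityD(1)[OF \<rho>]] closed_densityD(4)[OF \<rho> f] by (simp add: mean_def)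
  finally show ?thesis .
qed

lemma mean_closed_density_le_1: "closed_density m \<rho> \<Longrightarrow> mean m \<rho> \<le> 1"
  using mean_mono[OF m, of \<rho> "\<lambda>_. 1"] closed_densityD[of m \<rho>] mean_const[OF m, of 1] by simp

lemma closed_density_action_nonneg:
  assumes \<rho>: "closed_density m \<rho>" shows "(\<integral>p. \<rho> (fst p) * (L_at p + cG) \<partial>m) \<ge> 0"
proof (rule field_le_epsilon)
  fix e :: real assume "e > 0"
  obtain f where f: "f \<in> C1" "\<And>x. G x (differential A f x) \<le> cG + e" using critical_C1[OF \<open>e > 0\<close>] by blast
  have "0 \<le> \<rho> (fst p) * (L_at p + (cG + e) - differential_at f p)" if "p \<in> space m" for p
    using differential_le_L[OF f(1) tangent_mather[OF m that]] f(2)[of "fst p"] closed_densityD(2)[OF \<rho>]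
    by (intro mult_nonneg_nonneg) auto
  then have "0 \<le> (\<integral>p. \<rho> (fst p) * (L_at p + (cG + e) - differential_at f p) \<partial>m)"
    by (intro integral_nonneg_AE AE_I2)
  also have "\<dots> = (\<integral>p. \<rho> (fst p) * (L_at p + cG) \<partial>m) + e * mean m \<rho>"
    by (simp add: closed_density_defect[OF \<rho> f(1)])
  also have "e * mean m \<rho> \<le> e * 1"
    using \<open>e > 0\<close> mean_closed_density_le_1[OF \<rho>] by (intro mult_left_mono) auto
  finally show "0 \<le> (\<integral>p. \<rho> (fst p) * (L_at p + cG) \<partial>m) + e" by simp
qed

lemma minimizing_density_bound:
  fixes a k k' :: real
  assumes \<rho>: "minimizing_density m \<rho>" and f: "f \<in> C1" "f1 \<in> C1" "f2 \<in> C1"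
  defines "bound \<equiv> \<lambda>p. k * \<bar>differential_at f p\<bar>
    + k' * ((L_at p + a - differential_at f1 p) + (L_at p + a - differential_at f2 p))"
  shows "integrable m bound"
    and "(\<integral>p. \<rho> (fst p) * bound p \<partial>m)
      = k * (\<integral>p. \<rho> (fst p) * \<bar>differential_at f p\<bar> \<partial>m) + k' * (2 * (a - cG)) * mean m \<rho>"
proof -
  have closed: "closed_density m \<rho>" and \<rho>L: "(\<integral>p. \<rho> (fst p) * (L_at p + cG) \<partial>m) = 0"
    using \<rho> by (auto simp: minimizing_density_def)
  note int = integrable_mult_mather[OF m closed_densityD(1)[OF closed]]
  show "integrable m bound"
    unfolding bound_def by (intro Bochner_Integration.integrable_add integrable_mult_right integrable_abs integrable_defect
        integrable_differential_mather m f)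
  have "(\<integral>p. \<rho> (fst p) * bound p \<partial>m) = (\<integral>p. k * (\<rho> (fst p) * \<bar>differential_at f p\<bar>)
      + k' * (\<rho> (fst p) * (L_at p + a - differential_at f1 p) + \<rho> (fst p) * (L_at p + a - differential_at f2 p)) \<partial>m)"
    by (intro Bochner_Integration.integral_cong) (auto simp: bound_def algebra_simps)
  also have "\<dots> = k * (\<integral>p. \<rho> (fst p) * \<bar>differential_at f p\<bar> \<partial>m) + k' * (2 * (a - cG)) * mean m \<rho>"
    using int[OF integrable_abs[OF integrable_differential_mather[OF m f(1)]]] int[OF integrable_defect[OF f(2)]]
      int[OF integrable_defect[OF f(3)]] by (simp add: closed_density_defect[OF closed] f \<rho>L)
  finally show "(\<integral>p. \<rho> (fst p) * bound p \<partial>m)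
      = k * (\<integral>p. \<rho> (fst p) * \<bar>differential_at f p\<bar> \<partial>m) + k' * (2 * (a - cG)) * mean m \<rho>" .
qed

lemma minimizing_density_if_closed_density_le:
  assumes \<rho>: "minimizing_density m \<rho>" and \<tau>: "closed_density m \<tau>" and le: "\<And>x. \<tau> x \<le> \<rho> x"
  shows "minimizing_density m \<tau>" "minimizing_density m (\<lambda>x. \<rho> x - \<tau> x)"
proof -
  have closed: "closed_density m \<rho>" and \<rho>L: "(\<integral>p. \<rho> (fst p) * (L_at p + cG) \<partial>m) = 0"
    using \<rho> by (auto simp: minimizing_density_def)
  have diff: "(\<integral>p. (\<rho> (fst p) - \<tau> (fst p)) * H p \<partial>m) = (\<integral>p. \<rho> (fst p) * H p \<partial>m) - (\<integral>p. \<tau> (fst p) * H p \<partial>m)"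
    if "integrable m H" for H :: "_ \<Rightarrow> real"
    unfolding left_diff_distrib using integrable_mult_mather[OF m _ that] closed_densityD(1)[OF closed] closed_densityD(1)[OF \<tau>]
    by (intro Bochner_Integration.integral_diff)
  have "\<rho> x - \<tau> x \<le> 1" for x using closed_densityD(3)[OF closed, of x] closed_densityD(2)[OF \<tau>, of x] by linarith
  then have closed': "closed_density m (\<lambda>x. \<rho> x - \<tau> x)"
    unfolding closed_density_def using le closed_densityD[OF closed] closed_densityD[OF \<tau>]
    by (auto simp: diff integrable_differential_mather[OF m] intro!: continuous_intros)
  have "(\<integral>p. \<tau> (fst p) * (L_at p + cG) \<partial>m) = 0"
    using closed_density_action_nonneg[OF \<tau>] closed_density_action_nonneg[OF closed']
    by (simp add: diff[OF integrable_L_add_mather[OF m]] \<rho>L)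
  then show "minimizing_density m \<tau>" "minimizing_density m (\<lambda>x. \<rho> x - \<tau> x)"
    using \<tau> closed' by (simp_all add: minimizing_density_def diff[OF integrable_L_add_mather[OF m]] \<rho>L)
qed

end

lemma C1_diff: "f \<in> C1 \<Longrightarrow> h \<in> C1 \<Longrightarrow> (\<lambda>x. f x - h x) \<in> C1"
  using C1_add[OF _ C1_cmult[of h "- 1"]] by simp

lemma differential_diff:
  assumes "v \<in> tangent_space A x" "f \<in> C1" "h \<in> C1"
  shows "differential A (\<lambda>x. f x - h x) x v = differential A f x v - differential A h x v"
  using differential_add[OF assms(1,2) C1_cmult[OF assms(3), of "- 1"]] differential_cmult[OF assms(1,3), of "- 1"] by simp

context
  fixes \<theta> \<theta>' :: "real \<Rightarrow> real" and K :: real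
  assumes \<theta>: "\<And>t. (\<theta> has_real_derivative \<theta>' t) (at t)" "continuous_on UNIV \<theta>'" "\<And>t. \<bar>\<theta>' t\<bar> \<le> K"
begin

lemma compose_continuous: "continuous_on S f \<Longrightarrow> continuous_on S (\<lambda>x. \<theta> (f x))"
  by (rule continuous_on_compose2[of UNIV \<theta>]) (use \<theta>(1) DERIV_isCont continuous_at_imp_continuous_on in blast)+

lemma compose_diff_C1:
  assumes "f1 \<in> C1" "f2 \<in> C1" shows "(\<lambda>x. \<theta> (f1 x - f2 x)) \<in> C1"
  by (rule C1_compose_real[OF C1_diff[OF assms] \<theta>(1)]) (rule continuous_on_subset[OF \<theta>(2) subset_UNIV])

lemma compose_diff_differential_close:
  assumes v: "v \<in> tangent_space A x" and f: "f \<in> C1" "f1 \<in> C1" "f2 \<in> C1" and "\<bar>f x\<bar> \<le> B"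
    and close: "\<bar>f1 x - a1\<bar> \<le> e" "\<bar>f2 x - a2\<bar> \<le> e"
    and l: "differential A f1 x v \<le> l" "differential A f2 x v \<le> l"
  shows "\<bar>\<theta> (a1 - a2) * differential A f x v - differential A (\<lambda>x. \<theta> (f1 x - f2 x) * f x) x v\<bar>
    \<le> 2 * K * e * \<bar>differential A f x v\<bar> + B * K * ((l - differential A f1 x v) + (l - differential A f2 x v))"
proof -
  have "K \<ge> 0" using \<theta>(3)[of 0] by linarith
  let ?s = "f1 x - f2 x" and ?D = "differential A f1 x v - differential A f2 x v"
  have "\<bar>\<theta> (a1 - a2) - \<theta> ?s\<bar> \<le> K * \<bar>(a1 - a2) - ?s\<bar>"
    using field_differentiable_bound[of UNIV \<theta> \<theta>' K "a1 - a2" ?s] \<theta>(1,3) by (auto simp: has_field_derivative_at_within)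
  also have "\<dots> \<le> K * (2 * e)" using close \<open>K \<ge> 0\<close> by (intro mult_left_mono) auto
  finally have \<theta>_close: "\<bar>\<theta> (a1 - a2) - \<theta> ?s\<bar> \<le> 2 * K * e" by simp
  have "B \<ge> 0" using assms(5) by linarith
  have "\<bar>f x * \<theta>' ?s\<bar> \<le> B * K" unfolding abs_mult using assms(5) \<theta>(3) by (intro mult_mono) auto
  moreover have "\<bar>?D\<bar> \<le> (l - differential A f1 x v) + (l - differential A f2 x v)" using l by (simp add: abs_le_iff)
  ultimately have D_le: "\<bar>f x * \<theta>' ?s\<bar> * \<bar>?D\<bar> \<le> B * K * ((l - differential A f1 x v) + (l - differential A f2 x v))"
    by (rule mult_mono) (use \<open>B \<ge> 0\<close> \<open>K \<ge> 0\<close> in auto)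
  have "differential A (\<lambda>x. \<theta> (f1 x - f2 x) * f x) x v = \<theta> ?s * differential A f x v + f x * (\<theta>' ?s * ?D)"
    unfolding differential_mult[OF v compose_diff_C1[OF f(2,3)] f(1)]
    by (subst differential_compose_real[OF v C1_diff[OF f(2,3)] \<theta>(1)])
      (simp_all add: differential_diff[OF v f(2,3)] continuous_on_subset[OF \<theta>(2)])
  then have "\<theta> (a1 - a2) * differential A f x v - differential A (\<lambda>x. \<theta> (f1 x - f2 x) * f x) x v
      = (\<theta> (a1 - a2) - \<theta> ?s) * differential A f x v - (f x * \<theta>' ?s) * ?D" by (simp add: algebra_simps)
  also have "\<bar>\<dots>\<bar> \<le> \<bar>\<theta> (a1 - a2) - \<theta> ?s\<bar> * \<bar>differential A f x v\<bar> + \<bar>f x * \<theta>' ?s\<bar> * \<bar>?D\<bar>"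
    unfolding abs_mult[symmetric] by (rule abs_triangle_ineq4)
  also have "\<dots> \<le> 2 * K * e * \<bar>differential A f x v\<bar> + B * K * ((l - differential A f1 x v) + (l - differential A f2 x v))"
    using D_le by (intro add_mono mult_right_mono \<theta>_close) auto
  finally show ?thesis .
qed

text \<open>
  Smooth approximations of two subsolutions have asymptotically the same differential on the support
  of a Mather measure, so a function of their difference acts as a constant density.
\<close>

lemma compose_diff_integral_le:
  assumes m: "mather m" and \<rho>: "minimizing_density m \<rho>" and u: "continuous_on UNIV u1" "continuous_on UNIV u2"
    and f: "f \<in> C1" "\<And>x. \<bar>f x\<bar> \<le> B" and "e > 0"
    and f1: "f1 \<in> C1" "\<And>x. \<bar>f1 x - u1 x\<bar> \<le> e" "\<And>x. G x (differential A f1 x) \<le> cG + e"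
    and f2: "f2 \<in> C1" "\<And>x. \<bar>f2 x - u2 x\<bar> \<le> e" "\<And>x. G x (differential A f2 x) \<le> cG + e"
  shows "\<bar>\<integral>p. \<rho> (fst p) * (\<theta> (u1 (fst p) - u2 (fst p)) * differential_at f p) \<partial>m\<bar>
    \<le> e * (2 * K * (\<integral>p. \<rho> (fst p) * \<bar>differential_at f p\<bar> \<partial>m) + 2 * B * K)"
proof -
  have closed: "closed_density m \<rho>" using \<rho> by (simp add: minimizing_density_def)
  note int = integrable_mult_mather[OF m closed_densityD(1)[OF closed]]
  have "continuous_on UNIV (\<lambda>x. \<theta> (u1 x - u2 x))" by (intro compose_continuous continuous_on_diff u)
  note int_\<theta> = integrable_mult_mather[OF m this integrable_differential_mather[OF m f(1)]]
  let ?\<psi>f = "\<lambda>x. \<theta> (f1 x - f2 x) * f x" and ?n = "\<lambda>h p. L_at p + (cG + e) - differential_at h p"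
  have \<psi>f: "?\<psi>f \<in> C1" by (rule C1_mult[OF compose_diff_C1[OF f1(1) f2(1)] f(1)])
  note int_\<psi>f = integrable_differential_mather[OF m \<psi>f]
  let ?bound = "\<lambda>p. 2 * K * e * \<bar>differential_at f p\<bar> + B * K * (?n f1 p + ?n f2 p)"
  note bound = minimizing_density_bound[OF m \<rho> f(1) f1(1) f2(1)]
  have "\<bar>\<integral>p. \<rho> (fst p) * (\<theta> (u1 (fst p) - u2 (fst p)) * differential_at f p) \<partial>m\<bar>
      = \<bar>\<integral>p. \<rho> (fst p) * (\<theta> (u1 (fst p) - u2 (fst p)) * differential_at f p - differential_at ?\<psi>f p) \<partial>m\<bar>"
    using closed_densityD(4)[OF closed \<psi>f] by (simp add: right_diff_distrib int[OF int_\<theta>] int[OF int_\<psi>f])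
  also have "\<dots> \<le> (\<integral>p. \<bar>\<rho> (fst p) * (\<theta> (u1 (fst p) - u2 (fst p)) * differential_at f p - differential_at ?\<psi>f p)\<bar> \<partial>m)"
    by (rule integral_abs_bound)
  also have "\<dots> \<le> (\<integral>p. \<rho> (fst p) * ?bound p \<partial>m)"
  proof (intro integral_mono integrable_abs int[OF bound(1)] int Bochner_Integration.integrable_diff int_\<theta> int_\<psi>f)
    fix p assume "p \<in> space m"
    then have v: "snd p \<in> tangent_space A (fst p)" by (rule tangent_mather[OF m])
    have le: "differential_at h p \<le> L_at p + (cG + e)" if "h \<in> C1" "G (fst p) (differential A h (fst p)) \<le> cG + e" for h
      using differential_le_L[OF that(1) v] that(2) by linarith
    show "\<bar>\<rho> (fst p) * (\<theta> (u1 (fst p) - u2 (fst p)) * differential_at f p - differential_at ?\<psi>f p)\<bar> \<le> \<rho> (fst p) * ?bound p"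
      unfolding abs_mult abs_of_nonneg[OF closed_densityD(2)[OF closed]]
      by (intro mult_left_mono compose_diff_differential_close v le f f1 f2 closed_densityD(2)[OF closed])
  qed
  also have "\<dots> = 2 * K * e * (\<integral>p. \<rho> (fst p) * \<bar>differential_at f p\<bar> \<partial>m) + B * K * (2 * e) * mean m \<rho>"
    unfolding bound(2) by simp
  also have "B * K * (2 * e) * mean m \<rho> \<le> B * K * (2 * e) * 1"
    using f(2)[of undefined] \<theta>(3)[of 0] \<open>e > 0\<close> mean_closed_density_le_1[OF m closed]
    by (intro mult_left_mono mult_nonneg_nonneg) auto
  finally show ?thesis by (simp add: algebra_simps)
qed

lemma closed_density_mult_compose_diff:
  assumes m: "mather m" and \<rho>: "minimizing_density m \<rho>" and u: "dominated u1" "dominated u2"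
    and bounds: "\<And>t. 0 \<le> \<theta> t \<and> \<theta> t \<le> 1"
  shows "closed_density m (\<lambda>x. \<rho> x * \<theta> (u1 x - u2 x))"
  unfolding closed_density_def
proof (intro conjI allI ballI)
  have closed: "closed_density m \<rho>" using \<rho> by (simp add: minimizing_density_def)
  note cont = dominated_continuous[OF u(1)] dominated_continuous[OF u(2)]
  show "continuous_on UNIV (\<lambda>x. \<rho> x * \<theta> (u1 x - u2 x))"
    by (intro continuous_on_mult closed_densityD(1)[OF closed] compose_continuous continuous_on_diff cont)
  show "0 \<le> \<rho> x * \<theta> (u1 x - u2 x)" "\<rho> x * \<theta> (u1 x - u2 x) \<le> 1" for x
    using closed_densityD(2,3)[OF closed, of x] bounds by (simp_all add: mult_le_one)
  fix f assume f: "f \<in> C1"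
  obtain B where B: "B > 0" "\<And>x. \<bar>f x\<bar> \<le> B" using continuous_bounded[OF C1_continuous[OF f]] by blast
  let ?I = "\<integral>p. \<rho> (fst p) * (\<theta> (u1 (fst p) - u2 (fst p)) * differential_at f p) \<partial>m"
  define C where "C = 2 * K * (\<integral>p. \<rho> (fst p) * \<bar>differential_at f p\<bar> \<partial>m) + 2 * B * K + 1"
  have "(\<integral>p. \<rho> (fst p) * \<bar>differential_at f p\<bar> \<partial>m) \<ge> 0"
    using closed_densityD(2)[OF closed] by (intro integral_nonneg_AE) auto
  moreover have "K \<ge> 0" using \<theta>(3)[of 0] by linarith
  ultimately have C: "C > 0" using B(1) by (simp add: C_def add_nonneg_pos)
  have "\<bar>?I\<bar> \<le> 0"
  proof (rule field_le_epsilon)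
    fix e :: real assume "e > 0"
    then have \<epsilon>: "e / C > 0" using C by simp
    obtain f1 where f1: "f1 \<in> C1" "\<And>x. \<bar>f1 x - u1 x\<bar> \<le> e / C" "\<And>x. G x (differential A f1 x) \<le> cG + e / C"
      by (rule smooth_approximation[OF dominated_imp_subsolution[OF u(1)] \<epsilon>]) (rule that)
    obtain f2 where f2: "f2 \<in> C1" "\<And>x. \<bar>f2 x - u2 x\<bar> \<le> e / C" "\<And>x. G x (differential A f2 x) \<le> cG + e / C"
      by (rule smooth_approximation[OF dominated_imp_subsolution[OF u(2)] \<epsilon>]) (rule that)
    have "\<bar>?I\<bar> \<le> e / C * (C - 1)"
      using compose_diff_integral_le[OF m \<rho> cont f B(2) \<epsilon> f1 f2] by (simp add: C_def)
    also have "\<dots> \<le> e / C * C" using \<epsilon> by (intro mult_left_mono) auto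
    finally show "\<bar>?I\<bar> \<le> 0 + e" using C by simp
  qed
  then show "(\<integral>p. (\<rho> (fst p) * \<theta> (u1 (fst p) - u2 (fst p))) * differential_at f p \<partial>m) = 0" by (simp add: mult.assoc)
qed

end

lemma closed_density_mult_cutoff:
  assumes "mather m" "minimizing_density m \<rho>" "dominated u1" "dominated u2" and "b > 0"
  shows "closed_density m (\<lambda>x. \<rho> x * cutoff ((u1 x - u2 x - a) / b))"
proof (rule closed_density_mult_compose_diff[OF _ _ _ assms(1-4)])
  show "((\<lambda>t. cutoff ((t - a) / b)) has_real_derivative cutoff' ((t - a) / b) * (1 / b)) (at t)" for t
    by (rule DERIV_chain2[OF has_real_derivative_cutoff]) (use \<open>b > 0\<close> in \<open>auto intro!: derivative_eq_intros\<close>)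
  show "continuous_on UNIV (\<lambda>t. cutoff' ((t - a) / b) * (1 / b))"
    using \<open>b > 0\<close> by (intro continuous_intros continuous_on_cutoff') auto
  show "\<bar>cutoff' ((t - a) / b) * (1 / b)\<bar> \<le> 2 * (1 / b)" for t
    using abs_cutoff'_le \<open>b > 0\<close> unfolding abs_mult by (intro mult_mono) auto
qed (simp add: cutoff_bounds)

subsection \<open>Strict subsolutions and test functions\<close>

lemma peak_function:
  assumes U: "open U" "x \<in> U"
  shows "\<exists>\<psi>\<in>C1. \<psi> x = 1 \<and> (\<forall>y. y \<noteq> x \<longrightarrow> \<psi> y < 1) \<and> (\<forall>y. y \<notin> U \<longrightarrow> \<psi> y = 0)"
proof -
  obtain c where c: "c \<in> A" "x \<in> cdom c" using chart_ex by blast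
  have x: "cmap c x \<in> cimage c \<inter> cinv c -` U" using c U(2) by (simp add: cinv_cmap)
  obtain s where s: "s > 0" "cball (cmap c x) s \<subseteq> cimage c \<inter> cinv c -` U"
    using open_cinv_vimage[OF c(1) U(1)] x by (meson open_contains_cball)
  define r where "r = s / 3"
  have "cball (cmap c x) r \<subseteq> cball (cmap c x) s" using s(1) by (auto simp: r_def)
  then have r: "0 < r" "cball (cmap c x) (3 * r) \<subseteq> cimage c" "cinv c ` cball (cmap c x) r \<subseteq> U"
    using s by (auto simp: r_def)
  note bump = c(1) order_refl r(1,2)
  have "cinv c ` cball (cmap c x) 0 = {x}" using cinv_cmap[OF c] by simp
  then show ?thesis
    using chart_bump_C1[OF bump] chart_bump_eq_1[OF bump] chart_bump_less_1[OF bump] chart_bump_eq_0[OF bump] r(3)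
    by (intro bexI[of _ "chart_bump c x 0 r"]) blast+
qed

lemma strict_touching_function:
  assumes w: "continuous_on UNIV w" and f: "f \<in> C1" and touch: "\<forall>\<^sub>F y in nhds x. w y - f y \<ge> w x - f x"
  shows "\<exists>F\<in>C1. F x = w x \<and> (\<forall>y. y \<noteq> x \<longrightarrow> F y < w y) \<and> differential A F x = differential A f x"
proof -
  define a where "a = w x - f x"
  obtain U where U: "open U" "x \<in> U" "\<And>y. y \<in> U \<Longrightarrow> w y - f y \<ge> a"
    using touch unfolding eventually_nhds a_def by blast
  obtain \<psi> where \<psi>: "\<psi> \<in> C1" "\<psi> x = 1" "\<And>y. y \<noteq> x \<Longrightarrow> \<psi> y < 1" "\<And>y. y \<notin> U \<Longrightarrow> \<psi> y = 0"
    using peak_function[OF U(1,2)] by blast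
  have "continuous_on UNIV (\<lambda>y. f y + a - w y)" by (intro continuous_intros C1_continuous[OF f] w)
  then obtain B where B: "B > 0" "\<And>y. \<bar>f y + a - w y\<bar> \<le> B" using continuous_bounded by blast
  define F where "F y = f y + ((a - (B + 1)) + (B + 1) * \<psi> y)" for y
  have F: "F \<in> C1" unfolding F_def by (intro C1_add C1_const C1_cmult f \<psi>(1))
  have F_x: "F x = w x" by (simp add: F_def \<psi>(2) a_def)
  have less: "F y < w y" if "y \<noteq> x" for y
  proof (cases "y \<in> U")
    case True
    have "(B + 1) * \<psi> y < B + 1" using B(1) \<psi>(3)[OF that] by simp
    then show ?thesis using U(3)[OF True] by (simp add: F_def)
  next
    case False
    then show ?thesis using B(2)[of y] \<psi>(4)[OF False] by (simp add: F_def)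
  qed
  have "(B + 1) * \<psi> y \<le> (B + 1) * \<psi> x" for y
    using B(1) \<psi>(2) \<psi>(3)[of y] by (cases "y = x") (auto intro!: mult_left_mono simp: less_imp_le)
  then have "differential A F x = differential A f x"
    by (intro differential_eq_if_touching[OF F f] always_eventually) (simp add: F_def)
  then show ?thesis using F F_x less by blast
qed

lemma subsolution_max_margin:
  assumes w: "subsolution cG w" and F: "F \<in> C1" and "d \<ge> 0"
    and strict: "\<And>x. w x < F x \<Longrightarrow> G x (differential A F x) \<le> cG - d"
  shows "viscosity_subsolution A (\<lambda>x p. G x p + min d (max (w x) (F x) - w x)) cG (\<lambda>x. max (w x) (F x))"
  unfolding viscosity_subsolution_def
proof (intro conjI ballI allI impI)
  show "continuous_on UNIV (\<lambda>x. max (w x) (F x))"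
    by (intro continuous_on_max viscosity_subsolution_continuous[OF w] C1_continuous[OF F])
  fix k x assume k: "k \<in> C1" and touch: "\<forall>\<^sub>F y in nhds x. max (w y) (F y) - k y \<le> max (w x) (F x) - k x"
  show "G x (differential A k x) + min d (max (w x) (F x) - w x) \<le> cG"
  proof (cases "F x \<le> w x")
    case True
    then have "\<forall>\<^sub>F y in nhds x. w y - k y \<le> w x - k x" using touch by (auto elim: eventually_mono)
    then have "G x (differential A k x) \<le> cG" using w k by (auto simp: viscosity_subsolution_def)
    then show ?thesis using True \<open>d \<ge> 0\<close> by simp
  next
    case False
    then have "\<forall>\<^sub>F y in nhds x. F y - k y \<le> F x - k x" using touch by (auto elim: eventually_mono)
    then have "differential A k x = differential A F x" using differential_eq_if_touching[OF F k] by simp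
    then show ?thesis using strict[of x] False by simp
  qed
qed

lemma G_convex_combination:
  assumes q: "q \<in> C1" and f: "f \<in> C1" and l: "l \<in> {0..1}"
  shows "G x (differential A (\<lambda>x. (1 - l) * q x + l * f x) x)
    \<le> (1 - l) * G x (differential A q x) + l * G x (differential A f x)"
proof -
  have "differential A (\<lambda>x. (1 - l) * q x + l * f x) x v = (1 - l) * differential A q x v + l * differential A f x v" for v
  proof (cases "v \<in> tangent_space A x")
    case True
    then show ?thesis by (simp add: differential_add differential_cmult C1_cmult q f)
  qed (simp add: differential_def)
  then have "differential A (\<lambda>x. (1 - l) * q x + l * f x) x = (\<lambda>v. (1 - l) * differential A q x v + l * differential A f x v)" ..
  then show ?thesis
    using G_convex differential_in[OF q] differential_in[OF f] l by (simp add: convex_hamiltonian_def)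
qed

lemma approximation_strict_where_strict:
  assumes w: "subsolution cG w" and f: "f \<in> C1" and "d > 0" "\<eta> > 0"
  shows "\<exists>k\<in>C1. (\<forall>x. \<bar>k x - w x\<bar> \<le> \<eta>) \<and> (\<forall>x. G x (differential A f x) \<le> cG - d \<longrightarrow> G x (differential A k x) < cG)"
proof -
  have "continuous_on UNIV (\<lambda>x. f x - w x)" by (intro continuous_on_diff viscosity_subsolution_continuous[OF w] C1_continuous[OF f])
  then obtain B where B: "B > 0" "\<And>x. \<bar>f x - w x\<bar> \<le> B" using continuous_bounded by blast
  define l where "l = min (1 / 2) (\<eta> / (2 * B))"
  have l: "0 < l" "l \<le> 1 / 2" "l * B \<le> \<eta> / 2"
    using \<open>\<eta> > 0\<close> B(1) mult_right_mono[of l "\<eta> / (2 * B)" B] by (auto simp: l_def)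
  define e where "e = min (\<eta> / 2) (l * d / 2)"
  have e: "e > 0" "e \<le> \<eta> / 2" "e \<le> l * d / 2" using \<open>\<eta> > 0\<close> l(1) \<open>d > 0\<close> by (auto simp: e_def)
  obtain q where q: "q \<in> C1" "\<And>x. \<bar>q x - w x\<bar> \<le> e" "\<And>x. G x (differential A q x) \<le> cG + e"
    by (rule smooth_approximation[OF w e(1)]) (rule that)
  have "\<bar>((1 - l) * q x + l * f x) - w x\<bar> \<le> \<eta>" for x
  proof -
    have "((1 - l) * q x + l * f x) - w x = (1 - l) * (q x - w x) + l * (f x - w x)" by (simp add: algebra_simps)
    also have "\<bar>\<dots>\<bar> \<le> \<bar>(1 - l) * (q x - w x)\<bar> + \<bar>l * (f x - w x)\<bar>" by (rule abs_triangle_ineq)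
    also have "\<dots> \<le> 1 * e + l * B" unfolding abs_mult using l q(2)[of x] B(2)[of x] by (intro add_mono mult_mono) auto
    finally show ?thesis using l(3) e(2) by linarith
  qed
  moreover have "G x (differential A (\<lambda>x. (1 - l) * q x + l * f x) x) < cG" if "G x (differential A f x) \<le> cG - d" for x
  proof -
    have "(1 - l) * G x (differential A q x) + l * G x (differential A f x) \<le> (1 - l) * (cG + e) + l * (cG - d)"
      using q(3)[of x] that l by (intro add_mono mult_left_mono) auto
    also have "\<dots> = cG + (1 - l) * e - l * d" by (simp add: algebra_simps)
    also have "\<dots> \<le> cG + 1 * e - l * d" using l e(1) by (intro diff_right_mono add_left_mono mult_right_mono) auto
    also have "\<dots> < cG" using e(3) mult_pos_pos[OF l(1) \<open>d > 0\<close>] by linarith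
    finally show ?thesis using G_convex_combination[OF q(1) f, of l x] l by simp
  qed
  ultimately show ?thesis by (intro bexI[OF _ C1_add[OF C1_cmult[OF q(1)] C1_cmult[OF f]]]) blast
qed

lemma no_strict_subsolution_on_contact_set:
  assumes u: "viscosity_solution A G cG u" and w: "subsolution cG w" and max: "\<And>x. w x - u x \<le> M" "w x1 - u x1 = M"
    and f: "f \<in> C1" and "d > 0"
  shows "\<exists>x. w x - u x = M \<and> G x (differential A f x) > cG - d"
proof (rule ccontr)
  assume "\<not> ?thesis"
  then have strict: "G x (differential A f x) \<le> cG - d" if "w x - u x = M" for x
    using that by (metis linorder_not_le)
  have cont: "continuous_on UNIV w" "continuous_on UNIV u"
    using u viscosity_subsolution_continuous[OF w] by (simp_all add: viscosity_solution_def)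
  define V where "V = {x. G x (differential A f x) < cG - d / 2}"
  have "open V" unfolding V_def by (intro open_Collect_less G_differential_continuous[OF f] continuous_intros)
  moreover have "continuous_on UNIV (\<lambda>x. M - (w x - u x))" by (intro continuous_intros cont)
  moreover have "M - (w x - u x) > 0" if "x \<notin> V" for x
    using max(1)[of x] strict[of x] that \<open>d > 0\<close> by (force simp: V_def less_le)
  ultimately obtain \<eta> where \<eta>: "\<eta> > 0" "\<And>x. x \<notin> V \<Longrightarrow> \<eta> \<le> M - (w x - u x)" by (rule positive_outside_open) (assumption, rule that)
  have "d / 2 > 0" "\<eta> / 4 > 0" using \<open>d > 0\<close> \<eta>(1) by auto
  from approximation_strict_where_strict[OF w f this]
  obtain k where k: "k \<in> C1" "\<And>x. \<bar>k x - w x\<bar> \<le> \<eta> / 4" "\<And>x. x \<in> V \<Longrightarrow> G x (differential A k x) < cG"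
    by (auto simp: V_def less_imp_le)
  obtain x2 where x2: "\<And>x. u x2 - k x2 \<le> u x - k x"
    using continuous_attains_inf[OF compact_M _ continuous_on_diff[OF cont(2) C1_continuous[OF k(1)]]] by blast
  have "x2 \<in> V" using \<eta>(2)[of x2] max(2) x2[of x1] k(2)[of x1] k(2)[of x2] \<eta>(1) by (fastforce simp: abs_le_iff)
  moreover have "G x2 (differential A k x2) \<ge> cG" using u k(1) x2 by (simp add: viscosity_solution_def)
  ultimately show False using k(3)[of x2] by simp
qed

subsection \<open>The operator\<close>

context
  fixes \<sigma> :: "'m \<Rightarrow> real" assumes \<sigma>_cont: "continuous_on UNIV \<sigma>" and \<sigma>_pos: "\<And>x. \<sigma> x > 0"
begin

abbreviation "P \<equiv> P_operator A g G \<sigma>"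

lemma mean_weight_pos:
  assumes m: "mather m" shows "mean m \<sigma> > 0"
proof -
  obtain s where s: "s > 0" "\<And>x. s \<le> \<sigma> x" using continuous_attains_inf[OF compact_M _ \<sigma>_cont] \<sigma>_pos by blast
  have "s \<le> mean m \<sigma>" using mean_mono[OF m continuous_on_const \<sigma>_cont s(2)] by (simp add: mean_const[OF m])
  then show ?thesis using s by simp
qed

lemma P_eq_INF:
  assumes \<phi>: "continuous_on UNIV \<phi>"
  shows "P \<phi> x = (INF m\<in>{m. mather m}. mean m (\<lambda>y. \<sigma> y * (barrier y x + \<phi> y)) / mean m \<sigma>)"
proof -
  have "(\<integral>y. F y \<partial>distr m borel fst) = mean m F" if "mather m" "continuous_on UNIV F" for m F
    unfolding mean_def using that by (intro integral_distr fst_measurable_mather borel_measurable_continuous_onI)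
  then show ?thesis
    unfolding P_operator_def projected_mather_measures_def image_image peierls_barrier_eq_barrier real_of_ereal.simps
    by (intro arg_cong[where f = Inf] image_cong refl)
      (simp add: mean_mult_add \<sigma>_cont \<phi> barrier_continuous_left continuous_on_mult add_divide_distrib)
qed

lemma P_le:
  assumes \<phi>: "continuous_on UNIV \<phi>" and m: "mather m"
  shows "P \<phi> x * mean m \<sigma> \<le> mean m (\<lambda>y. \<sigma> y * (barrier y x + \<phi> y))"
proof -
  have cont: "continuous_on UNIV (\<lambda>y. barrier y x + \<phi> y)" by (intro continuous_on_add barrier_continuous_left \<phi>)
  then obtain B where B: "\<And>y. \<bar>barrier y x + \<phi> y\<bar> \<le> B" using continuous_bounded by blast
  have "bdd_below ((\<lambda>m. mean m (\<lambda>y. \<sigma> y * (barrier y x + \<phi> y)) / mean m \<sigma>) ` {m. mather m})"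
  proof (rule bdd_belowI2)
    fix m assume "m \<in> {m. mather m}"
    then have m: "mather m" by simp
    have "mean m (\<lambda>y. \<sigma> y * - B) \<le> mean m (\<lambda>y. \<sigma> y * (barrier y x + \<phi> y))"
    proof (intro mean_mult_mono[OF m] \<sigma>_cont cont continuous_on_const)
      show "- B \<le> barrier y x + \<phi> y" for y using B[of y] by linarith
    qed (simp add: \<sigma>_pos less_imp_le)
    then show "- B \<le> mean m (\<lambda>y. \<sigma> y * (barrier y x + \<phi> y)) / mean m \<sigma>"
      unfolding mean_mult_const using mean_weight_pos[OF m] by (simp add: pos_le_divide_eq)
  qed
  from cINF_lower[OF this, of m] show ?thesis
    using m mean_weight_pos[OF m] by (simp add: P_eq_INF[OF \<phi>] pos_le_divide_eq)
qed

lemma P_greatest: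
  assumes \<phi>: "continuous_on UNIV \<phi>"
    and "\<And>m. mather m \<Longrightarrow> a * mean m \<sigma> \<le> mean m (\<lambda>y. \<sigma> y * (barrier y x + \<phi> y))"
  shows "a \<le> P \<phi> x"
  unfolding P_eq_INF[OF \<phi>]
proof (rule cINF_greatest)
  show "{m. mather m} \<noteq> {}" using mather_ex by blast
  fix m assume "m \<in> {m. mather m}"
  then show "a \<le> mean m (\<lambda>y. \<sigma> y * (barrier y x + \<phi> y)) / mean m \<sigma>"
    using assms(2)[of m] mean_weight_pos[of m] by (simp add: pos_le_divide_eq)
qed

lemma P_dominated:
  assumes \<phi>: "continuous_on UNIV \<phi>" shows "dominated (P \<phi>)"
  unfolding dominated_def
proof (intro allI impI)
  fix r y y' l assume r: "r > (0::real)" "reach r y y' l"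
  define k where "k = l + cG * r"
  have "P \<phi> y' - k \<le> P \<phi> y"
  proof (rule P_greatest[OF \<phi>])
    fix m assume m: "mather m"
    have cont: "continuous_on UNIV (\<lambda>z. barrier z x + \<phi> z)" for x by (intro continuous_on_add barrier_continuous_left \<phi>)
    have "P \<phi> y' * mean m \<sigma> \<le> mean m (\<lambda>z. \<sigma> z * (barrier z y' + \<phi> z))" by (rule P_le[OF \<phi> m])
    also have "\<dots> \<le> mean m (\<lambda>z. \<sigma> z * ((barrier z y + \<phi> z) + k))"
    proof (intro mean_mult_mono[OF m] \<sigma>_cont cont continuous_on_add continuous_on_const)
      show "barrier z y' + \<phi> z \<le> (barrier z y + \<phi> z) + k" for z
        using dominatedD[OF barrier_dominated[of z] r] by (simp add: k_def)
    qed (simp add: \<sigma>_pos less_imp_le)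
    also have "\<dots> = mean m (\<lambda>z. \<sigma> z * (barrier z y + \<phi> z)) + k * mean m \<sigma>"
      by (simp add: mean_mult_add[OF m] \<sigma>_cont cont mean_mult_const)
    finally show "(P \<phi> y' - k) * mean m \<sigma> \<le> mean m (\<lambda>z. \<sigma> z * (barrier z y + \<phi> z))" by (simp add: left_diff_distrib)
  qed
  then show "P \<phi> y' - P \<phi> y \<le> l + cG * r" by (simp add: k_def)
qed

lemma P_continuous: "continuous_on UNIV \<phi> \<Longrightarrow> continuous_on UNIV (P \<phi>)"
  by (rule dominated_continuous[OF P_dominated])

lemma dominated_le_P:
  assumes \<phi>: "continuous_on UNIV \<phi>" and u: "dominated u"
    and le: "\<And>m. mather m \<Longrightarrow> mean m (\<lambda>y. \<sigma> y * u y) \<le> mean m (\<lambda>y. \<sigma> y * \<phi> y)"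
  shows "u x \<le> P \<phi> x"
proof (rule P_greatest[OF \<phi>])
  fix m assume m: "mather m"
  note cont = \<sigma>_cont barrier_continuous_left dominated_continuous[OF u]
  have "u x * mean m \<sigma> = mean m (\<lambda>y. \<sigma> y * u x)" by (simp add: mean_mult_const)
  also have "\<dots> \<le> mean m (\<lambda>y. \<sigma> y * (barrier y x + u y))"
  proof (intro mean_mult_mono[OF m] cont continuous_on_const continuous_on_add)
    show "u x \<le> barrier y x + u y" for y using dominated_le_barrier[OF u, of x y] by linarith
  qed (simp add: \<sigma>_pos less_imp_le)
  also have "\<dots> = mean m (\<lambda>y. \<sigma> y * barrier y x) + mean m (\<lambda>y. \<sigma> y * u y)"
    by (intro mean_mult_add[OF m] cont)
  also have "\<dots> \<le> mean m (\<lambda>y. \<sigma> y * barrier y x) + mean m (\<lambda>y. \<sigma> y * \<phi> y)" using le[OF m] by simp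
  also have "\<dots> = mean m (\<lambda>y. \<sigma> y * (barrier y x + \<phi> y))" by (intro mean_mult_add[OF m, symmetric] cont \<phi>)
  finally show "u x * mean m \<sigma> \<le> mean m (\<lambda>y. \<sigma> y * (barrier y x + \<phi> y))" .
qed

subsection \<open>The integral constraint\<close>

lemma P_le_density:
  assumes \<phi>: "continuous_on UNIV \<phi>" and m: "mather m" and \<rho>: "minimizing_density m \<rho>"
  shows "P \<phi> x * mean m (\<lambda>y. \<rho> y * \<sigma> y) \<le> mean m (\<lambda>y. \<rho> y * \<sigma> y * (barrier y x + \<phi> y))"
proof (cases "mean m \<rho> = 0")
  have \<rho>': "closed_density m \<rho>" using \<rho> by (simp add: minimizing_density_def)
  note cont = continuous_intros \<sigma>_cont \<phi> barrier_continuous_left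
  case True
  have "AE p in m. \<rho> (fst p) = 0" by (rule mean_eq_0_imp_AE[OF m closed_densityD(1,2)[OF \<rho>'] True])
  then show ?thesis by (simp add: mean_mult_eq_0 mult.assoc)
next
  have \<rho>': "closed_density m \<rho>" using \<rho> by (simp add: minimizing_density_def)
  case False
  then have pos: "mean m \<rho> > 0" using mean_nonneg[OF closed_densityD(2)[OF \<rho>']] by (simp add: less_le)
  obtain m' where m': "mather m'" "\<And>F. continuous_on UNIV F \<Longrightarrow> mean m' F = mean m (\<lambda>x. \<rho> x * F x) / mean m \<rho>"
    by (rule minimizing_density_normalize[OF m \<rho> pos]) (rule that)
  have "mean m' (\<lambda>y. \<sigma> y * (barrier y x + \<phi> y)) = mean m (\<lambda>y. \<rho> y * (\<sigma> y * (barrier y x + \<phi> y))) / mean m \<rho>"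
    by (rule m'(2)) (intro continuous_intros \<sigma>_cont \<phi> barrier_continuous_left)
  then show ?thesis
    using P_le[OF \<phi> m'(1), of x] m'(2)[OF \<sigma>_cont] pos by (simp add: mult.assoc divide_le_cancel)
qed

text \<open>
  On a piece where \<open>barrier z x + barrier x z\<close> is small, \<open>barrier y x \<le> barrier y z + barrier z x\<close>
  averages to almost nothing over pairs \<open>(y, x)\<close> of points of the piece.
\<close>

lemma mean_P_le_if_near:
  assumes m: "mather m" and \<phi>: "continuous_on UNIV \<phi>" and \<rho>: "minimizing_density m \<rho>"
    and near: "\<And>x. \<rho> x \<noteq> 0 \<Longrightarrow> barrier z x + barrier x z \<le> e"
  shows "mean m (\<lambda>x. \<rho> x * \<sigma> x * P \<phi> x) \<le> mean m (\<lambda>x. \<rho> x * \<sigma> x * (\<phi> x + e))"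
proof -
  define k where "k x = \<rho> x * \<sigma> x" for x
  have \<rho>': "closed_density m \<rho>" using \<rho> by (simp add: minimizing_density_def)
  have k: "continuous_on UNIV k" "\<And>x. k x \<ge> 0"
    using closed_densityD(1,2)[OF \<rho>'] \<sigma>_cont \<sigma>_pos by (auto simp: k_def[abs_def] less_imp_le intro: continuous_on_mult)
  note cont = continuous_on_add continuous_on_const k(1) \<phi> barrier_continuous barrier_continuous_left P_continuous[OF \<phi>]
  show ?thesis
  proof (cases "mean m k = 0")
    case True
    then show ?thesis using mean_mult_eq_0[OF mean_eq_0_imp_AE[OF m k True]] by (simp flip: k_def)
  next
    case False
    then have pos: "mean m k > 0" using mean_nonneg[OF k(2)] by (simp add: less_le)
    define H where "H = mean m (\<lambda>y. k y * (barrier y z + \<phi> y))"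
    have P_le_H: "P \<phi> x \<le> H / mean m k + barrier z x" for x
    proof -
      have "P \<phi> x * mean m k \<le> mean m (\<lambda>y. k y * (barrier y x + \<phi> y))"
        using P_le_density[OF \<phi> m \<rho>] by (simp add: k_def[abs_def])
      also have "\<dots> \<le> mean m (\<lambda>y. k y * ((barrier y z + \<phi> y) + barrier z x))"
      proof (intro mean_mult_mono[OF m] cont k(2))
        show "barrier y x + \<phi> y \<le> (barrier y z + \<phi> y) + barrier z x" for y using barrier_triangle[of y x z] by linarith
      qed
      also have "\<dots> = H + barrier z x * mean m k" by (simp add: mean_mult_add[OF m] cont mean_mult_const H_def)
      finally show ?thesis using pos by (simp add: field_simps)
    qed
    have "mean m (\<lambda>x. k x * P \<phi> x) \<le> mean m (\<lambda>x. k x * (H / mean m k + barrier z x))"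
      by (intro mean_mult_mono[OF m] cont k(2) P_le_H)
    also have "\<dots> = mean m (\<lambda>x. k x * (H / mean m k)) + mean m (\<lambda>x. k x * barrier z x)"
      by (intro mean_mult_add[OF m] cont)
    also have "mean m (\<lambda>x. k x * (H / mean m k)) = H" unfolding mean_mult_const using pos by simp
    also have "H + mean m (\<lambda>x. k x * barrier z x) = mean m (\<lambda>x. k x * ((barrier x z + \<phi> x) + barrier z x))"
      by (simp add: mean_mult_add[OF m] cont H_def)
    also have "\<dots> \<le> mean m (\<lambda>x. k x * (\<phi> x + e))"
    proof (intro mean_mult_mono[OF m] cont k(2))
      show "(barrier x z + \<phi> x) + barrier z x \<le> \<phi> x + e" if "k x \<noteq> 0" for x using near[of x] that by (simp add: k_def)
    qed
    finally show ?thesis by (simp add: k_def)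
  qed
qed

lemma mean_P_le_if_covered:
  assumes m: "mather m" and \<phi>: "continuous_on UNIV \<phi>" and "e > 0" and "finite Z" "minimizing_density m \<rho>"
    and "AE p in m. \<rho> (fst p) \<noteq> 0 \<longrightarrow> (\<exists>z\<in>Z. barrier z (fst p) + barrier (fst p) z < e)"
  shows "mean m (\<lambda>x. \<rho> x * \<sigma> x * P \<phi> x) \<le> mean m (\<lambda>x. \<rho> x * \<sigma> x * (\<phi> x + 2 * e))"
  using assms(4-6)
proof (induction Z arbitrary: \<rho> rule: finite_induct)
  case empty
  then have "AE p in m. \<rho> (fst p) = 0" by simp
  then show ?case by (simp add: mean_mult_eq_0 mult.assoc)
next
  case (insert z Z)
  let ?b = "\<lambda>x. barrier z x - (- barrier x z)"
  define \<tau> where "\<tau> x = \<rho> x * cutoff ((?b x - e) / e)" for x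
  have closed: "closed_density m \<tau>"
    unfolding \<tau>_def by (rule closed_density_mult_cutoff[OF m insert.prems(1) barrier_dominated neg_barrier_dominated \<open>e > 0\<close>])
  have "\<tau> x \<le> \<rho> x" for x
    using mult_left_le[OF cutoff_bounds(2)] insert.prems(1) by (simp add: \<tau>_def minimizing_density_def closed_density_def)
  note split = minimizing_density_if_closed_density_le[OF m insert.prems(1) closed this]
  have "mean m (\<lambda>x. \<tau> x * \<sigma> x * P \<phi> x) \<le> mean m (\<lambda>x. \<tau> x * \<sigma> x * (\<phi> x + 2 * e))"
  proof (rule mean_P_le_if_near[OF m \<phi> split(1)])
    fix x assume "\<tau> x \<noteq> 0"
    then have "\<not> (?b x - e) / e \<ge> 1" using cutoff_eq_0 by (auto simp: \<tau>_def)
    then show "barrier z x + barrier x z \<le> 2 * e" using \<open>e > 0\<close> by (simp add: field_simps)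
  qed
  moreover have "mean m (\<lambda>x. (\<rho> x - \<tau> x) * \<sigma> x * P \<phi> x) \<le> mean m (\<lambda>x. (\<rho> x - \<tau> x) * \<sigma> x * (\<phi> x + 2 * e))"
  proof (rule insert.IH[OF split(2)])
    show "AE p in m. \<rho> (fst p) - \<tau> (fst p) \<noteq> 0 \<longrightarrow> (\<exists>z\<in>Z. barrier z (fst p) + barrier (fst p) z < e)"
      using insert.prems(2)
    proof eventually_elim
      case (elim p)
      have "\<rho> (fst p) - \<tau> (fst p) = 0" if "barrier z (fst p) + barrier (fst p) z < e"
        using that \<open>e > 0\<close> by (simp add: \<tau>_def cutoff_eq_1 divide_le_0_iff)
      moreover have "\<rho> (fst p) - \<tau> (fst p) = 0" if "\<rho> (fst p) = 0" using that by (simp add: \<tau>_def)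
      ultimately show ?case using elim by auto
    qed
  qed
  moreover have "mean m (\<lambda>x. \<rho> x * \<sigma> x * F x) = mean m (\<lambda>x. \<tau> x * \<sigma> x * F x) + mean m (\<lambda>x. (\<rho> x - \<tau> x) * \<sigma> x * F x)"
    if "continuous_on UNIV F" for F
    using mean_mult_split[OF m _ _ continuous_on_mult[OF \<sigma>_cont that], of \<rho> \<tau>] insert.prems(1) closed
    by (simp add: minimizing_density_def closed_density_def mult.assoc)
  ultimately show ?case by (simp add: P_continuous[OF \<phi>] \<phi> continuous_on_add)
qed

lemma AE_near_finite_set:
  assumes m: "mather m" and "e > 0"
  shows "\<exists>Z. finite Z \<and> (AE p in m. \<exists>z\<in>Z. barrier z (fst p) + barrier (fst p) z < e)"
proof -
  let ?near = "\<lambda>z x. barrier z x + barrier x z < e"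
  have "\<exists>U. open U \<and> z \<in> U \<and> ((\<forall>x\<in>U. ?near z x) \<or> (AE p in m. fst p \<notin> U))" for z
  proof (cases "barrier z z > 0")
    case False
    have "open {x. ?near z x}" by (intro open_Collect_less continuous_intros barrier_continuous barrier_continuous_left)
    moreover have "?near z z" using False \<open>e > 0\<close> by simp
    ultimately show ?thesis by (intro exI[of _ "{x. ?near z x}"]) auto
  qed (use barrier_pos_null[OF m] in blast)
  then obtain U where U: "\<And>z. open (U z)" "\<And>z. z \<in> U z" "\<And>z. (\<forall>x\<in>U z. ?near z x) \<or> (AE p in m. fst p \<notin> U z)"
    by metis
  have "UNIV \<subseteq> (\<Union>z\<in>UNIV. U z)" using U(2) by blast
  then obtain Z where Z: "finite Z" "UNIV \<subseteq> (\<Union>z\<in>Z. U z)"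
    by (rule compactE_image[OF compact_M U(1)]) (rule that)
  have "AE p in m. \<forall>z\<in>{z \<in> Z. \<not> (\<forall>x\<in>U z. ?near z x)}. fst p \<notin> U z"
    using Z(1) U(3) by (intro AE_finite_allI) auto
  then have "AE p in m. \<exists>z\<in>Z. ?near z (fst p)"
  proof eventually_elim
    case (elim p)
    obtain z where "z \<in> Z" "fst p \<in> U z" using Z(2) by blast
    then show ?case using elim by blast
  qed
  then show ?thesis using Z(1) by blast
qed

theorem mean_P_le:
  assumes m: "mather m" and \<phi>: "continuous_on UNIV \<phi>"
  shows "mean m (\<lambda>x. \<sigma> x * P \<phi> x) \<le> mean m (\<lambda>x. \<sigma> x * \<phi> x)"
proof (rule field_le_epsilon)
  fix e :: real assume "e > 0"
  define \<epsilon> where "\<epsilon> = e / (2 * mean m \<sigma>)"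
  have \<epsilon>: "\<epsilon> > 0" "2 * \<epsilon> * mean m \<sigma> = e" using \<open>e > 0\<close> mean_weight_pos[OF m] by (auto simp: \<epsilon>_def)
  obtain Z where Z: "finite Z" "AE p in m. \<exists>z\<in>Z. barrier z (fst p) + barrier (fst p) z < \<epsilon>"
    using AE_near_finite_set[OF m \<epsilon>(1)] by blast
  have "mean m (\<lambda>x. \<sigma> x * P \<phi> x) \<le> mean m (\<lambda>x. \<sigma> x * (\<phi> x + 2 * \<epsilon>))"
    using mean_P_le_if_covered[OF m \<phi> \<epsilon>(1) Z(1) minimizing_density_one[OF m]] Z(2) by simp
  also have "\<dots> = mean m (\<lambda>x. \<sigma> x * \<phi> x) + e"
    by (simp add: mean_mult_add[OF m] \<sigma>_cont \<phi> mean_mult_const \<epsilon>(2))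
  finally show "mean m (\<lambda>x. \<sigma> x * P \<phi> x) \<le> mean m (\<lambda>x. \<sigma> x * \<phi> x) + e" .
qed

subsection \<open>The image of the operator\<close>

lemma strict_subsolution_le_P:
  assumes \<phi>: "continuous_on UNIV \<phi>" and F: "F \<in> C1" and "d > 0"
    and strict: "\<And>x. P \<phi> x < F x \<Longrightarrow> G x (differential A F x) \<le> cG - d"
  shows "F x \<le> P \<phi> x"
proof -
  define w where "w = P \<phi>"
  define w' where "w' x = max (w x) (F x)" for x
  define b where "b x = min d (w' x - w x)" for x
  have w: "subsolution cG w" unfolding w_def by (rule dominated_imp_subsolution[OF P_dominated[OF \<phi>]])
  note w_cont = viscosity_subsolution_continuous[OF w]
  have w'_cont: "continuous_on UNIV w'" unfolding w'_def by (intro continuous_on_max w_cont C1_continuous[OF F])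
  have b: "continuous_on UNIV b" "\<And>x. b x \<ge> 0"
    unfolding b_def using \<open>d > 0\<close> by (auto simp: w'_def intro!: continuous_intros w_cont C1_continuous[OF F])
  have margin: "viscosity_subsolution A (\<lambda>x p. G x p + b x) cG w'"
    using subsolution_max_margin[OF w F] strict \<open>d > 0\<close> by (simp add: b_def w'_def[abs_def] w_def)
  then have "subsolution cG w'"
    using b(2) unfolding viscosity_subsolution_def by (meson add_increasing2 dual_order.trans le_add_same_cancel1)
  then have "w' x \<le> w x"
    unfolding w_def
  proof (rule dominated_le_P[OF \<phi> subsolution_imp_dominated])
    fix m assume m: "mather m"
    have "AE p in m. \<sigma> (fst p) * w' (fst p) = \<sigma> (fst p) * w (fst p)"
      using margin_null[OF m margin b] by eventually_elim (use \<open>d > 0\<close> in \<open>auto simp: b_def min_def split: if_splits\<close>)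
    then have "mean m (\<lambda>x. \<sigma> x * w' x) = mean m (\<lambda>x. \<sigma> x * w x)"
      by (intro mean_cong_AE[OF m] continuous_on_mult \<sigma>_cont w_cont w'_cont)
    also have "\<dots> \<le> mean m (\<lambda>x. \<sigma> x * \<phi> x)" unfolding w_def by (rule mean_P_le[OF m \<phi>])
    finally show "mean m (\<lambda>y. \<sigma> y * w' y) \<le> mean m (\<lambda>y. \<sigma> y * \<phi> y)" .
  qed
  then show ?thesis by (simp add: w'_def w_def)
qed

lemma P_supersolution:
  assumes \<phi>: "continuous_on UNIV \<phi>" and f: "f \<in> C1"
    and touch: "\<forall>\<^sub>F y in nhds x. P \<phi> y - f y \<ge> P \<phi> x - f x"
  shows "G x (differential A f x) \<ge> cG"
proof (rule ccontr)
  assume less: "\<not> G x (differential A f x) \<ge> cG"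
  note w_cont = P_continuous[OF \<phi>]
  obtain F where F: "F \<in> C1" "F x = P \<phi> x" "\<And>y. y \<noteq> x \<Longrightarrow> F y < P \<phi> y" "differential A F x = differential A f x"
    using strict_touching_function[OF w_cont f touch] by blast
  define d where "d = (cG - G x (differential A f x)) / 2"
  define V where "V = {y. G y (differential A F y) < cG - d}"
  have d: "d > 0" "x \<in> V" using less by (auto simp: d_def V_def F(4) field_simps)
  have V: "open V" unfolding V_def by (intro open_Collect_less G_differential_continuous[OF F(1)] continuous_intros)
  have "P \<phi> y - F y > 0" if "y \<notin> V" for y using F(3)[of y] d(2) that by auto
  then obtain \<eta> where \<eta>: "\<eta> > 0" "\<And>y. y \<notin> V \<Longrightarrow> \<eta> \<le> P \<phi> y - F y"
    by (rule positive_outside_open[OF V continuous_on_diff[OF w_cont C1_continuous[OF F(1)]]]) (assumption, rule that)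
  have "F x + \<eta> \<le> P \<phi> x"
  proof (rule strict_subsolution_le_P[OF \<phi> C1_add[OF F(1) C1_const] d(1)])
    fix y assume "P \<phi> y < F y + \<eta>"
    then have "y \<in> V" using \<eta>(2)[of y] by force
    moreover have "differential A (\<lambda>x. F x + \<eta>) y = differential A F y"
      by (intro differential_eq_if_touching C1_add C1_const F(1) always_eventually) simp
    ultimately show "G y (differential A (\<lambda>x. F x + \<eta>) y) \<le> cG - d" by (simp add: V_def)
  qed
  then show False using F(2) \<eta>(1) by simp
qed

theorem viscosity_solution_P:
  assumes \<phi>: "continuous_on UNIV \<phi>" shows "viscosity_solution A G cG (P \<phi>)"
  using dominated_imp_subsolution[OF P_dominated[OF \<phi>]] P_supersolution[OF \<phi>]
  unfolding viscosity_subsolution_def viscosity_solution_def by blast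

theorem P_fixes_viscosity_solution:
  assumes u: "viscosity_solution A G cG u" shows "P u = u"
proof (rule antisym; rule le_funI)
  fix x
  have u_cont: "continuous_on UNIV u" and "subsolution cG u"
    using u by (auto simp: viscosity_solution_def viscosity_subsolution_def)
  then show "u x \<le> P u x" by (intro dominated_le_P[OF u_cont subsolution_imp_dominated]) auto
  note w_cont = P_continuous[OF u_cont]
  have cont: "continuous_on UNIV (\<lambda>x. P u x - u x)" by (intro continuous_on_diff w_cont u_cont)
  obtain x1 where max: "\<And>x. P u x - u x \<le> P u x1 - u x1" using continuous_attains_sup[OF compact_M _ cont] by blast
  define M where "M = P u x1 - u x1"
  define K where "K = {x. P u x - u x = M}"
  have "closed K" unfolding K_def by (intro closed_Collect_eq cont continuous_on_const)
  then have "compact K" using compact_Int_closed[OF compact_M, of K] by simp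
  moreover have "x1 \<in> K" by (simp add: K_def M_def)
  moreover have "\<not> (\<exists>f\<in>C1. \<exists>d>0. \<forall>x\<in>K. G x (differential A f x) \<le> cG - d)"
    using no_strict_subsolution_on_contact_set[OF u dominated_imp_subsolution[OF P_dominated[OF u_cont]] max refl]
    unfolding K_def M_def by (metis (mono_tags, lifting) linorder_not_less mem_Collect_eq)
  ultimately obtain m where m: "mather m" and m_K: "AE p in m. fst p \<in> K" using mather_or_strict_subsolution[of K] by blast
  have "mean m (\<lambda>x. \<sigma> x * u x) + M * mean m \<sigma> = mean m (\<lambda>x. \<sigma> x * (u x + M))"
    by (simp add: mean_mult_add[OF m] \<sigma>_cont u_cont mean_mult_const)
  also have "\<dots> = mean m (\<lambda>x. \<sigma> x * P u x)"
  proof (rule mean_cong_AE[OF m])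
    show "AE p in m. \<sigma> (fst p) * (u (fst p) + M) = \<sigma> (fst p) * P u (fst p)"
      using m_K by eventually_elim (auto simp: K_def)
  qed (intro continuous_intros \<sigma>_cont u_cont w_cont)+
  also have "\<dots> \<le> mean m (\<lambda>x. \<sigma> x * u x)" by (rule mean_P_le[OF m u_cont])
  finally have "M \<le> 0" using mean_weight_pos[OF m] by (simp add: mult_le_0_iff)
  then show "P u x \<le> u x" using max[of x] by (simp add: M_def)
qed

end

end

theorem corollary4:
  fixes A :: "('m::t2_space, 'e::euclidean_space) chart set"
    and g :: "'m \<Rightarrow> ('m, 'e) tvec \<Rightarrow> ('m, 'e) tvec \<Rightarrow> real"
    and G :: "'m \<Rightarrow> ('m, 'e) covec \<Rightarrow> real"
    and \<sigma> :: "'m \<Rightarrow> real"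
  assumes "closed_connected_riemannian_manifold A g"
    and "continuous_hamiltonian A G"
    and "convex_hamiltonian A G"
    and "superlinear_hamiltonian A g G"
    and "continuous_on UNIV \<sigma>"
    and "\<forall>x. \<sigma> x > 0"
  shows "P_operator A g G \<sigma> ` {\<phi>. continuous_on UNIV \<phi>}
    = {u. viscosity_solution A G (critical_value A G) u}"
proof (intro equalityI subsetI)
  interpret hamiltonian A g G by unfold_locales (rule assms)+
  note \<sigma> = assms(5) assms(6)[rule_format]
  show "u \<in> {u. viscosity_solution A G (critical_value A G) u}"
    if "u \<in> P_operator A g G \<sigma> ` {\<phi>. continuous_on UNIV \<phi>}" for u
    using that viscosity_solution_P[OF \<sigma>] by auto
  show "u \<in> P_operator A g G \<sigma> ` {\<phi>. continuous_on UNIV \<phi>}"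
    if "u \<in> {u. viscosity_solution A G (critical_value A G) u}" for u
  proof (rule image_eqI)
    show "u = P_operator A g G \<sigma> u" using that by (simp add: P_fixes_viscosity_solution[OF \<sigma>])
    show "u \<in> {\<phi>. continuous_on UNIV \<phi>}" using that by (simp add: viscosity_solution_def)
  qed
qed

end
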